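(* Let $\mu,\nu:\mathbb P\to\mathbf g$ be meromorphic maps regular along $\partial D$. Then, as operators on ${}_D\mathcal W$, $[{}_DJ^\mu,{}_DJ^\nu]-{}_DJ^{[\mu,\nu]}=0$ if either (a) both $\mu$ and $\nu$ are regular in $D'$, or (b) both $\mu$ and $\nu$ are regular in $D$. In general, $$[{}_DJ^\mu,{}_DJ^\nu]-{}_DJ^{[\mu,\nu]}=\frac1{2\pi i}\int_{\partial D}(\mu,d\nu).$$
   Context: $\mathbb P$ is a complex projective line; $D\subset\mathbb P$ is a domain biholomorphic to a disc with smooth boundary $\partial D$ oriented counterclockwise around $D$, $D'$ the complement of its closure. $\mathbf g$ is a complex Lie algebra with a nondegenerate invariant symmetric bilinear form $(\cdot,\cdot)$. $z_1,\dots,z_n$ are distinct points of $\mathbb P$ not on $\partial D$, and $W_1,\dots,W_n$ representations of $\mathbf g$. $\mathfrak g$ is the Lie algebra of meromorphic maps $\mathbb P\to\mathbf g$ (with $\mathbf g\subset\mathfrak g$ the constant maps), ${}_D\mathfrak g$ the subalgebra of maps with all poles in $D$, and ${}_D\mathcal W=U({}_D\mathfrak g)\otimes_{U\mathbf g}(W_1\otimes\cdots\otimes W_n)$. For $\nu\in\mathfrak g$ regular along $\partial D$ the operator ${}_DJ^\nu:{}_D\mathcal W\to{}_D\mathcal W$, linear in $\nu$, is defined inductively (simultaneously for all such $\nu$) by $$[{}_DJ^\nu,\alpha]={}_DJ^{[\nu,\alpha]}+\frac1{2\pi i}\int_{\partial D}(\nu,d\alpha),\qquad\alpha\in{}_D\mathfrak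 g$$ ($\alpha$ acting by left multiplication) together with: if $\nu$ is regular in $D'$, $${}_DJ^\nu(w_1\otimes\cdots\otimes w_n)=\nu\otimes_{U\mathbf g}(w_1\otimes\cdots\otimes w_n)-\sum_{z_k\in D'}w_1\otimes\cdots\otimes\nu(z_k)(w_k)\otimes\cdots\otimes w_n,$$ and if $\nu$ is regular in $D$, $${}_DJ^\nu(w_1\otimes\cdots\otimes w_n)=\sum_{z_k\in D}w_1\otimes\cdots\otimes\nu(z_k)(w_k)\otimes\cdots\otimes w_n .$$ Every $\nu$ regular along $\partial D$ is a sum of maps of these two types, unique up to constant maps, on which the two formulas agree. *)

theory Defs
  imports
    "HOL-Complex_Analysis.Complex_Analysis"
    "HOL-Library.Poly_Mapping"
    "HOL-Algebra.QuotRing"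
    "HOL-Algebra.Module"
begin

section \<open>Complex vector spaces and Lie algebras\<close>

class complex_vector = ab_group_add +
  fixes scaleC :: "complex \<Rightarrow> 'a \<Rightarrow> 'a"  (infixr \<open>*\<^sub>C\<close> 75)
  assumes scaleC_add_right: "c *\<^sub>C (x + y) = c *\<^sub>C x + c *\<^sub>C y"
    and scaleC_add_left: "(b + c) *\<^sub>C x = b *\<^sub>C x + c *\<^sub>C x"
    and scaleC_scaleC: "b *\<^sub>C c *\<^sub>C x = (b * c) *\<^sub>C x"
    and scaleC_one: "1 *\<^sub>C x = x"

global_interpretation complex_vector: vector_space "scaleC :: complex \<Rightarrow> 'a \<Rightarrow> 'a::complex_vector"
  apply unfold_locales
  apply (rule scaleC_add_right)
  apply (rule scaleC_add_left)
  apply (rule scaleC_scaleC)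
  apply (rule scaleC_one)
  done

class complex_lie_algebra = complex_vector +
  fixes lie :: "'a \<Rightarrow> 'a \<Rightarrow> 'a"
  assumes lie_add_left: "lie (x + y) w = lie x w + lie y w"
    and lie_add_right: "lie w (x + y) = lie w x + lie w y"
    and lie_scaleC_left: "lie (c *\<^sub>C x) y = c *\<^sub>C lie x y"
    and lie_scaleC_right: "lie x (c *\<^sub>C y) = c *\<^sub>C lie x y"
    and lie_self: "lie x x = 0"
    and jacobi: "lie x (lie y w) + lie y (lie w x) + lie w (lie x y) = 0"

definition nondegenerate_invariant_form :: "('g::complex_lie_algebra \<Rightarrow> 'g \<Rightarrow> complex) \<Rightarrow> bool" where
  "nondegenerate_invariant_form B \<longleftrightarrow>
     (\<forall>x. Vector_Spaces.linear scaleC (*) (B x)) \<and>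
     (\<forall>x y. B x y = B y x) \<and>
     (\<forall>x y w. B (lie x y) w = B x (lie y w)) \<and>
     (\<forall>x. (\<forall>y. B x y = 0) \<longrightarrow> x = 0)"

definition lie_representation ::
    "'w::complex_vector set \<Rightarrow> ('g::complex_lie_algebra \<Rightarrow> 'w \<Rightarrow> 'w) \<Rightarrow> bool" where
  "lie_representation W \<rho> \<longleftrightarrow>
     complex_vector.subspace W \<and>
     (\<forall>x. \<forall>w\<in>W. \<rho> x w \<in> W) \<and>
     (\<forall>w\<in>W. Vector_Spaces.linear scaleC scaleC (\<lambda>x. \<rho> x w)) \<and>
     (\<forall>x. \<forall>u\<in>W. \<forall>v\<in>W. \<rho> x (u + v) = \<rho> x u + \<rho> x v) \<and>
     (\<forall>x c. \<forall>w\<in>W. \<rho> x (c *\<^sub>C w) = c *\<^sub>C \<rho> x w) \<and>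
     (\<forall>x y. \<forall>w\<in>W. \<rho> (lie x y) w = \<rho> x (\<rho> y w) - \<rho> y (\<rho> x w))"


section \<open>The projective line\<close>

text \<open>The projective line is the Riemann sphere, \<open>None\<close> being the point at infinity.\<close>

abbreviation proj_line :: "complex option topology" where
  "proj_line \<equiv> Alexandroff_compactification euclidean"

text \<open>The inverse of a holomorphic coordinate centred at \<open>p\<close>. It is an open embedding of the
  complex plane sending \<open>0\<close> to \<open>p\<close>.\<close>

fun chart :: "complex option \<Rightarrow> complex \<Rightarrow> complex option" where
  "chart (Some a) t = Some (a + t)"
| "chart None t = (if t = 0 then None else Some (1 / t))"

definition biholomorphic_to_disc :: "complex option set \<Rightarrow> bool" where
  "biholomorphic_to_disc D \<longleftrightarrow> (\<exists>f. bij_betw f (ball 0 1) D \<and>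
     (\<forall>a\<in>ball 0 1. \<exists>h. h analytic_on {a} \<and> h a = 0 \<and>
        (\<forall>\<^sub>F w in nhds a. f w = chart (f a) (h w))) \<and>
     (\<forall>p\<in>D. (inv_into (ball 0 1) f \<circ> chart p) analytic_on {0}))"

definition exterior :: "complex option set \<Rightarrow> complex option set" where
  "exterior D = topspace proj_line - proj_line closure_of D"

text \<open>\<open>\<gamma>\<close> is a smooth regular parametrization by \<open>\<real>/\<int>\<close> of the boundary of \<open>D\<close>. In the
  coordinate centred at \<open>\<gamma> t\<close> it is given by \<open>F 0\<close>, whose \<open>k\<close>-th derivative is \<open>F k\<close>; turning
  its velocity \<open>F 1 t\<close> to the left (multiplication by \<open>\<i>\<close>) gives a vector that points into \<open>D\<close>,
  turning it to the right a vector that points out of the closure of \<open>D\<close>.\<close>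

definition oriented_smooth_boundary ::
    "complex option set \<Rightarrow> (real \<Rightarrow> complex option) \<Rightarrow> bool" where
  "oriented_smooth_boundary D \<gamma> \<longleftrightarrow>
     (\<forall>t. \<gamma> (t + 1) = \<gamma> t) \<and>
     bij_betw \<gamma> {0..<1} (proj_line frontier_of D) \<and>
     (\<forall>t. \<exists>F :: nat \<Rightarrow> real \<Rightarrow> complex.
        F 0 t = 0 \<and> F 1 t \<noteq> 0 \<and>
        (\<forall>\<^sub>F s in nhds t. \<gamma> s = chart (\<gamma> t) (F 0 s)) \<and>
        (\<forall>\<^sub>F s in nhds t. \<forall>k. (F k has_vector_derivative F (Suc k) s) (at s)) \<and>
        (\<forall>\<^sub>F e in at_right 0.
           chart (\<gamma> t) (\<i> * of_real e * F 1 t) \<in> D \<and>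
           chart (\<gamma> t) (- \<i> * of_real e * F 1 t) \<in> exterior D))"

definition smoothly_bounded_disc ::
    "complex option set \<Rightarrow> (real \<Rightarrow> complex option) \<Rightarrow> bool" where
  "smoothly_bounded_disc D \<gamma> \<longleftrightarrow>
     openin proj_line D \<and> connectedin proj_line D \<and> biholomorphic_to_disc D \<and>
     oriented_smooth_boundary D \<gamma>"


section \<open>Meromorphic maps\<close>

text \<open>The Lie algebra is not assumed to be finite dimensional. A map into it is holomorphic
  (meromorphic) at a point if near that point it takes values in a finite dimensional subspace
  and is holomorphic (meromorphic) as a map into that subspace.\<close>

definition holomorphic_at_0 :: "(complex \<Rightarrow> 'g::complex_vector) \<Rightarrow> bool" where
  "holomorphic_at_0 f \<longleftrightarrow> (\<exists>(n::nat) h x. (\<forall>i<n. h i analytic_on {0}) \<and>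
     (\<forall>\<^sub>F t in nhds 0. f t = (\<Sum>i<n. h i t *\<^sub>C x i)))"

definition meromorphic_at_0 :: "(complex \<Rightarrow> 'g::complex_vector) \<Rightarrow> bool" where
  "meromorphic_at_0 f \<longleftrightarrow> (\<exists>(n::nat) h x. (\<forall>i<n. h i meromorphic_on {0}) \<and>
     (\<forall>\<^sub>F t in at 0. f t = (\<Sum>i<n. h i t *\<^sub>C x i)))"

definition meromorphic_map :: "(complex option \<Rightarrow> 'g::complex_vector) \<Rightarrow> bool" where
  "meromorphic_map f \<longleftrightarrow> (\<forall>p. meromorphic_at_0 (f \<circ> chart p))"

lemma meromorphic_at_0_add:
  assumes "meromorphic_at_0 f" "meromorphic_at_0 g"
  shows "meromorphic_at_0 (\<lambda>t. f t + g t)"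
proof -
  obtain n h x where 1: "\<forall>i<n::nat. h i meromorphic_on {0}"
      "\<forall>\<^sub>F t in at 0. f t = (\<Sum>i<n. h i t *\<^sub>C x i)"
    using assms(1) unfolding meromorphic_at_0_def by blast
  obtain m k y where 2: "\<forall>i<m::nat. k i meromorphic_on {0}"
      "\<forall>\<^sub>F t in at 0. g t = (\<Sum>i<m. k i t *\<^sub>C y i)"
    using assms(2) unfolding meromorphic_at_0_def by blast
  define l where "l i = (if i < n then h i else k (i - n))" for i
  define w where "w i = (if i < n then x i else y (i - n))" for i
  have sum: "(\<Sum>i<n + m. l i t *\<^sub>C w i) = (\<Sum>i<n. h i t *\<^sub>C x i) + (\<Sum>i<m. k i t *\<^sub>C y i)" for t
  proof -
    have "(\<Sum>i<n + m. F i) = (\<Sum>i<n. F i) + (\<Sum>i<m. F (n + i))" for F :: "nat \<Rightarrow> 'a"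
      by (induction m) (simp_all add: add.assoc)
    then show ?thesis by (simp add: l_def w_def)
  qed
  have "\<forall>i<n + m. l i meromorphic_on {0}"
    using 1(1) 2(1) by (auto simp: l_def)
  moreover have "\<forall>\<^sub>F t in at 0. f t + g t = (\<Sum>i<n + m. l i t *\<^sub>C w i)"
    using 1(2) 2(2) by eventually_elim (simp add: sum)
  ultimately show ?thesis unfolding meromorphic_at_0_def by blast
qed

lemma meromorphic_at_0_scaleC:
  assumes "meromorphic_at_0 f"
  shows "meromorphic_at_0 (\<lambda>t. c *\<^sub>C f t)"
proof -
  obtain n h x where 1: "\<forall>i<n::nat. h i meromorphic_on {0}"
      "\<forall>\<^sub>F t in at 0. f t = (\<Sum>i<n. h i t *\<^sub>C x i)"
    using assms unfolding meromorphic_at_0_def by blast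
  have "c *\<^sub>C (\<Sum>i<n. h i t *\<^sub>C x i) = (\<Sum>i<n. h i t *\<^sub>C c *\<^sub>C x i)" for t
    unfolding complex_vector.scale_sum_right
    by (intro sum.cong refl) (rule complex_vector.scale_left_commute)
  note * = this
  have "\<forall>\<^sub>F t in at 0. c *\<^sub>C f t = (\<Sum>i<n. h i t *\<^sub>C c *\<^sub>C x i)"
    using 1(2) by eventually_elim (simp only: * )
  with 1(1) show ?thesis
    unfolding meromorphic_at_0_def
    by (intro exI[of _ n] exI[of _ h] exI[of _ "\<lambda>i. c *\<^sub>C x i"] conjI)
qed

lemma lie_sum_left: "lie (sum f A) y = (\<Sum>a\<in>A. lie (f a) y)"
proof -
  have z: "lie 0 y = 0" using lie_add_left[of 0 0 y] by simp
  show ?thesis by (induction A rule: infinite_finite_induct) (simp_all add: z lie_add_left)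
qed

lemma lie_sum_right: "lie y (sum f A) = (\<Sum>a\<in>A. lie y (f a))"
proof -
  have z: "lie y 0 = 0" using lie_add_right[of y 0 0] by simp
  show ?thesis by (induction A rule: infinite_finite_induct) (simp_all add: z lie_add_right)
qed

lemma meromorphic_at_0_zero: "meromorphic_at_0 (\<lambda>_. 0)"
  unfolding meromorphic_at_0_def by (rule exI[of _ 0]) auto

lemma meromorphic_at_0_sum:
  "(\<And>a. a \<in> A \<Longrightarrow> meromorphic_at_0 (f a)) \<Longrightarrow> meromorphic_at_0 (\<lambda>t. \<Sum>a\<in>A. f a t)"
  by (induction A rule: infinite_finite_induct)
    (simp_all add: meromorphic_at_0_zero meromorphic_at_0_add)

lemma meromorphic_at_0_single:
  assumes "h meromorphic_on {0}"
  shows "meromorphic_at_0 (\<lambda>t. h t *\<^sub>C x)"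
  unfolding meromorphic_at_0_def
  by (rule exI[of _ 1], rule exI[of _ "\<lambda>_. h"], rule exI[of _ "\<lambda>_. x"]) (use assms in auto)

lemma meromorphic_at_0_cong:
  assumes "meromorphic_at_0 f" "\<forall>\<^sub>F t in at 0. g t = f t"
  shows "meromorphic_at_0 g"
proof -
  obtain n h x where 1: "\<forall>i<n::nat. h i meromorphic_on {0}"
      "\<forall>\<^sub>F t in at 0. f t = (\<Sum>i<n. h i t *\<^sub>C x i)"
    using assms(1) unfolding meromorphic_at_0_def by blast
  have "\<forall>\<^sub>F t in at 0. g t = (\<Sum>i<n. h i t *\<^sub>C x i)"
    using 1(2) assms(2) by eventually_elim simp
  with 1(1) show ?thesis unfolding meromorphic_at_0_def by blast
qed

lemma meromorphic_at_0_lie: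
  assumes "meromorphic_at_0 f" "meromorphic_at_0 g"
  shows "meromorphic_at_0 (\<lambda>t. lie (f t) (g t))"
proof -
  obtain n h x where 1: "\<forall>i<n::nat. h i meromorphic_on {0}"
      "\<forall>\<^sub>F t in at 0. f t = (\<Sum>i<n. h i t *\<^sub>C x i)"
    using assms(1) unfolding meromorphic_at_0_def by blast
  obtain m k y where 2: "\<forall>i<m::nat. k i meromorphic_on {0}"
      "\<forall>\<^sub>F t in at 0. g t = (\<Sum>i<m. k i t *\<^sub>C y i)"
    using assms(2) unfolding meromorphic_at_0_def by blast
  have "meromorphic_at_0 (\<lambda>t. \<Sum>i<n. \<Sum>j<m. (h i t * k j t) *\<^sub>C lie (x i) (y j))"
    by (intro meromorphic_at_0_sum meromorphic_at_0_single meromorphic_on_mult)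
      (use 1(1) 2(1) in auto)
  moreover have "\<forall>\<^sub>F t in at 0. lie (f t) (g t) =
      (\<Sum>i<n. \<Sum>j<m. (h i t * k j t) *\<^sub>C lie (x i) (y j))"
    using 1(2) 2(2)
  proof eventually_elim
    case (elim t)
    have "lie (h i t *\<^sub>C x i) (k j t *\<^sub>C y j) = (h i t * k j t) *\<^sub>C lie (x i) (y j)" for i j
      by (simp only: lie_scaleC_left lie_scaleC_right scaleC_scaleC mult.commute)
    then show ?case
      unfolding elim lie_sum_left unfolding lie_sum_right by (simp only:)
  qed
  ultimately show ?thesis by (rule meromorphic_at_0_cong)
qed

lemma inj_chart: "inj (chart p)"
proof (rule injI)
  fix s t assume "chart p s = chart p t"
  then show "s = t" by (cases p) (simp_all split: if_split_asm)
qed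

lemma eventually_chart_notin:
  assumes "finite S"
  shows "\<forall>\<^sub>F t in at 0. chart p t \<notin> S"
proof -
  have "finite (chart p -` S)"
    using assms inj_chart by (rule finite_vimageI)
  then have "open (- (chart p -` S - {0}))"
    by (intro open_Compl finite_imp_closed finite_Diff)
  then have "\<forall>\<^sub>F t in nhds 0. t \<in> - (chart p -` S - {0})"
    by (rule eventually_nhds_in_open) simp
  then show ?thesis
    unfolding eventually_at_filter by (rule eventually_mono) auto
qed

lemma meromorphic_map_const: "meromorphic_map (\<lambda>_. x)"
proof -
  have "(\<lambda>_. 1) meromorphic_on {0}"
    by (rule analytic_on_imp_meromorphic_on) (rule analytic_on_const)
  then have "meromorphic_at_0 (\<lambda>t. 1 *\<^sub>C x)"
    by (rule meromorphic_at_0_single)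
  then show ?thesis
    by (simp add: meromorphic_map_def comp_def scaleC_one)
qed

text \<open>Meromorphic maps are identified when they agree outside a finite set; so their values at
  the poles are irrelevant.\<close>

definition mero_eq ::
    "(complex option \<Rightarrow> 'g::complex_vector) \<Rightarrow> (complex option \<Rightarrow> 'g) \<Rightarrow> bool" where
  "mero_eq f g \<longleftrightarrow> meromorphic_map f \<and> meromorphic_map g \<and> finite {p. f p \<noteq> g p}"

quotient_type (overloaded) 'g mero = "complex option \<Rightarrow> 'g::complex_vector" / partial: mero_eq
proof (rule part_equivpI)
  show "\<exists>f. mero_eq f (f :: complex option \<Rightarrow> 'g)"
    using meromorphic_map_const[of "0::'g"] by (intro exI[of _ "\<lambda>_. 0"]) (simp add: mero_eq_def)
  show "symp (mero_eq :: (complex option \<Rightarrow> 'g) \<Rightarrow> _)"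
    by (rule sympI) (simp add: mero_eq_def eq_commute)
  show "transp (mero_eq :: (complex option \<Rightarrow> 'g) \<Rightarrow> _)"
  proof (rule transpI)
    fix f g h :: "complex option \<Rightarrow> 'g"
    assume "mero_eq f g" "mero_eq g h"
    moreover have "{p. f p \<noteq> h p} \<subseteq> {p. f p \<noteq> g p} \<union> {p. g p \<noteq> h p}" by auto
    ultimately show "mero_eq f h"
      unfolding mero_eq_def by (meson finite_UnI finite_subset)
  qed
qed

lemma mero_eqI2:
  assumes "mero_eq f f'" "mero_eq g g'"
    and "\<And>p. meromorphic_at_0 (f \<circ> chart p) \<Longrightarrow> meromorphic_at_0 (g \<circ> chart p) \<Longrightarrow>
      meromorphic_at_0 ((\<lambda>q. F (f q) (g q)) \<circ> chart p)"
    and "\<And>p. meromorphic_at_0 (f' \<circ> chart p) \<Longrightarrow> meromorphic_at_0 (g' \<circ> chart p) \<Longrightarrow>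
      meromorphic_at_0 ((\<lambda>q. F (f' q) (g' q)) \<circ> chart p)"
  shows "mero_eq (\<lambda>q. F (f q) (g q)) (\<lambda>q. F (f' q) (g' q))"
proof -
  have "{q. F (f q) (g q) \<noteq> F (f' q) (g' q)} \<subseteq> {q. f q \<noteq> f' q} \<union> {q. g q \<noteq> g' q}" by auto
  then have "finite {q. F (f q) (g q) \<noteq> F (f' q) (g' q)}"
    using assms(1,2) unfolding mero_eq_def by (meson finite_UnI finite_subset)
  with assms show ?thesis unfolding mero_eq_def meromorphic_map_def by blast
qed

lemma mero_eq_add:
  "mero_eq f f' \<Longrightarrow> mero_eq g g' \<Longrightarrow> mero_eq (\<lambda>p. f p + g p) (\<lambda>p. f' p + g' p)"
  by (rule mero_eqI2) (auto simp: comp_def intro: meromorphic_at_0_add)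

lemma mero_eq_scaleC:
  assumes "mero_eq f f'"
  shows "mero_eq (\<lambda>p. c *\<^sub>C f p) (\<lambda>p. c *\<^sub>C f' p)"
  by (rule mero_eqI2[OF assms assms, where F = "\<lambda>x _. c *\<^sub>C x"])
    (auto simp: comp_def intro: meromorphic_at_0_scaleC)

lemma mero_eq_uminus: "mero_eq f f' \<Longrightarrow> mero_eq (\<lambda>p. - f p) (\<lambda>p. - f' p)"
  using mero_eq_scaleC[of f f' "- 1"] by (simp add: complex_vector.scale_minus_left scaleC_one)

lemma mero_eq_lie:
  "mero_eq f f' \<Longrightarrow> mero_eq g g' \<Longrightarrow> mero_eq (\<lambda>p. lie (f p) (g p)) (\<lambda>p. lie (f' p) (g' p))"
  by (rule mero_eqI2) (auto simp: comp_def intro: meromorphic_at_0_lie)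

lemma mero_eq_refl_const: "mero_eq (\<lambda>_. x) (\<lambda>_. x)"
  by (simp add: mero_eq_def meromorphic_map_const)

instantiation mero :: (complex_vector) complex_vector
begin

lift_definition zero_mero :: "'a mero" is "\<lambda>_. 0"
  by (simp add: mero_eq_def meromorphic_map_const)

lift_definition plus_mero :: "'a mero \<Rightarrow> 'a mero \<Rightarrow> 'a mero" is "\<lambda>f g p. f p + g p"
  by (rule mero_eq_add)

lift_definition scaleC_mero :: "complex \<Rightarrow> 'a mero \<Rightarrow> 'a mero" is "\<lambda>c f p. c *\<^sub>C f p"
  by (rule mero_eq_scaleC)

lift_definition uminus_mero :: "'a mero \<Rightarrow> 'a mero" is "\<lambda>f p. - f p"
  by (rule mero_eq_uminus)

definition minus_mero :: "'a mero \<Rightarrow> 'a mero \<Rightarrow> 'a mero" where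
  "minus_mero \<mu> \<nu> = \<mu> + - \<nu>"

instance
proof
  fix a b c :: "'a mero" and r s :: complex
  show "a + b + c = a + (b + c)"
    by transfer (simp add: add.assoc mero_eq_add)
  show "a + b = b + a"
    by transfer (subst add.commute, rule mero_eq_add)
  show "0 + a = a"
    by transfer simp
  show "- a + a = 0"
    by transfer (simp add: mero_eq_def meromorphic_map_const)
  show "a - b = a + - b"
    by (simp add: minus_mero_def)
  show "r *\<^sub>C (a + b) = r *\<^sub>C a + r *\<^sub>C b"
    by transfer (simp add: scaleC_add_right mero_eq_add mero_eq_scaleC)
  show "(r + s) *\<^sub>C a = r *\<^sub>C a + s *\<^sub>C a"
    by transfer (simp add: scaleC_add_left mero_eq_add mero_eq_scaleC)
  show "r *\<^sub>C s *\<^sub>C a = (r * s) *\<^sub>C a"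
    by transfer (simp add: scaleC_scaleC mero_eq_scaleC)
  show "1 *\<^sub>C a = a"
    by transfer (simp add: scaleC_one)
qed

end

instantiation mero :: (complex_lie_algebra) complex_lie_algebra
begin

lift_definition lie_mero :: "'a mero \<Rightarrow> 'a mero \<Rightarrow> 'a mero" is "\<lambda>f g p. lie (f p) (g p)"
  by (rule mero_eq_lie)

instance
proof
  fix a b c :: "'a mero" and r :: complex
  show "lie (a + b) c = lie a c + lie b c"
    by transfer (simp add: lie_add_left mero_eq_add mero_eq_lie)
  show "lie c (a + b) = lie c a + lie c b"
    by transfer (simp add: lie_add_right mero_eq_add mero_eq_lie)
  show "lie (r *\<^sub>C a) b = r *\<^sub>C lie a b"
    by transfer (simp add: lie_scaleC_left mero_eq_scaleC mero_eq_lie)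
  show "lie a (r *\<^sub>C b) = r *\<^sub>C lie a b"
    by transfer (simp add: lie_scaleC_right mero_eq_scaleC mero_eq_lie)
  show "lie a a = 0"
    by transfer (simp add: lie_self mero_eq_def meromorphic_map_const)
  show "lie a (lie b c) + lie b (lie c a) + lie c (lie a b) = 0"
    by transfer (simp add: jacobi mero_eq_def meromorphic_map_const)
qed

end

lift_definition const_mero :: "'g::complex_vector \<Rightarrow> 'g mero" is "\<lambda>x _. x"
  by (simp add: mero_eq_def meromorphic_map_const)

lemma mero_eq_update:
  assumes "mero_eq f g"
  shows "holomorphic_at_0 (f(p := v) \<circ> chart p) \<longleftrightarrow> holomorphic_at_0 (g(p := v) \<circ> chart p)"
proof -
  have fin: "finite {q. f q \<noteq> g q}" using assms by (simp add: mero_eq_def)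
  have "\<forall>\<^sub>F t in at 0. (f(p := v)) (chart p t) = (g(p := v)) (chart p t)"
    using eventually_chart_notin[OF fin, of p] by eventually_elim auto
  moreover have "chart p 0 = p" by (cases p) auto
  ultimately have *: "\<forall>\<^sub>F t in nhds 0. (f(p := v)) (chart p t) = (g(p := v)) (chart p t)"
    by (auto simp: eventually_at_filter elim: eventually_mono)
  have "(\<forall>\<^sub>F t in nhds 0. (f(p := v)) (chart p t) = r t) \<longleftrightarrow>
        (\<forall>\<^sub>F t in nhds 0. (g(p := v)) (chart p t) = r t)" for r :: "complex \<Rightarrow> 'a"
    by (rule eventually_cong[OF *]) simp
  then show ?thesis unfolding holomorphic_at_0_def comp_def by simp
qed

lift_definition has_value_at :: "'g::complex_vector mero \<Rightarrow> complex option \<Rightarrow> 'g \<Rightarrow> bool"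
  is "\<lambda>f p v. holomorphic_at_0 (f(p := v) \<circ> chart p)"
  by (intro ext mero_eq_update)

definition regular_at :: "'g::complex_vector mero \<Rightarrow> complex option \<Rightarrow> bool" where
  "regular_at \<nu> p \<longleftrightarrow> (\<exists>v. has_value_at \<nu> p v)"

definition mero_value :: "'g::complex_vector mero \<Rightarrow> complex option \<Rightarrow> 'g" where
  "mero_value \<nu> p = (THE v. has_value_at \<nu> p v)"

definition regular_on :: "complex option set \<Rightarrow> 'g::complex_vector mero set" where
  "regular_on S = {\<nu>. \<forall>p\<in>S. regular_at \<nu> p}"

abbreviation poles_in :: "complex option set \<Rightarrow> 'g::complex_vector mero set" where
  "poles_in D \<equiv> regular_on (- D)"

text \<open>\<open>(1 / 2 \<pi> \<i>) \<integral> (\<mu>, d\<nu>)\<close> along \<open>\<gamma>\<close>: the pull-back of the form \<open>(\<mu>, d\<nu>)\<close> by \<open>\<gamma>\<close> is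
  \<open>(\<mu> (\<gamma> t), (d/ds) \<nu> (\<gamma> s)) dt\<close> at \<open>s = t\<close>.\<close>

definition boundary_pairing ::
    "('g::complex_vector \<Rightarrow> 'g \<Rightarrow> complex) \<Rightarrow> (real \<Rightarrow> complex option) \<Rightarrow> 'g mero \<Rightarrow> 'g mero \<Rightarrow> complex"
  where
  "boundary_pairing B \<gamma> \<mu> \<nu> =
     1 / (2 * of_real pi * \<i>) *
     integral {0..1} (\<lambda>t. vector_derivative
       (\<lambda>s. B (mero_value \<mu> (\<gamma> t)) (mero_value \<nu> (\<gamma> s))) (at t))"


section \<open>Free modules, quotients and tensor products\<close>

definition free_module :: "'x set \<Rightarrow> (complex, 'x \<Rightarrow>\<^sub>0 complex) module" where
  "free_module S = \<lparr>carrier = {f. Poly_Mapping.keys f \<subseteq> S}, monoid.mult = undefined, one = undefined,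
     ring.zero = 0, add = (+), smult = (\<lambda>c f. Poly_Mapping.map ((*) c) f)\<rparr>"

definition complex_ring :: "complex ring" where
  "complex_ring = \<lparr>carrier = UNIV, monoid.mult = (*), one = 1, ring.zero = 0, add = (+)\<rparr>"

definition submodule_gen :: "(complex, 'a, 'm) module_scheme \<Rightarrow> 'a set \<Rightarrow> 'a set" where
  "submodule_gen M S = \<Inter>{H. submodule H complex_ring M \<and> S \<subseteq> H}"

text \<open>The quotient of a module by a submodule, or of an algebra by a two-sided ideal. Its elements
  are cosets. (The set added to the scalar multiple of a coset only matters for the scalar 0.)\<close>

definition quot_module ::
    "(complex, 'a, 'm) module_scheme \<Rightarrow> 'a set \<Rightarrow> (complex, 'a set) module" where
  "quot_module M N = ring.extend (M Quot N)
     (module.fields (\<lambda>c A. N <+>\<^bsub>M\<^esub> (\<lambda>a. c \<odot>\<^bsub>M\<^esub> a) ` A))"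

text \<open>The linear map, from a quotient of a free module to \<open>M\<close>, with prescribed values on the
  classes of the basis vectors (provided that it exists).\<close>

definition lin_lift ::
    "(complex, 'a, 'm) module_scheme \<Rightarrow> ('x \<Rightarrow> 'a) \<Rightarrow> ('x \<Rightarrow>\<^sub>0 complex) set \<Rightarrow> 'a" where
  "lin_lift M \<phi> A =
     the_elem ((\<lambda>f. \<Oplus>\<^bsub>M\<^esub>x\<in>Poly_Mapping.keys f. Poly_Mapping.lookup f x \<odot>\<^bsub>M\<^esub> \<phi> x) ` A)"

text \<open>The tensor product, over a complex algebra \<open>R\<close>, of a right \<open>R\<close>-module \<open>M\<close> with action
  \<open>ract\<close> and a left \<open>R\<close>-module \<open>N\<close> with action \<open>lact\<close>.\<close>

definition tensor_relations ::
    "(complex, 'r) module \<Rightarrow> (complex, 'a) module \<Rightarrow> (complex, 'b) module \<Rightarrow>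
     ('a \<Rightarrow> 'r \<Rightarrow> 'a) \<Rightarrow> ('r \<Rightarrow> 'b \<Rightarrow> 'b) \<Rightarrow> ('a \<times> 'b \<Rightarrow>\<^sub>0 complex) set" where
  "tensor_relations R M N ract lact =
     submodule_gen (free_module (carrier M \<times> carrier N))
      ({Poly_Mapping.single (a \<oplus>\<^bsub>M\<^esub> a', b) 1 - Poly_Mapping.single (a, b) 1
          - Poly_Mapping.single (a', b) 1 | a a' b.
          a \<in> carrier M \<and> a' \<in> carrier M \<and> b \<in> carrier N} \<union>
       {Poly_Mapping.single (a, b \<oplus>\<^bsub>N\<^esub> b') 1 - Poly_Mapping.single (a, b) 1
          - Poly_Mapping.single (a, b') 1 | a b b'.
          a \<in> carrier M \<and> b \<in> carrier N \<and> b' \<in> carrier N} \<union>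
       {Poly_Mapping.single (c \<odot>\<^bsub>M\<^esub> a, b) 1 - Poly_Mapping.single (a, b) c | c a b.
          a \<in> carrier M \<and> b \<in> carrier N} \<union>
       {Poly_Mapping.single (a, c \<odot>\<^bsub>N\<^esub> b) 1 - Poly_Mapping.single (a, b) c | c a b.
          a \<in> carrier M \<and> b \<in> carrier N} \<union>
       {Poly_Mapping.single (ract a r, b) 1 - Poly_Mapping.single (a, lact r b) 1 | a r b.
          a \<in> carrier M \<and> r \<in> carrier R \<and> b \<in> carrier N})"

definition tensor_over ::
    "(complex, 'r) module \<Rightarrow> (complex, 'a) module \<Rightarrow> (complex, 'b) module \<Rightarrow>
     ('a \<Rightarrow> 'r \<Rightarrow> 'a) \<Rightarrow> ('r \<Rightarrow> 'b \<Rightarrow> 'b) \<Rightarrow> (complex, ('a \<times> 'b \<Rightarrow>\<^sub>0 complex) set) module" where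
  "tensor_over R M N ract lact =
     quot_module (free_module (carrier M \<times> carrier N)) (tensor_relations R M N ract lact)"

text \<open>The class of a basis vector in a quotient of a free module. As every coset contains its
  representatives, the zero of the quotient module is the submodule divided out.\<close>

definition basis_class :: "(complex, ('x \<Rightarrow>\<^sub>0 complex) set) module \<Rightarrow> 'x \<Rightarrow> ('x \<Rightarrow>\<^sub>0 complex) set" where
  "basis_class Q x = (\<lambda>f. f + Poly_Mapping.single x 1) ` \<zero>\<^bsub>Q\<^esub>"


section \<open>Universal enveloping algebras\<close>

text \<open>Lists form a monoid under concatenation, so that \<^typ>\<open>'l list \<Rightarrow>\<^sub>0 complex\<close> is the
  free associative algebra on \<^typ>\<open>'l\<close>.\<close>

instantiation list :: (type) monoid_add
begin

definition zero_list :: "'a list" where "zero_list = []"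
definition plus_list :: "'a list \<Rightarrow> 'a list \<Rightarrow> 'a list" where "plus_list = (@)"

instance by standard (simp_all add: zero_list_def plus_list_def)

end

definition free_algebra :: "'l set \<Rightarrow> (complex, 'l list \<Rightarrow>\<^sub>0 complex) module" where
  "free_algebra L = (free_module (lists L)) \<lparr>monoid.mult := (*), one := 1\<rparr>"

text \<open>The enveloping algebra of a Lie subalgebra \<open>L\<close> of the Lie algebra \<^typ>\<open>'l\<close>.\<close>

definition env_ideal :: "'l::complex_lie_algebra set \<Rightarrow> ('l list \<Rightarrow>\<^sub>0 complex) set" where
  "env_ideal L = genideal (free_algebra L)
     ({Poly_Mapping.single [x + y] 1 - Poly_Mapping.single [x] 1 - Poly_Mapping.single [y] 1 | x y.
         x \<in> L \<and> y \<in> L} \<union>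
      {Poly_Mapping.single [c *\<^sub>C x] 1 - Poly_Mapping.single [x] c | c x. x \<in> L} \<union>
      {Poly_Mapping.single [x] 1 * Poly_Mapping.single [y] 1
         - Poly_Mapping.single [y] 1 * Poly_Mapping.single [x] 1
         - Poly_Mapping.single [lie x y] 1 | x y. x \<in> L \<and> y \<in> L})"

definition env :: "'l::complex_lie_algebra set \<Rightarrow> (complex, ('l list \<Rightarrow>\<^sub>0 complex) set) module" where
  "env L = quot_module (free_algebra L) (env_ideal L)"

text \<open>The algebra homomorphism induced by a homomorphism of Lie algebras \<open>h\<close> into \<open>L\<close>.\<close>

definition env_map ::
    "'l::complex_lie_algebra set \<Rightarrow> ('k \<Rightarrow> 'l) \<Rightarrow> ('k list \<Rightarrow>\<^sub>0 complex) set \<Rightarrow> ('l list \<Rightarrow>\<^sub>0 complex) set" where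
  "env_map L h = lin_lift (env L) (\<lambda>ws. basis_class (env L) (map h ws))"


section \<open>The tensor product of the representations\<close>

type_synonym 'l env_elem = "('l list \<Rightarrow>\<^sub>0 complex) set"
type_synonym 'w tensor_elem = "((nat \<Rightarrow> 'w) \<Rightarrow>\<^sub>0 complex) set"
type_synonym ('g, 'w) ind_elem = "('g mero env_elem \<times> 'w tensor_elem \<Rightarrow>\<^sub>0 complex) set"

context
  fixes n :: nat
    and W :: "nat \<Rightarrow> 'w::complex_vector set"
    and \<rho> :: "nat \<Rightarrow> 'g::complex_lie_algebra \<Rightarrow> 'w \<Rightarrow> 'w"
begin

definition tensor_reps :: "(complex, 'w tensor_elem) module" where
  "tensor_reps =
     (let F = free_module (\<Pi>\<^sub>E k\<in>{1..n}. W k) in quot_module F (submodule_gen F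
       ({Poly_Mapping.single (w(k := u + v)) 1 - Poly_Mapping.single (w(k := u)) 1
           - Poly_Mapping.single (w(k := v)) 1 | w k u v.
           w \<in> (\<Pi>\<^sub>E k\<in>{1..n}. W k) \<and> k \<in> {1..n} \<and> u \<in> W k \<and> v \<in> W k} \<union>
        {Poly_Mapping.single (w(k := c *\<^sub>C u)) 1 - Poly_Mapping.single (w(k := u)) c | w k c u.
           w \<in> (\<Pi>\<^sub>E k\<in>{1..n}. W k) \<and> k \<in> {1..n} \<and> u \<in> W k})))"

definition pure_tensor :: "(nat \<Rightarrow> 'w) \<Rightarrow> 'w tensor_elem" where
  "pure_tensor w = basis_class tensor_reps w"

definition tensor_reps_act ::
    "'g \<Rightarrow> 'w tensor_elem \<Rightarrow> 'w tensor_elem" where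
  "tensor_reps_act x = lin_lift tensor_reps
     (\<lambda>w. \<Oplus>\<^bsub>tensor_reps\<^esub>k\<in>{1..n}. pure_tensor (w(k := \<rho> k x (w k))))"

definition tensor_reps_env_act ::
    "'g env_elem \<Rightarrow> 'w tensor_elem \<Rightarrow> 'w tensor_elem" where
  "tensor_reps_env_act a t = lin_lift tensor_reps (\<lambda>xs. foldr tensor_reps_act xs t) a"


section \<open>The induced module and the current operators\<close>

context
  fixes D :: "complex option set"
begin

text \<open>\<open>U(\<^sub>D\<gg>) \<otimes> (W\<^sub>1 \<otimes> \<dots> \<otimes> W\<^sub>n)\<close> over the enveloping algebra of the Lie algebra of constants\<close>

definition ind_module ::
    "(complex, ('g, 'w) ind_elem) module"
  where
  "ind_module = tensor_over (env (UNIV :: 'g set)) (env (poles_in D)) tensor_reps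
     (\<lambda>u a. u \<otimes>\<^bsub>env (poles_in D)\<^esub> env_map (poles_in D) const_mero a)
     tensor_reps_env_act"

definition ind_act ::
    "'g mero \<Rightarrow> ('g, 'w) ind_elem \<Rightarrow>
     ('g, 'w) ind_elem" where
  "ind_act \<alpha> = lin_lift ind_module
     (\<lambda>(u, t). basis_class ind_module
        (basis_class (env (poles_in D)) [\<alpha>] \<otimes>\<^bsub>env (poles_in D)\<^esub> u, t))"

definition ind_tensor ::
    "(nat \<Rightarrow> 'w) \<Rightarrow> ('g, 'w) ind_elem" where
  "ind_tensor w = basis_class ind_module (\<one>\<^bsub>env (poles_in D)\<^esub>, pure_tensor w)"

context
  fixes B :: "'g \<Rightarrow> 'g \<Rightarrow> complex"
    and \<gamma> :: "real \<Rightarrow> complex option"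
    and z :: "nat \<Rightarrow> complex option"
begin

definition is_current_operator ::
    "('g mero \<Rightarrow>
      ('g, 'w) ind_elem \<Rightarrow>
      ('g, 'w) ind_elem) \<Rightarrow> bool"
  where
  "is_current_operator J \<longleftrightarrow>
     (let V = ind_module; G = regular_on (proj_line frontier_of D) in
      J \<in> G \<rightarrow>\<^sub>E (carrier V \<rightarrow>\<^sub>E carrier V) \<and>
      (\<forall>\<nu>\<in>G. \<forall>v\<in>carrier V. \<forall>v'\<in>carrier V. J \<nu> (v \<oplus>\<^bsub>V\<^esub> v') = J \<nu> v \<oplus>\<^bsub>V\<^esub> J \<nu> v') \<and>
      (\<forall>\<nu>\<in>G. \<forall>c. \<forall>v\<in>carrier V. J \<nu> (c \<odot>\<^bsub>V\<^esub> v) = c \<odot>\<^bsub>V\<^esub> J \<nu> v) \<and>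
      (\<forall>\<mu>\<in>G. \<forall>\<nu>\<in>G. \<forall>v\<in>carrier V. J (\<mu> + \<nu>) v = J \<mu> v \<oplus>\<^bsub>V\<^esub> J \<nu> v) \<and>
      (\<forall>\<nu>\<in>G. \<forall>c. \<forall>v\<in>carrier V. J (c *\<^sub>C \<nu>) v = c \<odot>\<^bsub>V\<^esub> J \<nu> v) \<and>
      (\<forall>\<nu>\<in>G. \<forall>\<alpha>\<in>poles_in D. \<forall>v\<in>carrier V.
         J \<nu> (ind_act \<alpha> v) \<ominus>\<^bsub>V\<^esub> ind_act \<alpha> (J \<nu> v) =
         J (lie \<nu> \<alpha>) v \<oplus>\<^bsub>V\<^esub> boundary_pairing B \<gamma> \<nu> \<alpha> \<odot>\<^bsub>V\<^esub> v) \<and>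
      (\<forall>\<nu>\<in>G \<inter> regular_on (exterior D). \<forall>w\<in>(\<Pi>\<^sub>E k\<in>{1..n}. W k).
         J \<nu> (ind_tensor w) = ind_act \<nu> (ind_tensor w) \<ominus>\<^bsub>V\<^esub>
           (\<Oplus>\<^bsub>V\<^esub>k\<in>{k\<in>{1..n}. z k \<in> exterior D}.
              ind_tensor (w(k := \<rho> k (mero_value \<nu> (z k)) (w k))))) \<and>
      (\<forall>\<nu>\<in>G \<inter> regular_on D. \<forall>w\<in>(\<Pi>\<^sub>E k\<in>{1..n}. W k).
         J \<nu> (ind_tensor w) =
           (\<Oplus>\<^bsub>V\<^esub>k\<in>{k\<in>{1..n}. z k \<in> D}.
              ind_tensor (w(k := \<rho> k (mero_value \<nu> (z k)) (w k))))))"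

text \<open>The family \<open>\<^sub>DJ\<close>, indexed by the maps that are regular along the boundary. The conditions
  above determine it, as the induced module is generated by the image of \<open>W\<^sub>1 \<otimes> \<dots> \<otimes> W\<^sub>n\<close>.\<close>

definition current_operator ::
    "'g mero \<Rightarrow>
      ('g, 'w) ind_elem \<Rightarrow>
      ('g, 'w) ind_elem"
  where "current_operator = (THE J. is_current_operator J)"

end

end

end

end

theory Submission
  imports Defs "HOL-Library.Function_Algebras"
begin

text \<open>
  Write \<open>V\<close> for the induced module \<open>U(\<^sub>D\<gg>) \<otimes> (W\<^sub>1 \<otimes> \<dots> \<otimes> W\<^sub>n)\<close>, \<open>L\<close> for the Lie algebra of the maps with
  all poles in \<open>D\<close>, \<open>G\<close> for that of the maps that are regular along the boundary, and
  \<open>c(\<mu>, \<nu>)\<close> for the boundary pairing. Everything rests on two properties of \<open>V\<close>: it is generated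
  by the image of \<open>W\<^sub>1 \<otimes> \<dots> \<otimes> W\<^sub>n\<close> under \<open>L\<close> (\<open>vs_generated\<close>), and a multilinear map from the \<open>W\<^sub>k\<close>
  to a representation of \<open>L\<close> that is equivariant under the constants extends to a homomorphism on
  \<open>V\<close> (\<open>vs_universal\<close>).

  The pairing \<open>c\<close> is antisymmetric by integration by parts, and a cocycle by the invariance of the
  form: \<open>c(\<nu>, [\<alpha>, \<beta>]) = c([\<nu>, \<alpha>], \<beta>) - c([\<nu>, \<beta>], \<alpha>)\<close> (\<open>bp_cocycle\<close>). It vanishes if the poles of
  both arguments lie in one connected set that avoids the boundary (\<open>bp_eq_0\<close>): by partial
  fractions it suffices to consider maps with a single pole, and then Cauchy's theorem applies,
  since in a coordinate with pole at one point of the set the boundary curve has winding number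
  zero around every other point of the set. The domain \<open>D\<close> is such a set. By the Jordan curve
  theorem the exterior is contained in such a set, which suffices (\<open>exterior_in_connected\<close>).
  Hence \<open>c(\<mu>, \<nu>) = 0\<close> in the cases (a) and (b), and only the general formula remains.

  The current operators are the only family with their defining properties, as \<open>V\<close> is generated by
  the tensor product (\<open>current_family_unique\<close>). For the existence (\<open>ex_current_family\<close>), let \<open>L\<close> act
  on the pairs of a vector \<open>v\<close> and a linear map \<open>\<phi>\<close> from \<open>G\<close> to \<open>V\<close> by
  \<open>\<alpha> (v, \<phi>) = (\<alpha> v, \<nu> \<mapsto> \<alpha> \<phi>(\<nu>) + \<phi>([\<nu>, \<alpha>]) + c(\<nu>, \<alpha>) v)\<close>.
  This is a representation by the cocycle identity, and the commutation relations of the family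
  \<open>J\<close> with \<open>L\<close> say that \<open>v \<mapsto> (v, \<nu> \<mapsto> J \<nu> v)\<close> is a homomorphism. So \<open>J\<close> is provided by the universal
  property; the two formulas that prescribe it on the tensor product are compatible, because by
  partial fractions every map in \<open>G\<close> is a sum of a map in \<open>L\<close> and a map with all poles in the
  exterior, uniquely up to constants.

  Finally, consider the defect \<open>R(\<mu>, \<nu>) = [J \<mu>, J \<nu>] - J [\<mu>, \<nu>] - c(\<mu>, \<nu>)\<close>. By the Jacobi identity
  and the cocycle identity \<open>[R(\<mu>, \<nu>), \<alpha>] = R([\<mu>, \<alpha>], \<nu>) + R(\<mu>, [\<nu>, \<alpha>])\<close> for \<open>\<alpha>\<close> in \<open>L\<close> (\<open>defect_act\<close>).
  So it suffices that all \<open>R(\<mu>, \<nu>)\<close> vanish on the image of the tensor product. By bilinearity and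
  antisymmetry there are three cases, according to the positions of the poles, in which the
  defining formulas can be inserted: \<open>defect_tens_L\<close>, \<open>defect_tens_G2\<close> and \<open>defect_tens_G2_L\<close>. In the
  mixed case the operators at the points in \<open>D\<close> and at the points in the exterior commute because
  they act on different tensor factors, and the term \<open>c(\<mu>, \<nu>)\<close> arises from the commutation
  relation with \<open>L\<close>.
\<close>

section \<open>Values of meromorphic maps\<close>

lemma linear_functional_separates:
  fixes x y :: "'v::complex_vector"
  assumes "\<And>\<phi>. Vector_Spaces.linear scaleC (*) \<phi> \<Longrightarrow> \<phi> x = \<phi> y"
  shows "x = y"
proof (rule ccontr)
  assume "x \<noteq> y"
  define d where "d = x - y"
  have "d \<noteq> 0" using \<open>x \<noteq> y\<close> by (simp add: d_def)
  interpret cc: vector_space_pair "scaleC :: complex \<Rightarrow> 'v \<Rightarrow> 'v" "(*) :: complex \<Rightarrow> complex \<Rightarrow> complex"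
    by unfold_locales (auto simp: algebra_simps)
  have "complex_vector.independent {d}"
    using \<open>d \<noteq> 0\<close> complex_vector.dependent_single by auto
  then obtain \<phi> where \<phi>: "Vector_Spaces.linear scaleC (*) \<phi>" "\<forall>x\<in>{d}. \<phi> x = 1"
    using cc.linear_independent_extend[of "{d}" "\<lambda>_. 1"] by blast
  interpret \<phi>: Vector_Spaces.linear scaleC "(*)" \<phi> by (fact \<phi>(1))
  have "\<phi> x - \<phi> y = 1" using \<phi>(2) by (simp add: d_def \<phi>.diff)
  then show False using assms[OF \<phi>(1)] by simp
qed

lemma linear_functional_sum_scaleC:
  assumes "Vector_Spaces.linear scaleC (*) \<phi>"
  shows "\<phi> (\<Sum>i\<in>A. c i *\<^sub>C x i) = (\<Sum>i\<in>A. c i * \<phi> (x i))"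
proof -
  interpret Vector_Spaces.linear scaleC "(*)" \<phi> by fact
  show ?thesis by (simp add: sum scale)
qed

lemma holomorphic_at_0_zero: "holomorphic_at_0 (\<lambda>_. 0)"
  unfolding holomorphic_at_0_def by (rule exI[of _ 0]) auto

lemma holomorphic_at_0_single:
  assumes "h analytic_on {0}"
  shows "holomorphic_at_0 (\<lambda>t. h t *\<^sub>C x)"
  unfolding holomorphic_at_0_def
  by (rule exI[of _ 1], rule exI[of _ "\<lambda>_. h"], rule exI[of _ "\<lambda>_. x"]) (use assms in auto)

lemma holomorphic_at_0_const: "holomorphic_at_0 (\<lambda>_. x)"
  using holomorphic_at_0_single[of "\<lambda>_. 1" x] by (simp add: scaleC_one analytic_on_const)

lemma holomorphic_at_0_cong:
  assumes "holomorphic_at_0 f" "\<forall>\<^sub>F t in nhds 0. g t = f t"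
  shows "holomorphic_at_0 g"
proof -
  obtain n h x where 1: "\<forall>i<n::nat. h i analytic_on {0}"
      "\<forall>\<^sub>F t in nhds 0. f t = (\<Sum>i<n. h i t *\<^sub>C x i)"
    using assms(1) unfolding holomorphic_at_0_def by blast
  have "\<forall>\<^sub>F t in nhds 0. g t = (\<Sum>i<n. h i t *\<^sub>C x i)"
    using 1(2) assms(2) by eventually_elim simp
  with 1(1) show ?thesis unfolding holomorphic_at_0_def by blast
qed

lemma holomorphic_at_0_add:
  assumes "holomorphic_at_0 f" "holomorphic_at_0 g"
  shows "holomorphic_at_0 (\<lambda>t. f t + g t)"
proof -
  obtain n h x where 1: "\<forall>i<n::nat. h i analytic_on {0}"
      "\<forall>\<^sub>F t in nhds 0. f t = (\<Sum>i<n. h i t *\<^sub>C x i)"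
    using assms(1) unfolding holomorphic_at_0_def by blast
  obtain m k y where 2: "\<forall>i<m::nat. k i analytic_on {0}"
      "\<forall>\<^sub>F t in nhds 0. g t = (\<Sum>i<m. k i t *\<^sub>C y i)"
    using assms(2) unfolding holomorphic_at_0_def by blast
  define l where "l i = (if i < n then h i else k (i - n))" for i
  define w where "w i = (if i < n then x i else y (i - n))" for i
  have sum: "(\<Sum>i<n + m. l i t *\<^sub>C w i) = (\<Sum>i<n. h i t *\<^sub>C x i) + (\<Sum>i<m. k i t *\<^sub>C y i)" for t
  proof -
    have "(\<Sum>i<n + m. F i) = (\<Sum>i<n. F i) + (\<Sum>i<m. F (n + i))" for F :: "nat \<Rightarrow> 'a"
      by (induction m) (simp_all add: add.assoc)
    then show ?thesis by (simp add: l_def w_def)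
  qed
  have "\<forall>i<n + m. l i analytic_on {0}"
    using 1(1) 2(1) by (auto simp: l_def)
  moreover have "\<forall>\<^sub>F t in nhds 0. f t + g t = (\<Sum>i<n + m. l i t *\<^sub>C w i)"
    using 1(2) 2(2) by eventually_elim (simp add: sum)
  ultimately show ?thesis unfolding holomorphic_at_0_def by blast
qed

lemma holomorphic_at_0_sum:
  "(\<And>a. a \<in> A \<Longrightarrow> holomorphic_at_0 (f a)) \<Longrightarrow> holomorphic_at_0 (\<lambda>t. \<Sum>a\<in>A. f a t)"
  by (induction A rule: infinite_finite_induct)
    (simp_all add: holomorphic_at_0_zero holomorphic_at_0_add)

lemma holomorphic_at_0_scaleC:
  assumes "holomorphic_at_0 f"
  shows "holomorphic_at_0 (\<lambda>t. c *\<^sub>C f t)"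
proof -
  obtain n h x where 1: "\<forall>i<n::nat. h i analytic_on {0}"
      "\<forall>\<^sub>F t in nhds 0. f t = (\<Sum>i<n. h i t *\<^sub>C x i)"
    using assms(1) unfolding holomorphic_at_0_def by blast
  have "holomorphic_at_0 (\<lambda>t. \<Sum>i<n. h i t *\<^sub>C c *\<^sub>C x i)"
    by (intro holomorphic_at_0_sum holomorphic_at_0_single) (use 1 in auto)
  moreover have "\<forall>\<^sub>F t in nhds 0. c *\<^sub>C f t = (\<Sum>i<n. h i t *\<^sub>C c *\<^sub>C x i)"
    using 1(2) by eventually_elim
      (simp add: complex_vector.scale_sum_right mult.commute)
  ultimately show ?thesis by (rule holomorphic_at_0_cong)
qed

lemma holomorphic_at_0_lie:
  assumes "holomorphic_at_0 f" "holomorphic_at_0 g"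
  shows "holomorphic_at_0 (\<lambda>t. lie (f t) (g t))"
proof -
  obtain n h x where 1: "\<forall>i<n::nat. h i analytic_on {0}"
      "\<forall>\<^sub>F t in nhds 0. f t = (\<Sum>i<n. h i t *\<^sub>C x i)"
    using assms(1) unfolding holomorphic_at_0_def by blast
  obtain m k y where 2: "\<forall>i<m::nat. k i analytic_on {0}"
      "\<forall>\<^sub>F t in nhds 0. g t = (\<Sum>i<m. k i t *\<^sub>C y i)"
    using assms(2) unfolding holomorphic_at_0_def by blast
  have "holomorphic_at_0 (\<lambda>t. \<Sum>i<n. \<Sum>j<m. (h i t * k j t) *\<^sub>C lie (x i) (y j))"
    by (intro holomorphic_at_0_sum holomorphic_at_0_single analytic_on_mult)
      (use 1(1) 2(1) in auto)
  moreover have "\<forall>\<^sub>F t in nhds 0. lie (f t) (g t) =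
      (\<Sum>i<n. \<Sum>j<m. (h i t * k j t) *\<^sub>C lie (x i) (y j))"
    using 1(2) 2(2)
  proof eventually_elim
    case (elim t)
    have "lie (h i t *\<^sub>C x i) (k j t *\<^sub>C y j) = (h i t * k j t) *\<^sub>C lie (x i) (y j)" for i j
      by (simp only: lie_scaleC_left lie_scaleC_right scaleC_scaleC mult.commute)
    then show ?case
      unfolding elim lie_sum_left unfolding lie_sum_right by (simp only:)
  qed
  ultimately show ?thesis by (rule holomorphic_at_0_cong)
qed

text \<open>Properties of maps with values in a vector space are reduced to those of scalar functions by
  means of linear functionals, which separate the points.\<close>

lemma holomorphic_at_0_functional:
  assumes "holomorphic_at_0 f" "Vector_Spaces.linear scaleC (*) \<phi>"
  shows "(\<lambda>t. \<phi> (f t)) analytic_on {0}"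
proof -
  obtain n h x where 1: "\<forall>i<n::nat. h i analytic_on {0}"
      "\<forall>\<^sub>F t in nhds 0. f t = (\<Sum>i<n. h i t *\<^sub>C x i)"
    using assms(1) unfolding holomorphic_at_0_def by blast
  have "(\<lambda>t. \<Sum>i<n. h i t * \<phi> (x i)) analytic_on {0}"
    using 1(1) by (intro analytic_on_sum analytic_on_mult analytic_on_const) auto
  moreover have "\<forall>\<^sub>F t in nhds 0. \<phi> (f t) = (\<Sum>i<n. h i t * \<phi> (x i))"
    using 1(2) by eventually_elim (simp add: linear_functional_sum_scaleC[OF assms(2)])
  ultimately show ?thesis
    using analytic_at_cong by fastforce
qed

lemma chart_0 [simp]: "chart p 0 = p"
  by (cases p) auto

lemma has_value_at_unique:
  assumes "has_value_at \<nu> p v" "has_value_at \<nu> p w"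
  shows "v = w"
  using assms
proof (transfer fixing: p v w)
  fix f :: "complex option \<Rightarrow> 'a"
  assume v: "holomorphic_at_0 (f(p := v) \<circ> chart p)" and w: "holomorphic_at_0 (f(p := w) \<circ> chart p)"
  show "v = w"
  proof (rule linear_functional_separates)
    fix \<phi> :: "'a \<Rightarrow> complex" assume \<phi>: "Vector_Spaces.linear scaleC (*) \<phi>"
    have lim: "((\<lambda>t. \<phi> (f (chart p t))) \<longlongrightarrow> \<phi> u) (at 0)"
      if u: "holomorphic_at_0 (f(p := u) \<circ> chart p)" for u
    proof -
      have "isCont (\<lambda>t. \<phi> ((f(p := u) \<circ> chart p) t)) 0"
        using holomorphic_at_0_functional[OF u \<phi>] by (rule analytic_at_imp_isCont)
      then have l: "((\<lambda>t. \<phi> ((f(p := u) \<circ> chart p) t)) \<longlongrightarrow> \<phi> u) (at 0)"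
        by (simp add: isCont_def)
      have "\<forall>\<^sub>F t in at 0. \<phi> ((f(p := u) \<circ> chart p) t) = \<phi> (f (chart p t))"
        by (rule eventually_mono[OF eventually_chart_notin[of "{p}" p]]) simp_all
      with l show ?thesis by (rule Lim_transform_eventually)
    qed
    show "\<phi> v = \<phi> w"
      by (rule tendsto_unique[OF _ lim[OF v] lim[OF w]]) simp
  qed
qed

lemma mero_value_eq: "has_value_at \<nu> p v \<Longrightarrow> mero_value \<nu> p = v"
  unfolding mero_value_def by (rule the_equality) (auto intro: has_value_at_unique)

lemma has_value_at_mero_value: "regular_at \<nu> p \<Longrightarrow> has_value_at \<nu> p (mero_value \<nu> p)"
  unfolding regular_at_def using mero_value_eq by force

lemma has_value_at_add:
  "has_value_at \<mu> p v \<Longrightarrow> has_value_at \<nu> p w \<Longrightarrow> has_value_at (\<mu> + \<nu>) p (v + w)"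
proof (transfer fixing: p v w)
  fix f g assume "holomorphic_at_0 (f(p := v) \<circ> chart p)" "holomorphic_at_0 (g(p := w) \<circ> chart p)"
  from holomorphic_at_0_add[OF this]
  show "holomorphic_at_0 ((\<lambda>q. f q + g q)(p := v + w) \<circ> chart p)"
    by (rule back_subst[of holomorphic_at_0]) auto
qed

lemma has_value_at_scaleC:
  "has_value_at \<mu> p v \<Longrightarrow> has_value_at (c *\<^sub>C \<mu>) p (c *\<^sub>C v)"
proof (transfer fixing: p v c)
  fix f assume "holomorphic_at_0 (f(p := v) \<circ> chart p)"
  from holomorphic_at_0_scaleC[OF this, of c]
  show "holomorphic_at_0 ((\<lambda>q. c *\<^sub>C f q)(p := c *\<^sub>C v) \<circ> chart p)"
    by (rule back_subst[of holomorphic_at_0]) auto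
qed

lemma has_value_at_lie:
  "has_value_at \<mu> p v \<Longrightarrow> has_value_at \<nu> p w \<Longrightarrow> has_value_at (lie \<mu> \<nu>) p (lie v w)"
proof (transfer fixing: p v w)
  fix f g assume "holomorphic_at_0 (f(p := v) \<circ> chart p)" "holomorphic_at_0 (g(p := w) \<circ> chart p)"
  from holomorphic_at_0_lie[OF this]
  show "holomorphic_at_0 ((\<lambda>q. lie (f q) (g q))(p := lie v w) \<circ> chart p)"
    by (rule back_subst[of holomorphic_at_0]) auto
qed

lemma has_value_at_const: "has_value_at (const_mero x) p x"
proof (transfer fixing: p x)
  have "(\<lambda>_. x)(p := x) \<circ> chart p = (\<lambda>_. x)" by auto
  then show "holomorphic_at_0 ((\<lambda>_. x)(p := x) \<circ> chart p)"
    by (simp add: holomorphic_at_0_const)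
qed

lemma const_mero_add: "const_mero (x + y) = const_mero x + const_mero y"
  by transfer (rule mero_eq_refl_const)

lemma const_mero_scaleC: "const_mero (c *\<^sub>C x) = c *\<^sub>C const_mero x"
  by transfer (rule mero_eq_refl_const)

lemma const_mero_lie: "const_mero (lie x y) = lie (const_mero x) (const_mero y)"
  by transfer (rule mero_eq_refl_const)

lemma const_mero_0: "const_mero 0 = 0"
  by transfer (rule mero_eq_refl_const)

lemma mero_value_const [simp]: "mero_value (const_mero x) p = x"
  by (rule mero_value_eq) (rule has_value_at_const)

lemma const_in_regular_on [simp]: "const_mero x \<in> regular_on S"
  unfolding regular_on_def regular_at_def using has_value_at_const by blast

lemma regular_on_has_value_at:
  "\<nu> \<in> regular_on S \<Longrightarrow> p \<in> S \<Longrightarrow> has_value_at \<nu> p (mero_value \<nu> p)"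
  by (simp add: regular_on_def has_value_at_mero_value)

lemma subspace_regular_on: "complex_vector.subspace (regular_on S)"
proof (rule complex_vector.subspaceI)
  show "0 \<in> regular_on S" using const_in_regular_on[of 0] by (simp add: const_mero_0)
qed (unfold regular_on_def regular_at_def, blast intro: has_value_at_add, blast intro: has_value_at_scaleC)

lemma lie_in_regular_on: "\<mu> \<in> regular_on S \<Longrightarrow> \<nu> \<in> regular_on S \<Longrightarrow> lie \<mu> \<nu> \<in> regular_on S"
  unfolding regular_on_def regular_at_def by (blast intro: has_value_at_lie)

lemma mero_value_add:
  "\<mu> \<in> regular_on S \<Longrightarrow> \<nu> \<in> regular_on S \<Longrightarrow> p \<in> S \<Longrightarrow>
    mero_value (\<mu> + \<nu>) p = mero_value \<mu> p + mero_value \<nu> p"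
  by (intro mero_value_eq has_value_at_add regular_on_has_value_at)

lemma mero_value_scaleC:
  "\<mu> \<in> regular_on S \<Longrightarrow> p \<in> S \<Longrightarrow> mero_value (c *\<^sub>C \<mu>) p = c *\<^sub>C mero_value \<mu> p"
  by (intro mero_value_eq has_value_at_scaleC regular_on_has_value_at)

lemma mero_value_lie:
  "\<mu> \<in> regular_on S \<Longrightarrow> \<nu> \<in> regular_on S \<Longrightarrow> p \<in> S \<Longrightarrow>
    mero_value (lie \<mu> \<nu>) p = lie (mero_value \<mu> p) (mero_value \<nu> p)"
  by (intro mero_value_eq has_value_at_lie regular_on_has_value_at)

section \<open>Vector spaces, free modules and their quotients\<close>

instantiation complex :: complex_vector
begin
definition scaleC_complex :: "complex \<Rightarrow> complex \<Rightarrow> complex" where "scaleC_complex c x = c * x"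
instance by standard (simp_all add: scaleC_complex_def algebra_simps)
end

instantiation poly_mapping :: (type, complex_vector) complex_vector
begin
lift_definition scaleC_poly_mapping :: "complex \<Rightarrow> ('a \<Rightarrow>\<^sub>0 'b) \<Rightarrow> 'a \<Rightarrow>\<^sub>0 'b" is "\<lambda>c f x. c *\<^sub>C f x"
  by (rule finite_subset) (auto simp: complex_vector.scale_zero_right)
instance
  by standard
    (transfer; simp add: fun_eq_iff scaleC_add_right scaleC_add_left scaleC_scaleC scaleC_one)+
end

lemma lookup_scaleC [simp]: "Poly_Mapping.lookup (c *\<^sub>C f) x = c *\<^sub>C Poly_Mapping.lookup f x"
  by transfer simp

lemma poly_mapping_map_mult: "Poly_Mapping.map ((*) c) f = c *\<^sub>C (f :: 'x \<Rightarrow>\<^sub>0 complex)"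
  by (rule poly_mapping_eqI) (simp add: Poly_Mapping.map.rep_eq scaleC_complex_def when_def)

lemma scaleC_single: "c *\<^sub>C Poly_Mapping.single x a = Poly_Mapping.single x (c * a)" for a :: complex
  by (rule poly_mapping_eqI) (simp add: lookup_single scaleC_complex_def when_def)

lemma keys_scaleC_subset: "Poly_Mapping.keys (c *\<^sub>C f) \<subseteq> Poly_Mapping.keys f"
  by (auto simp: in_keys_iff complex_vector.scale_zero_right)

lemma subspace_keys_subset:
  "complex_vector.subspace {f :: 'x \<Rightarrow>\<^sub>0 complex. Poly_Mapping.keys f \<subseteq> X}"
proof (rule complex_vector.subspaceI)
  fix f g :: "'x \<Rightarrow>\<^sub>0 complex" and c
  assume "f \<in> {f. Poly_Mapping.keys f \<subseteq> X}" "g \<in> {f. Poly_Mapping.keys f \<subseteq> X}"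
  then show "f + g \<in> {f. Poly_Mapping.keys f \<subseteq> X}" using keys_add[of f g] by auto
next
  fix f :: "'x \<Rightarrow>\<^sub>0 complex" and c assume "f \<in> {f. Poly_Mapping.keys f \<subseteq> X}"
  then show "c *\<^sub>C f \<in> {f. Poly_Mapping.keys f \<subseteq> X}" using keys_scaleC_subset[of c f] by auto
qed simp

text \<open>The linear extension to a free vector space of a map given on the basis.\<close>

definition lin_ext :: "('x \<Rightarrow> 'v::complex_vector) \<Rightarrow> ('x \<Rightarrow>\<^sub>0 complex) \<Rightarrow> 'v" where
  "lin_ext \<psi> f = (\<Sum>x\<in>Poly_Mapping.keys f. Poly_Mapping.lookup f x *\<^sub>C \<psi> x)"

lemma lin_ext_superset:
  assumes "finite A" "Poly_Mapping.keys f \<subseteq> A"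
  shows "lin_ext \<psi> f = (\<Sum>x\<in>A. Poly_Mapping.lookup f x *\<^sub>C \<psi> x)"
  unfolding lin_ext_def using assms
  by (intro sum.mono_neutral_left) (auto simp: in_keys_iff)

lemma lin_ext_add: "lin_ext \<psi> (f + g) = lin_ext \<psi> f + lin_ext \<psi> g"
proof -
  let ?A = "Poly_Mapping.keys f \<union> Poly_Mapping.keys g"
  have "finite ?A" by simp
  moreover have "Poly_Mapping.keys (f + g) \<subseteq> ?A" by (rule keys_add)
  ultimately show ?thesis
    by (simp add: lin_ext_superset[of ?A] lookup_add scaleC_add_left sum.distrib)
qed

lemma lin_ext_scaleC: "lin_ext \<psi> (c *\<^sub>C f) = c *\<^sub>C lin_ext \<psi> f"
proof -
  let ?A = "Poly_Mapping.keys f"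
  have "finite ?A" by simp
  moreover have "Poly_Mapping.keys (c *\<^sub>C f) \<subseteq> ?A" by (rule keys_scaleC_subset)
  ultimately show ?thesis
    by (simp add: lin_ext_superset[of ?A] complex_vector.scale_sum_right scaleC_complex_def)
qed

lemma lin_ext_0 [simp]: "lin_ext \<psi> 0 = 0"
  by (simp add: lin_ext_def)

lemma lin_ext_diff: "lin_ext \<psi> (f - g) = lin_ext \<psi> f - lin_ext \<psi> g"
  using lin_ext_add[of \<psi> "f - g" g] by simp

lemma lin_ext_single [simp]: "lin_ext \<psi> (Poly_Mapping.single x c) = c *\<^sub>C \<psi> x"
  by (simp add: lin_ext_def)

lemma lin_ext_in_subspace:
  assumes "complex_vector.subspace E" "\<And>x. x \<in> Poly_Mapping.keys f \<Longrightarrow> \<psi> x \<in> E"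
  shows "lin_ext \<psi> f \<in> E"
  unfolding lin_ext_def
  by (intro complex_vector.subspace_sum complex_vector.subspace_scale assms)

lemma free_induct [consumes 1, case_names zero add single]:
  fixes f :: "'x \<Rightarrow>\<^sub>0 complex"
  assumes "Poly_Mapping.keys f \<subseteq> X" "P 0"
    and "\<And>f g. Poly_Mapping.keys f \<subseteq> X \<Longrightarrow> Poly_Mapping.keys g \<subseteq> X \<Longrightarrow> P f \<Longrightarrow> P g \<Longrightarrow> P (f + g)"
    and "\<And>c x. x \<in> X \<Longrightarrow> P (Poly_Mapping.single x c)"
  shows "P f"
proof -
  have "P (\<Sum>x\<in>A. Poly_Mapping.single x (Poly_Mapping.lookup f x)) \<and>
      Poly_Mapping.keys (\<Sum>x\<in>A. Poly_Mapping.single x (Poly_Mapping.lookup f x)) \<subseteq> X"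
    if "finite A" "A \<subseteq> X" for A
    using that
  proof (induction A)
    case (insert x A)
    have k: "Poly_Mapping.keys (Poly_Mapping.single x (Poly_Mapping.lookup f x)) \<subseteq> X"
      using insert by simp
    show ?case
      using insert k keys_add[of "Poly_Mapping.single x (Poly_Mapping.lookup f x)"
          "\<Sum>x\<in>A. Poly_Mapping.single x (Poly_Mapping.lookup f x)"]
      by (auto intro!: assms(3,4))
  qed (simp add: assms(2))
  note sum = this
  have "f = (\<Sum>x\<in>Poly_Mapping.keys f. Poly_Mapping.single x (Poly_Mapping.lookup f x))"
    by (rule poly_mapping_eqI)
      (simp add: lookup_sum lookup_single when_def in_keys_iff)
  with sum[of "Poly_Mapping.keys f"] assms(1) show ?thesis by simp
qed

text \<open>The coset of \<open>f\<close> modulo \<open>T\<close>, for a subspace \<open>T\<close> of a type. The quotients below are computed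
  with such cosets.\<close>

definition vcoset :: "'a::ab_group_add set \<Rightarrow> 'a \<Rightarrow> 'a set" where
  "vcoset T f = (\<lambda>t. t + f) ` T"

lemma vcoset_memI: "complex_vector.subspace T \<Longrightarrow> f \<in> vcoset T f"
  unfolding vcoset_def using complex_vector.subspace_0[of T] by force

lemma vcoset_memD:
  assumes "g \<in> vcoset T f"
  shows "g - f \<in> T"
  using assms unfolding vcoset_def by auto

lemma vcoset_eq_iff:
  assumes "complex_vector.subspace T"
  shows "vcoset T f = vcoset T g \<longleftrightarrow> f - g \<in> T"
proof
  assume "vcoset T f = vcoset T g"
  then show "f - g \<in> T" using vcoset_memI[OF assms, of f] vcoset_memD by blast
next
  assume d: "f - g \<in> T"
  show "vcoset T f = vcoset T g"
  proof (intro equalityI subsetI)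
    fix x assume "x \<in> vcoset T f"
    then obtain t where t: "t \<in> T" "x = t + f" by (auto simp: vcoset_def)
    have "x = (t + (f - g)) + g" using t by simp
    then show "x \<in> vcoset T g"
      unfolding vcoset_def using complex_vector.subspace_add[OF assms t(1) d] by blast
  next
    fix x assume "x \<in> vcoset T g"
    then obtain t where t: "t \<in> T" "x = t + g" by (auto simp: vcoset_def)
    have "x = (t - (f - g)) + f" using t by simp
    then show "x \<in> vcoset T f"
      unfolding vcoset_def using complex_vector.subspace_diff[OF assms t(1) d] by blast
  qed
qed

lemma cring_complex_ring: "cring complex_ring"
  unfolding complex_ring_def
proof (rule cringI)
  show "abelian_group (\<lparr>carrier = UNIV, monoid.mult = (*), one = 1, ring.zero = 0, add = (+)\<rparr> :: complex ring)"
    by (rule abelian_groupI) (auto simp: algebra_simps intro: exI[where x = "- _"])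
  show "comm_monoid (\<lparr>carrier = UNIV, monoid.mult = (*), one = 1, ring.zero = 0, add = (+)\<rparr> :: complex ring)"
    by unfold_locales auto
qed (auto simp: algebra_simps)

lemma carrier_complex_ring [simp]: "carrier complex_ring = UNIV"
  by (simp add: complex_ring_def)

text \<open>Modules and algebras whose underlying vector space is a subspace of a type; their
  multiplication, if any, is arbitrary.\<close>

locale vec_module =
  fixes M :: "(complex, 'a::complex_vector) module"
  assumes carrier_subspace: "complex_vector.subspace (carrier M)"
    and add_eq: "add M = (+)" and zero_eq: "ring.zero M = 0" and smult_eq: "smult M = scaleC"
begin

lemmas eqs = add_eq zero_eq smult_eq

lemma closed:
  "0 \<in> carrier M" "f \<in> carrier M \<Longrightarrow> g \<in> carrier M \<Longrightarrow> f + g \<in> carrier M"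
  "f \<in> carrier M \<Longrightarrow> g \<in> carrier M \<Longrightarrow> f - g \<in> carrier M"
  "f \<in> carrier M \<Longrightarrow> c *\<^sub>C f \<in> carrier M" "f \<in> carrier M \<Longrightarrow> - f \<in> carrier M"
  by (simp_all add: complex_vector.subspace_0[OF carrier_subspace]
      complex_vector.subspace_add[OF carrier_subspace] complex_vector.subspace_diff[OF carrier_subspace]
      complex_vector.subspace_scale[OF carrier_subspace] complex_vector.subspace_neg[OF carrier_subspace])

lemma abelian_group: "abelian_group M"
proof (rule abelian_groupI)
  fix x assume "x \<in> carrier M"
  then show "\<exists>y\<in>carrier M. y \<oplus>\<^bsub>M\<^esub> x = \<zero>\<^bsub>M\<^esub>"
    by (intro bexI[of _ "- x"]) (simp_all add: eqs closed)
qed (simp_all add: eqs closed algebra_simps)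

lemma module: "module complex_ring M"
  by (rule moduleI[OF cring_complex_ring abelian_group])
    (simp_all add: eqs closed scaleC_add_left scaleC_add_right scaleC_scaleC scaleC_one complex_ring_def)

lemma a_inv_eq: "x \<in> carrier M \<Longrightarrow> a_inv M x = - x"
proof -
  assume x: "x \<in> carrier M"
  interpret abelian_group M by (rule abelian_group)
  show ?thesis by (rule minus_equality) (use x in \<open>simp_all add: eqs closed\<close>)
qed

lemma submodule_iff:
  "submodule H complex_ring M \<longleftrightarrow> complex_vector.subspace H \<and> H \<subseteq> carrier M"
proof
  assume "submodule H complex_ring M"
  then interpret submodule H complex_ring M .
  show "complex_vector.subspace H \<and> H \<subseteq> carrier M"
    using one_closed m_closed smult_closed subset
    by (auto simp: eqs intro!: complex_vector.subspaceI)
next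
  assume H: "complex_vector.subspace H \<and> H \<subseteq> carrier M"
  interpret module complex_ring M by (rule module)
  show "submodule H complex_ring M"
  proof (rule submoduleI)
    fix a assume "a \<in> H"
    then show "\<ominus>\<^bsub>M\<^esub> a \<in> H" using H by (auto simp: a_inv_eq complex_vector.subspace_neg)
  qed (use H in \<open>auto simp: eqs complex_vector.subspace_0 complex_vector.subspace_add
      complex_vector.subspace_scale\<close>)
qed

lemma submodule_gen_eq:
  assumes "S \<subseteq> carrier M"
  shows "submodule_gen M S = complex_vector.span S"
proof
  show "submodule_gen M S \<subseteq> complex_vector.span S"
    unfolding submodule_gen_def submodule_iff
    using complex_vector.span_minimal[OF assms carrier_subspace]
      complex_vector.subspace_span complex_vector.span_superset by blast
  show "complex_vector.span S \<subseteq> submodule_gen M S"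
    unfolding submodule_gen_def submodule_iff
    using complex_vector.span_minimal by blast
qed

end

text \<open>The quotient of such a module by a subspace, in terms of representatives: \<open>cl f\<close> is the
  class of \<open>f\<close>.\<close>

locale vec_quot = vec_module M for M :: "(complex, 'a::complex_vector) module" +
  fixes T :: "'a set"
  assumes T_subspace: "complex_vector.subspace T" and T_subset: "T \<subseteq> carrier M"
begin

abbreviation "Q \<equiv> quot_module M T"
abbreviation "cl \<equiv> vcoset T"

lemma cl_eq_iff: "cl f = cl g \<longleftrightarrow> f - g \<in> T"
  by (rule vcoset_eq_iff) (rule T_subspace)

lemma coset_cl: "T +>\<^bsub>M\<^esub> f = cl f"
  by (auto simp: a_r_coset_def r_coset_def vcoset_def eqs)

lemma carrier_Q: "carrier Q = cl ` carrier M"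
  by (auto simp: quot_module_def ring.defs FactRing_def A_RCOSETS_def RCOSETS_def
      module.defs coset_cl[unfolded a_r_coset_def])

lemma carrier_Q_I: "f \<in> carrier M \<Longrightarrow> cl f \<in> carrier Q"
  by (simp add: carrier_Q)

lemma carrier_Q_E:
  assumes "A \<in> carrier Q" obtains f where "f \<in> carrier M" "A = cl f"
  using assms by (auto simp: carrier_Q)

lemma set_add_cl: "cl f <+>\<^bsub>M\<^esub> cl g = cl (f + g)"
proof
  show "cl f <+>\<^bsub>M\<^esub> cl g \<subseteq> cl (f + g)"
  proof
    fix x assume "x \<in> cl f <+>\<^bsub>M\<^esub> cl g"
    then obtain t s where ts: "t \<in> T" "s \<in> T" "x = (t + f) + (s + g)"
      unfolding set_add_def set_mult_def vcoset_def by (auto simp: eqs)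
    then have "x = (t + s) + (f + g)" by simp
    then show "x \<in> cl (f + g)"
      unfolding vcoset_def using complex_vector.subspace_add[OF T_subspace ts(1,2)] by blast
  qed
  show "cl (f + g) \<subseteq> cl f <+>\<^bsub>M\<^esub> cl g"
  proof
    fix x assume "x \<in> cl (f + g)"
    then obtain t where t: "t \<in> T" "x = (t + f) + g" by (auto simp: vcoset_def add.assoc)
    have "t + f \<in> cl f" using t(1) by (simp add: vcoset_def)
    moreover have "g \<in> cl g" by (rule vcoset_memI[OF T_subspace])
    ultimately show "x \<in> cl f <+>\<^bsub>M\<^esub> cl g"
      unfolding set_add_def set_mult_def using t(2) by (auto simp: eqs)
  qed
qed

lemma cl_0: "cl 0 = T"
  by (simp add: vcoset_def)

lemma add_Q: "cl f \<oplus>\<^bsub>Q\<^esub> cl g = cl (f + g)"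
  using set_add_cl by (simp add: quot_module_def ring.defs FactRing_def module.defs)

lemma zero_Q: "\<zero>\<^bsub>Q\<^esub> = cl 0"
  by (simp add: quot_module_def ring.defs FactRing_def module.defs cl_0)

lemma smult_Q: "c \<odot>\<^bsub>Q\<^esub> cl f = cl (c *\<^sub>C f)"
proof -
  have "c \<odot>\<^bsub>Q\<^esub> cl f = T <+>\<^bsub>M\<^esub> (\<lambda>a. c *\<^sub>C a) ` cl f"
    by (simp add: quot_module_def ring.defs module.defs smult_eq)
  also have "\<dots> = cl (c *\<^sub>C f)"
  proof
    have *: "s + c *\<^sub>C (t + f) = (s + c *\<^sub>C t) + c *\<^sub>C f" for s t by (simp add: scaleC_add_right)
    show "T <+>\<^bsub>M\<^esub> (\<lambda>a. c *\<^sub>C a) ` cl f \<subseteq> cl (c *\<^sub>C f)"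
      unfolding set_add_def set_mult_def vcoset_def
      using complex_vector.subspace_add[OF T_subspace] complex_vector.subspace_scale[OF T_subspace]
      by (auto simp: eqs * )
    show "cl (c *\<^sub>C f) \<subseteq> T <+>\<^bsub>M\<^esub> (\<lambda>a. c *\<^sub>C a) ` cl f"
    proof
      fix x assume "x \<in> cl (c *\<^sub>C f)"
      then obtain t where t: "t \<in> T" "x = t + c *\<^sub>C f" by (auto simp: vcoset_def)
      then show "x \<in> T <+>\<^bsub>M\<^esub> (\<lambda>a. c *\<^sub>C a) ` cl f"
        unfolding set_add_def set_mult_def using vcoset_memI[OF T_subspace, of f]
        by (auto simp: eqs)
    qed
  qed
  finally show ?thesis .
qed

lemma abelian_group_Q: "abelian_group Q"
proof (rule abelian_groupI)
  fix x assume "x \<in> carrier Q"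
  then obtain f where "f \<in> carrier M" "x = cl f" by (rule carrier_Q_E)
  then show "\<exists>y\<in>carrier Q. y \<oplus>\<^bsub>Q\<^esub> x = \<zero>\<^bsub>Q\<^esub>"
    by (intro bexI[of _ "cl (- f)"]) (simp_all add: add_Q zero_Q carrier_Q closed)
qed (auto simp: add_Q zero_Q carrier_Q closed algebra_simps)

lemma module_Q: "module complex_ring Q"
  by (rule moduleI[OF cring_complex_ring abelian_group_Q])
    (auto simp: add_Q smult_Q carrier_Q closed scaleC_add_left
      scaleC_add_right scaleC_scaleC scaleC_one complex_ring_def)

lemma minus_Q:
  assumes "f \<in> carrier M" "g \<in> carrier M"
  shows "cl f \<ominus>\<^bsub>Q\<^esub> cl g = cl (f - g)"
proof -
  interpret Q: abelian_group Q by (rule abelian_group_Q)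
  have "\<ominus>\<^bsub>Q\<^esub> cl g = cl (- g)"
    by (rule Q.minus_equality) (use assms in \<open>simp_all add: add_Q zero_Q carrier_Q closed\<close>)
  then show ?thesis by (simp add: a_minus_def add_Q)
qed

lemma finsum_Q:
  assumes "\<And>i. i \<in> A \<Longrightarrow> f i \<in> carrier M"
  shows "(\<Oplus>\<^bsub>Q\<^esub>i\<in>A. cl (f i)) = cl (\<Sum>i\<in>A. f i)"
proof -
  interpret Q: abelian_group Q by (rule abelian_group_Q)
  show ?thesis using assms
  proof (induction A rule: infinite_finite_induct)
    case (infinite A)
    then show ?case by (simp add: Q.finsum_infinite zero_Q)
  next
    case (insert x A)
    then show ?case by (subst Q.finsum_insert) (auto simp: add_Q carrier_Q_I)
  qed (simp add: zero_Q)
qed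

text \<open>\<open>lin_lift\<close> is the map of the quotients that is induced by the linear extension of a map \<open>\<psi>\<close>
  of representatives, provided that this extension respects the subspaces divided out.\<close>

lemma lin_lift_cl:
  assumes R: "complex_vector.subspace R" "R \<subseteq> {f. Poly_Mapping.keys f \<subseteq> X}"
    and \<psi>: "\<And>x. x \<in> X \<Longrightarrow> \<psi> x \<in> carrier M" "\<And>x. x \<in> X \<Longrightarrow> \<phi> x = cl (\<psi> x)"
    and RT: "\<And>r. r \<in> R \<Longrightarrow> lin_ext \<psi> r \<in> T"
    and f: "Poly_Mapping.keys f \<subseteq> X"
  shows "lin_lift Q \<phi> (vcoset R f) = cl (lin_ext \<psi> f)"
proof -
  interpret Q: abelian_group Q by (rule abelian_group_Q)
  have *: "(\<Oplus>\<^bsub>Q\<^esub>x\<in>Poly_Mapping.keys g. Poly_Mapping.lookup g x \<odot>\<^bsub>Q\<^esub> \<phi> x) = cl (lin_ext \<psi> f)"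
    if g: "g \<in> vcoset R f" for g
  proof -
    have d: "g - f \<in> R" using vcoset_memD[OF g] .
    have gX: "Poly_Mapping.keys g \<subseteq> X"
      using complex_vector.subspace_add[OF subspace_keys_subset, of "g - f" X f] d f R(2) by auto
    have "(\<Oplus>\<^bsub>Q\<^esub>x\<in>Poly_Mapping.keys g. Poly_Mapping.lookup g x \<odot>\<^bsub>Q\<^esub> \<phi> x) =
        (\<Oplus>\<^bsub>Q\<^esub>x\<in>Poly_Mapping.keys g. cl (Poly_Mapping.lookup g x *\<^sub>C \<psi> x))"
    proof (rule Q.finsum_cong')
      show "(\<lambda>x. cl (Poly_Mapping.lookup g x *\<^sub>C \<psi> x)) \<in> Poly_Mapping.keys g \<rightarrow> carrier Q"
        using gX \<psi>(1) by (auto intro!: carrier_Q_I closed)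
    qed (use gX \<psi>(2) in \<open>auto simp: smult_Q subset_iff\<close>)
    also have "\<dots> = cl (lin_ext \<psi> g)"
      unfolding lin_ext_def using gX \<psi>(1) by (intro finsum_Q closed) auto
    also have "\<dots> = cl (lin_ext \<psi> f)"
      using RT[OF d] by (simp add: cl_eq_iff lin_ext_diff)
    finally show ?thesis .
  qed
  have "(\<lambda>g. \<Oplus>\<^bsub>Q\<^esub>x\<in>Poly_Mapping.keys g. Poly_Mapping.lookup g x \<odot>\<^bsub>Q\<^esub> \<phi> x) ` vcoset R f = {cl (lin_ext \<psi> f)}"
    using * vcoset_memI[OF R(1), of f] by auto
  then show ?thesis unfolding lin_lift_def by simp
qed

text \<open>A complement of \<open>T\<close> identifies the quotient with a subspace of the type.\<close>

lemma ex_section: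
  "\<exists>\<iota> :: 'a set \<Rightarrow> 'a. inj_on \<iota> (carrier Q) \<and>
     (\<forall>A\<in>carrier Q. \<forall>B\<in>carrier Q. \<iota> (A \<oplus>\<^bsub>Q\<^esub> B) = \<iota> A + \<iota> B) \<and>
     (\<forall>c. \<forall>A\<in>carrier Q. \<iota> (c \<odot>\<^bsub>Q\<^esub> A) = c *\<^sub>C \<iota> A)"
proof -
  interpret vp: vector_space_pair "scaleC :: complex \<Rightarrow> 'a \<Rightarrow> 'a" "scaleC :: complex \<Rightarrow> 'a \<Rightarrow> 'a"
    by unfold_locales
  obtain B where B: "B \<subseteq> T" "complex_vector.independent B" "T \<subseteq> complex_vector.span B"
    by (rule complex_vector.basis_exists[of T])
  obtain C where C: "B \<subseteq> C" "complex_vector.independent C" "UNIV \<subseteq> complex_vector.span C"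
    by (rule complex_vector.maximal_independent_subset_extend[OF subset_UNIV B(2)])
  \<comment> \<open>the projection with kernel \<open>T\<close> onto the span of the vectors of the basis \<open>C\<close> that are not in
    \<open>B\<close>\<close>
  obtain \<pi> where \<pi>: "Vector_Spaces.linear scaleC scaleC \<pi>"
      "\<forall>x\<in>C. \<pi> x = (if x \<in> B then 0 else x)"
    using vp.linear_independent_extend[OF C(2), of "\<lambda>x. if x \<in> B then 0 else x"] by (elim exE conjE)
  interpret \<pi>: Vector_Spaces.linear scaleC scaleC \<pi> by (fact \<pi>(1))
  have \<pi>T: "\<pi> t = 0" if "t \<in> T" for t
    by (rule \<pi>.eq_0_on_span[of B]) (use \<pi>(2) B C that in auto)
  have \<pi>d: "\<pi> f - f \<in> T" for f
  proof -
    have "f \<in> complex_vector.span C" using C by auto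
    then show ?thesis
    proof (induction rule: complex_vector.span_induct_alt)
      case base then show ?case using T_subspace complex_vector.subspace_0 by (simp add: \<pi>.zero)
    next
      case (step c x y)
      have "\<pi> x - x \<in> T"
        using \<pi>(2) step(1) B(1) complex_vector.subspace_neg[OF T_subspace]
          complex_vector.subspace_0[OF T_subspace] by auto
      then have "c *\<^sub>C (\<pi> x - x) + (\<pi> y - y) \<in> T"
        using step by (intro complex_vector.subspace_add complex_vector.subspace_scale T_subspace)
      then show ?case
        by (simp add: \<pi>.add \<pi>.scale complex_vector.scale_right_diff_distrib algebra_simps)
    qed
  qed
  define \<iota> where "\<iota> A = the_elem (\<pi> ` A)" for A
  have \<iota>: "\<iota> (cl f) = \<pi> f" for f
  proof -
    have "\<pi> ` cl f = {\<pi> f}"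
      using complex_vector.subspace_0[OF T_subspace]
      by (auto simp: vcoset_def \<pi>.add \<pi>T image_image)
    then show ?thesis by (simp add: \<iota>_def)
  qed
  have "inj_on \<iota> (carrier Q)"
  proof (rule inj_onI)
    fix A B assume "A \<in> carrier Q" "B \<in> carrier Q" "\<iota> A = \<iota> B"
    then obtain f g where fg: "A = cl f" "B = cl g" "\<pi> f = \<pi> g" by (auto simp: carrier_Q \<iota>)
    have "(\<pi> g - g) - (\<pi> f - f) \<in> T"
      using \<pi>d complex_vector.subspace_diff[OF T_subspace] by blast
    then show "A = B" using fg by (simp add: cl_eq_iff)
  qed
  moreover have "\<iota> (A \<oplus>\<^bsub>Q\<^esub> B) = \<iota> A + \<iota> B" if "A \<in> carrier Q" "B \<in> carrier Q" for A B
    using that by (auto simp: carrier_Q add_Q \<iota> \<pi>.add)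
  moreover have "\<iota> (c \<odot>\<^bsub>Q\<^esub> A) = c *\<^sub>C \<iota> A" if "A \<in> carrier Q" for c A
    using that by (auto simp: carrier_Q smult_Q \<iota> \<pi>.scale)
  ultimately show ?thesis by (intro exI[of _ \<iota>] conjI ballI allI)
qed

end

lemma vec_module_free: "vec_module (free_module X)"
  by unfold_locales
    (simp_all add: free_module_def subspace_keys_subset poly_mapping_map_mult fun_eq_iff)

lemma carrier_free: "carrier (free_module X) = {f. Poly_Mapping.keys f \<subseteq> X}"
  by (simp add: free_module_def)

lemma basis_class_vcoset: "\<zero>\<^bsub>Q\<^esub> = R \<Longrightarrow> basis_class Q x = vcoset R (Poly_Mapping.single x 1)"
  by (simp add: basis_class_def vcoset_def)

section \<open>Enveloping algebras\<close>

lemma lin_ext_span_kills: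
  assumes "complex_vector.subspace S" "\<And>r. r \<in> R \<Longrightarrow> lin_ext \<psi> r \<in> S" "r \<in> complex_vector.span R"
  shows "lin_ext \<psi> r \<in> S"
  using assms(3)
proof (induction rule: complex_vector.span_induct_alt)
  case base then show ?case using assms(1) by (simp add: complex_vector.subspace_0)
next
  case (step c x y)
  then show ?case
    by (simp add: lin_ext_add lin_ext_scaleC complex_vector.subspace_add
        complex_vector.subspace_scale assms)
qed

lemma single_zero_times: "Poly_Mapping.single 0 c * f = c *\<^sub>C f"
  for f :: "'m::monoid_add \<Rightarrow>\<^sub>0 complex"
proof -
  have "Poly_Mapping.keys f \<subseteq> UNIV" by simp
  then show ?thesis
    by (induction f rule: free_induct)
      (simp_all add: distrib_left scaleC_add_right mult_single scaleC_single
        complex_vector.scale_zero_right)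
qed

lemma times_single_zero: "f * Poly_Mapping.single 0 c = c *\<^sub>C f"
  for f :: "'m::monoid_add \<Rightarrow>\<^sub>0 complex"
proof -
  have "Poly_Mapping.keys f \<subseteq> UNIV" by simp
  then show ?thesis
    by (induction f rule: free_induct)
      (simp_all add: distrib_right scaleC_add_right mult_single scaleC_single mult.commute
        complex_vector.scale_zero_right)
qed

lemma scaleC_mult_left: "(c *\<^sub>C f) * g = c *\<^sub>C (f * g)"
  for f :: "'m::monoid_add \<Rightarrow>\<^sub>0 complex"
  by (simp flip: single_zero_times add: mult.assoc)

lemma scaleC_mult_right: "f * (c *\<^sub>C g) = c *\<^sub>C (f * g)"
  for f :: "'m::monoid_add \<Rightarrow>\<^sub>0 complex"
  by (simp flip: times_single_zero add: mult.assoc)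

lemma one_free_algebra: "1 = Poly_Mapping.single [] (1::complex)"
  by (simp flip: zero_list_def)

lemma free_algebra_simps [simp]:
  "carrier (free_algebra L) = {f. Poly_Mapping.keys f \<subseteq> lists L}"
  "monoid.mult (free_algebra L) = (*)" "one (free_algebra L) = 1"
  by (simp_all add: free_algebra_def free_module_def)

lemma vec_module_free_algebra: "vec_module (free_algebra L)"
  by unfold_locales
    (simp_all add: free_algebra_def free_module_def subspace_keys_subset poly_mapping_map_mult
      fun_eq_iff)

lemma keys_mult_lists:
  fixes f g :: "'l list \<Rightarrow>\<^sub>0 complex"
  assumes "Poly_Mapping.keys f \<subseteq> lists L" "Poly_Mapping.keys g \<subseteq> lists L"
  shows "Poly_Mapping.keys (f * g) \<subseteq> lists L"
  using keys_mult[of f g] assms by (fastforce simp: plus_list_def)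

lemma keys_one_lists: "Poly_Mapping.keys (1 :: 'l list \<Rightarrow>\<^sub>0 complex) \<subseteq> lists L"
  by (simp add: zero_list_def)

lemma ring_free_algebra: "ring (free_algebra L)"
proof -
  interpret vec_module "free_algebra L" by (rule vec_module_free_algebra)
  show ?thesis
  proof (rule ringI[OF abelian_group])
    show "Group.monoid (free_algebra L)"
      by (rule monoidI) (simp_all add: keys_mult_lists keys_one_lists[simplified] mult.assoc)
  qed (simp_all add: eqs distrib_left distrib_right)
qed

text \<open>A Lie subalgebra \<open>L\<close> of a type. The class map from the free algebra on \<open>L\<close> to the enveloping
  algebra is \<open>U.cl\<close>.\<close>

locale lie_subalgebra =
  fixes L :: "'l::complex_lie_algebra set"
  assumes L_subspace: "complex_vector.subspace L"
    and L_lie: "x \<in> L \<Longrightarrow> y \<in> L \<Longrightarrow> lie x y \<in> L"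
begin

text \<open>The relations that generate \<open>env_ideal L\<close> as a two-sided ideal.\<close>

definition env_relations :: "('l list \<Rightarrow>\<^sub>0 complex) set" where
  "env_relations =
     {Poly_Mapping.single [x + y] 1 - Poly_Mapping.single [x] 1 - Poly_Mapping.single [y] 1 | x y.
         x \<in> L \<and> y \<in> L} \<union>
      {Poly_Mapping.single [c *\<^sub>C x] 1 - Poly_Mapping.single [x] c | c x. x \<in> L} \<union>
      {Poly_Mapping.single [x] 1 * Poly_Mapping.single [y] 1
         - Poly_Mapping.single [y] 1 * Poly_Mapping.single [x] 1
         - Poly_Mapping.single [lie x y] 1 | x y. x \<in> L \<and> y \<in> L}"

lemma env_ideal_eq: "env_ideal L = genideal (free_algebra L) env_relations"
  by (simp add: env_ideal_def env_relations_def)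

sublocale FA: vec_module "free_algebra L"
  by (rule vec_module_free_algebra)

lemma single_closed: "set ws \<subseteq> L \<Longrightarrow> Poly_Mapping.single ws c \<in> carrier (free_algebra L)"
  by (auto simp: in_lists_conv_set)

lemma mult_closed: "f \<in> carrier (free_algebra L) \<Longrightarrow> g \<in> carrier (free_algebra L) \<Longrightarrow>
    f * g \<in> carrier (free_algebra L)"
  by (simp add: keys_mult_lists)

lemma env_relations_subset: "env_relations \<subseteq> carrier (free_algebra L)"
  unfolding env_relations_def
  by (auto simp del: free_algebra_simps(1) intro!: FA.closed single_closed mult_closed
      simp: complex_vector.subspace_add[OF L_subspace] complex_vector.subspace_scale[OF L_subspace] L_lie)

lemma env_ideal_ideal: "ideal (env_ideal L) (free_algebra L)"
  unfolding env_ideal_eq by (rule ring.genideal_ideal[OF ring_free_algebra env_relations_subset])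

lemma env_relations_in: "env_relations \<subseteq> env_ideal L"
  unfolding env_ideal_eq by (rule ring.genideal_self[OF ring_free_algebra env_relations_subset])

lemma env_ideal_subset: "env_ideal L \<subseteq> carrier (free_algebra L)"
  using env_ideal_ideal additive_subgroup.a_subset ideal.axioms(1) by blast

lemma env_ideal_lmult: "a \<in> env_ideal L \<Longrightarrow> x \<in> carrier (free_algebra L) \<Longrightarrow> x * a \<in> env_ideal L"
  using ideal.I_l_closed[OF env_ideal_ideal, of a x] by simp

lemma env_ideal_rmult: "a \<in> env_ideal L \<Longrightarrow> x \<in> carrier (free_algebra L) \<Longrightarrow> a * x \<in> env_ideal L"
  using ideal.I_r_closed[OF env_ideal_ideal, of a x] by simp

lemma env_ideal_subspace: "complex_vector.subspace (env_ideal L)"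
proof (rule complex_vector.subspaceI)
  show "0 \<in> env_ideal L"
    using additive_subgroup.zero_closed[OF ideal.axioms(1)[OF env_ideal_ideal]] by (simp add: FA.eqs)
  show "x + y \<in> env_ideal L" if "x \<in> env_ideal L" "y \<in> env_ideal L" for x y
    using additive_subgroup.a_closed[OF ideal.axioms(1)[OF env_ideal_ideal] that] by (simp add: FA.eqs)
  show "c *\<^sub>C x \<in> env_ideal L" if "x \<in> env_ideal L" for c x
  proof -
    have "Poly_Mapping.single [] c * x \<in> env_ideal L"
      by (rule env_ideal_lmult[OF that single_closed]) simp
    then show ?thesis by (simp add: single_zero_times flip: zero_list_def)
  qed
qed

lemma env_ideal_minimal:
  assumes K: "complex_vector.subspace K" "K \<subseteq> carrier (free_algebra L)" "env_relations \<subseteq> K"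
    and "\<And>a x. a \<in> K \<Longrightarrow> x \<in> carrier (free_algebra L) \<Longrightarrow> x * a \<in> K"
    and "\<And>a x. a \<in> K \<Longrightarrow> x \<in> carrier (free_algebra L) \<Longrightarrow> a * x \<in> K"
  shows "env_ideal L \<subseteq> K"
proof -
  have "submodule K complex_ring (free_algebra L)" using K FA.submodule_iff by blast
  then have "subgroup K (add_monoid (free_algebra L))" by (rule submodule.axioms(1))
  then have "ideal K (free_algebra L)"
    by (rule idealI[OF ring_free_algebra]) (use assms in auto)
  then show ?thesis
    unfolding env_ideal_eq using ring.genideal_minimal[OF ring_free_algebra] K(3) by blast
qed

sublocale U: vec_quot "free_algebra L" "env_ideal L"
  by unfold_locales (rule env_ideal_subspace env_ideal_subset)+

lemma env_eq: "env L = U.Q"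
  by (simp add: env_def)

lemma mult_U:
  assumes "f \<in> carrier (free_algebra L)" "g \<in> carrier (free_algebra L)"
  shows "U.cl f \<otimes>\<^bsub>env L\<^esub> U.cl g = U.cl (f * g)"
  using ideal.rcoset_mult_add[OF env_ideal_ideal assms]
  by (simp add: env_def quot_module_def ring.defs module.defs FactRing_def U.coset_cl)

lemma one_U: "\<one>\<^bsub>env L\<^esub> = U.cl 1"
  by (simp add: env_def quot_module_def ring.defs module.defs FactRing_def U.coset_cl)

lemma basis_class_env: "basis_class (env L) ws = U.cl (Poly_Mapping.single ws 1)"
  by (rule basis_class_vcoset) (simp add: env_eq U.zero_Q U.cl_0)

end

text \<open>A representation of \<open>L\<close> on the quotient of \<open>E\<close> by \<open>S\<close>, given by linear operators on \<open>E\<close>;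
  linearity in the elements of \<open>L\<close> and compatibility with the bracket are only required modulo
  \<open>S\<close>. For \<open>S = {0}\<close> it is a representation on \<open>E\<close>.\<close>

locale lie_rep_mod = lie_subalgebra L for L :: "'l::complex_lie_algebra set" +
  fixes act :: "'l \<Rightarrow> 'e::complex_vector \<Rightarrow> 'e" and E S :: "'e set"
  assumes E_subspace: "complex_vector.subspace E"
    and S_subspace: "complex_vector.subspace S"
    and act_E: "x \<in> L \<Longrightarrow> e \<in> E \<Longrightarrow> act x e \<in> E"
    and act_S: "x \<in> L \<Longrightarrow> e \<in> S \<Longrightarrow> act x e \<in> S"
    and S_subset: "S \<subseteq> E"
    and act_add: "x \<in> L \<Longrightarrow> e \<in> E \<Longrightarrow> e' \<in> E \<Longrightarrow> act x (e + e') = act x e + act x e'"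
    and act_scaleC: "x \<in> L \<Longrightarrow> e \<in> E \<Longrightarrow> act x (c *\<^sub>C e) = c *\<^sub>C act x e"
    and act_add_left: "x \<in> L \<Longrightarrow> y \<in> L \<Longrightarrow> e \<in> E \<Longrightarrow> act (x + y) e - act x e - act y e \<in> S"
    and act_scaleC_left: "x \<in> L \<Longrightarrow> e \<in> E \<Longrightarrow> act (c *\<^sub>C x) e - c *\<^sub>C act x e \<in> S"
    and act_lie: "x \<in> L \<Longrightarrow> y \<in> L \<Longrightarrow> e \<in> E \<Longrightarrow>
       act x (act y e) - act y (act x e) - act (lie x y) e \<in> S"
begin

text \<open>The action of the free algebra on \<open>E\<close>. Modulo \<open>S\<close> the ideal \<open>env_ideal L\<close> acts by zero
  (\<open>env_act_ideal\<close>), so that the enveloping algebra acts on the quotient.\<close>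

definition env_act :: "('l list \<Rightarrow>\<^sub>0 complex) \<Rightarrow> 'e \<Rightarrow> 'e" where
  "env_act a e = lin_ext (\<lambda>ws. foldr act ws e) a"

lemma word_E: "set ws \<subseteq> L \<Longrightarrow> e \<in> E \<Longrightarrow> foldr act ws e \<in> E"
  by (induction ws) (auto intro: act_E)

lemma word_S: "set ws \<subseteq> L \<Longrightarrow> e \<in> S \<Longrightarrow> foldr act ws e \<in> S"
  by (induction ws) (auto intro: act_S)

lemma word_add: "set ws \<subseteq> L \<Longrightarrow> e \<in> E \<Longrightarrow> e' \<in> E \<Longrightarrow>
    foldr act ws (e + e') = foldr act ws e + foldr act ws e'"
  by (induction ws) (auto simp: act_add word_E)

lemma word_scaleC: "set ws \<subseteq> L \<Longrightarrow> e \<in> E \<Longrightarrow> foldr act ws (c *\<^sub>C e) = c *\<^sub>C foldr act ws e"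
  by (induction ws) (auto simp: act_scaleC word_E)

lemma env_act_E: "Poly_Mapping.keys a \<subseteq> lists L \<Longrightarrow> e \<in> E \<Longrightarrow> env_act a e \<in> E"
  unfolding env_act_def by (rule lin_ext_in_subspace[OF E_subspace]) (auto intro!: word_E)

lemma env_act_S: "Poly_Mapping.keys a \<subseteq> lists L \<Longrightarrow> e \<in> S \<Longrightarrow> env_act a e \<in> S"
  unfolding env_act_def by (rule lin_ext_in_subspace[OF S_subspace]) (auto intro!: word_S)

lemma env_act_add_left: "env_act (a + b) e = env_act a e + env_act b e"
  by (simp add: env_act_def lin_ext_add)

lemma env_act_diff_left: "env_act (a - b) e = env_act a e - env_act b e"
  by (simp add: env_act_def lin_ext_diff)

lemma env_act_scaleC_left: "env_act (c *\<^sub>C a) e = c *\<^sub>C env_act a e"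
  by (simp add: env_act_def lin_ext_scaleC)

lemma env_act_single [simp]: "env_act (Poly_Mapping.single ws c) e = c *\<^sub>C foldr act ws e"
  by (simp add: env_act_def)

lemma env_act_zero_left [simp]: "env_act 0 e = 0"
  by (simp add: env_act_def)

lemma env_act_add:
  "Poly_Mapping.keys a \<subseteq> lists L \<Longrightarrow> e \<in> E \<Longrightarrow> e' \<in> E \<Longrightarrow> env_act a (e + e') = env_act a e + env_act a e'"
proof (induction a rule: free_induct)
  case (single c x)
  then show ?case by (simp add: word_add in_lists_conv_set subset_iff scaleC_add_right)
qed (simp_all add: env_act_add_left)

lemma env_act_scaleC:
  "Poly_Mapping.keys a \<subseteq> lists L \<Longrightarrow> e \<in> E \<Longrightarrow> env_act a (c *\<^sub>C e) = c *\<^sub>C env_act a e"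
proof (induction a rule: free_induct)
  case (single d x)
  then show ?case
    by (simp add: word_scaleC in_lists_conv_set subset_iff mult.commute)
qed (simp_all add: env_act_add_left scaleC_add_right complex_vector.scale_zero_right)

lemma env_act_mult:
  assumes "Poly_Mapping.keys a \<subseteq> lists L" "Poly_Mapping.keys b \<subseteq> lists L" "e \<in> E"
  shows "env_act (a * b) e = env_act a (env_act b e)"
  using assms(1)
proof (induction a rule: free_induct)
  case (add f g)
  then show ?case by (simp add: distrib_right env_act_add_left)
next
  case (single c xs)
  then have xs: "set xs \<subseteq> L" by (auto simp: in_lists_conv_set)
  show ?case using assms(2)
  proof (induction b rule: free_induct)
    case zero
    have "foldr act xs 0 = 0"
      using word_scaleC[OF xs assms(3), of 0] by (simp add: complex_vector.scale_zero_left)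
    then show ?case by (simp add: complex_vector.scale_zero_right)
  next
    case (add f g)
    then show ?case
      by (simp add: distrib_left env_act_add_left word_add[OF xs] env_act_E assms(3) scaleC_add_right)
  next
    case (single d ys)
    then have ys: "foldr act ys e \<in> E" using assms(3) by (auto intro!: word_E simp: in_lists_conv_set)
    show ?case by (simp add: mult_single plus_list_def word_scaleC[OF xs ys])
  qed
qed simp

lemma env_act_relation: "r \<in> env_relations \<Longrightarrow> e \<in> E \<Longrightarrow> env_act r e \<in> S"
  unfolding env_relations_def
  by (auto simp: env_act_diff_left mult_single plus_list_def scaleC_one
      act_add_left act_scaleC_left act_lie)

lemma env_act_ideal:
  assumes "a \<in> env_ideal L" "e \<in> E"
  shows "env_act a e \<in> S"
proof -
  define K where "K = {a \<in> carrier (free_algebra L). \<forall>e\<in>E. env_act a e \<in> S}"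
  have "env_ideal L \<subseteq> K"
  proof (rule env_ideal_minimal)
    show "complex_vector.subspace K"
    proof (rule complex_vector.subspaceI)
      show "0 \<in> K" by (simp add: K_def complex_vector.subspace_0[OF S_subspace])
      show "x + y \<in> K" if "x \<in> K" "y \<in> K" for x y
        using that FA.closed(2)[of x y] complex_vector.subspace_add[OF S_subspace]
        by (simp add: K_def env_act_add_left)
      show "c *\<^sub>C x \<in> K" if "x \<in> K" for x c
        using that FA.closed(4)[of x c] complex_vector.subspace_scale[OF S_subspace]
        by (simp add: K_def env_act_scaleC_left)
    qed
    show "env_relations \<subseteq> K"
      using env_relations_subset env_act_relation by (auto simp: K_def)
    show "x * a \<in> K" if "a \<in> K" "x \<in> carrier (free_algebra L)" for a x
      using that by (simp add: K_def keys_mult_lists env_act_mult env_act_S)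
    show "a * x \<in> K" if "a \<in> K" "x \<in> carrier (free_algebra L)" for a x
      using that by (simp add: K_def keys_mult_lists env_act_mult env_act_E)
  qed (auto simp: K_def)
  then show ?thesis using assms by (auto simp: K_def)
qed

end

section \<open>Tensor products of representations\<close>

(* Keeps the index set {1..n} from being rewritten to {Suc 0..n}. *)
declare One_nat_def [simp del]

text \<open>Maps of \<open>n\<close> arguments that are multilinear modulo a subspace \<open>S\<close>.\<close>

definition multilinear_mod ::
    "'e::complex_vector set \<Rightarrow> nat \<Rightarrow> (nat \<Rightarrow> 'w::complex_vector set) \<Rightarrow> ((nat \<Rightarrow> 'w) \<Rightarrow> 'e) \<Rightarrow> bool" where
  "multilinear_mod S n W \<Phi> \<longleftrightarrow>
     (\<forall>w\<in>(\<Pi>\<^sub>E k\<in>{1..n}. W k). \<forall>k\<in>{1..n}. \<forall>u\<in>W k. \<forall>v\<in>W k.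
        \<Phi> (w(k := u + v)) - \<Phi> (w(k := u)) - \<Phi> (w(k := v)) \<in> S) \<and>
     (\<forall>w\<in>(\<Pi>\<^sub>E k\<in>{1..n}. W k). \<forall>k\<in>{1..n}. \<forall>c. \<forall>u\<in>W k.
        \<Phi> (w(k := c *\<^sub>C u)) - c *\<^sub>C \<Phi> (w(k := u)) \<in> S)"

text \<open>Linear operators \<open>X k\<close> on the spaces \<open>W k\<close>, for \<open>k\<close> in \<open>K\<close>.\<close>

definition slot_ops :: "(nat \<Rightarrow> 'w::complex_vector set) \<Rightarrow> nat set \<Rightarrow> (nat \<Rightarrow> 'w \<Rightarrow> 'w) \<Rightarrow> bool" where
  "slot_ops W K X \<longleftrightarrow> (\<forall>k\<in>K. (\<forall>u\<in>W k. X k u \<in> W k) \<and>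
     (\<forall>u\<in>W k. \<forall>v\<in>W k. X k (u + v) = X k u + X k v) \<and>
     (\<forall>c. \<forall>u\<in>W k. X k (c *\<^sub>C u) = c *\<^sub>C X k u))"

text \<open>The sum over the slots \<open>k\<close> in \<open>K\<close> of the values of \<open>\<Phi>\<close> after \<open>X k\<close> is applied in the slot
  \<open>k\<close>.\<close>

definition slot_sum ::
    "((nat \<Rightarrow> 'w) \<Rightarrow> 'e::ab_group_add) \<Rightarrow> nat set \<Rightarrow> (nat \<Rightarrow> 'w \<Rightarrow> 'w) \<Rightarrow> (nat \<Rightarrow> 'w) \<Rightarrow> 'e" where
  "slot_sum \<Phi> K X w = (\<Sum>k\<in>K. \<Phi> (w(k := X k (w k))))"

lemma lin_ext_sum: "lin_ext \<psi> (\<Sum>i\<in>A. f i) = (\<Sum>i\<in>A. lin_ext \<psi> (f i))"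
  by (induction A rule: infinite_finite_induct) (simp_all add: lin_ext_add)

lemma PiE_fun_upd: "w \<in> (\<Pi>\<^sub>E k\<in>I. W k) \<Longrightarrow> k \<in> I \<Longrightarrow> u \<in> W k \<Longrightarrow> w(k := u) \<in> (\<Pi>\<^sub>E k\<in>I. W k)"
  by (auto simp: PiE_iff extensional_def)

lemma multilinear_modD:
  assumes "multilinear_mod S n W \<Phi>" "w \<in> (\<Pi>\<^sub>E k\<in>{1..n}. W k)" "k \<in> {1..n}" "u \<in> W k"
  shows "v \<in> W k \<Longrightarrow> \<Phi> (w(k := u + v)) - \<Phi> (w(k := u)) - \<Phi> (w(k := v)) \<in> S"
    and "\<Phi> (w(k := c *\<^sub>C u)) - c *\<^sub>C \<Phi> (w(k := u)) \<in> S"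
  using assms unfolding multilinear_mod_def by blast+

lemma multilinear_mod_slot_sum:
  assumes S: "complex_vector.subspace S" and \<Phi>: "multilinear_mod S n W \<Phi>"
    and K: "K \<subseteq> {1..n}" and X: "slot_ops W K X"
  shows "multilinear_mod S n W (slot_sum \<Phi> K X)"
proof -
  have upd: "w(k := X k (w k)) \<in> (\<Pi>\<^sub>E k\<in>{1..n}. W k)"
    if "w \<in> (\<Pi>\<^sub>E k\<in>{1..n}. W k)" "k \<in> K" for w k
    using that K X by (intro PiE_fun_upd) (auto simp: slot_ops_def PiE_iff subset_iff)
  show ?thesis unfolding multilinear_mod_def
  proof (intro conjI ballI allI)
    fix w j u v assume w: "w \<in> (\<Pi>\<^sub>E k\<in>{1..n}. W k)" and j: "j \<in> {1..n}" and u: "u \<in> W j" and v: "v \<in> W j"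
    have "(\<Sum>k\<in>K. \<Phi> ((w(j := u + v))(k := X k ((w(j := u + v)) k)))
        - \<Phi> ((w(j := u))(k := X k ((w(j := u)) k))) - \<Phi> ((w(j := v))(k := X k ((w(j := v)) k)))) \<in> S"
    proof (intro complex_vector.subspace_sum[OF S])
      fix k assume k: "k \<in> K"
      show "\<Phi> ((w(j := u + v))(k := X k ((w(j := u + v)) k)))
        - \<Phi> ((w(j := u))(k := X k ((w(j := u)) k))) - \<Phi> ((w(j := v))(k := X k ((w(j := v)) k))) \<in> S"
      proof (cases "k = j")
        case True
        then show ?thesis
          using multilinear_modD(1)[OF \<Phi> w j, of "X j u" "X j v"] X k u v
          by (simp add: slot_ops_def)
      next
        case False
        then show ?thesis
          using multilinear_modD(1)[OF \<Phi> upd[OF w k] j u v] by (simp add: fun_upd_twist[OF False[symmetric]])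
      qed
    qed
    then show "slot_sum \<Phi> K X (w(j := u + v)) - slot_sum \<Phi> K X (w(j := u))
        - slot_sum \<Phi> K X (w(j := v)) \<in> S"
      by (simp only: slot_sum_def sum_subtractf)
  next
    fix w j c u assume w: "w \<in> (\<Pi>\<^sub>E k\<in>{1..n}. W k)" and j: "j \<in> {1..n}" and u: "u \<in> W j"
    have "(\<Sum>k\<in>K. \<Phi> ((w(j := c *\<^sub>C u))(k := X k ((w(j := c *\<^sub>C u)) k)))
        - c *\<^sub>C \<Phi> ((w(j := u))(k := X k ((w(j := u)) k)))) \<in> S"
    proof (intro complex_vector.subspace_sum[OF S])
      fix k assume k: "k \<in> K"
      show "\<Phi> ((w(j := c *\<^sub>C u))(k := X k ((w(j := c *\<^sub>C u)) k)))
        - c *\<^sub>C \<Phi> ((w(j := u))(k := X k ((w(j := u)) k))) \<in> S"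
      proof (cases "k = j")
        case True
        then show ?thesis
          using multilinear_modD(2)[OF \<Phi> w j, of "X j u" c] X k u
          by (simp add: slot_ops_def)
      next
        case False
        then show ?thesis
          using multilinear_modD(2)[OF \<Phi> upd[OF w k] j u, of c] by (simp add: fun_upd_twist[OF False[symmetric]])
      qed
    qed
    then show "slot_sum \<Phi> K X (w(j := c *\<^sub>C u)) - c *\<^sub>C slot_sum \<Phi> K X (w(j := u)) \<in> S"
      by (simp only: slot_sum_def sum_subtractf complex_vector.scale_sum_right)
  qed
qed

text \<open>Operators in different slots commute, so that only the diagonal contributes to a commutator.\<close>

lemma slot_sum_commutator:
  assumes S: "complex_vector.subspace S" and \<Phi>: "multilinear_mod S n W \<Phi>"
    and W: "\<And>k. k \<in> {1..n} \<Longrightarrow> complex_vector.subspace (W k)"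
    and K: "K \<subseteq> {1..n}" "K' \<subseteq> {1..n}" and X: "slot_ops W K X" and Y: "slot_ops W K' Y"
    and w: "w \<in> (\<Pi>\<^sub>E k\<in>{1..n}. W k)"
  shows "slot_sum (slot_sum \<Phi> K' Y) K X w - slot_sum (slot_sum \<Phi> K X) K' Y w
     - slot_sum \<Phi> (K \<inter> K') (\<lambda>k u. Y k (X k u) - X k (Y k u)) w \<in> S"
proof -
  have fin: "finite K" "finite K'" using K finite_subset by auto
  define d where "d k = \<Phi> (w(k := Y k (X k (w k)))) - \<Phi> (w(k := X k (Y k (w k))))" for k
  have "slot_sum (slot_sum \<Phi> K' Y) K X w - slot_sum (slot_sum \<Phi> K X) K' Y w =
    (\<Sum>k\<in>K. \<Sum>l\<in>K'. \<Phi> ((w(k := X k (w k)))(l := Y l ((w(k := X k (w k))) l)))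
       - \<Phi> ((w(l := Y l (w l)))(k := X k ((w(l := Y l (w l))) k))))"
    unfolding slot_sum_def by (subst (2) sum.swap) (simp only: sum_subtractf)
  also have "\<dots> = (\<Sum>k\<in>K. \<Sum>l\<in>K'. if l = k then d k else 0)"
  proof (intro sum.cong refl)
    fix k l
    show "\<Phi> ((w(k := X k (w k)))(l := Y l ((w(k := X k (w k))) l)))
       - \<Phi> ((w(l := Y l (w l)))(k := X k ((w(l := Y l (w l))) k))) = (if l = k then d k else 0)"
      by (cases "l = k") (simp_all add: d_def fun_upd_twist)
  qed
  also have "\<dots> = (\<Sum>k\<in>K. if k \<in> K' then d k else 0)"
    using fin by (simp add: sum.delta)
  also have "\<dots> = (\<Sum>k\<in>K \<inter> K'. d k)"
    using fin by (simp add: sum.inter_restrict)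
  finally have "slot_sum (slot_sum \<Phi> K' Y) K X w - slot_sum (slot_sum \<Phi> K X) K' Y w
     - slot_sum \<Phi> (K \<inter> K') (\<lambda>k u. Y k (X k u) - X k (Y k u)) w =
     (\<Sum>k\<in>K \<inter> K'. d k - \<Phi> (w(k := Y k (X k (w k)) - X k (Y k (w k)))))"
    by (simp add: slot_sum_def sum_subtractf)
  also have "\<dots> \<in> S"
  proof (intro complex_vector.subspace_sum[OF S])
    fix k assume k: "k \<in> K \<inter> K'"
    then have k': "k \<in> {1..n}" using K by auto
    have wk: "w k \<in> W k" using w k' by (auto simp: PiE_iff)
    have in1: "Y k (X k (w k)) \<in> W k" and in2: "X k (Y k (w k)) \<in> W k"
      using X Y k wk by (auto simp: slot_ops_def)
    have "\<Phi> (w(k := (Y k (X k (w k)) - X k (Y k (w k))) + X k (Y k (w k))))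
        - \<Phi> (w(k := Y k (X k (w k)) - X k (Y k (w k)))) - \<Phi> (w(k := X k (Y k (w k)))) \<in> S"
      by (rule multilinear_modD(1)[OF \<Phi> w k' _ in2]) (rule complex_vector.subspace_diff[OF W[OF k'] in1 in2])
    then show "d k - \<Phi> (w(k := Y k (X k (w k)) - X k (Y k (w k)))) \<in> S"
      by (simp add: d_def algebra_simps)
  qed
  finally show ?thesis .
qed

text \<open>The tensor product of the representations, with the class map \<open>T.cl\<close> from the free module
  \<open>F0\<close>.\<close>

locale tensor_ctx =
  fixes n :: nat and W :: "nat \<Rightarrow> 'w::complex_vector set"
    and \<rho> :: "nat \<Rightarrow> 'g::complex_lie_algebra \<Rightarrow> 'w \<Rightarrow> 'w"
  assumes reps: "\<forall>k\<in>{1..n}. lie_representation (W k) (\<rho> k)"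
begin

abbreviation "PW \<equiv> (\<Pi>\<^sub>E k\<in>{1..n}. W k)"
abbreviation "F0 \<equiv> free_module PW"

text \<open>The multilinearity relations. Their span \<open>T0\<close> is the submodule divided out.\<close>

definition tensor_rels :: "((nat \<Rightarrow> 'w) \<Rightarrow>\<^sub>0 complex) set" where
  "tensor_rels = {Poly_Mapping.single (w(k := u + v)) 1 - Poly_Mapping.single (w(k := u)) 1
           - Poly_Mapping.single (w(k := v)) 1 | w k u v.
           w \<in> PW \<and> k \<in> {1..n} \<and> u \<in> W k \<and> v \<in> W k} \<union>
        {Poly_Mapping.single (w(k := c *\<^sub>C u)) 1 - Poly_Mapping.single (w(k := u)) c | w k c u.
           w \<in> PW \<and> k \<in> {1..n} \<and> u \<in> W k}"

definition T0 :: "((nat \<Rightarrow> 'w) \<Rightarrow>\<^sub>0 complex) set" where "T0 = complex_vector.span tensor_rels"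

sublocale F0: vec_module F0 by (rule vec_module_free)

lemma carrier_F0: "carrier F0 = {f. Poly_Mapping.keys f \<subseteq> PW}"
  by (rule carrier_free)

lemma W_subspace: "k \<in> {1..n} \<Longrightarrow> complex_vector.subspace (W k)"
  using reps by (auto simp: lie_representation_def)

lemma slot_ops_rho: "K \<subseteq> {1..n} \<Longrightarrow> slot_ops W K (\<lambda>k. \<rho> k (x k))"
  using reps by (auto simp: slot_ops_def lie_representation_def subset_iff)

lemma rho_add:
  assumes "k \<in> {1..n}" "u \<in> W k"
  shows "\<rho> k (x + y) u = \<rho> k x u + \<rho> k y u"
proof -
  interpret Vector_Spaces.linear scaleC scaleC "\<lambda>x. \<rho> k x u"
    using reps assms unfolding lie_representation_def by blast
  show ?thesis by (rule add)
qed

lemma rho_scaleC: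
  assumes "k \<in> {1..n}" "u \<in> W k"
  shows "\<rho> k (c *\<^sub>C x) u = c *\<^sub>C \<rho> k x u"
proof -
  interpret Vector_Spaces.linear scaleC scaleC "\<lambda>x. \<rho> k x u"
    using reps assms unfolding lie_representation_def by blast
  show ?thesis by (rule scale)
qed

lemma rho_lie: "k \<in> {1..n} \<Longrightarrow> u \<in> W k \<Longrightarrow> \<rho> k (lie x y) u = \<rho> k x (\<rho> k y u) - \<rho> k y (\<rho> k x u)"
  using reps unfolding lie_representation_def by blast

lemma rho_closed: "k \<in> {1..n} \<Longrightarrow> u \<in> W k \<Longrightarrow> \<rho> k x u \<in> W k"
  using reps unfolding lie_representation_def by blast

lemma single_F0: "w \<in> PW \<Longrightarrow> Poly_Mapping.single w c \<in> carrier F0"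
  by (auto simp: carrier_F0)

lemma upd_PW: "w \<in> PW \<Longrightarrow> k \<in> {1..n} \<Longrightarrow> u \<in> W k \<Longrightarrow> w(k := u) \<in> PW"
  by (rule PiE_fun_upd)

lemma upd_rho_PW: "w \<in> PW \<Longrightarrow> k \<in> {1..n} \<Longrightarrow> w(k := \<rho> k x (w k)) \<in> PW"
  by (intro upd_PW rho_closed) (auto simp: PiE_iff)

lemma tensor_rels_subset: "tensor_rels \<subseteq> carrier F0"
proof
  fix r assume "r \<in> tensor_rels"
  then consider (add) w k u v where "r = Poly_Mapping.single (w(k := u + v)) 1
      - Poly_Mapping.single (w(k := u)) 1 - Poly_Mapping.single (w(k := v)) 1"
      "w \<in> PW" "k \<in> {1..n}" "u \<in> W k" "v \<in> W k"
    | (scale) w k c u where "r = Poly_Mapping.single (w(k := c *\<^sub>C u)) 1 - Poly_Mapping.single (w(k := u)) c"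
      "w \<in> PW" "k \<in> {1..n}" "u \<in> W k"
    unfolding tensor_rels_def by blast
  then show "r \<in> carrier F0"
  proof cases
    case add
    have "u + v \<in> W k" by (rule complex_vector.subspace_add[OF W_subspace[OF add(3)] add(4,5)])
    then show ?thesis using add by (simp only: F0.closed(3) single_F0 upd_PW)
  next
    case scale
    have "c *\<^sub>C u \<in> W k" by (rule complex_vector.subspace_scale[OF W_subspace[OF scale(3)] scale(4)])
    then show ?thesis using scale by (simp only: F0.closed(3) single_F0 upd_PW)
  qed
qed

lemma T0_subspace: "complex_vector.subspace T0"
  by (simp add: T0_def complex_vector.subspace_span)

lemma T0_subset: "T0 \<subseteq> carrier F0"
  unfolding T0_def by (rule complex_vector.span_minimal[OF tensor_rels_subset F0.carrier_subspace])

sublocale T: vec_quot F0 T0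
  by unfold_locales (rule T0_subspace T0_subset)+

lemma tensor_reps_eq: "tensor_reps n W = T.Q"
  unfolding tensor_reps_def Let_def T0_def F0.submodule_gen_eq[OF tensor_rels_subset, symmetric]
  by (simp only: tensor_rels_def)

text \<open>The universal property of the tensor product.\<close>

lemma T0_kills:
  assumes "complex_vector.subspace S" "multilinear_mod S n W \<Phi>" "r \<in> T0"
  shows "lin_ext \<Phi> r \<in> S"
proof (rule lin_ext_span_kills[OF assms(1) _ assms(3)[unfolded T0_def]])
  fix r assume "r \<in> tensor_rels"
  then show "lin_ext \<Phi> r \<in> S"
    using assms(2) unfolding tensor_rels_def multilinear_mod_def
    by (auto simp: lin_ext_diff scaleC_one)
qed

lemma multilinear_mod_single: "multilinear_mod T0 n W (\<lambda>w. Poly_Mapping.single w 1)"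
  unfolding multilinear_mod_def
proof (intro conjI ballI allI)
  fix w k u v assume "w \<in> PW" "k \<in> {1..n}" "u \<in> W k" "v \<in> W k"
  then have "Poly_Mapping.single (w(k := u + v)) 1 - Poly_Mapping.single (w(k := u)) 1
           - Poly_Mapping.single (w(k := v)) 1 \<in> tensor_rels"
    unfolding tensor_rels_def by blast
  then show "Poly_Mapping.single (w(k := u + v)) 1 - Poly_Mapping.single (w(k := u)) 1
           - Poly_Mapping.single (w(k := v)) 1 \<in> T0"
    by (simp add: T0_def complex_vector.span_base)
next
  fix w k c u assume "w \<in> PW" "k \<in> {1..n}" "u \<in> W k"
  then have "Poly_Mapping.single (w(k := c *\<^sub>C u)) 1 - Poly_Mapping.single (w(k := u)) c \<in> tensor_rels"
    unfolding tensor_rels_def by blast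
  then show "Poly_Mapping.single (w(k := c *\<^sub>C u)) 1 - c *\<^sub>C Poly_Mapping.single (w(k := u)) 1 \<in> T0"
    by (simp add: T0_def complex_vector.span_base scaleC_single)
qed

text \<open>The action on the tensor product, on representatives.\<close>

definition tact :: "'g \<Rightarrow> ((nat \<Rightarrow> 'w) \<Rightarrow>\<^sub>0 complex) \<Rightarrow> ((nat \<Rightarrow> 'w) \<Rightarrow>\<^sub>0 complex)" where
  "tact x = lin_ext (slot_sum (\<lambda>w. Poly_Mapping.single w 1) {1..n} (\<lambda>k. \<rho> k x))"

lemma tact_single: "tact x (Poly_Mapping.single w c) = c *\<^sub>C slot_sum (\<lambda>w. Poly_Mapping.single w 1) {1..n} (\<lambda>k. \<rho> k x) w"
  by (simp add: tact_def)

lemma slot_sum_F0: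
  "w \<in> PW \<Longrightarrow> slot_sum (\<lambda>w. Poly_Mapping.single w 1) {1..n} (\<lambda>k. \<rho> k x) w \<in> carrier F0"
  unfolding slot_sum_def
  by (intro complex_vector.subspace_sum[OF F0.carrier_subspace] single_F0 upd_rho_PW)

text \<open>A linear map out of the free module intertwines \<open>tact\<close> with the sum over all slots.\<close>

lemma lin_ext_tact: "lin_ext \<Phi> (tact x f) = lin_ext (slot_sum \<Phi> {1..n} (\<lambda>k. \<rho> k x)) f"
proof -
  have "Poly_Mapping.keys f \<subseteq> UNIV" by simp
  then show ?thesis
    by (induction f rule: free_induct)
      (simp_all add: tact_def lin_ext_add lin_ext_scaleC slot_sum_def lin_ext_sum scaleC_one)
qed

lemma F0_induct [consumes 1, case_names zero add single]:
  assumes "f \<in> carrier F0" "P 0"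
    and "\<And>f g. f \<in> carrier F0 \<Longrightarrow> g \<in> carrier F0 \<Longrightarrow> P f \<Longrightarrow> P g \<Longrightarrow> P (f + g)"
    and "\<And>c x. x \<in> PW \<Longrightarrow> P (c *\<^sub>C Poly_Mapping.single x 1)"
  shows "P f"
  using assms(1)[unfolded carrier_F0, simplified]
  by (induction f rule: free_induct) (use assms(2-) in \<open>auto simp: carrier_F0 scaleC_single\<close>)

lemma slot_sum_single_lie:
  assumes w: "w \<in> PW"
  shows "tact x (slot_sum (\<lambda>w. Poly_Mapping.single w 1) {1..n} (\<lambda>k. \<rho> k y) w)
    - tact y (slot_sum (\<lambda>w. Poly_Mapping.single w 1) {1..n} (\<lambda>k. \<rho> k x) w)
    - slot_sum (\<lambda>w. Poly_Mapping.single w 1) {1..n} (\<lambda>k. \<rho> k (lie x y)) w \<in> T0"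
proof -
  let ?s = "\<lambda>w. Poly_Mapping.single w (1::complex)"
  have 1: "tact x (slot_sum ?s {1..n} (\<lambda>k. \<rho> k y) w) =
      slot_sum (slot_sum ?s {1..n} (\<lambda>k. \<rho> k x)) {1..n} (\<lambda>k. \<rho> k y) w" for x y
    unfolding slot_sum_def[of ?s] tact_def lin_ext_sum by (simp add: slot_sum_def scaleC_one)
  have 2: "slot_sum ?s {1..n} (\<lambda>k. \<rho> k (lie x y)) w =
      slot_sum ?s ({1..n} \<inter> {1..n}) (\<lambda>k u. \<rho> k x (\<rho> k y u) - \<rho> k y (\<rho> k x u)) w"
    unfolding slot_sum_def using w by (intro sum.cong) (auto simp: rho_lie PiE_iff)
  show ?thesis
    unfolding 1 2
    by (rule slot_sum_commutator[OF T0_subspace multilinear_mod_single W_subspace])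
      (use w slot_ops_rho in auto)
qed

sublocale G: lie_subalgebra "UNIV :: 'g set"
  by unfold_locales (auto simp: complex_vector.subspace_UNIV)

sublocale TR: lie_rep_mod "UNIV :: 'g set" tact "carrier F0" T0
proof unfold_locales
  show "complex_vector.subspace (carrier F0)" by (rule F0.carrier_subspace)
  show "complex_vector.subspace T0" by (rule T0_subspace)
  show "T0 \<subseteq> carrier F0" by (rule T0_subset)
  show "tact x e \<in> carrier F0" if "e \<in> carrier F0" for x e
    unfolding tact_def using that
    by (intro lin_ext_in_subspace F0.carrier_subspace slot_sum_F0) (auto simp: carrier_F0)
  show "tact x e \<in> T0" if "e \<in> T0" for x e
    unfolding tact_def
    by (rule T0_kills[OF T0_subspace _ that], rule multilinear_mod_slot_sum[OF T0_subspace multilinear_mod_single])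
      (auto intro: slot_ops_rho)
  show "tact x (e + e') = tact x e + tact x e'" for x e e' by (simp add: tact_def lin_ext_add)
  show "tact x (c *\<^sub>C e) = c *\<^sub>C tact x e" for x c e by (simp add: tact_def lin_ext_scaleC)
  note sub = T0_subspace complex_vector.subspace_0[OF T0_subspace]
    complex_vector.subspace_add[OF T0_subspace] complex_vector.subspace_scale[OF T0_subspace]
  show "tact (x + y) e - tact x e - tact y e \<in> T0" if "e \<in> carrier F0" for x y e
    using that
  proof (induction e rule: F0_induct)
    case zero then show ?case by (simp add: tact_def sub)
  next
    case (add f g)
    have "(tact (x + y) f - tact x f - tact y f) + (tact (x + y) g - tact x g - tact y g) \<in> T0"
      using add by (intro sub)
    then show ?case by (simp add: tact_def lin_ext_add algebra_simps)
  next
    case (single c w)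
    have "(\<Sum>k\<in>{1..n}. Poly_Mapping.single (w(k := \<rho> k (x + y) (w k))) (1::complex)
        - Poly_Mapping.single (w(k := \<rho> k x (w k))) 1 - Poly_Mapping.single (w(k := \<rho> k y (w k))) 1) \<in> T0"
    proof (intro complex_vector.subspace_sum[OF T0_subspace])
      fix k assume k: "k \<in> {1..n}"
      then have wk: "w k \<in> W k" using single by (auto simp: PiE_iff)
      show "Poly_Mapping.single (w(k := \<rho> k (x + y) (w k))) (1::complex)
        - Poly_Mapping.single (w(k := \<rho> k x (w k))) 1 - Poly_Mapping.single (w(k := \<rho> k y (w k))) 1 \<in> T0"
        using multilinear_modD(1)[OF multilinear_mod_single single k rho_closed[OF k wk] rho_closed[OF k wk], of x y]
        by (simp add: rho_add[OF k wk])
    qed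
    then have "c *\<^sub>C (\<Sum>k\<in>{1..n}. Poly_Mapping.single (w(k := \<rho> k (x + y) (w k))) (1::complex)
        - Poly_Mapping.single (w(k := \<rho> k x (w k))) 1 - Poly_Mapping.single (w(k := \<rho> k y (w k))) 1) \<in> T0"
      by (rule sub)
    then show ?case
      by (simp add: tact_def lin_ext_scaleC scaleC_one slot_sum_def sum_subtractf
          complex_vector.scale_right_diff_distrib)
  qed
  show "tact (c *\<^sub>C x) e - c *\<^sub>C tact x e \<in> T0" if "e \<in> carrier F0" for x c e
    using that
  proof (induction e rule: F0_induct)
    case zero then show ?case by (simp add: tact_def sub complex_vector.scale_zero_right)
  next
    case (add f g)
    have "(tact (c *\<^sub>C x) f - c *\<^sub>C tact x f) + (tact (c *\<^sub>C x) g - c *\<^sub>C tact x g) \<in> T0"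
      using add by (intro sub)
    then show ?case by (simp add: tact_def lin_ext_add scaleC_add_right algebra_simps)
  next
    case (single d w)
    have "(\<Sum>k\<in>{1..n}. Poly_Mapping.single (w(k := \<rho> k (c *\<^sub>C x) (w k))) (1::complex)
        - c *\<^sub>C Poly_Mapping.single (w(k := \<rho> k x (w k))) 1) \<in> T0"
    proof (intro complex_vector.subspace_sum[OF T0_subspace])
      fix k assume k: "k \<in> {1..n}"
      then have wk: "w k \<in> W k" using single by (auto simp: PiE_iff)
      show "Poly_Mapping.single (w(k := \<rho> k (c *\<^sub>C x) (w k))) (1::complex)
        - c *\<^sub>C Poly_Mapping.single (w(k := \<rho> k x (w k))) 1 \<in> T0"
        using multilinear_modD(2)[OF multilinear_mod_single single k rho_closed[OF k wk], of c x]
        by (simp add: rho_scaleC[OF k wk])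
    qed
    then have "d *\<^sub>C (\<Sum>k\<in>{1..n}. Poly_Mapping.single (w(k := \<rho> k (c *\<^sub>C x) (w k))) (1::complex)
        - c *\<^sub>C Poly_Mapping.single (w(k := \<rho> k x (w k))) 1) \<in> T0"
      by (rule sub)
    then show ?case
      by (simp add: tact_def lin_ext_scaleC scaleC_one slot_sum_def sum_subtractf
          complex_vector.scale_right_diff_distrib complex_vector.scale_sum_right mult.commute)
  qed
  show "tact x (tact y e) - tact y (tact x e) - tact (lie x y) e \<in> T0" if "e \<in> carrier F0" for x y e
    using that
  proof (induction e rule: F0_induct)
    case zero then show ?case by (simp add: tact_def sub)
  next
    case (add f g)
    have "(tact x (tact y f) - tact y (tact x f) - tact (lie x y) f)
        + (tact x (tact y g) - tact y (tact x g) - tact (lie x y) g) \<in> T0"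
      using add by (intro sub)
    then show ?case by (simp add: tact_def lin_ext_add algebra_simps)
  next
    case (single c w)
    have "c *\<^sub>C (tact x (slot_sum (\<lambda>w. Poly_Mapping.single w 1) {1..n} (\<lambda>k. \<rho> k y) w)
    - tact y (slot_sum (\<lambda>w. Poly_Mapping.single w 1) {1..n} (\<lambda>k. \<rho> k x) w)
    - slot_sum (\<lambda>w. Poly_Mapping.single w 1) {1..n} (\<lambda>k. \<rho> k (lie x y)) w) \<in> T0"
      by (intro sub slot_sum_single_lie single)
    then show ?case
      by (simp add: tact_def lin_ext_scaleC scaleC_one complex_vector.scale_right_diff_distrib)
  qed
qed

lemma pure_tensor_eq: "pure_tensor n W w = T.cl (Poly_Mapping.single w 1)"
  unfolding pure_tensor_def
  by (rule basis_class_vcoset) (simp add: tensor_reps_eq T.zero_Q T.cl_0)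

lemma tensor_reps_act_cl:
  assumes "f \<in> carrier F0"
  shows "tensor_reps_act n W \<rho> x (T.cl f) = T.cl (tact x f)"
  unfolding tensor_reps_act_def tact_def tensor_reps_eq
proof (rule T.lin_lift_cl[OF T0_subspace])
  show "T0 \<subseteq> {f. Poly_Mapping.keys f \<subseteq> PW}" using T0_subset by (simp add: carrier_F0)
  show "Poly_Mapping.keys f \<subseteq> PW" using assms by (simp add: carrier_F0)
  fix w assume w: "w \<in> PW"
  then show "slot_sum (\<lambda>w. Poly_Mapping.single w 1) {1..n} (\<lambda>k. \<rho> k x) w \<in> carrier F0"
    by (rule slot_sum_F0)
  show "(\<Oplus>\<^bsub>T.Q\<^esub>k\<in>{1..n}. pure_tensor n W (w(k := \<rho> k x (w k)))) =
      T.cl (slot_sum (\<lambda>w. Poly_Mapping.single w 1) {1..n} (\<lambda>k. \<rho> k x) w)"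
    unfolding slot_sum_def pure_tensor_eq
    by (rule T.finsum_Q) (intro single_F0 upd_rho_PW w)
next
  fix r assume "r \<in> T0"
  then show "lin_ext (slot_sum (\<lambda>w. Poly_Mapping.single w 1) {1..n} (\<lambda>k. \<rho> k x)) r \<in> T0"
    using TR.act_S[of x r] by (simp add: tact_def)
qed

lemma tensor_reps_env_act_cl:
  assumes f: "f \<in> carrier F0" and a: "a \<in> carrier (free_algebra UNIV)"
  shows "tensor_reps_env_act n W \<rho> (G.U.cl a) (T.cl f) = T.cl (TR.env_act a f)"
  unfolding tensor_reps_env_act_def tensor_reps_eq TR.env_act_def
proof (rule T.lin_lift_cl[OF G.env_ideal_subspace])
  show "env_ideal UNIV \<subseteq> {a. Poly_Mapping.keys a \<subseteq> UNIV}" by simp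
  show "Poly_Mapping.keys a \<subseteq> UNIV" by simp
  show "foldr tact ws f \<in> carrier F0" for ws by (rule TR.word_E[OF _ f]) simp
  show "foldr (tensor_reps_act n W \<rho>) ws (T.cl f) = T.cl (foldr tact ws f)" for ws
  proof (induction ws)
    case (Cons x ws)
    then show ?case using tensor_reps_act_cl[OF TR.word_E[OF _ f], of ws x] by simp
  qed simp
  show "lin_ext (\<lambda>ws. foldr tact ws f) r \<in> T0" if "r \<in> env_ideal UNIV" for r
    using TR.env_act_ideal[OF that f] by (simp add: TR.env_act_def)
qed

end

section \<open>The induced module\<close>

text \<open>The induced module. The free algebra on \<open>L\<close> has the carrier \<open>AP\<close>; \<open>cP\<close> and \<open>c0\<close> are the
  class maps to the enveloping algebra of \<open>L\<close> and to the tensor product of the representations,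
  and \<open>Bv x f c\<close> is \<open>c\<close> times the basis vector attached to the classes of \<open>x\<close> and \<open>f\<close> in the free
  module \<open>F2\<close>, of which the induced module is a quotient.\<close>

locale ind_ctx = tensor_ctx n W \<rho>
  for n :: nat and W :: "nat \<Rightarrow> 'w::complex_vector set"
    and \<rho> :: "nat \<Rightarrow> 'g::complex_lie_algebra \<Rightarrow> 'w \<Rightarrow> 'w" +
  fixes D :: "complex option set"
begin

abbreviation L :: "'g mero set" where "L \<equiv> poles_in D"

sublocale P: lie_subalgebra L
  by unfold_locales (rule subspace_regular_on lie_in_regular_on, assumption?)+

abbreviation AP :: "('g mero list \<Rightarrow>\<^sub>0 complex) set" where "AP \<equiv> carrier (free_algebra L)"
abbreviation cP where "cP \<equiv> P.U.cl"
abbreviation c0 where "c0 \<equiv> T.cl"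
abbreviation Bv where "Bv x f c \<equiv> Poly_Mapping.single (cP x, c0 f) (c::complex)"

text \<open>The homomorphism of free algebras given by the inclusion of the constants.\<close>

definition const_alg :: "('g list \<Rightarrow>\<^sub>0 complex) \<Rightarrow> ('g mero list \<Rightarrow>\<^sub>0 complex)" where
  "const_alg r = lin_ext (\<lambda>ws. Poly_Mapping.single (map const_mero ws) 1) r"

lemma const_alg_AP: "const_alg r \<in> AP"
  unfolding const_alg_def
  by (rule lin_ext_in_subspace[OF P.FA.carrier_subspace]) (rule P.single_closed, auto)

lemma single_const_AP: "Poly_Mapping.single [const_mero x] c \<in> AP"
  by (rule P.single_closed) simp

text \<open>By left multiplication the constants act on the free algebra on \<open>L\<close>, and modulo \<open>env_ideal L\<close> this is a representation; the image of \<open>r\<close> in the free algebra on \<open>L\<close> is the result of the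
  action of \<open>r\<close> on the unit.\<close>

lemma const_alg_ideal:
  assumes "r \<in> env_ideal UNIV"
  shows "const_alg r \<in> env_ideal L"
proof -
  let ?s = "\<lambda>x::'g. Poly_Mapping.single [const_mero x] (1::complex)"
  interpret C: lie_rep_mod "UNIV :: 'g set" "\<lambda>x f. ?s x * f" AP "env_ideal L"
  proof unfold_locales
    fix x y :: 'g and e assume e: "e \<in> AP"
    have "?s (x + y) - ?s x - ?s y \<in> P.env_relations"
      unfolding P.env_relations_def by (fastforce simp: const_mero_add)
    then show "?s (x + y) * e - ?s x * e - ?s y * e \<in> env_ideal L"
      using P.env_ideal_rmult[OF _ e] P.env_relations_in by (auto simp flip: left_diff_distrib)
    have "?s x * ?s y - ?s y * ?s x - ?s (lie x y) \<in> P.env_relations"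
      unfolding P.env_relations_def by (fastforce simp: const_mero_lie)
    then show "?s x * (?s y * e) - ?s y * (?s x * e) - ?s (lie x y) * e \<in> env_ideal L"
      using P.env_ideal_rmult[OF _ e] P.env_relations_in
      by (auto simp flip: left_diff_distrib mult.assoc)
  next
    fix x :: 'g and c e assume e: "e \<in> AP"
    have "?s (c *\<^sub>C x) - Poly_Mapping.single [const_mero x] c \<in> P.env_relations"
      unfolding P.env_relations_def by (fastforce simp: const_mero_scaleC)
    then have "(?s (c *\<^sub>C x) - Poly_Mapping.single [const_mero x] c) * e \<in> env_ideal L"
      using P.env_ideal_rmult[OF _ e] P.env_relations_in by auto
    moreover have "Poly_Mapping.single [const_mero x] c = c *\<^sub>C ?s x" by (simp add: scaleC_single)
    ultimately show "?s (c *\<^sub>C x) * e - c *\<^sub>C (?s x * e) \<in> env_ideal L"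
      by (simp add: left_diff_distrib scaleC_mult_left)
    show "?s x * e \<in> AP" using e single_const_AP P.mult_closed by blast
    show "?s x * (c *\<^sub>C e) = c *\<^sub>C (?s x * e)" by (rule scaleC_mult_right)
  qed (simp_all only: distrib_left P.FA.carrier_subspace P.env_ideal_subspace P.env_ideal_subset
      P.env_ideal_lmult single_const_AP)
  have "foldr (\<lambda>x f. ?s x * f) ws 1 = Poly_Mapping.single (map const_mero ws) 1" for ws
    by (induction ws) (simp_all add: mult_single plus_list_def one_free_algebra del: single_one)
  then have "C.env_act r 1 = const_alg r"
    by (simp add: C.env_act_def const_alg_def)
  then show ?thesis
    using C.env_act_ideal[OF assms, of 1] keys_one_lists[of L] by simp
qed

lemma env_map_cl: "env_map L const_mero (G.U.cl r) = cP (const_alg r)"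
  unfolding env_map_def P.env_eq const_alg_def
proof (rule P.U.lin_lift_cl[OF G.env_ideal_subspace])
  show "env_ideal UNIV \<subseteq> {a. Poly_Mapping.keys a \<subseteq> UNIV}" "Poly_Mapping.keys r \<subseteq> UNIV" by simp_all
  show "Poly_Mapping.single (map const_mero ws) 1 \<in> AP" for ws
    by (rule P.single_closed) auto
  show "basis_class P.U.Q (map const_mero ws) = cP (Poly_Mapping.single (map const_mero ws) 1)" for ws
    using P.basis_class_env by (simp add: P.env_eq)
  show "lin_ext (\<lambda>ws. Poly_Mapping.single (map const_mero ws) 1) r \<in> env_ideal L"
    if "r \<in> env_ideal UNIV" for r
    using const_alg_ideal[OF that] by (simp add: const_alg_def)
qed

abbreviation F2 where "F2 \<equiv> free_module (carrier (env L) \<times> carrier (tensor_reps n W))"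

sublocale F2: vec_module F2 by (rule vec_module_free)

text \<open>The relations of the tensor product over the enveloping algebra of the constants, in terms
  of representatives. Their span \<open>T2\<close> is the submodule divided out.\<close>

definition ind_rels where
  "ind_rels =
      {Bv (x + y) f 1 - Bv x f 1 - Bv y f 1 | x y f. x \<in> AP \<and> y \<in> AP \<and> f \<in> carrier F0} \<union>
      {Bv x (f + g) 1 - Bv x f 1 - Bv x g 1 | x f g. x \<in> AP \<and> f \<in> carrier F0 \<and> g \<in> carrier F0} \<union>
      {Bv (c *\<^sub>C x) f 1 - Bv x f c | c x f. x \<in> AP \<and> f \<in> carrier F0} \<union>
      {Bv x (c *\<^sub>C f) 1 - Bv x f c | c x f. x \<in> AP \<and> f \<in> carrier F0} \<union>
      {Bv (x * const_alg r) f 1 - Bv x (TR.env_act r f) 1 | x r f.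
         x \<in> AP \<and> r \<in> carrier (free_algebra UNIV) \<and> f \<in> carrier F0}"

definition T2 where "T2 = complex_vector.span ind_rels"

lemma carrier_env: "carrier (env L) = cP ` AP"
  by (simp only: P.env_eq P.U.carrier_Q)

lemma carrier_tensor: "carrier (tensor_reps n W) = c0 ` carrier F0"
  by (simp only: tensor_reps_eq T.carrier_Q)

lemma Bv_F2: "x \<in> AP \<Longrightarrow> f \<in> carrier F0 \<Longrightarrow> Bv x f c \<in> carrier F2"
  by (auto simp: carrier_free carrier_env carrier_tensor simp del: free_algebra_simps)

lemma tensor_relations_eq:
  "tensor_relations (env (UNIV :: 'g set)) (env L) (tensor_reps n W)
     (\<lambda>u a. u \<otimes>\<^bsub>env L\<^esub> env_map L const_mero a) (tensor_reps_env_act n W \<rho>) = submodule_gen F2 ind_rels"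
proof -
  have image3: "{H a b d | a b d. a \<in> p ` X \<and> b \<in> q ` Y \<and> d \<in> r ` Z} =
      {H (p x) (q y) (r z) | x y z. x \<in> X \<and> y \<in> Y \<and> z \<in> Z}"
    for H :: "'x \<Rightarrow> 'y \<Rightarrow> 'z \<Rightarrow> 'u" and p :: "'p \<Rightarrow> 'x" and q :: "'q \<Rightarrow> 'y" and r :: "'r \<Rightarrow> 'z" and X Y Z
    by blast
  have image2: "{H c a b | c a b. a \<in> p ` X \<and> b \<in> q ` Y} =
      {H c (p x) (q y) | c x y. x \<in> X \<and> y \<in> Y}"
    for H :: "'x \<Rightarrow> 'y \<Rightarrow> 'z \<Rightarrow> 'u" and p :: "'p \<Rightarrow> 'y" and q :: "'q \<Rightarrow> 'z" and X Y
    by blast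
  have add_P: "cP x \<oplus>\<^bsub>env L\<^esub> cP y = cP (x + y)" and smult_P: "c \<odot>\<^bsub>env L\<^esub> cP x = cP (c *\<^sub>C x)" for c x y
    by (simp_all only: P.env_eq P.U.add_Q P.U.smult_Q)
  have add_0: "c0 f \<oplus>\<^bsub>tensor_reps n W\<^esub> c0 g = c0 (f + g)"
    and smult_0: "c \<odot>\<^bsub>tensor_reps n W\<^esub> c0 f = c0 (c *\<^sub>C f)" for c f g
    by (simp_all only: tensor_reps_eq T.add_Q T.smult_Q)
  have 5: "{Poly_Mapping.single (cP x \<otimes>\<^bsub>env L\<^esub> env_map L const_mero (G.U.cl r), c0 f) (1::complex) -
         Poly_Mapping.single (cP x, tensor_reps_env_act n W \<rho> (G.U.cl r) (c0 f)) 1 |x r f.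
         x \<in> AP \<and> r \<in> carrier (free_algebra UNIV) \<and> f \<in> carrier F0} =
     {Bv (x * const_alg r) f 1 - Bv x (TR.env_act r f) 1 | x r f.
         x \<in> AP \<and> r \<in> carrier (free_algebra UNIV) \<and> f \<in> carrier F0}"
    by (intro Collect_cong ex_cong1 rev_conj_cong refl)
      (simp only: env_map_cl P.mult_U const_alg_AP tensor_reps_env_act_cl)
  have carrier_G: "carrier (env (UNIV :: 'g set)) = G.U.cl ` carrier (free_algebra UNIV)"
    by (simp only: G.env_eq G.U.carrier_Q)
  show ?thesis
    unfolding tensor_relations_def ind_rels_def
    by (simp only: carrier_env carrier_tensor carrier_G image3 image2 add_P smult_P add_0 smult_0 5)
qed

lemma ind_rels_subset: "ind_rels \<subseteq> carrier F2"
  unfolding ind_rels_def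
proof (intro Un_least subsetI; elim CollectE exE conjE; hypsubst)
qed (simp_all only: F2.closed(3) Bv_F2 P.FA.closed(2,4) F0.closed(2,4) P.mult_closed const_alg_AP
    TR.env_act_E[unfolded mem_Collect_eq] TR.env_act_E free_algebra_simps(1)[of UNIV] mem_Collect_eq)


lemma T2_subspace: "complex_vector.subspace T2"
  by (simp add: T2_def complex_vector.subspace_span)

lemma T2_subset: "T2 \<subseteq> carrier F2"
  unfolding T2_def by (rule complex_vector.span_minimal[OF ind_rels_subset F2.carrier_subspace])

sublocale V: vec_quot F2 T2
  by unfold_locales (rule T2_subspace T2_subset)+

lemma ind_module_eq: "ind_module n W \<rho> D = V.Q"
  by (simp only: ind_module_def tensor_over_def tensor_relations_eq T2_def
      F2.submodule_gen_eq[OF ind_rels_subset])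

lemma F2_induct [consumes 1, case_names zero add scale single]:
  assumes "g \<in> carrier F2" "P 0"
    and "\<And>g h. g \<in> carrier F2 \<Longrightarrow> h \<in> carrier F2 \<Longrightarrow> P g \<Longrightarrow> P h \<Longrightarrow> P (g + h)"
    and scale: "\<And>c g. g \<in> carrier F2 \<Longrightarrow> P g \<Longrightarrow> P (c *\<^sub>C g)"
    and single: "\<And>x f. x \<in> AP \<Longrightarrow> f \<in> carrier F0 \<Longrightarrow> P (Bv x f 1)"
  shows "P g"
proof -
  have "Poly_Mapping.keys g \<subseteq> carrier (env L) \<times> carrier (tensor_reps n W)"
    using assms(1) by (simp add: carrier_free)
  then show ?thesis
  proof (induction g rule: free_induct)
    case (single c ut)
    then obtain x f where xf: "x \<in> AP" "f \<in> carrier F0" "ut = (cP x, c0 f)"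
      unfolding carrier_env carrier_tensor by blast
    have "P (c *\<^sub>C Bv x f 1)" by (intro scale assms(5) Bv_F2 xf)
    then show ?case by (simp add: xf scaleC_single)
  qed (use assms in \<open>auto simp: carrier_free\<close>)
qed

text \<open>A linear condition on the free module need only be checked on its basis.\<close>

lemma F2_linear_mod:
  assumes S: "complex_vector.subspace S"
    and "\<And>g h. p (g + h) = p g + p h" "\<And>c g. p (c *\<^sub>C g) = c *\<^sub>C p g"
    and "\<And>x f. x \<in> AP \<Longrightarrow> f \<in> carrier F0 \<Longrightarrow> p (Bv x f 1) \<in> S" and "g \<in> carrier F2"
  shows "p g \<in> S"
  using assms(5)
proof (induction g rule: F2_induct)
  case zero
  have "p 0 = 0" using assms(3)[of 0 0] by (simp add: complex_vector.scale_zero_left)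
  then show ?case using complex_vector.subspace_0[OF S] by simp
qed (simp_all add: assms(2-4) complex_vector.subspace_add[OF S] complex_vector.subspace_scale[OF S])

lemma T2_kills:
  assumes S: "complex_vector.subspace S"
    and "\<And>x y f. x \<in> AP \<Longrightarrow> y \<in> AP \<Longrightarrow> f \<in> carrier F0 \<Longrightarrow>
       \<psi> (cP (x + y), c0 f) - \<psi> (cP x, c0 f) - \<psi> (cP y, c0 f) \<in> S"
    and "\<And>x f g. x \<in> AP \<Longrightarrow> f \<in> carrier F0 \<Longrightarrow> g \<in> carrier F0 \<Longrightarrow>
       \<psi> (cP x, c0 (f + g)) - \<psi> (cP x, c0 f) - \<psi> (cP x, c0 g) \<in> S"
    and "\<And>c x f. x \<in> AP \<Longrightarrow> f \<in> carrier F0 \<Longrightarrow> \<psi> (cP (c *\<^sub>C x), c0 f) - c *\<^sub>C \<psi> (cP x, c0 f) \<in> S"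
    and "\<And>c x f. x \<in> AP \<Longrightarrow> f \<in> carrier F0 \<Longrightarrow> \<psi> (cP x, c0 (c *\<^sub>C f)) - c *\<^sub>C \<psi> (cP x, c0 f) \<in> S"
    and "\<And>x r f. x \<in> AP \<Longrightarrow> r \<in> carrier (free_algebra UNIV) \<Longrightarrow> f \<in> carrier F0 \<Longrightarrow>
       \<psi> (cP (x * const_alg r), c0 f) - \<psi> (cP x, c0 (TR.env_act r f)) \<in> S"
    and r: "r \<in> T2"
  shows "lin_ext \<psi> r \<in> S"
proof (rule lin_ext_span_kills[OF S _ r[unfolded T2_def]])
  fix r assume "r \<in> ind_rels"
  then show "lin_ext \<psi> r \<in> S"
    unfolding ind_rels_def
    by (elim UnE CollectE exE conjE; hypsubst)
      (simp_all only: lin_ext_diff lin_ext_single scaleC_one assms)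
qed

lemma Bv_add_left: "x \<in> AP \<Longrightarrow> y \<in> AP \<Longrightarrow> f \<in> carrier F0 \<Longrightarrow> Bv (x + y) f 1 - Bv x f 1 - Bv y f 1 \<in> T2"
  unfolding T2_def by (rule complex_vector.span_base) (unfold ind_rels_def, blast)

lemma Bv_add_right:
  "x \<in> AP \<Longrightarrow> f \<in> carrier F0 \<Longrightarrow> g \<in> carrier F0 \<Longrightarrow> Bv x (f + g) 1 - Bv x f 1 - Bv x g 1 \<in> T2"
  unfolding T2_def by (rule complex_vector.span_base) (unfold ind_rels_def, blast)

lemma Bv_scale_left: "x \<in> AP \<Longrightarrow> f \<in> carrier F0 \<Longrightarrow> Bv (c *\<^sub>C x) f 1 - c *\<^sub>C Bv x f 1 \<in> T2"
  unfolding T2_def scaleC_single mult_1_right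
  by (rule complex_vector.span_base) (unfold ind_rels_def, blast)

lemma Bv_scale_right: "x \<in> AP \<Longrightarrow> f \<in> carrier F0 \<Longrightarrow> Bv x (c *\<^sub>C f) 1 - c *\<^sub>C Bv x f 1 \<in> T2"
  unfolding T2_def scaleC_single mult_1_right
  by (rule complex_vector.span_base) (unfold ind_rels_def, blast)

lemma Bv_balanced:
  "x \<in> AP \<Longrightarrow> r \<in> carrier (free_algebra UNIV) \<Longrightarrow> f \<in> carrier F0 \<Longrightarrow>
     Bv (x * const_alg r) f 1 - Bv x (TR.env_act r f) 1 \<in> T2"
  unfolding T2_def by (rule complex_vector.span_base) (unfold ind_rels_def, blast)

lemma Bv_cong: "x - y \<in> env_ideal L \<Longrightarrow> Bv x f c = Bv y f c"
  using P.U.cl_eq_iff by metis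

lemma cl_Bv_add_left: "x \<in> AP \<Longrightarrow> y \<in> AP \<Longrightarrow> f \<in> carrier F0 \<Longrightarrow>
    V.cl (Bv (x + y) f 1) = V.cl (Bv x f 1 + Bv y f 1)"
  using Bv_add_left[of x y f] by (simp only: V.cl_eq_iff diff_diff_eq)

lemma cl_Bv_scale_left: "x \<in> AP \<Longrightarrow> f \<in> carrier F0 \<Longrightarrow> V.cl (Bv (c *\<^sub>C x) f 1) = V.cl (c *\<^sub>C Bv x f 1)"
  using Bv_scale_left[of x f c] by (simp only: V.cl_eq_iff)

lemma cl_Bv_add_right: "x \<in> AP \<Longrightarrow> f \<in> carrier F0 \<Longrightarrow> g \<in> carrier F0 \<Longrightarrow>
    V.cl (Bv x (f + g) 1) = V.cl (Bv x f 1 + Bv x g 1)"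
  using Bv_add_right[of x f g] by (simp only: V.cl_eq_iff diff_diff_eq)

lemma cl_Bv_scale_right: "x \<in> AP \<Longrightarrow> f \<in> carrier F0 \<Longrightarrow> V.cl (Bv x (c *\<^sub>C f) 1) = V.cl (c *\<^sub>C Bv x f 1)"
  using Bv_scale_right[of x f c] by (simp only: V.cl_eq_iff)

text \<open>The action of \<open>L\<close> on the induced module by left multiplication, on representatives.\<close>

definition iact where
  "iact \<alpha> = lin_ext (\<lambda>(u, t). Poly_Mapping.single (basis_class (env L) [\<alpha>] \<otimes>\<^bsub>env L\<^esub> u, t) (1::complex))"

lemma single_AP: "\<alpha> \<in> L \<Longrightarrow> Poly_Mapping.single [\<alpha>] c \<in> AP"
  by (rule P.single_closed) simp

lemma left_mult_env:
  "\<alpha> \<in> L \<Longrightarrow> x \<in> AP \<Longrightarrow>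
    basis_class (env L) [\<alpha>] \<otimes>\<^bsub>env L\<^esub> cP x = cP (Poly_Mapping.single [\<alpha>] 1 * x)"
  unfolding P.basis_class_env by (rule P.mult_U[OF single_AP])

lemma iact_Bv: "\<alpha> \<in> L \<Longrightarrow> x \<in> AP \<Longrightarrow> iact \<alpha> (Bv x f 1) = Bv (Poly_Mapping.single [\<alpha>] 1 * x) f 1"
  by (simp only: iact_def lin_ext_single scaleC_one prod.case left_mult_env)

lemma iact_add: "iact \<alpha> (g + h) = iact \<alpha> g + iact \<alpha> h"
  and iact_scaleC: "iact \<alpha> (c *\<^sub>C g) = c *\<^sub>C iact \<alpha> g"
  by (simp_all add: iact_def lin_ext_add lin_ext_scaleC)

lemma iact_F2: "\<alpha> \<in> L \<Longrightarrow> g \<in> carrier F2 \<Longrightarrow> iact \<alpha> g \<in> carrier F2"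
  by (rule F2_linear_mod[OF F2.carrier_subspace iact_add iact_scaleC])
    (simp only: iact_Bv Bv_F2 P.mult_closed single_AP)

lemma iact_T2:
  assumes "\<alpha> \<in> L" "r \<in> T2"
  shows "iact \<alpha> r \<in> T2"
proof -
  note m = P.mult_closed[OF single_AP[OF assms(1), of 1]]
  note lm = left_mult_env[OF assms(1)]
  let ?m = "basis_class (env L) [\<alpha>]"
  let ?s = "Poly_Mapping.single [\<alpha>] (1::complex)"
  let ?\<psi> = "\<lambda>u t. Poly_Mapping.single (?m \<otimes>\<^bsub>env L\<^esub> u, t) (1::complex)"
  have 1: "?\<psi> (cP (x + y)) (c0 f) - ?\<psi> (cP x) (c0 f) - ?\<psi> (cP y) (c0 f) \<in> T2"
    if x: "x \<in> AP" and y: "y \<in> AP" and f: "f \<in> carrier F0" for x y f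
    using Bv_add_left[OF m[OF x] m[OF y] f] x y
    by (simp only: lm P.FA.closed(2) distrib_left)
  have 2: "?\<psi> (cP x) (c0 (f + g)) - ?\<psi> (cP x) (c0 f) - ?\<psi> (cP x) (c0 g) \<in> T2"
    if x: "x \<in> AP" and f: "f \<in> carrier F0" and g: "g \<in> carrier F0" for x f g
    using Bv_add_right[OF m[OF x] f g] x by (simp only: lm)
  have 3: "?\<psi> (cP (c *\<^sub>C x)) (c0 f) - c *\<^sub>C ?\<psi> (cP x) (c0 f) \<in> T2"
    if x: "x \<in> AP" and f: "f \<in> carrier F0" for c x f
    using Bv_scale_left[OF m[OF x] f, of c] x by (simp only: lm P.FA.closed(4) scaleC_mult_right)
  have 4: "?\<psi> (cP x) (c0 (c *\<^sub>C f)) - c *\<^sub>C ?\<psi> (cP x) (c0 f) \<in> T2"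
    if x: "x \<in> AP" and f: "f \<in> carrier F0" for c x f
    using Bv_scale_right[OF m[OF x] f, of c] x by (simp only: lm)
  have 5: "?\<psi> (cP (x * const_alg r)) (c0 f) - ?\<psi> (cP x) (c0 (TR.env_act r f)) \<in> T2"
    if x: "x \<in> AP" and r: "r \<in> carrier (free_algebra UNIV)" and f: "f \<in> carrier F0" for x r f
    using Bv_balanced[OF m[OF x] r f] x by (simp only: lm P.mult_closed const_alg_AP mult.assoc)
  show ?thesis
    unfolding iact_def
    by (rule T2_kills[OF T2_subspace _ _ _ _ _ assms(2)]; unfold prod.case; rule 1 2 3 4 5; assumption)
qed

lemma ind_act_cl:
  assumes "\<alpha> \<in> L" "g \<in> carrier F2"
  shows "ind_act n W \<rho> D \<alpha> (V.cl g) = V.cl (iact \<alpha> g)"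
  unfolding ind_act_def ind_module_eq iact_def
proof (rule V.lin_lift_cl[OF T2_subspace])
  show "T2 \<subseteq> {f. Poly_Mapping.keys f \<subseteq> carrier (env L) \<times> carrier (tensor_reps n W)}"
    using T2_subset by (simp only: carrier_free)
  show "Poly_Mapping.keys g \<subseteq> carrier (env L) \<times> carrier (tensor_reps n W)"
    using assms(2) by (simp add: carrier_free)
  fix ut assume ut: "ut \<in> carrier (env L) \<times> carrier (tensor_reps n W)"
  then obtain x f where xf: "x \<in> AP" "f \<in> carrier F0" "ut = (cP x, c0 f)"
    unfolding carrier_env carrier_tensor by blast
  show "(case ut of (u, t) \<Rightarrow> Poly_Mapping.single (basis_class (env L) [\<alpha>] \<otimes>\<^bsub>env L\<^esub> u, t) (1::complex)) \<in> carrier F2"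
    using xf by (simp only: prod.case left_mult_env[OF assms(1)] Bv_F2 P.mult_closed single_AP[OF assms(1)])
  have "basis_class V.Q z = V.cl (Poly_Mapping.single z 1)" for z
    by (rule basis_class_vcoset) (simp only: V.zero_Q V.cl_0)
  then show "(case ut of (u, t) \<Rightarrow> basis_class V.Q (basis_class (env L) [\<alpha>] \<otimes>\<^bsub>env L\<^esub> u, t)) =
     V.cl (case ut of (u, t) \<Rightarrow> Poly_Mapping.single (basis_class (env L) [\<alpha>] \<otimes>\<^bsub>env L\<^esub> u, t) 1)"
    by (simp add: xf)
next
  show "lin_ext (\<lambda>(u, t). Poly_Mapping.single (basis_class (env L) [\<alpha>] \<otimes>\<^bsub>env L\<^esub> u, t) 1) r \<in> T2" if "r \<in> T2" for r
    using iact_T2[OF assms(1) that] by (simp add: iact_def)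
qed

sublocale VR: lie_rep_mod L iact "carrier F2" T2
proof unfold_locales
  fix \<alpha> \<beta> g c assume \<alpha>: "\<alpha> \<in> L" and \<beta>: "\<beta> \<in> L" and g: "g \<in> carrier F2"
  have \<alpha>\<beta>: "\<alpha> + \<beta> \<in> L" and c\<alpha>: "c *\<^sub>C \<alpha> \<in> L" and lie: "lie \<alpha> \<beta> \<in> L"
    by (rule complex_vector.subspace_add[OF P.L_subspace \<alpha> \<beta>]
      complex_vector.subspace_scale[OF P.L_subspace \<alpha>] P.L_lie[OF \<alpha> \<beta>])+
  let ?s = "\<lambda>\<alpha>. Poly_Mapping.single [\<alpha>] (1::complex)"
  have rel: "r * x \<in> env_ideal L" if "r \<in> P.env_relations" "x \<in> AP" for r x
    using P.env_relations_in that by (intro P.env_ideal_rmult) auto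
  note lin = iact_add iact_scaleC scaleC_add_right complex_vector.scale_right_diff_distrib
  show "iact (\<alpha> + \<beta>) g - iact \<alpha> g - iact \<beta> g \<in> T2"
  proof (rule F2_linear_mod[OF T2_subspace _ _ _ g])
    fix x f assume x: "x \<in> AP" and f: "f \<in> carrier F0"
    have "?s (\<alpha> + \<beta>) - ?s \<alpha> - ?s \<beta> \<in> P.env_relations"
      unfolding P.env_relations_def using \<alpha> \<beta> by blast
    then have "(?s (\<alpha> + \<beta>) - ?s \<alpha> - ?s \<beta>) * x \<in> env_ideal L" by (rule rel[OF _ x])
    then have "Bv (?s (\<alpha> + \<beta>) * x) f 1 = Bv (?s \<alpha> * x + ?s \<beta> * x) f 1"
      by (intro Bv_cong) (simp only: left_diff_distrib diff_diff_eq distrib_right)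
    then show "iact (\<alpha> + \<beta>) (Bv x f 1) - iact \<alpha> (Bv x f 1) - iact \<beta> (Bv x f 1) \<in> T2"
      using Bv_add_left[OF P.mult_closed[OF single_AP[OF \<alpha>] x] P.mult_closed[OF single_AP[OF \<beta>] x] f]
      by (simp only: iact_Bv \<alpha> \<beta> \<alpha>\<beta> x)
  qed (simp_all add: lin)
  show "iact (c *\<^sub>C \<alpha>) g - c *\<^sub>C iact \<alpha> g \<in> T2"
  proof (rule F2_linear_mod[OF T2_subspace _ _ _ g])
    fix x f assume x: "x \<in> AP" and f: "f \<in> carrier F0"
    have "?s (c *\<^sub>C \<alpha>) - Poly_Mapping.single [\<alpha>] c \<in> P.env_relations"
      unfolding P.env_relations_def using \<alpha> by blast
    then have "(?s (c *\<^sub>C \<alpha>) - Poly_Mapping.single [\<alpha>] c) * x \<in> env_ideal L" by (rule rel[OF _ x])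
    moreover have "Poly_Mapping.single [\<alpha>] c = c *\<^sub>C ?s \<alpha>" by (simp add: scaleC_single)
    ultimately have "Bv (?s (c *\<^sub>C \<alpha>) * x) f 1 = Bv (c *\<^sub>C (?s \<alpha> * x)) f 1"
      by (intro Bv_cong) (simp only: left_diff_distrib scaleC_mult_left)
    then show "iact (c *\<^sub>C \<alpha>) (Bv x f 1) - c *\<^sub>C iact \<alpha> (Bv x f 1) \<in> T2"
      using Bv_scale_left[OF P.mult_closed[OF single_AP[OF \<alpha>] x] f, of c]
      by (simp only: iact_Bv \<alpha> c\<alpha> x)
  qed (simp_all add: lin mult.commute)
  show "iact \<alpha> (iact \<beta> g) - iact \<beta> (iact \<alpha> g) - iact (lie \<alpha> \<beta>) g \<in> T2"
  proof (rule F2_linear_mod[OF T2_subspace _ _ _ g])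
    fix x f assume x: "x \<in> AP" and f: "f \<in> carrier F0"
    have "?s \<alpha> * ?s \<beta> - ?s \<beta> * ?s \<alpha> - ?s (lie \<alpha> \<beta>) \<in> P.env_relations"
      unfolding P.env_relations_def using \<alpha> \<beta> by blast
    then have "(?s \<alpha> * ?s \<beta> - ?s \<beta> * ?s \<alpha> - ?s (lie \<alpha> \<beta>)) * x \<in> env_ideal L" by (rule rel[OF _ x])
    then have "Bv (?s \<alpha> * (?s \<beta> * x)) f 1 = Bv (?s \<beta> * (?s \<alpha> * x) + ?s (lie \<alpha> \<beta>) * x) f 1"
      by (intro Bv_cong) (simp only: left_diff_distrib mult.assoc diff_diff_eq distrib_right)
    moreover have "Bv (?s \<beta> * (?s \<alpha> * x) + ?s (lie \<alpha> \<beta>) * x) f 1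
        - Bv (?s \<beta> * (?s \<alpha> * x)) f 1 - Bv (?s (lie \<alpha> \<beta>) * x) f 1 \<in> T2"
      by (intro Bv_add_left P.mult_closed single_AP \<alpha> \<beta> lie x f)
    ultimately show "iact \<alpha> (iact \<beta> (Bv x f 1)) - iact \<beta> (iact \<alpha> (Bv x f 1)) - iact (lie \<alpha> \<beta>) (Bv x f 1) \<in> T2"
      by (simp only: iact_Bv \<alpha> \<beta> lie x P.mult_closed[OF single_AP])
  qed (simp_all add: lin)
qed (simp_all only: iact_F2 iact_T2 iact_add iact_scaleC F2.carrier_subspace T2_subspace T2_subset)

lemma ind_tensor_eq: "ind_tensor n W \<rho> D w = V.cl (Bv 1 (Poly_Mapping.single w 1) 1)"
  unfolding ind_tensor_def ind_module_eq P.one_U pure_tensor_eq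
  by (rule basis_class_vcoset) (simp only: V.zero_Q V.cl_0)

lemma one_AP: "1 \<in> AP"
  using keys_one_lists by (simp only: free_algebra_simps mem_Collect_eq)


text \<open>The image \<open>1 \<otimes> w\<^sub>1 \<otimes> \<dots> \<otimes> w\<^sub>n\<close> of a pure tensor in the induced module, as a
  representative.\<close>

definition itens where "itens w = Bv 1 (Poly_Mapping.single w 1) 1"

lemma itens_F2: "w \<in> PW \<Longrightarrow> itens w \<in> carrier F2"
  unfolding itens_def by (intro Bv_F2 one_AP single_F0)

lemma itens_multilinear: "multilinear_mod T2 n W itens"
proof -
  let ?s = "\<lambda>w. Poly_Mapping.single w (1::complex)"
  show ?thesis
    unfolding multilinear_mod_def
  proof (intro conjI ballI allI)
    fix w k u v assume w: "w \<in> PW" "k \<in> {1..n}" and u: "u \<in> W k" and v: "v \<in> W k"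
    have "?s (w(k := u + v)) - (?s (w(k := u)) + ?s (w(k := v))) \<in> T0"
      using multilinear_modD(1)[OF multilinear_mod_single w u v] by (simp add: diff_diff_eq)
    then have "c0 (?s (w(k := u + v))) = c0 (?s (w(k := u)) + ?s (w(k := v)))"
      by (simp only: T.cl_eq_iff)
    then show "itens (w(k := u + v)) - itens (w(k := u)) - itens (w(k := v)) \<in> T2"
      unfolding itens_def
      using Bv_add_right[OF one_AP single_F0[OF upd_PW[OF w u]] single_F0[OF upd_PW[OF w v]]] by simp
  next
    fix w k u c assume w: "w \<in> PW" "k \<in> {1..n}" and u: "u \<in> W k"
    have "c0 (?s (w(k := c *\<^sub>C u))) = c0 (c *\<^sub>C ?s (w(k := u)))"
      using multilinear_modD(2)[OF multilinear_mod_single w u] by (simp only: T.cl_eq_iff)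
    then show "itens (w(k := c *\<^sub>C u)) - c *\<^sub>C itens (w(k := u)) \<in> T2"
      unfolding itens_def
      using Bv_scale_right[OF one_AP single_F0[OF upd_PW[OF w u]]] by simp
  qed
qed

lemma cl_Bv_sum_right:
  assumes "finite K" "x \<in> AP" "\<And>k. k \<in> K \<Longrightarrow> f k \<in> carrier F0"
  shows "V.cl (Bv x (\<Sum>k\<in>K. f k) 1) = V.cl (\<Sum>k\<in>K. Bv x (f k) 1)"
  using assms(1,3)
proof (induction K)
  case empty
  show ?case using cl_Bv_scale_right[OF assms(2) F0.closed(1), of 0]
    by (simp add: complex_vector.scale_zero_left)
next
  case (insert k K)
  have s: "(\<Sum>k\<in>K. f k) \<in> carrier F0"
    using insert by (intro complex_vector.subspace_sum F0.carrier_subspace) auto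
  have "V.cl (Bv x (f k + (\<Sum>k\<in>K. f k)) 1) = V.cl (Bv x (f k) 1 + Bv x (\<Sum>k\<in>K. f k) 1)"
    using insert s assms(2) by (intro cl_Bv_add_right) auto
  also have "\<dots> = V.cl (Bv x (f k) 1 + (\<Sum>k\<in>K. Bv x (f k) 1))"
    using insert by (simp add: V.cl_eq_iff)
  finally show ?case using insert by simp
qed

text \<open>The constants act on the image of the tensor product as they act on the tensor product,
  because the induced module is a tensor product over their enveloping algebra.\<close>

lemma iact_const_itens:
  assumes w: "w \<in> PW"
  shows "V.cl (iact (const_mero x) (itens w)) = V.cl (slot_sum itens {1..n} (\<lambda>k. \<rho> k x) w)"
proof -
  have r: "Poly_Mapping.single [x] 1 \<in> carrier (free_algebra UNIV)" by simp
  have "iact (const_mero x) (itens w) = Bv (1 * const_alg (Poly_Mapping.single [x] 1)) (Poly_Mapping.single w 1) 1"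
    unfolding itens_def by (simp add: iact_Bv one_AP[simplified] const_alg_def scaleC_one)
  then have "V.cl (iact (const_mero x) (itens w)) =
      V.cl (Bv 1 (TR.env_act (Poly_Mapping.single [x] 1) (Poly_Mapping.single w 1)) 1)"
    using Bv_balanced[OF one_AP r single_F0[OF w]] by (simp only: V.cl_eq_iff)
  also have "TR.env_act (Poly_Mapping.single [x] 1) (Poly_Mapping.single w 1) =
      (\<Sum>k\<in>{1..n}. Poly_Mapping.single (w(k := \<rho> k x (w k))) 1)"
    by (simp add: scaleC_one tact_single slot_sum_def)
  also have "V.cl (Bv 1 (\<Sum>k\<in>{1..n}. Poly_Mapping.single (w(k := \<rho> k x (w k))) 1) 1) =
      V.cl (\<Sum>k\<in>{1..n}. Bv 1 (Poly_Mapping.single (w(k := \<rho> k x (w k))) 1) 1)"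
    by (intro cl_Bv_sum_right one_AP single_F0 upd_rho_PW w) auto
  finally show ?thesis by (simp only: slot_sum_def itens_def)
qed

text \<open>The induced module is generated by the image of the tensor product: an induction principle
  for properties of representatives that only depend on the class.\<close>

lemma ind_generated:
  assumes g: "g \<in> carrier F2"
    and cong: "\<And>g h. g \<in> carrier F2 \<Longrightarrow> h \<in> carrier F2 \<Longrightarrow> V.cl g = V.cl h \<Longrightarrow> P g \<Longrightarrow> P h"
    and zero: "P 0"
    and add: "\<And>g h. g \<in> carrier F2 \<Longrightarrow> h \<in> carrier F2 \<Longrightarrow> P g \<Longrightarrow> P h \<Longrightarrow> P (g + h)"
    and scale: "\<And>c g. g \<in> carrier F2 \<Longrightarrow> P g \<Longrightarrow> P (c *\<^sub>C g)"
    and act: "\<And>\<alpha> g. \<alpha> \<in> L \<Longrightarrow> g \<in> carrier F2 \<Longrightarrow> P g \<Longrightarrow> P (iact \<alpha> g)"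
    and tens: "\<And>w. w \<in> PW \<Longrightarrow> P (itens w)"
  shows "P g"
  using g
proof (induction g rule: F2_induct)
  case (single x f)
  note f = single(2)
  have 1: "P (Bv 1 f 1)"
    using f
  proof (induction f rule: F0_induct)
    case zero
    have "V.cl 0 = V.cl (Bv 1 0 1)"
      using cl_Bv_sum_right[of "{}" 1 "\<lambda>_. 0"] one_AP by simp
    then show ?case using cong[OF _ _ _ assms(3)] Bv_F2 one_AP F0.closed(1) F2.closed(1) by blast
  next
    case (add f g)
    show ?case
      by (rule cong[OF _ _ cl_Bv_add_right[OF one_AP add(1,2), symmetric] assms(4)])
        (intro F2.closed Bv_F2 one_AP F0.closed add)+
  next
    case (single c w)
    show ?case
      by (rule cong[OF _ _ cl_Bv_scale_right[OF one_AP single_F0[OF single], symmetric]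
            scale[OF _ tens[OF single, unfolded itens_def]]])
        (intro F2.closed Bv_F2 one_AP F0.closed single_F0 single)+
  qed
  have word: "P (Bv (Poly_Mapping.single ws 1) f 1)" if "set ws \<subseteq> L" for ws
    using that
  proof (induction ws)
    case Nil
    show ?case using 1 by (simp only: one_free_algebra)
  next
    case (Cons \<alpha> ws)
    have ws: "Poly_Mapping.single ws 1 \<in> AP" using Cons by (intro P.single_closed) auto
    have "iact \<alpha> (Bv (Poly_Mapping.single ws 1) f 1) = Bv (Poly_Mapping.single [\<alpha>] 1 * Poly_Mapping.single ws 1) f 1"
      using Cons by (intro iact_Bv ws) auto
    also have "\<dots> = Bv (Poly_Mapping.single (\<alpha> # ws) 1) f 1"
      by (simp add: mult_single plus_list_def)
    finally show ?case
      using act[OF _ Bv_F2[OF ws f] Cons.IH, of \<alpha>] Cons.prems by simp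
  qed
  have "Poly_Mapping.keys x \<subseteq> lists L" using single(1) by simp
  then show ?case
  proof (induction x rule: free_induct)
    case zero
    have "V.cl 0 = V.cl (Bv 0 f 1)"
      using cl_Bv_scale_left[OF one_AP f, of 0] by (simp add: complex_vector.scale_zero_left)
    then show ?case using cong[OF _ _ _ assms(3)] Bv_F2 P.FA.closed(1) f F2.closed(1) by blast
  next
    case (add x y)
    then have xy: "x \<in> AP" "y \<in> AP" by simp_all
    show ?case
      by (rule cong[OF _ _ cl_Bv_add_left[OF xy f, symmetric] assms(4)])
        (intro F2.closed Bv_F2 P.FA.closed xy f add)+
  next
    case (single c ws)
    then have ws: "set ws \<subseteq> L" by auto
    note s = P.single_closed[OF ws, of 1]
    have "P (Bv (c *\<^sub>C Poly_Mapping.single ws 1) f 1)"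
      by (rule cong[OF _ _ cl_Bv_scale_left[OF s f, symmetric] scale[OF _ word[OF ws]]])
        (intro F2.closed Bv_F2 P.FA.closed s f)+
    then show ?case by (simp add: scaleC_single)
  qed
qed (use assms in auto)

text \<open>The universal property of the induced module: a multilinear map to a representation of \<open>L\<close>
  that is equivariant under the constants extends to a homomorphism of representations, given here
  by its values on representatives.\<close>

lemma ind_universal:
  fixes act :: "'g mero \<Rightarrow> 'e::complex_vector \<Rightarrow> 'e"
  assumes "lie_rep_mod L act E {0}"
    and \<Phi>: "multilinear_mod {0} n W \<Phi>" "\<And>w. w \<in> PW \<Longrightarrow> \<Phi> w \<in> E"
    and const: "\<And>x w. w \<in> PW \<Longrightarrow> act (const_mero x) (\<Phi> w) = slot_sum \<Phi> {1..n} (\<lambda>k. \<rho> k x) w"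
  obtains \<Psi> where "\<And>g. g \<in> carrier F2 \<Longrightarrow> \<Psi> g \<in> E" "\<And>r. r \<in> T2 \<Longrightarrow> \<Psi> r = 0"
    "\<And>g h. \<Psi> (g + h) = \<Psi> g + \<Psi> h" "\<And>c g. \<Psi> (c *\<^sub>C g) = c *\<^sub>C \<Psi> g"
    "\<And>\<alpha> g. \<alpha> \<in> L \<Longrightarrow> g \<in> carrier F2 \<Longrightarrow> \<Psi> (iact \<alpha> g) = act \<alpha> (\<Psi> g)"
    "\<And>w. w \<in> PW \<Longrightarrow> \<Psi> (itens w) = \<Phi> w"
proof -
  interpret R: lie_rep_mod L act E "{0}" by fact
  have z: "complex_vector.subspace {0 :: 'e}" by (rule R.S_subspace)
  have \<Phi>E: "lin_ext \<Phi> f \<in> E" if "f \<in> carrier F0" for f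
    using that \<Phi>(2) by (intro lin_ext_in_subspace R.E_subspace) (auto simp: carrier_F0)
  have act0: "act \<alpha> 0 = 0" if "\<alpha> \<in> L" for \<alpha>
    using R.act_S[OF that] by simp
  \<comment> \<open>the class of \<open>x\<close> tensored with that of \<open>f\<close> has to be mapped to the result of the action of
    \<open>x\<close> on the value at \<open>f\<close>; this does not depend on the representatives chosen\<close>
  define \<psi> where "\<psi> = (\<lambda>(u, t). R.env_act (SOME x. x \<in> AP \<and> cP x = u) (lin_ext \<Phi> (SOME f. f \<in> carrier F0 \<and> c0 f = t)))"
  have \<psi>: "\<psi> (cP x, c0 f) = R.env_act x (lin_ext \<Phi> f)" if x: "x \<in> AP" and f: "f \<in> carrier F0" for x f
  proof -
    define y where "y = (SOME y. y \<in> AP \<and> cP y = cP x)"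
    define h where "h = (SOME h. h \<in> carrier F0 \<and> c0 h = c0 f)"
    have y: "y \<in> AP" "cP y = cP x"
      using someI[of "\<lambda>y. y \<in> AP \<and> cP y = cP x" x] x by (auto simp: y_def)
    have h: "h \<in> carrier F0" "c0 h = c0 f"
      using someI[of "\<lambda>h. h \<in> carrier F0 \<and> c0 h = c0 f" f] f by (auto simp: h_def)
    have "lin_ext \<Phi> (h - f) = 0"
      using T0_kills[OF z \<Phi>(1), of "h - f"] h(2) by (simp add: T.cl_eq_iff)
    then have hf: "lin_ext \<Phi> h = lin_ext \<Phi> f" by (simp add: lin_ext_diff)
    have "R.env_act (y - x) (lin_ext \<Phi> f) = 0"
      using R.env_act_ideal[OF _ \<Phi>E[OF f], of "y - x"] y(2) by (simp add: P.U.cl_eq_iff)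
    then have "R.env_act y (lin_ext \<Phi> f) = R.env_act x (lin_ext \<Phi> f)"
      by (simp add: R.env_act_diff_left)
    then show ?thesis unfolding \<psi>_def prod.case y_def[symmetric] h_def[symmetric] hf .
  qed
  have const': "act (const_mero x) (lin_ext \<Phi> f) = lin_ext \<Phi> (tact x f)" if "f \<in> carrier F0" for x f
    using that
  proof (induction f rule: F0_induct)
    case zero
    show ?case by (simp add: act0 tact_def)
  next
    case (add f g)
    then show ?case by (simp add: lin_ext_add R.act_add \<Phi>E TR.act_add)
  next
    case (single c w)
    then show ?case
      by (simp add: lin_ext_scaleC lin_ext_tact R.act_scaleC \<Phi>(2) const scaleC_one)
  qed
  have words: "foldr act (map const_mero xs) (lin_ext \<Phi> f) = lin_ext \<Phi> (foldr tact xs f)"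
    if "f \<in> carrier F0" for xs f
    by (induction xs) (simp_all add: const' TR.word_E that)
  have balanced: "R.env_act (const_alg r) (lin_ext \<Phi> f) = lin_ext \<Phi> (TR.env_act r f)"
    if "f \<in> carrier F0" for r f
  proof -
    have "Poly_Mapping.keys r \<subseteq> UNIV" by simp
    then show ?thesis
      by (induction r rule: free_induct)
        (simp_all add: const_alg_def lin_ext_add lin_ext_scaleC R.env_act_add_left TR.env_act_add_left
          R.env_act_scaleC_left words[OF that] scaleC_one)
  qed
  have kills: "lin_ext \<psi> r = 0" if "r \<in> T2" for r
  proof -
    have k: "Poly_Mapping.keys x \<subseteq> lists L" if "x \<in> AP" for x using that by simp
    have "lin_ext \<psi> r \<in> {0}"
    proof (rule T2_kills[OF z _ _ _ _ _ that])
      fix x y f assume "x \<in> AP" "y \<in> AP" "f \<in> carrier F0"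
      then show "\<psi> (cP (x + y), c0 f) - \<psi> (cP x, c0 f) - \<psi> (cP y, c0 f) \<in> {0}"
        by (simp only: \<psi> P.FA.closed R.env_act_add_left) simp
    next
      fix x f g assume "x \<in> AP" "f \<in> carrier F0" "g \<in> carrier F0"
      then show "\<psi> (cP x, c0 (f + g)) - \<psi> (cP x, c0 f) - \<psi> (cP x, c0 g) \<in> {0}"
        by (simp only: \<psi> F0.closed lin_ext_add R.env_act_add[OF k] \<Phi>E) simp
    next
      fix c x f assume "x \<in> AP" "f \<in> carrier F0"
      then show "\<psi> (cP (c *\<^sub>C x), c0 f) - c *\<^sub>C \<psi> (cP x, c0 f) \<in> {0}"
        by (simp only: \<psi> P.FA.closed R.env_act_scaleC_left) simp
    next
      fix c x f assume "x \<in> AP" "f \<in> carrier F0"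
      then show "\<psi> (cP x, c0 (c *\<^sub>C f)) - c *\<^sub>C \<psi> (cP x, c0 f) \<in> {0}"
        by (simp only: \<psi> F0.closed lin_ext_scaleC R.env_act_scaleC[OF k] \<Phi>E) simp
    next
      fix x r f assume x: "x \<in> AP" and r: "r \<in> carrier (free_algebra (UNIV :: 'g set))" and f: "f \<in> carrier F0"
      have "TR.env_act r f \<in> carrier F0" using f by (intro TR.env_act_E) simp_all
      then show "\<psi> (cP (x * const_alg r), c0 f) - \<psi> (cP x, c0 (TR.env_act r f)) \<in> {0}"
        using x f by (simp only: \<psi> P.mult_closed const_alg_AP R.env_act_mult[OF k k] \<Phi>E balanced) simp
    qed
    then show ?thesis by simp
  qed
  show thesis
  proof (rule that[of "lin_ext \<psi>"])
    show "lin_ext \<psi> g \<in> E" if "g \<in> carrier F2" for g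
      by (rule F2_linear_mod[OF R.E_subspace lin_ext_add lin_ext_scaleC _ that])
        (simp add: \<psi> scaleC_one R.env_act_E \<Phi>E)
    show "lin_ext \<psi> (iact \<alpha> g) = act \<alpha> (lin_ext \<psi> g)" if \<alpha>: "\<alpha> \<in> L" and g: "g \<in> carrier F2" for \<alpha> g
      using g
    proof (induction g rule: F2_induct)
      case zero
      show ?case by (simp add: act0[OF \<alpha>] iact_def)
    next
      case (add g h)
      then show ?case
        using \<open>\<And>g. g \<in> carrier F2 \<Longrightarrow> lin_ext \<psi> g \<in> E\<close> by (simp add: iact_add lin_ext_add R.act_add[OF \<alpha>])
    next
      case (scale c g)
      then show ?case
        using \<open>\<And>g. g \<in> carrier F2 \<Longrightarrow> lin_ext \<psi> g \<in> E\<close> by (simp add: iact_scaleC lin_ext_scaleC R.act_scaleC[OF \<alpha>])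
    next
      case (single x f)
      have "lin_ext \<psi> (iact \<alpha> (Bv x f 1)) = R.env_act (Poly_Mapping.single [\<alpha>] 1 * x) (lin_ext \<Phi> f)"
        using P.mult_closed[OF single_AP[OF \<alpha>] single(1)] single
        by (simp only: iact_Bv[OF \<alpha>] lin_ext_single scaleC_one \<psi>)
      also have "\<dots> = act \<alpha> (R.env_act x (lin_ext \<Phi> f))"
        using single \<alpha> by (subst R.env_act_mult) (simp_all add: \<Phi>E scaleC_one)
      finally show ?case using single by (simp add: \<psi> scaleC_one)
    qed
    show "lin_ext \<psi> (itens w) = \<Phi> w" if "w \<in> PW" for w
      unfolding itens_def lin_ext_single scaleC_one \<psi>[OF one_AP single_F0[OF that]]
      by (simp add: one_free_algebra scaleC_one del: single_one)
  qed (simp_all add: kills lin_ext_add lin_ext_scaleC)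
qed

end

section \<open>Partial fractions\<close>

text \<open>The meromorphic function on the projective line that is \<open>1 / t\<close> in the coordinate \<open>t\<close>
  centred at \<open>p\<close>. It is an isomorphism from the complement of \<open>p\<close> to the complex plane; its value
  at \<open>p\<close> is irrelevant.\<close>

fun coord :: "complex option \<Rightarrow> complex option \<Rightarrow> complex" where
  "coord (Some a) (Some z) = 1 / (z - a)"
| "coord (Some a) None = 0"
| "coord None (Some z) = z"
| "coord None None = 0"

lemma coord_chart_self: "coord p (chart p t) = 1 / t"
  by (cases p) auto

lemma coord_analytic:
  assumes "q \<noteq> p"
  shows "(\<lambda>t. coord p (chart q t)) analytic_on {0}"
proof (cases p)
  case None
  then obtain b where "q = Some b" using assms by (cases q) auto
  then show ?thesis using None by (auto intro!: analytic_intros)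
next
  case (Some a)
  show ?thesis
  proof (cases q)
    case None
    have eq: "coord p (chart q t) = t / (1 - a * t)" if "1 - a * t \<noteq> 0" for t
      using that None Some by (auto simp: divide_simps)
    have "(\<lambda>t. t / (1 - a * t)) analytic_on {0}"
      by (auto intro!: analytic_intros)
    moreover have "\<forall>\<^sub>F t in nhds 0. coord p (chart q t) = t / (1 - a * t)"
    proof -
      have "open {t. 1 - a * t \<noteq> 0}" by (intro open_Collect_neq continuous_intros)
      then have "\<forall>\<^sub>F t in nhds 0. t \<in> {t. 1 - a * t \<noteq> 0}" by (rule eventually_nhds_in_open) simp
      then show ?thesis by (rule eventually_mono) (use eq in simp)
    qed
    ultimately show ?thesis by (subst analytic_at_cong) auto
  next
    case (Some b)
    then show ?thesis using \<open>p = Some a\<close> assms by (auto intro!: analytic_intros)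
  qed
qed

lemma coord_meromorphic: "(\<lambda>t. coord p (chart q t)) meromorphic_on {0}"
proof (cases "q = p")
  case True
  then show ?thesis by (simp add: coord_chart_self) (intro meromorphic_intros)
qed (intro analytic_on_imp_meromorphic_on coord_analytic)

text \<open>The map with the value \<open>coord p q ^ k *\<^sub>C x\<close> at every \<open>q\<close> other than \<open>p\<close>, its only
  possible pole.\<close>

lift_definition pole_map :: "complex option \<Rightarrow> nat \<Rightarrow> 'g::complex_vector \<Rightarrow> 'g mero"
  is "\<lambda>p k x q. coord p q ^ k *\<^sub>C x"
  by (simp add: mero_eq_def meromorphic_map_def comp_def)
    (intro allI meromorphic_at_0_single meromorphic_on_power coord_meromorphic)

lemma has_value_at_pole_map:
  assumes "q \<noteq> p"
  shows "has_value_at (pole_map p k x) q (coord p q ^ k *\<^sub>C x)"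
proof (transfer fixing: p q k x)
  have "(\<lambda>q. coord p q ^ k *\<^sub>C x)(q := coord p q ^ k *\<^sub>C x) = (\<lambda>q. coord p q ^ k *\<^sub>C x)" by auto
  moreover have "holomorphic_at_0 (\<lambda>t. coord p (chart q t) ^ k *\<^sub>C x)"
    by (intro holomorphic_at_0_single analytic_on_power coord_analytic assms)
  ultimately show "holomorphic_at_0 ((\<lambda>q. coord p q ^ k *\<^sub>C x)(q := coord p q ^ k *\<^sub>C x) \<circ> chart q)"
    by (simp add: comp_def)
qed

lemma mero_value_pole_map: "q \<noteq> p \<Longrightarrow> mero_value (pole_map p k x) q = coord p q ^ k *\<^sub>C x"
  by (intro mero_value_eq has_value_at_pole_map)

lemma pole_map_in_regular_on: "p \<notin> S \<Longrightarrow> pole_map p k x \<in> regular_on S"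
  unfolding regular_on_def regular_at_def
proof (intro CollectI ballI exI)
  show "has_value_at (pole_map p k x) q (coord p q ^ k *\<^sub>C x)" if "p \<notin> S" "q \<in> S" for q
    by (rule has_value_at_pole_map) (use that in auto)
qed

text \<open>A meromorphic map has the value \<open>v\<close> at \<open>p\<close> if a representing function becomes holomorphic at
  \<open>p\<close> when it is redefined to be \<open>v\<close> there.\<close>

lemma mero_cases:
  fixes \<nu> :: "'g::complex_vector mero"
  obtains f where "meromorphic_map f" "\<nu> = abs_mero f"
    "\<And>p v. has_value_at \<nu> p v \<longleftrightarrow> holomorphic_at_0 (f(p := v) \<circ> chart p)"
proof -
  have "\<exists>f. mero_eq f f \<and> \<nu> = abs_mero f"
    by (rule mero.abs_induct[of _ \<nu>]) auto
  then obtain f where f: "mero_eq f f" "\<nu> = abs_mero f" by blast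
  show ?thesis
    by (rule that[of f]) (use f has_value_at.abs_eq[OF f(1)] in \<open>auto simp: mero_eq_def\<close>)
qed

text \<open>The coordinate centred at \<open>p\<close> is a holomorphic function of the coordinate centred at a
  nearby point.\<close>

lemma chart_transition:
  assumes "t0 \<noteq> 0"
  obtains \<tau> where "\<tau> analytic_on {0}" "\<tau> 0 = t0"
    "\<forall>\<^sub>F s in nhds 0. chart (chart p t0) s = chart p (\<tau> s)"
proof (cases p)
  case None
  show ?thesis
  proof (rule that[of "\<lambda>s. 1 / (1 / t0 + s)"])
    show "(\<lambda>s. 1 / (1 / t0 + s)) analytic_on {0}" using assms by (auto intro!: analytic_intros)
    have "open {s. 1 / t0 + s \<noteq> 0}" by (intro open_Collect_neq continuous_intros)
    then have "\<forall>\<^sub>F s in nhds 0. s \<in> {s. 1 / t0 + s \<noteq> 0}"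
      by (rule eventually_nhds_in_open) (use assms in simp)
    then show "\<forall>\<^sub>F s in nhds 0. chart (chart p t0) s = chart p (1 / (1 / t0 + s))"
      by (rule eventually_mono) (use assms None in auto)
  qed simp
next
  case (Some a)
  show ?thesis
    by (rule that[of "\<lambda>s. t0 + s"]) (use Some in \<open>auto intro!: analytic_intros\<close>)
qed

text \<open>The projective line is compact: a set without accumulation points is finite.\<close>

lemma finite_of_chart_discrete:
  assumes "\<And>p. \<forall>\<^sub>F t in at 0. chart p t \<notin> S"
  shows "finite S"
proof -
  define Z where "Z = {z. Some z \<in> S}"
  obtain r where r: "r > 0" "\<And>t. t \<noteq> 0 \<Longrightarrow> dist t 0 < r \<Longrightarrow> chart None t \<notin> S"
    using assms[of None] unfolding eventually_at by auto
  have "z \<in> cball 0 (1 / r)" if "z \<in> Z" for z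
  proof (rule ccontr)
    assume "z \<notin> cball 0 (1 / r)"
    then have z: "1 / r < norm z" by simp
    then have "norm z > 0" using r(1) by (meson less_trans zero_less_divide_1_iff)
    then have "dist (1 / z) 0 < r" using z r(1) by (simp add: norm_divide field_simps)
    then have "chart None (1 / z) \<notin> S" using r(2)[of "1 / z"] \<open>norm z > 0\<close> by auto
    then show False using that \<open>norm z > 0\<close> by (simp add: Z_def)
  qed
  then have "Z = cball 0 (1 / r) \<inter> Z" by auto
  moreover have "finite (cball 0 (1 / r) \<inter> Z)"
  proof (rule finite_not_islimpt_in_compact)
    fix z :: complex assume "z \<in> cball 0 (1 / r)"
    have "\<forall>\<^sub>F w in at z. w \<notin> Z"
      using assms[of "Some z"] unfolding at_to_0[of z] eventually_filtermap
      by (simp add: Z_def add.commute)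
    then show "\<not> z islimpt Z" by (simp add: islimpt_iff_eventually)
  qed simp
  ultimately have "finite Z" by simp
  moreover have "S \<subseteq> insert None (Some ` Z)"
  proof
    fix p assume "p \<in> S" then show "p \<in> insert None (Some ` Z)" by (cases p) (auto simp: Z_def)
  qed
  ultimately show ?thesis by (meson finite_imageI finite_insert finite_subset)
qed

lemma meromorphic_map_singularities_finite:
  fixes f :: "complex option \<Rightarrow> 'g::complex_vector"
  assumes "meromorphic_map f"
  shows "finite {p. \<not> holomorphic_at_0 (f \<circ> chart p)}"
proof (rule finite_of_chart_discrete)
  fix p
  obtain n h x where h: "\<forall>i<n::nat. h i meromorphic_on {0}"
    and f: "\<forall>\<^sub>F t in at 0. (f \<circ> chart p) t = (\<Sum>i<n. h i t *\<^sub>C x i)"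
    using assms unfolding meromorphic_map_def meromorphic_at_0_def by blast
  have "\<forall>\<^sub>F t in at 0. h i analytic_on {t}" if "i < n" for i
  proof -
    have "isolated_singularity_at (h i) 0"
      using h that by (intro meromorphic_on_isolated_singularity) simp
    then obtain r where r: "r > 0" "h i analytic_on ball 0 r - {0}"
      unfolding isolated_singularity_at_def by (elim exE conjE)
    then have "\<forall>\<^sub>F t in at 0. t \<in> ball 0 r - {0}"
      by (intro eventually_at_in_open) auto
    then show ?thesis by (rule eventually_mono) (rule analytic_on_subset[OF r(2)], simp)
  qed
  then have "\<forall>\<^sub>F t in at 0. \<forall>i\<in>{..<n}. h i analytic_on {t}"
    by (intro eventually_ball_finite) auto
  then have "\<forall>\<^sub>F t in at 0. (f \<circ> chart p) t = (\<Sum>i<n. h i t *\<^sub>C x i) \<and> (\<forall>i\<in>{..<n}. h i analytic_on {t})"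
    using f by (rule eventually_conj[rotated])
  then obtain U where U: "open U" "0 \<in> U"
    and fU: "\<And>t. t \<in> U \<Longrightarrow> t \<noteq> 0 \<Longrightarrow> f (chart p t) = (\<Sum>i<n. h i t *\<^sub>C x i)"
    and hU: "\<And>t i. t \<in> U \<Longrightarrow> t \<noteq> 0 \<Longrightarrow> i < n \<Longrightarrow> h i analytic_on {t}"
    unfolding eventually_at_topological by auto
  have "\<forall>\<^sub>F t in at 0. t \<in> U - {0}" using U by (intro eventually_at_in_open) auto
  then show "\<forall>\<^sub>F t in at 0. chart p t \<notin> {p. \<not> holomorphic_at_0 (f \<circ> chart p)}"
  proof (rule eventually_mono)
    fix t0 assume t0: "t0 \<in> U - {0}"
    then obtain \<tau> where \<tau>: "\<tau> analytic_on {0}" "\<tau> 0 = t0"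
        "\<forall>\<^sub>F s in nhds 0. chart (chart p t0) s = chart p (\<tau> s)"
      using chart_transition[of t0 p] by auto
    have "isCont \<tau> 0" using \<tau>(1) by (rule analytic_at_imp_isCont)
    then have "(\<tau> \<longlongrightarrow> \<tau> 0) (nhds 0)"
      by (simp only: isCont_def tendsto_at_iff_tendsto_nhds)
    then have "(\<tau> \<longlongrightarrow> t0) (nhds 0)" using \<tau>(2) by simp
    then have "\<forall>\<^sub>F s in nhds 0. \<tau> s \<in> U - {0}"
      using t0 U(1) by (intro topological_tendstoD) auto
    with \<tau>(3) have "\<forall>\<^sub>F s in nhds 0. (f \<circ> chart (chart p t0)) s = (\<Sum>i<n. (h i \<circ> \<tau>) s *\<^sub>C x i)"
      by eventually_elim (simp add: fU)
    moreover have "h i \<circ> \<tau> analytic_on {0}" if "i < n" for i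
      using \<tau>(1) by (rule analytic_on_compose) (use \<tau>(2) hU[of t0 i] t0 that in auto)
    ultimately have "holomorphic_at_0 (f \<circ> chart (chart p t0))"
      unfolding holomorphic_at_0_def
      by (intro exI[of _ n] exI[of _ "\<lambda>i. h i \<circ> \<tau>"] exI[of _ x] conjI allI impI)
    then show "chart p t0 \<notin> {p. \<not> holomorphic_at_0 (f \<circ> chart p)}" by simp
  qed
qed

lemma finite_poles: "finite {p. \<not> regular_at \<nu> p}"
proof -
  obtain f where f: "meromorphic_map f"
    "\<And>p v. has_value_at \<nu> p v \<longleftrightarrow> holomorphic_at_0 (f(p := v) \<circ> chart p)"
    using mero_cases by metis
  have "{p. \<not> regular_at \<nu> p} \<subseteq> {p. \<not> holomorphic_at_0 (f \<circ> chart p)}"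
    using f(2) unfolding regular_at_def by (metis (mono_tags, lifting) Collect_mono fun_upd_triv)
  then show ?thesis
    using meromorphic_map_singularities_finite[OF f(1)] finite_subset by blast
qed

text \<open>Liouville's theorem, applied to all linear functionals.\<close>

lemma regular_everywhere_const:
  fixes \<nu> :: "'g::complex_vector mero"
  assumes "\<nu> \<in> regular_on UNIV"
  obtains x where "\<nu> = const_mero x"
proof -
  obtain f where f: "meromorphic_map f" "\<nu> = abs_mero f"
    and hv: "\<And>p v. has_value_at \<nu> p v \<longleftrightarrow> holomorphic_at_0 (f(p := v) \<circ> chart p)"
    using mero_cases by metis
  define F where "F = mero_value \<nu>"
  have F: "has_value_at \<nu> p (F p)" for p
    using regular_on_has_value_at[OF assms] by (simp add: F_def)
  have "F p = f p" if "holomorphic_at_0 (f \<circ> chart p)" for p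
    using has_value_at_unique[OF F, of p "f p"] that by (simp add: hv)
  then have "{p. f p \<noteq> F p} \<subseteq> {p. \<not> holomorphic_at_0 (f \<circ> chart p)}" by auto
  then have fin: "finite {p. f p \<noteq> F p}"
    using meromorphic_map_singularities_finite[OF f(1)] finite_subset by blast
  have hol: "holomorphic_at_0 (F \<circ> chart p)" for p
  proof (rule holomorphic_at_0_cong)
    show "holomorphic_at_0 (f(p := F p) \<circ> chart p)" using F hv by blast
    have "\<forall>\<^sub>F t in at 0. F (chart p t) = f (chart p t)"
      by (rule eventually_mono[OF eventually_chart_notin[OF fin, of p]]) auto
    then show "\<forall>\<^sub>F t in nhds 0. (F \<circ> chart p) t = (f(p := F p) \<circ> chart p) t"
      unfolding eventually_at_filter by (rule eventually_mono) auto
  qed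
  have const: "F p = F None" for p
  proof (rule linear_functional_separates)
    fix \<phi> :: "'g \<Rightarrow> complex" assume \<phi>: "Vector_Spaces.linear scaleC (*) \<phi>"
    define g where "g z = \<phi> (F (Some z))" for z
    have an: "(\<lambda>t. \<phi> ((F \<circ> chart q) t)) analytic_on {0}" for q
      by (rule holomorphic_at_0_functional[OF hol \<phi>])
    have "g analytic_on {a}" for a
    proof -
      have "(\<lambda>t. g (a + t)) \<circ> (\<lambda>z. z - a) analytic_on {a}"
        by (rule analytic_on_compose) (use an[of "Some a"] in \<open>auto intro!: analytic_intros simp: g_def comp_def\<close>)
      then show ?thesis by (simp add: comp_def)
    qed
    then have "g holomorphic_on UNIV"
      by (intro analytic_imp_holomorphic) (simp add: analytic_on_analytic_at[of g UNIV])
    moreover have "(g \<longlongrightarrow> \<phi> (F None)) at_infinity"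
    proof -
      have "isCont (\<lambda>t. \<phi> ((F \<circ> chart None) t)) 0"
        using an[of None] by (rule analytic_at_imp_isCont)
      then have "((\<lambda>t. \<phi> ((F \<circ> chart None) t)) \<longlongrightarrow> \<phi> (F None)) (at 0)" by (simp add: isCont_def)
      then have "((g \<circ> inverse) \<longlongrightarrow> \<phi> (F None)) (at 0)"
        by (rule Lim_transform_eventually)
          (auto simp: eventually_at_filter g_def divide_inverse)
      then show ?thesis by (simp add: lim_at_infinity_0)
    qed
    ultimately have "g z = \<phi> (F None)" for z by (rule Liouville_weak)
    then show "\<phi> (F p) = \<phi> (F None)" by (cases p) (auto simp: g_def)
  qed
  have "mero_eq f (\<lambda>_. F None)"
  proof -
    have "{p. f p \<noteq> F None} = {p. f p \<noteq> F p}" using const by metis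
    then show ?thesis using f(1) fin meromorphic_map_const[of "F None"] by (simp add: mero_eq_def)
  qed
  moreover have "mero_eq (\<lambda>_. F None) (\<lambda>_. F None)" by (rule mero_eq_refl_const)
  ultimately have "\<nu> = abs_mero (\<lambda>_. F None)"
    unfolding f(2) using Quotient_rel[OF Quotient_mero] f(1) by (metis mero_eq_def)
  then show ?thesis using that by (simp add: const_mero_def)
qed

lemma principal_part_power:
  assumes "g analytic_on {0}"
  shows "\<exists>a g'. g' analytic_on {0} \<and>
    (\<forall>\<^sub>F t in at 0. g t / t ^ N = g' t + (\<Sum>k\<in>{1..N}. a k * (1 / t) ^ k :: complex))"
  using assms
proof (induction N arbitrary: g)
  case 0
  then show ?case by (intro exI[of _ "\<lambda>_. 0"] exI[of _ g]) auto
next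
  case (Suc N)
  \<comment> \<open>the difference quotient of \<open>g\<close> at \<open>0\<close>, extended holomorphically\<close>
  define g1 where "g1 t = (if t = 0 then deriv g 0 else (g t - g 0) / t)" for t
  have "(\<lambda>t. if t = 0 then deriv g 0 else g t / t - g 0 / (t - 0)) analytic_on {0}"
    by (rule pole_theorem_analytic[OF Suc.prems]) (auto intro!: exI[of _ 1])
  moreover have "(\<lambda>t. if t = 0 then deriv g 0 else g t / t - g 0 / (t - 0)) = g1"
    by (auto simp: g1_def diff_divide_distrib)
  ultimately have "g1 analytic_on {0}" by simp
  then obtain a g' where g': "g' analytic_on {0}"
      and ev: "\<forall>\<^sub>F t in at 0. g1 t / t ^ N = g' t + (\<Sum>k\<in>{1..N}. a k * (1 / t) ^ k)"
    using Suc.IH by blast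
  have "\<forall>\<^sub>F t in at 0. g t / t ^ Suc N = g' t + (\<Sum>k\<in>{1..Suc N}. (a(Suc N := g 0)) k * (1 / t) ^ k)"
    using ev eventually_neq_at_within[of 0 0 UNIV]
  proof eventually_elim
    case (elim t)
    have "g t = t * g1 t + g 0" using elim by (simp add: g1_def)
    then have "g t / t ^ Suc N = g1 t / t ^ N + g 0 * (1 / t) ^ Suc N"
      using elim(2) by (simp add: field_simps)
    moreover have "(\<Sum>k\<in>{1..N}. (a(Suc N := g 0)) k * (1 / t) ^ k) = (\<Sum>k\<in>{1..N}. a k * (1 / t) ^ k)"
      by (intro sum.cong) auto
    ultimately show ?case using elim(1) by simp
  qed
  then show ?case using g' by blast
qed

text \<open>All large \<open>N\<close> are admitted, in order that one \<open>N\<close> serves for the finitely many component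
  functions of a map with values in a vector space.\<close>

lemma principal_part:
  assumes "h meromorphic_on {0}"
  shows "\<exists>N0. \<forall>N\<ge>N0. \<exists>a g. g analytic_on {0} \<and>
    (\<forall>\<^sub>F t in at 0. h t = g t + (\<Sum>k\<in>{1..N}. a k * (1 / t) ^ k :: complex))"
proof -
  have "\<exists>N0 g. g analytic_on {0} \<and> (\<forall>\<^sub>F t in at 0. h t = g t / t ^ N0)"
  proof (cases "\<exists>\<^sub>F t in at 0. h t \<noteq> 0")
    case True
    define n where "n = zorder h 0"
    define g where "g = zor_poly h 0"
    obtain r where r: "r > 0" "g holomorphic_on cball 0 r" "\<forall>w\<in>cball 0 r - {0}. h w = g w * w powi n"
      using zorder_exist[OF meromorphic_on_isolated_singularity[OF assms]
          meromorphic_on_not_essential[OF assms] True] by (auto simp: n_def g_def)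
    \<comment> \<open>the order of the pole, or \<open>0\<close> if \<open>h\<close> has none\<close>
    define m where "m = nat (- n)"
    define g2 where "g2 w = g w * w ^ nat (n + int m)" for w
    have "g holomorphic_on ball 0 r" using r(2) by (rule holomorphic_on_subset) auto
    then have "g analytic_on {0}" using r(1) by (auto simp: analytic_at_ball)
    then have "g2 analytic_on {0}" unfolding g2_def by (intro analytic_intros)
    moreover have "\<forall>\<^sub>F t in at 0. t \<in> ball 0 r - {0}"
      using r(1) by (intro eventually_at_in_open) auto
    then have "\<forall>\<^sub>F t in at 0. h t = g2 t / t ^ m"
    proof (rule eventually_mono)
      fix t :: complex assume t: "t \<in> ball 0 r - {0}"
      have "t powi n = t powi (n + int m) / t ^ m"
        using t by (simp add: power_int_add)
      also have "t powi (n + int m) = t ^ nat (n + int m)"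
        by (simp add: power_int_def m_def)
      finally show "h t = g2 t / t ^ m" using r(3) t by (simp add: g2_def)
    qed
    ultimately show ?thesis by blast
  next
    case False
    then show ?thesis
      by (intro exI[of _ 0] exI[of _ "\<lambda>_. 0"]) (auto simp: frequently_def)
  qed
  then obtain N0 g where g: "g analytic_on {0}" "\<forall>\<^sub>F t in at 0. h t = g t / t ^ N0" by blast
  show ?thesis
  proof (intro exI[of _ N0] allI impI)
    fix N assume N: "N \<ge> N0"
    have "(\<lambda>t. g t * t ^ (N - N0)) analytic_on {0}" by (intro analytic_intros g)
    from principal_part_power[OF this, of N] obtain a g' where g': "g' analytic_on {0}"
      and ev: "\<forall>\<^sub>F t in at 0. g t * t ^ (N - N0) / t ^ N = g' t + (\<Sum>k\<in>{1..N}. a k * (1 / t) ^ k)"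
      by blast
    have "\<forall>\<^sub>F t in at 0. h t = g' t + (\<Sum>k\<in>{1..N}. a k * (1 / t) ^ k)"
      using ev g(2) eventually_neq_at_within[of 0 0 UNIV]
    proof eventually_elim
      case (elim t)
      have "g t / t ^ N0 = g t * t ^ (N - N0) / t ^ N"
        using elim(3) N by (simp add: field_simps flip: power_add)
      then show ?case using elim by simp
    qed
    then show "\<exists>a g. g analytic_on {0} \<and> (\<forall>\<^sub>F t in at 0. h t = g t + (\<Sum>k\<in>{1..N}. a k * (1 / t) ^ k))"
      using g' by blast
  qed
qed

lemma meromorphic_at_0_principal_part:
  assumes "meromorphic_at_0 f"
  obtains N X G where "holomorphic_at_0 G"
    "\<forall>\<^sub>F t in at 0. f t = G t + (\<Sum>k\<in>{1..N}. (1 / t) ^ k *\<^sub>C X k)"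
proof -
  obtain n h x where h: "\<forall>i<n::nat. h i meromorphic_on {0}"
    and f: "\<forall>\<^sub>F t in at 0. f t = (\<Sum>i<n. h i t *\<^sub>C x i)"
    using assms unfolding meromorphic_at_0_def by blast
  define P where "P i N a g \<longleftrightarrow> g analytic_on {0} \<and>
    (\<forall>\<^sub>F t in at 0. h i t = g t + (\<Sum>k\<in>{1..N}. a k * (1 / t) ^ k))" for i N a g
  have "\<exists>N0. i < n \<longrightarrow> (\<forall>N\<ge>N0. \<exists>a g. P i N a g)" for i
  proof (cases "i < n")
    case True
    then have "h i meromorphic_on {0}" using h by blast
    from principal_part[OF this] show ?thesis by (simp add: P_def True)
  qed blast
  then obtain M where M: "\<And>i N. i < n \<Longrightarrow> N \<ge> M i \<Longrightarrow> \<exists>a g. P i N a g"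
    by metis
  define N where "N = (\<Sum>i<n. M i)"
  have "N \<ge> M i" if "i < n" for i
    unfolding N_def using that by (intro member_le_sum) auto
  then have "\<forall>i. \<exists>ag. i < n \<longrightarrow> P i N (fst ag) (snd ag)"
    using M by (metis fst_conv snd_conv)
  then obtain ag where ag: "\<And>i. i < n \<Longrightarrow> P i N (fst (ag i)) (snd (ag i))"
    by metis
  define a where "a i = fst (ag i)" for i
  define g where "g i = snd (ag i)" for i
  have g: "g i analytic_on {0}"
    and ev: "\<forall>\<^sub>F t in at 0. h i t = g i t + (\<Sum>k\<in>{1..N}. a i k * (1 / t) ^ k)" if "i < n" for i
    using ag[OF that] by (simp_all add: P_def a_def g_def)
  have "\<forall>\<^sub>F t in at 0. \<forall>i\<in>{..<n}. h i t = g i t + (\<Sum>k\<in>{1..N}. a i k * (1 / t) ^ k)"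
    using ev by (intro eventually_ball_finite) auto
  with f have "\<forall>\<^sub>F t in at 0. f t = (\<Sum>i<n. g i t *\<^sub>C x i)
      + (\<Sum>k\<in>{1..N}. (1 / t) ^ k *\<^sub>C (\<Sum>i<n. a i k *\<^sub>C x i))"
  proof eventually_elim
    case (elim t)
    have "f t = (\<Sum>i<n. g i t *\<^sub>C x i) + (\<Sum>i<n. \<Sum>k\<in>{1..N}. (a i k * (1 / t) ^ k) *\<^sub>C x i)"
      unfolding elim(1) sum.distrib[symmetric]
      by (intro sum.cong) (use elim(2) in \<open>simp_all add: scaleC_add_left complex_vector.scale_sum_left\<close>)
    also have "(\<Sum>i<n. \<Sum>k\<in>{1..N}. (a i k * (1 / t) ^ k) *\<^sub>C x i) =
        (\<Sum>k\<in>{1..N}. \<Sum>i<n. (a i k * (1 / t) ^ k) *\<^sub>C x i)"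
      by (rule sum.swap)
    also have "\<dots> = (\<Sum>k\<in>{1..N}. (1 / t) ^ k *\<^sub>C (\<Sum>i<n. a i k *\<^sub>C x i))"
      by (simp add: complex_vector.scale_sum_right scaleC_scaleC mult.commute)
    finally show ?case .
  qed
  moreover have "holomorphic_at_0 (\<lambda>t. \<Sum>i<n. g i t *\<^sub>C x i)"
    by (intro holomorphic_at_0_sum holomorphic_at_0_single g) auto
  ultimately show ?thesis by (rule that[rotated])
qed

lemma mero_sum_pole_map:
  "(\<Sum>k\<in>{1..N}. pole_map p k (X k)) = abs_mero (\<lambda>q. \<Sum>k\<in>{1..N}. coord p q ^ k *\<^sub>C X k) \<and>
    meromorphic_map (\<lambda>q. \<Sum>k\<in>{1..N}. coord p q ^ k *\<^sub>C X k)" for N :: nat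
proof (induction N)
  case 0
  show ?case using meromorphic_map_const[of 0] by (simp add: zero_mero_def)
next
  case (Suc N)
  have m: "mero_eq (\<lambda>q. coord p q ^ k *\<^sub>C x) (\<lambda>q. coord p q ^ k *\<^sub>C x)" for k and x :: 'a
    by (simp add: mero_eq_def meromorphic_map_def comp_def)
      (intro allI meromorphic_at_0_single meromorphic_on_power coord_meromorphic)
  have s: "mero_eq (\<lambda>q. \<Sum>k\<in>{1..N}. coord p q ^ k *\<^sub>C X k) (\<lambda>q. \<Sum>k\<in>{1..N}. coord p q ^ k *\<^sub>C X k)"
    using Suc by (simp add: mero_eq_def)
  show ?case
    using Suc plus_mero.abs_eq[OF s m] mero_eq_add[OF s m] by (simp add: pole_map.abs_eq mero_eq_def del: power_Suc)
qed

lemma subtract_principal_part: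
  fixes \<nu> :: "'g::complex_vector mero"
  obtains N :: nat and X where "regular_at (\<nu> - (\<Sum>k\<in>{1..N}. pole_map p k (X k))) p"
proof -
  obtain f where f: "meromorphic_map f" "\<nu> = abs_mero f" using mero_cases by metis
  then have "meromorphic_at_0 (f \<circ> chart p)" by (simp add: meromorphic_map_def)
  then obtain N X G where G: "holomorphic_at_0 G"
    and ev: "\<forall>\<^sub>F t in at 0. (f \<circ> chart p) t = G t + (\<Sum>k\<in>{1..N}. (1 / t) ^ k *\<^sub>C X k)"
    by (rule meromorphic_at_0_principal_part)
  define S where "S = (\<lambda>q. \<Sum>k\<in>{1..N}. coord p q ^ k *\<^sub>C X k)"
  have S: "(\<Sum>k\<in>{1..N}. pole_map p k (X k)) = abs_mero S" "mero_eq S S"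
    using mero_sum_pole_map[of p X N] by (simp_all add: S_def mero_eq_def)
  have ff: "mero_eq f f" using f by (simp add: mero_eq_def)
  have eq: "\<nu> - (\<Sum>k\<in>{1..N}. pole_map p k (X k)) = abs_mero (\<lambda>q. f q + - S q)"
    unfolding f(2) S(1) minus_mero_def
    by (simp add: uminus_mero.abs_eq[OF S(2)] plus_mero.abs_eq[OF ff mero_eq_uminus[OF S(2)]])
  have d: "mero_eq (\<lambda>q. f q + - S q) (\<lambda>q. f q + - S q)"
    by (intro mero_eq_add ff mero_eq_uminus S)
  have "holomorphic_at_0 ((\<lambda>q. f q + - S q)(p := G 0) \<circ> chart p)"
  proof (rule holomorphic_at_0_cong[OF G])
    have "\<forall>\<^sub>F t in at 0. ((\<lambda>q. f q + - S q)(p := G 0) \<circ> chart p) t = G t"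
      using ev eventually_chart_notin[of "{p}" p, simplified]
      by eventually_elim (simp add: S_def coord_chart_self)
    then show "\<forall>\<^sub>F t in nhds 0. ((\<lambda>q. f q + - S q)(p := G 0) \<circ> chart p) t = G t"
      unfolding eventually_at_filter by (rule eventually_mono) auto
  qed
  then have "regular_at (\<nu> - (\<Sum>k\<in>{1..N}. pole_map p k (X k))) p"
    unfolding eq regular_at_def has_value_at.abs_eq[OF d] by blast
  then show ?thesis by (rule that)
qed

lemma regular_at_diff: "regular_at \<mu> p \<Longrightarrow> regular_at \<nu> p \<Longrightarrow> regular_at (\<mu> - \<nu>) p"
  using complex_vector.subspace_diff[OF subspace_regular_on, of \<mu> "{p}" \<nu>]
  by (simp add: regular_on_def)

text \<open>The terms of partial fractions: the constants, and the multiples of the powers of the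
  functions \<open>coord p\<close> for \<open>p\<close> outside \<open>S\<close>. They span the maps that are regular on \<open>S\<close>
  (\<open>regular_on_eq_span\<close>).\<close>

definition fractions :: "complex option set \<Rightarrow> 'g::complex_vector mero set" where
  "fractions S = range const_mero \<union> {pole_map p k x | p k x. p \<notin> S \<and> k \<ge> 1}"

lemma pole_map_in_fractions: "p \<notin> S \<Longrightarrow> k \<ge> 1 \<Longrightarrow> pole_map p k x \<in> fractions S"
  unfolding fractions_def by blast

lemma const_in_fractions: "const_mero x \<in> fractions S"
  unfolding fractions_def by blast

text \<open>The poles are removed one after the other by subtracting principal parts; a map without
  poles is constant.\<close>

lemma partial_fractions:
  fixes \<nu> :: "'g::complex_vector mero"
  assumes "finite A" "{p. \<not> regular_at \<nu> p} \<subseteq> A" "A \<inter> S = {}"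
  shows "\<nu> \<in> complex_vector.span (fractions S)"
  using assms
proof (induction A arbitrary: \<nu>)
  case empty
  then have "\<nu> \<in> regular_on UNIV" by (auto simp: regular_on_def)
  then obtain x where "\<nu> = const_mero x" by (rule regular_everywhere_const)
  then show ?case by (simp add: complex_vector.span_base const_in_fractions)
next
  case (insert p A)
  obtain N :: nat and X where reg: "regular_at (\<nu> - (\<Sum>k\<in>{1..N}. pole_map p k (X k))) p"
    by (rule subtract_principal_part)
  let ?\<sigma> = "\<Sum>k\<in>{1..N}. pole_map p k (X k)"
  have "?\<sigma> \<in> regular_on (- {p})"
    by (intro complex_vector.subspace_sum[OF subspace_regular_on] pole_map_in_regular_on) auto
  then have \<sigma>: "regular_at ?\<sigma> q" if "q \<noteq> p" for q
    using that by (simp add: regular_on_def)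
  have "{q. \<not> regular_at (\<nu> - ?\<sigma>) q} \<subseteq> A"
  proof
    fix q assume "q \<in> {q. \<not> regular_at (\<nu> - ?\<sigma>) q}"
    then have q: "\<not> regular_at (\<nu> - ?\<sigma>) q" by simp
    then have "q \<noteq> p" using reg by auto
    moreover have "\<not> regular_at \<nu> q" using q regular_at_diff[OF _ \<sigma>[OF \<open>q \<noteq> p\<close>]] by blast
    ultimately show "q \<in> A" using insert.prems(1) by blast
  qed
  then have "\<nu> - ?\<sigma> \<in> complex_vector.span (fractions S)"
    using insert by auto
  moreover have "?\<sigma> \<in> complex_vector.span (fractions S)"
    using insert.prems(2)
    by (intro complex_vector.span_sum complex_vector.span_base pole_map_in_fractions) auto
  ultimately have "\<nu> - ?\<sigma> + ?\<sigma> \<in> complex_vector.span (fractions S)"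
    by (rule complex_vector.span_add)
  then show ?case by simp
qed

lemma fractions_subset: "fractions S \<subseteq> regular_on S"
  by (auto simp: fractions_def intro: pole_map_in_regular_on)

lemma regular_on_eq_span: "(regular_on S :: 'g::complex_vector mero set) = complex_vector.span (fractions S)"
proof
  show "(regular_on S :: 'g mero set) \<subseteq> complex_vector.span (fractions S)"
  proof
    fix \<nu> :: "'g mero" assume "\<nu> \<in> regular_on S"
    then show "\<nu> \<in> complex_vector.span (fractions S)"
      by (intro partial_fractions[OF finite_poles order_refl]) (auto simp: regular_on_def)
  qed
  show "complex_vector.span (fractions S) \<subseteq> (regular_on S :: 'g mero set)"
    by (rule complex_vector.span_minimal[OF fractions_subset subspace_regular_on])
qed

lemma regular_on_Int_decompose:
  fixes \<nu> :: "'g::complex_vector mero"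
  assumes "\<nu> \<in> regular_on (S \<inter> S')"
  obtains \<nu>1 \<nu>2 where "\<nu> = \<nu>1 + \<nu>2" "\<nu>1 \<in> regular_on S" "\<nu>2 \<in> regular_on S'"
proof -
  have "(fractions (S \<inter> S') :: 'g mero set) = fractions S \<union> fractions S'"
    unfolding fractions_def by blast
  then have "\<nu> \<in> complex_vector.span (fractions S \<union> fractions S')"
    using assms by (simp add: regular_on_eq_span)
  then obtain \<nu>1 \<nu>2 where "\<nu>1 \<in> complex_vector.span (fractions S)"
      "\<nu>2 \<in> complex_vector.span (fractions S')" "\<nu> = \<nu>1 + \<nu>2"
    unfolding complex_vector.span_Un by blast
  then show ?thesis
    by (intro that[of \<nu>1 \<nu>2]) (simp_all add: regular_on_eq_span)
qed

section \<open>The topology of the projective line\<close>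

lemma openin_proj_line_Some: "openin proj_line Z \<Longrightarrow> open {z. Some z \<in> Z}"
proof -
  assume "openin proj_line Z"
  then consider (1) U where "open U" "Z = Some ` U"
    | (2) C where "compact C" "Z = insert None (Some ` (- C))"
    by (auto simp: openin_Alexandroff_compactification Compl_eq_Diff_UNIV)
  then show ?thesis
  proof cases
    case 1
    then have "{z. Some z \<in> Z} = U" by auto
    then show ?thesis using 1 by simp
  next
    case 2
    then have "{z. Some z \<in> Z} = - C" by auto
    then show ?thesis using 2 by (simp add: open_Compl compact_imp_closed)
  qed
qed

lemma openin_proj_line_iff:
  "openin proj_line Z \<longleftrightarrow> (\<forall>q\<in>Z. \<forall>\<^sub>F t in nhds 0. chart q t \<in> Z)"
proof
  assume Z: "openin proj_line Z"
  note open_Some = openin_proj_line_Some[OF Z]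
  show "\<forall>q\<in>Z. \<forall>\<^sub>F t in nhds 0. chart q t \<in> Z"
  proof
    fix q assume q: "q \<in> Z"
    show "\<forall>\<^sub>F t in nhds 0. chart q t \<in> Z"
    proof (cases q)
      case (Some a)
      have "open ((\<lambda>t. a + t) -` {z. Some z \<in> Z})"
        by (rule open_vimage[OF open_Some]) (intro continuous_intros)
      then have "\<forall>\<^sub>F t in nhds 0. t \<in> (\<lambda>t. a + t) -` {z. Some z \<in> Z}"
        by (rule eventually_nhds_in_open) (use q Some in simp)
      then show ?thesis by (rule eventually_mono) (simp add: Some)
    next
      case None
      then obtain C where C: "compact C" "Z = insert None (Some ` (- C))"
        using Z q by (auto simp: openin_Alexandroff_compactification Compl_eq_Diff_UNIV)
      obtain b where b: "b > 0" "\<forall>z\<in>C. norm z \<le> b"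
        using compact_imp_bounded[OF C(1)] bounded_pos by blast
      have "chart q t \<in> Z" if t: "t \<in> ball 0 (1 / b)" for t
      proof (cases "t = 0")
        case False
        then have "norm (1 / t) > b" using t b(1) by (simp add: norm_divide field_simps)
        then have "1 / t \<notin> C" using b(2) by auto
        then show ?thesis using False None C(2) by simp
      qed (use q in simp)
      moreover have "\<forall>\<^sub>F t in nhds 0. t \<in> ball 0 (1 / b)"
        by (rule eventually_nhds_in_open) (use b(1) in auto)
      ultimately show ?thesis by (rule eventually_mono[rotated])
    qed
  qed
next
  assume Z: "\<forall>q\<in>Z. \<forall>\<^sub>F t in nhds 0. chart q t \<in> Z"
  define U where "U = {z. Some z \<in> Z}"
  have "open U" unfolding open_subopen[of U]
  proof
    fix a assume "a \<in> U"
    then have "\<forall>\<^sub>F t in nhds 0. Some (a + t) \<in> Z" using Z by (auto simp: U_def)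
    then obtain T where T: "open T" "0 \<in> T" "\<And>t. t \<in> T \<Longrightarrow> Some (a + t) \<in> Z"
      unfolding eventually_nhds by blast
    have "open ((\<lambda>z. z - a) -` T)" by (rule open_vimage[OF T(1)]) (intro continuous_intros)
    moreover have "(\<lambda>z. z - a) -` T \<subseteq> U"
      using T(3) by (force simp: U_def)
    ultimately show "\<exists>T. open T \<and> a \<in> T \<and> T \<subseteq> U"
      using T(2) by (intro exI[of _ "(\<lambda>z. z - a) -` T"]) simp
  qed
  show "openin proj_line Z"
  proof (cases "None \<in> Z")
    case False
    have "Z = Some ` U"
    proof (intro equalityI subsetI)
      fix q assume "q \<in> Z" then show "q \<in> Some ` U" using False by (cases q) (auto simp: U_def)
    qed (auto simp: U_def)
    then show ?thesis using \<open>open U\<close> by simp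
  next
    case True
    then have "\<forall>\<^sub>F t in nhds 0. chart None t \<in> Z" using Z by blast
    then obtain e where e: "e > 0" "\<And>t. dist t 0 < e \<Longrightarrow> chart None t \<in> Z"
      unfolding eventually_nhds_metric by blast
    have "norm z \<le> 1 / e" if "z \<notin> U" for z
    proof (rule ccontr)
      assume "\<not> norm z \<le> 1 / e"
      then have z: "1 / e < norm z" by simp
      then have "z \<noteq> 0" using e(1) by auto
      then have "dist (1 / z) 0 < e" using z e(1) by (simp add: norm_divide field_simps)
      then show False using e(2)[of "1 / z"] that \<open>z \<noteq> 0\<close> by (simp add: U_def)
    qed
    then have "bounded (- U)" by (intro boundedI) auto
    then have "compact (- U)" using \<open>open U\<close> by (simp add: compact_eq_bounded_closed closed_Compl)
    moreover have "Z = insert None (Some ` (UNIV - (- U)))"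
    proof (intro equalityI subsetI)
      fix q assume "q \<in> Z" then show "q \<in> insert None (Some ` (UNIV - (- U)))" by (cases q) (auto simp: U_def)
    qed (use True in \<open>auto simp: U_def\<close>)
    ultimately show ?thesis
      unfolding openin_Alexandroff_compactification
      by (intro disjI2 exI[of _ "- U"] conjI) (auto simp: compact_imp_closed)
  qed
qed

text \<open>The inverse of the restriction of \<open>coord p\<close> to the complement of \<open>p\<close>.\<close>

definition uncoord :: "complex option \<Rightarrow> complex \<Rightarrow> complex option" where
  "uncoord p w = (case p of None \<Rightarrow> Some w | Some a \<Rightarrow> if w = 0 then None else Some (a + 1 / w))"

lemma coord_uncoord [simp]: "coord p (uncoord p w) = w"
  by (auto simp: uncoord_def split: option.split)

lemma uncoord_coord: "q \<noteq> p \<Longrightarrow> uncoord p (coord p q) = q"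
  by (cases p; cases q) (auto simp: uncoord_def)

lemma uncoord_inverse: "t \<noteq> 0 \<Longrightarrow> uncoord p (1 / t) = chart p t"
  by (cases p) (auto simp: uncoord_def)

lemma coord_inj: "coord p q = coord p q' \<Longrightarrow> q \<noteq> p \<Longrightarrow> q' \<noteq> p \<Longrightarrow> q = q'"
  using uncoord_coord by metis

lemma uncoord_chart:
  obtains \<tau> where "isCont \<tau> w0" "\<tau> w0 = 0" "\<forall>\<^sub>F w in nhds w0. uncoord p w = chart (uncoord p w0) (\<tau> w)"
proof (cases p)
  case None
  show ?thesis
    by (rule that[of "\<lambda>w. w - w0"]) (auto simp: None uncoord_def)
next
  case (Some a)
  show ?thesis
  proof (cases "w0 = 0")
    case True
    show ?thesis
    proof (rule that[of "\<lambda>w. w / (1 + a * w)"])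
      show "isCont (\<lambda>w. w / (1 + a * w)) w0" using True by (intro continuous_intros) auto
      have "open {w. 1 + a * w \<noteq> 0}" by (intro open_Collect_neq continuous_intros)
      then have "\<forall>\<^sub>F w in nhds w0. w \<in> {w. 1 + a * w \<noteq> 0}"
        by (rule eventually_nhds_in_open) (use True in simp)
      then show "\<forall>\<^sub>F w in nhds w0. uncoord p w = chart (uncoord p w0) (w / (1 + a * w))"
        by (rule eventually_mono) (auto simp: True Some uncoord_def field_simps)
    qed (use True in simp)
  next
    case False
    show ?thesis
    proof (rule that[of "\<lambda>w. 1 / w - 1 / w0"])
      show "isCont (\<lambda>w. 1 / w - 1 / w0) w0" using False by (intro continuous_intros) auto
      have "open {w::complex. w \<noteq> 0}" by (intro open_Collect_neq continuous_intros)
      then have "\<forall>\<^sub>F w in nhds w0. w \<in> {w. w \<noteq> 0}"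
        by (rule eventually_nhds_in_open) (use False in simp)
      then show "\<forall>\<^sub>F w in nhds w0. uncoord p w = chart (uncoord p w0) (1 / w - 1 / w0)"
        by (rule eventually_mono) (auto simp: False Some uncoord_def)
    qed simp
  qed
qed

lemma open_uncoord_vimage:
  assumes "openin proj_line Z"
  shows "open {w. uncoord p w \<in> Z}"
  unfolding open_subopen[of "{w. uncoord p w \<in> Z}"]
proof
  fix w0 assume "w0 \<in> {w. uncoord p w \<in> Z}"
  then have Z: "\<forall>\<^sub>F t in nhds 0. chart (uncoord p w0) t \<in> Z"
    using assms unfolding openin_proj_line_iff by blast
  obtain \<tau> where \<tau>: "isCont \<tau> w0" "\<tau> w0 = 0" "\<forall>\<^sub>F w in nhds w0. uncoord p w = chart (uncoord p w0) (\<tau> w)"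
    by (rule uncoord_chart)
  have "(\<tau> \<longlongrightarrow> \<tau> w0) (nhds w0)"
    using \<tau>(1) by (simp only: isCont_def tendsto_at_iff_tendsto_nhds)
  then have "\<forall>\<^sub>F w in nhds w0. chart (uncoord p w0) (\<tau> w) \<in> Z"
    unfolding \<tau>(2) by (rule eventually_compose_filterlim[OF Z])
  with \<tau>(3) have "\<forall>\<^sub>F w in nhds w0. uncoord p w \<in> Z" by eventually_elim simp
  then show "\<exists>T. open T \<and> w0 \<in> T \<and> T \<subseteq> {w. uncoord p w \<in> Z}"
    unfolding eventually_nhds by blast
qed

lemma coord_chart_tendsto: "q \<noteq> p \<Longrightarrow> ((\<lambda>t. coord p (chart q t)) \<longlongrightarrow> coord p q) (nhds 0)"
  using analytic_at_imp_isCont[OF coord_analytic, of q p] tendsto_at_iff_tendsto_nhds[of "\<lambda>t. coord p (chart q t)" 0]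
  by (simp add: isCont_def)

lemma eventually_chart_neq: "q \<noteq> p \<Longrightarrow> \<forall>\<^sub>F t in nhds 0. chart q t \<noteq> p"
proof -
  assume "q \<noteq> p"
  have "\<forall>\<^sub>F t in nhds 0. t \<noteq> 0 \<longrightarrow> chart q t \<noteq> p"
    using eventually_chart_notin[of "{p}" q] by (simp add: eventually_at_filter)
  then show "\<forall>\<^sub>F t in nhds 0. chart q t \<noteq> p"
    by (rule eventually_mono) (use \<open>q \<noteq> p\<close> in \<open>metis chart_0\<close>)
qed

lemma openin_coord_vimage:
  assumes "open O'"
  shows "openin proj_line {q. q \<noteq> p \<and> coord p q \<in> O'}"
  unfolding openin_proj_line_iff
proof
  fix q assume "q \<in> {q. q \<noteq> p \<and> coord p q \<in> O'}"
  then have q: "q \<noteq> p" "coord p q \<in> O'" by auto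
  have "\<forall>\<^sub>F t in nhds 0. coord p (chart q t) \<in> O'"
    by (rule topological_tendstoD[OF coord_chart_tendsto[OF q(1)] assms q(2)])
  then show "\<forall>\<^sub>F t in nhds 0. chart q t \<in> {q. q \<noteq> p \<and> coord p q \<in> O'}"
    using eventually_chart_neq[OF q(1)] by eventually_elim simp
qed

lemma openin_coord_vimage_cobounded:
  assumes "open O'" "bounded (- O')"
  shows "openin proj_line (insert p {q. q \<noteq> p \<and> coord p q \<in> O'})"
  unfolding openin_proj_line_iff
proof
  fix q assume q: "q \<in> insert p {q. q \<noteq> p \<and> coord p q \<in> O'}"
  show "\<forall>\<^sub>F t in nhds 0. chart q t \<in> insert p {q. q \<noteq> p \<and> coord p q \<in> O'}"
  proof (cases "q = p")
    case False
    then have "\<forall>\<^sub>F t in nhds 0. chart q t \<in> {q. q \<noteq> p \<and> coord p q \<in> O'}"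
      using q openin_coord_vimage[OF assms(1), of p] unfolding openin_proj_line_iff by blast
    then show ?thesis by (rule eventually_mono) auto
  next
    case True
    obtain b where b: "b > 0" "\<forall>z\<in>- O'. norm z \<le> b"
      using assms(2) bounded_pos by blast
    have "chart q t \<in> insert p {q. q \<noteq> p \<and> coord p q \<in> O'}" if t: "t \<in> ball 0 (1 / b)" for t
    proof (cases "t = 0")
      case False
      then have "norm (1 / t) > b" using t b(1) by (simp add: norm_divide field_simps)
      then have "1 / t \<in> O'" using b(2) by (metis ComplI not_le)
      then show ?thesis by (simp add: True coord_chart_self)
    qed (simp add: True)
    moreover have "\<forall>\<^sub>F t in nhds 0. t \<in> ball 0 (1 / b)"
      by (rule eventually_nhds_in_open) (use b(1) in auto)
    ultimately show ?thesis by (rule eventually_mono[rotated])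
  qed
qed

lemma topspace_proj_line: "topspace proj_line = UNIV"
  by (auto simp: UNIV_option_conv)

text \<open>A closed curve on the projective line avoiding a connected set has winding number zero around
  one point of the set, in a coordinate with pole at another.\<close>

lemma winding_number_coord_eq_0:
  assumes S: "connectedin proj_line S" and pq: "p \<in> S" "q \<in> S" "q \<noteq> p"
    and u: "path u" "pathfinish u = pathstart u"
    and off: "\<And>s. s \<in> S \<Longrightarrow> s \<noteq> p \<Longrightarrow> coord p s \<notin> path_image u"
  shows "winding_number u (coord p q) = 0"
proof (rule winding_number_zero_in_outside[OF u])
  let ?K = "path_image u"
  have K: "closed ?K" "bounded ?K" using u by (auto simp: closed_path_image bounded_path_image)
  define C where "C = connected_component_set (- ?K) (coord p q)"
  have c: "coord p q \<in> - ?K" using off pq by auto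
  have openC: "open C" unfolding C_def using K by (intro open_connected_component) auto
  have openC': "open (- (C \<union> ?K))"
  proof -
    have "- (C \<union> ?K) = (\<Union>x\<in>- (C \<union> ?K). connected_component_set (- ?K) x)"
    proof (intro equalityI subsetI)
      fix x assume "x \<in> - (C \<union> ?K)"
      then show "x \<in> (\<Union>x\<in>- (C \<union> ?K). connected_component_set (- ?K) x)"
        by (intro UN_I[of x]) simp_all
    next
      fix y assume "y \<in> (\<Union>x\<in>- (C \<union> ?K). connected_component_set (- ?K) x)"
      then obtain x where x: "x \<notin> C" "connected_component (- ?K) x y" by auto
      then have "y \<notin> ?K" using connected_component_in[OF x(2)] by simp
      moreover have "y \<notin> C"
        using x connected_component_trans[of "- ?K" "coord p q" y x] connected_component_sym
        unfolding C_def by auto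
      ultimately show "y \<in> - (C \<union> ?K)" by auto
    qed
    moreover have "open (\<Union>x\<in>- (C \<union> ?K). connected_component_set (- ?K) x)"
      using K by (intro open_UN ballI open_connected_component) auto
    ultimately show ?thesis by simp
  qed
  \<comment> \<open>If \<open>C\<close> were bounded, it would correspond to an open set of points of the projective line that
    contains \<open>q\<close>, while the other components together with \<open>p\<close> correspond to another open set; the
    two would disconnect \<open>S\<close>.\<close>
  have "\<not> bounded C"
  proof
    assume b: "bounded C"
    define E1 where "E1 = {s. s \<noteq> p \<and> coord p s \<in> C}"
    define E2 where "E2 = insert p {s. s \<noteq> p \<and> coord p s \<in> - (C \<union> ?K)}"
    have "openin proj_line E1" unfolding E1_def by (rule openin_coord_vimage[OF openC])
    moreover have "openin proj_line E2"
      unfolding E2_def by (rule openin_coord_vimage_cobounded[OF openC']) (use b K in simp)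
    moreover have "S \<subseteq> E1 \<union> E2" using off by (auto simp: E1_def E2_def)
    moreover have "E1 \<inter> E2 \<inter> S = {}" by (auto simp: E1_def E2_def)
    moreover have "q \<in> E1 \<inter> S"
      using pq c connected_component_refl[of "coord p q" "- ?K"] by (auto simp: E1_def C_def)
    moreover have "p \<in> E2 \<inter> S" using pq by (simp add: E2_def)
    ultimately show False using S unfolding connectedin by blast
  qed
  then show "coord p q \<in> outside ?K" by (simp add: outside C_def)
qed

section \<open>The boundary curve\<close>

text \<open>A domain \<open>D\<close> of the projective line bounded by the smooth curve \<open>\<gamma>\<close>, with boundary \<open>bd\<close>.\<close>

locale bounded_disc =
  fixes D :: "complex option set" and \<gamma> :: "real \<Rightarrow> complex option"
  assumes disc: "smoothly_bounded_disc D \<gamma>"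
begin

abbreviation "bd \<equiv> proj_line frontier_of D"

lemma D_open: "openin proj_line D" and D_connected: "connectedin proj_line D"
  using disc by (auto simp: smoothly_bounded_disc_def)

lemma D_nonempty: "D \<noteq> {}"
proof -
  have "\<exists>f :: complex \<Rightarrow> complex option. bij_betw f (ball 0 1) D"
    using disc unfolding smoothly_bounded_disc_def biholomorphic_to_disc_def
    by (elim conjE exE) (rule exI)
  then obtain f :: "complex \<Rightarrow> complex option" where "bij_betw f (ball 0 1) D" by (elim exE)
  then have "f 0 \<in> D" by (auto simp: bij_betw_def)
  then show ?thesis by auto
qed

lemma bd_eq: "bd = proj_line closure_of D - D"
  by (rule frontier_of_openin[OF D_open])

lemma D_closure: "D \<subseteq> proj_line closure_of D"
  by (rule closure_of_subset) (simp only: topspace_proj_line subset_UNIV)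

lemma exterior_eq: "exterior D = - (proj_line closure_of D)"
  unfolding exterior_def topspace_proj_line by auto

lemma exterior_open: "openin proj_line (exterior D)"
  unfolding exterior_def by (intro openin_diff openin_topspace closedin_closure_of)

lemma compl_bd: "- bd = D \<union> exterior D"
  using D_closure by (auto simp: bd_eq exterior_eq)

lemma compl_D: "- D = bd \<union> exterior D"
  using D_closure by (auto simp: bd_eq exterior_eq)

lemma compl_exterior: "- exterior D = bd \<union> D"
  using D_closure by (auto simp: bd_eq exterior_eq)

lemma D_exterior: "D \<inter> exterior D = {}"
  using D_closure by (auto simp: exterior_eq)

lemma gamma_periodic: "\<gamma> (t + 1) = \<gamma> t"
  using disc by (auto simp: smoothly_bounded_disc_def oriented_smooth_boundary_def)

lemma gamma_bij: "bij_betw \<gamma> {0..<1} bd"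
  using disc by (auto simp: smoothly_bounded_disc_def oriented_smooth_boundary_def)

lemma gamma_int: "\<gamma> (t + of_int k) = \<gamma> t"
proof (induction k rule: int_induct[where k = 0])
  case (step1 i)
  then show ?case using gamma_periodic[of "t + of_int i"] by (simp add: add.assoc)
next
  case (step2 i)
  then show ?case using gamma_periodic[of "t + of_int (i - 1)"] by (simp add: algebra_simps)
qed simp

lemma gamma_bd: "\<gamma> t \<in> bd"
proof -
  have "\<gamma> t = \<gamma> (frac t)"
    using gamma_int[of "frac t" "\<lfloor>t\<rfloor>"] by (simp add: frac_def)
  moreover have "frac t \<in> {0..<1}" by (simp add: frac_lt_1)
  then have "\<gamma> (frac t) \<in> \<gamma> ` {0..<1}" by (rule imageI)
  ultimately show ?thesis using bij_betw_imp_surj_on[OF gamma_bij] by simp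
qed

text \<open>In the coordinate \<open>coord p\<close>, for \<open>p\<close> off the boundary, the boundary curve is continuously
  differentiable near every \<open>t\<close>: it is there the composition of a holomorphic function with the
  curve that represents \<open>\<gamma>\<close> in the coordinate centred at \<open>\<gamma> t\<close>.\<close>

lemma coord_gamma_local:
  assumes "p \<notin> bd"
  obtains d where "\<forall>\<^sub>F s in nhds t. ((\<lambda>s. coord p (\<gamma> s)) has_vector_derivative d s) (at s)" "isCont d t"
proof -
  define u where "u s = coord p (\<gamma> s)" for s
  have pt: "\<gamma> t \<noteq> p" using gamma_bd assms by auto
  obtain F :: "nat \<Rightarrow> real \<Rightarrow> complex" where F0: "F 0 t = 0"
    and F: "\<forall>\<^sub>F s in nhds t. \<gamma> s = chart (\<gamma> t) (F 0 s)"
    and F': "\<forall>\<^sub>F s in nhds t. \<forall>k. (F k has_vector_derivative F (Suc k) s) (at s)"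
    using disc unfolding smoothly_bounded_disc_def oriented_smooth_boundary_def by blast
  define c where "c w = coord p (chart (\<gamma> t) w)" for w
  have c: "c analytic_on {0}" unfolding c_def by (rule coord_analytic[OF pt])
  from c obtain e where e: "e > 0" "c holomorphic_on ball 0 e" by (auto simp: analytic_at_ball)
  have Fcont: "isCont (F k) t" for k
    using eventually_nhds_x_imp_x[OF F'] has_vector_derivative_continuous by blast
  have "(F 0 \<longlongrightarrow> 0) (nhds t)"
    using Fcont[of 0] tendsto_at_iff_tendsto_nhds[of "F 0" t] by (simp add: isCont_def F0)
  then have ball: "\<forall>\<^sub>F s in nhds t. F 0 s \<in> ball 0 e"
    using e(1) by (intro topological_tendstoD) auto
  define d where "d s = F 1 s * deriv c (F 0 s)" for s
  have "\<forall>\<^sub>F s in nhds t. \<forall>\<^sub>F r in nhds s. \<gamma> r = chart (\<gamma> t) (F 0 r)"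
    using F by (simp add: eventually_eventually)
  then have "\<forall>\<^sub>F s in nhds t. (u has_vector_derivative d s) (at s)"
    using F' ball
  proof eventually_elim
    case (elim s)
    have "(c has_field_derivative deriv c (F 0 s)) (at (F 0 s))"
      using e(2) elim(3) by (intro holomorphic_derivI[of _ "ball 0 e"]) auto
    moreover have "(F 0 has_vector_derivative F 1 s) (at s)"
      using elim(2) by (metis One_nat_def)
    ultimately have cF: "(c \<circ> F 0 has_vector_derivative d s) (at s)"
      unfolding d_def by (rule field_vector_diff_chain_at[rotated])
    obtain A where A: "open A" "s \<in> A" "\<And>r. r \<in> A \<Longrightarrow> \<gamma> r = chart (\<gamma> t) (F 0 r)"
      using elim(1) unfolding eventually_nhds by blast
    show ?case
      by (rule has_vector_derivative_transform_within_open[OF cF A(1,2)]) (simp add: c_def u_def A(3))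
  qed
  moreover have "isCont d t"
  proof -
    have "isCont (deriv c) (F 0 t)"
      unfolding F0 by (intro analytic_at_imp_isCont analytic_deriv c)
    then show ?thesis unfolding d_def by (intro continuous_intros Fcont isCont_o2[OF Fcont])
  qed
  ultimately show ?thesis using that unfolding u_def by blast
qed

lemma coord_gamma_C1:
  assumes "p \<notin> bd"
  obtains u' where "\<And>t. ((\<lambda>s. coord p (\<gamma> s)) has_vector_derivative u' t) (at t)" "continuous_on UNIV u'"
proof
  define u where "u = (\<lambda>s. coord p (\<gamma> s))"
  have *: "(u has_vector_derivative vector_derivative u (at t)) (at t) \<and> isCont (\<lambda>t. vector_derivative u (at t)) t" for t
  proof -
    obtain d where d: "\<forall>\<^sub>F s in nhds t. (u has_vector_derivative d s) (at s)" "isCont d t"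
      unfolding u_def by (rule coord_gamma_local[OF assms])
    have "(u has_vector_derivative d t) (at t)" using eventually_nhds_x_imp_x[OF d(1)] .
    then have 1: "(u has_vector_derivative vector_derivative u (at t)) (at t)"
      by (simp add: vector_derivative_at)
    have "\<forall>\<^sub>F s in nhds t. vector_derivative u (at s) = d s"
      using d(1) by (rule eventually_mono) (rule vector_derivative_at)
    then have "isCont (\<lambda>t. vector_derivative u (at t)) t"
      using d(2) by (simp add: isCont_cong)
    with 1 show ?thesis by blast
  qed
  show "((\<lambda>s. coord p (\<gamma> s)) has_vector_derivative vector_derivative u (at t)) (at t)" for t
    using * by (simp add: u_def)
  show "continuous_on UNIV (\<lambda>t. vector_derivative u (at t))"
    using * by (simp add: continuous_at_imp_continuous_on)
qed

lemma coord_gamma_path: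
  assumes "p \<notin> bd"
  shows "path (\<lambda>s. coord p (\<gamma> s))" "pathfinish (\<lambda>s. coord p (\<gamma> s)) = pathstart (\<lambda>s. coord p (\<gamma> s))"
proof -
  obtain u' where "\<And>t. ((\<lambda>s. coord p (\<gamma> s)) has_vector_derivative u' t) (at t)"
    using coord_gamma_C1[OF assms] by blast
  then have "isCont (\<lambda>s. coord p (\<gamma> s)) t" for t
    using has_vector_derivative_continuous by blast
  then show "path (\<lambda>s. coord p (\<gamma> s))"
    unfolding path_def by (intro continuous_at_imp_continuous_on) auto
  show "pathfinish (\<lambda>s. coord p (\<gamma> s)) = pathstart (\<lambda>s. coord p (\<gamma> s))"
    using gamma_periodic[of 0] by (simp add: pathfinish_def pathstart_def)
qed

lemma coord_gamma_image: "path_image (\<lambda>s. coord p (\<gamma> s)) = coord p ` bd"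
proof -
  have "\<gamma> ` {0..<1} \<subseteq> \<gamma> ` {0..1}" by (rule image_mono) auto
  then have "\<gamma> ` {0..1} = bd"
    unfolding bij_betw_imp_surj_on[OF gamma_bij] using gamma_bd by blast
  then show ?thesis by (simp add: path_image_def flip: image_image)
qed

text \<open>For a point \<open>p\<close> in \<open>D\<close> the boundary is a Jordan curve in the coordinate \<open>coord p\<close>. The
  unbounded component of its complement meets \<open>D\<close>, as it contains the points near \<open>p\<close> other than
  \<open>p\<close>; being connected, it does not meet the exterior. So the exterior is contained in the bounded
  component.\<close>

lemma exterior_in_connected:
  obtains S where "connectedin proj_line S" "exterior D \<subseteq> S" "S \<inter> bd = {}"
proof -
  obtain p where p: "p \<in> D" using D_nonempty by blast
  then have pbd: "p \<notin> bd" by (simp add: bd_eq)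
  define u where "u = (\<lambda>s. coord p (\<gamma> s))"
  have u: "path u" "pathfinish u = pathstart u"
    unfolding u_def by (rule coord_gamma_path[OF pbd])+
  have "loop_free u"
  proof -
    have *: "x = y" if "x \<in> {0..<1}" "y \<in> {0..<1}" "u x = u y" for x y
    proof -
      have "\<gamma> x = \<gamma> y"
        using that(3) gamma_bd pbd unfolding u_def by (metis coord_inj)
      then show ?thesis by (rule inj_onD[OF bij_betw_imp_inj_on[OF gamma_bij] _ that(1,2)])
    qed
    have 10: "u 1 = u 0" using u(2) by (simp add: pathfinish_def pathstart_def)
    show ?thesis unfolding loop_free_def
    proof (intro ballI impI)
      fix x y :: real assume xy: "x \<in> {0..1}" "y \<in> {0..1}" "u x = u y"
      show "x = y \<or> x = 0 \<and> y = 1 \<or> x = 1 \<and> y = 0"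
      proof (cases "x = 1")
        case True
        then have "y = 0" if "y \<noteq> 1" using xy 10 that by (intro *[of y 0]) simp_all
        then show ?thesis using True by blast
      next
        case x: False
        show ?thesis
        proof (cases "y = 1")
          case True
          then have "x = 0" using xy 10 x by (intro *[of x 0]) simp_all
          then show ?thesis using True by blast
        next
          case False
          then have "x = y" using xy x by (intro *[of x y]) simp_all
          then show ?thesis by blast
        qed
      qed
    qed
  qed
  then have "simple_path u" using u by (simp add: simple_path_def)
  note J = Jordan_inside_outside[OF this u(2)]
  let ?K = "path_image u"
  have K: "?K = coord p ` bd" unfolding u_def by (rule coord_gamma_image)
  define S where "S = uncoord p ` inside ?K"
  have conn: "connectedin proj_line S"
    unfolding connectedin
  proof (intro conjI notI)
    show "S \<subseteq> topspace proj_line" by (simp only: topspace_proj_line subset_UNIV)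
    assume "\<exists>E1 E2. openin proj_line E1 \<and> openin proj_line E2 \<and> S \<subseteq> E1 \<union> E2 \<and>
      E1 \<inter> E2 \<inter> S = {} \<and> E1 \<inter> S \<noteq> {} \<and> E2 \<inter> S \<noteq> {}"
    then obtain E1 E2 where E: "openin proj_line E1" "openin proj_line E2" "S \<subseteq> E1 \<union> E2"
      "E1 \<inter> E2 \<inter> S = {}" "E1 \<inter> S \<noteq> {}" "E2 \<inter> S \<noteq> {}" by blast
    have "connected (inside ?K)" using J by blast
    moreover have "{w. uncoord p w \<in> E1} \<inter> {w. uncoord p w \<in> E2} \<inter> inside ?K = {}"
      "inside ?K \<subseteq> {w. uncoord p w \<in> E1} \<union> {w. uncoord p w \<in> E2}"
      "{w. uncoord p w \<in> E1} \<inter> inside ?K \<noteq> {}" "{w. uncoord p w \<in> E2} \<inter> inside ?K \<noteq> {}"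
      using E(3-6) unfolding S_def by blast+
    ultimately show False
      using open_uncoord_vimage[OF E(1), of p] open_uncoord_vimage[OF E(2), of p]
      unfolding connected_def by blast
  qed
  have disj: "S \<inter> bd = {}"
  proof -
    have "w \<in> ?K" if "uncoord p w \<in> bd" for w
      unfolding K using that by (metis coord_uncoord image_eqI)
    then show ?thesis using inside_no_overlap[of ?K] unfolding S_def by blast
  qed
  have "exterior D \<subseteq> S"
  proof
    fix q assume q: "q \<in> exterior D"
    have qp: "q \<noteq> p" using q p D_exterior by blast
    have "coord p q \<notin> ?K"
    proof
      assume "coord p q \<in> ?K"
      then obtain r where r: "r \<in> bd" "coord p q = coord p r" unfolding K by blast
      then have "q = r" using coord_inj qp pbd by metis
      then show False using r q compl_bd by blast
    qed
    moreover have "coord p q \<notin> outside ?K"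
    proof
      assume out: "coord p q \<in> outside ?K"
      have bdd: "bounded (- outside ?K)"
        using u by (intro cobounded_outside bounded_path_image)
      let ?A = "{w. uncoord p w \<in> D}" and ?B = "{w. uncoord p w \<in> exterior D}"
      have op: "open ?A" "open ?B" using D_open exterior_open by (simp_all add: open_uncoord_vimage)
      have cover: "outside ?K \<subseteq> ?A \<union> ?B"
      proof
        fix w assume "w \<in> outside ?K"
        then have "w \<notin> ?K" using outside_no_overlap[of ?K] by blast
        then have "uncoord p w \<notin> bd" unfolding K by (metis coord_uncoord image_eqI)
        then show "w \<in> ?A \<union> ?B" using compl_bd by blast
      qed
      have AB: "?A \<inter> ?B \<inter> outside ?K = {}" using D_exterior by blast
      have "coord p q \<in> ?B \<inter> outside ?K" using out q by (simp add: uncoord_coord[OF qp])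
      moreover have "?A \<inter> outside ?K \<noteq> {}"
      proof -
        have "\<forall>\<^sub>F t in nhds 0. chart p t \<in> D"
          using D_open p unfolding openin_proj_line_iff by blast
        then have 1: "\<forall>\<^sub>F t in at 0. chart p t \<in> D" by (rule eventually_nhds_conv_at[THEN iffD1, THEN conjunct1])
        obtain b where b: "b > 0" "\<forall>z\<in>- outside ?K. norm z \<le> b"
          using bdd bounded_pos by blast
        have "\<forall>\<^sub>F t in at (0::complex). t \<in> ball 0 (1 / b) - {0}"
          using b by (intro eventually_at_in_open) auto
        with 1 have "\<forall>\<^sub>F t in at 0. 1 / t \<in> ?A \<inter> outside ?K"
        proof eventually_elim
          case (elim t)
          then have "norm (1 / t) > b" using b(1) by (simp add: norm_divide field_simps)
          then have "1 / t \<in> outside ?K" using b(2) by (metis ComplI not_le)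
          then show ?case using elim by (simp add: uncoord_inverse)
        qed
        then obtain t where "1 / t \<in> ?A \<inter> outside ?K"
          using eventually_happens'[OF at_neq_bot] by blast
        then show ?thesis by blast
      qed
      moreover have "connected (outside ?K)" using J by (elim conjE)
      ultimately show False using connectedD[OF _ op AB cover] by blast
    qed
    moreover have "inside ?K \<union> outside ?K = - ?K" using J by (elim conjE)
    ultimately have "coord p q \<in> inside ?K" by blast
    then show "q \<in> S" unfolding S_def using uncoord_coord[OF qp] by (metis image_eqI)
  qed
  then show ?thesis by (rule that[OF conn _ disj])
qed

end

section \<open>The boundary pairing\<close>

text \<open>\<open>C1_with F F'\<close>: the curve \<open>F\<close> is a finite sum of terms \<open>f t *\<^sub>C x\<close> with continuously
  differentiable functions \<open>f\<close>, and \<open>F'\<close> is the corresponding derivative. This needs no topology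
  on the vector space.\<close>

inductive C1_with :: "(real \<Rightarrow> 'v::complex_vector) \<Rightarrow> (real \<Rightarrow> 'v) \<Rightarrow> bool" where
  single: "(\<And>t. (f has_vector_derivative f' t) (at t)) \<Longrightarrow> continuous_on UNIV f' \<Longrightarrow>
     C1_with (\<lambda>t. f t *\<^sub>C x) (\<lambda>t. f' t *\<^sub>C x)"
| add: "C1_with F F' \<Longrightarrow> C1_with G G' \<Longrightarrow> C1_with (\<lambda>t. F t + G t) (\<lambda>t. F' t + G' t)"

lemma C1_with_const: "C1_with (\<lambda>_. x) (\<lambda>_. 0)"
  using C1_with.single[of "\<lambda>_. 1" "\<lambda>_. 0" x] by (simp add: scaleC_one complex_vector.scale_zero_left)

lemma C1_with_scaleC: "C1_with F F' \<Longrightarrow> C1_with (\<lambda>t. c *\<^sub>C F t) (\<lambda>t. c *\<^sub>C F' t)"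
proof (induction rule: C1_with.induct)
  case (single f f' x)
  have "C1_with (\<lambda>t. (c * f t) *\<^sub>C x) (\<lambda>t. (c * f' t) *\<^sub>C x)"
    by (intro C1_with.single continuous_intros single has_vector_derivative_mult_right)
  then show ?case by (simp add: scaleC_scaleC)
next
  case (add F F' G G')
  then show ?case using C1_with.add by (fastforce simp: scaleC_add_right)
qed

text \<open>Bilinear maps of complex vector spaces.\<close>

definition bilin :: "('a::complex_vector \<Rightarrow> 'b::complex_vector \<Rightarrow> 'c::complex_vector) \<Rightarrow> bool" where
  "bilin b \<longleftrightarrow> (\<forall>x y z. b (x + y) z = b x z + b y z) \<and> (\<forall>x y z. b x (y + z) = b x y + b x z) \<and>
     (\<forall>c x y. b (c *\<^sub>C x) y = c *\<^sub>C b x y) \<and> (\<forall>c x y. b x (c *\<^sub>C y) = c *\<^sub>C b x y)"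

lemma bilinD:
  assumes "bilin b"
  shows "b (x + x') y = b x y + b x' y" "b x (y + y') = b x y + b x y'"
    "b (c *\<^sub>C x) y = c *\<^sub>C b x y" "b x (c *\<^sub>C y) = c *\<^sub>C b x y" "b 0 y = 0" "b x 0 = 0"
proof -
  show 3: "b (c *\<^sub>C x) y = c *\<^sub>C b x y" and 4: "b x (c *\<^sub>C y) = c *\<^sub>C b x y" for c x y
    using assms by (simp_all add: bilin_def)
  show "b 0 y = 0" using 3[of 0 0 y] by (simp add: complex_vector.scale_zero_left)
  show "b x 0 = 0" using 4[of x 0 0] by (simp add: complex_vector.scale_zero_left)
qed (use assms in \<open>simp_all add: bilin_def\<close>)

lemma C1_with_bilin:
  assumes b: "bilin b" and F: "C1_with F F'" and G: "C1_with G G'"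
  shows "C1_with (\<lambda>t. b (F t) (G t)) (\<lambda>t. b (F' t) (G t) + b (F t) (G' t))"
  using F
proof (induction rule: C1_with.induct)
  case (single f f' x)
  note f = single
  show ?case using G
  proof (induction rule: C1_with.induct)
    case (single g g' y)
    have cont: "continuous_on UNIV f" "continuous_on UNIV g"
      using f(1) single(1) has_vector_derivative_continuous
      by (blast intro: continuous_at_imp_continuous_on)+
    have "C1_with (\<lambda>t. (f t * g t) *\<^sub>C b x y) (\<lambda>t. (f t * g' t + f' t * g t) *\<^sub>C b x y)"
      by (intro C1_with.single continuous_intros cont f single has_vector_derivative_mult)
    then show ?case
      by (simp add: bilinD[OF b] scaleC_scaleC scaleC_add_left add.commute mult.commute)
  next
    case (add G1 G1' G2 G2')
    show ?case
      using C1_with.add[OF add.IH] by (simp add: bilinD[OF b] algebra_simps)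
  qed
next
  case (add F1 F1' F2 F2')
  show ?case
    using C1_with.add[OF add.IH] by (simp add: bilinD[OF b] algebra_simps)
qed

lemma C1_with_continuous_bilin:
  fixes b :: "'a::complex_vector \<Rightarrow> 'b::complex_vector \<Rightarrow> complex"
  assumes b: "bilin b" and F: "C1_with F F'" and G: "C1_with G G'"
  shows "continuous_on UNIV (\<lambda>t. b (F t) (G' t))"
  using F
proof (induction rule: C1_with.induct)
  case (single f f' x)
  note f = single
  show ?case using G
  proof (induction rule: C1_with.induct)
    case (single g g' y)
    have "continuous_on UNIV f"
      using f(1) has_vector_derivative_continuous by (blast intro: continuous_at_imp_continuous_on)
    then show ?case
      by (simp add: bilinD[OF b] scaleC_complex_def) (intro continuous_intros single)
  next
    case (add G1 G1' G2 G2')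
    then show ?case by (simp add: bilinD[OF b]) (intro continuous_intros)
  qed
next
  case (add F1 F1' F2 F2')
  then show ?case by (simp add: bilinD[OF b]) (intro continuous_intros)
qed

lemma C1_with_complex:
  fixes F :: "real \<Rightarrow> complex"
  assumes "C1_with F F'"
  shows "(F has_vector_derivative F' t) (at t)"
  using assms
proof (induction rule: C1_with.induct)
  case (single f f' x)
  then show ?case by (simp add: scaleC_complex_def has_vector_derivative_mult_left)
next
  case (add F F' G G')
  then show ?case by (intro has_vector_derivative_add)
qed

lemma bilin_lie: "bilin (lie :: 'g::complex_lie_algebra \<Rightarrow> 'g \<Rightarrow> 'g)"
  by (simp add: bilin_def lie_add_left lie_add_right lie_scaleC_left lie_scaleC_right)

lemma lie_antisym: "lie x y = - lie y x" for x y :: "'g::complex_lie_algebra"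
proof -
  have "lie x y + lie y x = 0"
    unfolding lie_self[of "x + y", unfolded lie_add_left lie_add_right lie_self[of x] lie_self[of y]
        add_0_left add_0_right, symmetric] by (rule add.commute)
  then show ?thesis by (rule eq_neg_iff_add_eq_0[THEN iffD2])
qed

text \<open>Two coordinates with different poles are related by a Moebius transformation.\<close>

lemma coord_moebius:
  assumes "q \<noteq> p"
  obtains A A' where "\<And>r. r \<noteq> p \<Longrightarrow> r \<noteq> q \<Longrightarrow> coord q r = A / (coord p r - coord p q) + A'"
proof (cases p)
  case None
  then obtain b where q: "q = Some b" using assms by (cases q) auto
  show ?thesis
  proof (rule that[of 1 0])
    fix r assume "r \<noteq> p" "r \<noteq> q"
    then show "coord q r = 1 / (coord p r - coord p q) + 0" using None q by (cases r) auto
  qed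
next
  case (Some a)
  show ?thesis
  proof (cases q)
    case None
    show ?thesis
    proof (rule that[of 1 a])
      fix r assume "r \<noteq> p" "r \<noteq> q"
      then show "coord q r = 1 / (coord p r - coord p q) + a"
        using None Some by (cases r) auto
    qed
  next
    case q: (Some b)
    define d where "d = a - b"
    have d: "d \<noteq> 0" "b = a - d" using assms Some q by (auto simp: d_def)
    show ?thesis
    proof (rule that[of "- 1 / d^2" "1 / d"])
      fix r assume r: "r \<noteq> p" "r \<noteq> q"
      show "coord q r = (- 1 / d^2) / (coord p r - coord p q) + 1 / d"
      proof (cases r)
        case None
        then show ?thesis using d Some q by (simp add: field_simps power2_eq_square)
      next
        case r': (Some z)
        define e where "e = z - a"
        have "e \<noteq> 0" using r(1) r' Some by (auto simp: e_def)
        moreover have "e + d \<noteq> 0" using r(2) r' q by (simp add: e_def d_def)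
        ultimately have e: "e \<noteq> 0" "e + d \<noteq> 0" by blast+
        have "coord q r = 1 / (e + d)" using r' q by (simp add: e_def d_def)
        moreover have "b - a = - d" by (simp add: d_def)
        then have "coord p r - coord p q = 1 / e + 1 / d"
          using r' Some q by (simp add: e_def)
        moreover have "1 / e + 1 / d = (e + d) / (e * d)" using e d by (simp add: field_simps)
        moreover have "1 / (e + d) = (- 1 / d^2) / ((e + d) / (e * d)) + 1 / d"
        proof -
          have 1: "1 / (e + d) = d / (d * (e + d))" using d(1) by simp
          have 2: "1 / d = (e + d) / (d * (e + d))" using e(2) by simp
          have 3: "(- 1 / d^2) / ((e + d) / (e * d)) = - e / (d * (e + d))"
            using e d(1) by (simp add: power2_eq_square)
          show ?thesis unfolding 3 1 2 add_divide_distrib[symmetric] by simp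
        qed
        ultimately show ?thesis by simp
      qed
    qed
  qed
qed

text \<open>The maps that are regular along the boundary form the Lie algebra \<open>G\<close>, on which the boundary
  pairing \<open>bp\<close> is defined; \<open>curve \<mu>\<close> are the values of \<open>\<mu>\<close> along the boundary.\<close>

locale form_ctx = bounded_disc D \<gamma>
  for D :: "complex option set" and \<gamma> :: "real \<Rightarrow> complex option" +
  fixes B :: "'g::complex_lie_algebra \<Rightarrow> 'g \<Rightarrow> complex"
  assumes form: "nondegenerate_invariant_form B"
begin

abbreviation G :: "'g mero set" where "G \<equiv> regular_on bd"
abbreviation bp :: "'g mero \<Rightarrow> 'g mero \<Rightarrow> complex" where "bp \<equiv> boundary_pairing B \<gamma>"
abbreviation curve :: "'g mero \<Rightarrow> real \<Rightarrow> 'g" where "curve \<mu> \<equiv> \<lambda>t. mero_value \<mu> (\<gamma> t)"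

lemma B_sym: "B x y = B y x"
  using form unfolding nondegenerate_invariant_form_def by blast

lemma B_inv: "B (lie x y) w = B x (lie y w)"
  using form unfolding nondegenerate_invariant_form_def by blast

lemma B_bilin: "bilin B"
proof -
  have lin: "Vector_Spaces.linear scaleC (*) (B x)" for x
    using form unfolding nondegenerate_invariant_form_def by blast
  have add: "B x (y + z) = B x y + B x z" and scale: "B x (c *\<^sub>C y) = c * B x y" for x y z c
  proof -
    interpret Vector_Spaces.linear scaleC "(*)" "B x" by (rule lin)
    show "B x (y + z) = B x y + B x z" "B x (c *\<^sub>C y) = c * B x y" by (rule add, rule scale)
  qed
  have "B (x + y) z = B x z + B y z" "B (c *\<^sub>C x) y = c * B x y" for x y z c
    using add[of z x y] scale[of y c x]
    by (simp_all only: B_sym[of "x + y" z] B_sym[of x z] B_sym[of y z] B_sym[of "c *\<^sub>C x" y] B_sym[of x y])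
  then show ?thesis by (simp add: bilin_def add scale scaleC_complex_def)
qed

lemmas B_simps = bilinD[OF B_bilin]

lemma curve_C1:
  assumes "\<mu> \<in> G"
  shows "\<exists>F'. C1_with (curve \<mu>) F'"
proof -
  have "\<mu> \<in> complex_vector.span (fractions bd)" using assms by (simp only: regular_on_eq_span)
  then have "\<mu> \<in> G \<and> (\<exists>F'. C1_with (curve \<mu>) F')"
  proof (induction rule: complex_vector.span_induct_alt)
    case base
    have "C1_with (curve (const_mero 0)) (\<lambda>_. 0)" using C1_with_const[of 0] by simp
    then show ?case using complex_vector.subspace_0[OF subspace_regular_on] unfolding const_mero_0 by blast
  next
    case (step c \<alpha> \<beta>)
    have \<alpha>: "\<alpha> \<in> G" by (rule subsetD[OF fractions_subset step(1)])
    have \<beta>: "\<beta> \<in> G" using step(2) by blast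
    have c\<alpha>: "c *\<^sub>C \<alpha> \<in> G" by (rule complex_vector.subspace_scale[OF subspace_regular_on \<alpha>])
    have "\<exists>F'. C1_with (curve \<alpha>) F'"
      using step(1) unfolding fractions_def
    proof (elim UnE imageE CollectE exE conjE)
      fix x assume "\<alpha> = const_mero x"
      then show ?thesis using C1_with_const[of x] by auto
    next
      fix p k x assume \<alpha>p: "\<alpha> = pole_map p k x" "p \<notin> bd"
      obtain u' where u': "\<And>t. ((\<lambda>s. coord p (\<gamma> s)) has_vector_derivative u' t) (at t)" "continuous_on UNIV u'"
        using coord_gamma_C1[OF \<alpha>p(2)] by blast
      define d where "d = (\<lambda>t. u' t * (of_nat k * coord p (\<gamma> t) ^ (k - 1)))"
      have 1: "((\<lambda>s. coord p (\<gamma> s) ^ k) has_vector_derivative d t) (at t)" for t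
      proof -
        have "((\<lambda>w. w ^ k) has_field_derivative (of_nat k * coord p (\<gamma> t) ^ (k - 1))) (at (coord p (\<gamma> t)))"
          by (rule DERIV_cong[OF DERIV_power[OF DERIV_ident]]) (simp add: One_nat_def)
        from field_vector_diff_chain_at[OF u'(1) this] show ?thesis by (simp add: d_def comp_def)
      qed
      have "continuous_on UNIV (\<lambda>s. coord p (\<gamma> s))"
        using u'(1) has_vector_derivative_continuous by (blast intro: continuous_at_imp_continuous_on)
      then have 2: "continuous_on UNIV d" unfolding d_def by (intro continuous_intros u')
      have "curve \<alpha> = (\<lambda>t. coord p (\<gamma> t) ^ k *\<^sub>C x)"
        using \<alpha>p gamma_bd by (auto simp: mero_value_pole_map fun_eq_iff intro!: mero_value_pole_map)
      then show ?thesis using C1_with.single[OF 1 2, of x] by auto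
    qed
    then obtain F' where F': "C1_with (curve \<alpha>) F'" ..
    obtain G' where G': "C1_with (curve \<beta>) G'" using step by blast
    have "curve (c *\<^sub>C \<alpha> + \<beta>) = (\<lambda>t. c *\<^sub>C curve \<alpha> t + curve \<beta> t)"
      by (intro ext) (simp add: mero_value_add[OF c\<alpha> \<beta> gamma_bd] mero_value_scaleC[OF \<alpha> gamma_bd])
    then have "C1_with (curve (c *\<^sub>C \<alpha> + \<beta>)) (\<lambda>t. c *\<^sub>C F' t + G' t)"
      using C1_with.add[OF C1_with_scaleC[OF F'] G'] by simp
    moreover have "c *\<^sub>C \<alpha> + \<beta> \<in> G" by (rule complex_vector.subspace_add[OF subspace_regular_on c\<alpha> \<beta>])
    ultimately show ?case by blast
  qed
  then show ?thesis by blast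
qed

text \<open>The derivative of the values of \<open>\<mu>\<close> along the boundary.\<close>

definition dcurve :: "'g mero \<Rightarrow> real \<Rightarrow> 'g" where
  "dcurve \<mu> = (SOME F'. C1_with (curve \<mu>) F')"

lemma dcurve: "\<mu> \<in> G \<Longrightarrow> C1_with (curve \<mu>) (dcurve \<mu>)"
  unfolding dcurve_def using curve_C1 by (rule someI_ex)

lemma bp_eq:
  assumes "C1_with (curve \<nu>) G'"
  shows "bp \<mu> \<nu> = 1 / (2 * of_real pi * \<i>) * integral {0..1} (\<lambda>t. B (curve \<mu> t) (G' t))"
proof -
  have "((\<lambda>s. B v (curve \<nu> s)) has_vector_derivative B v (G' t)) (at t)" for v t
    using C1_with_complex[OF C1_with_bilin[OF B_bilin C1_with_const[of v] assms]]
    by (simp add: B_simps)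
  then have "vector_derivative (\<lambda>s. B (curve \<mu> t) (curve \<nu> s)) (at t) = B (curve \<mu> t) (G' t)" for t
    by (intro vector_derivative_at) auto
  then show ?thesis unfolding boundary_pairing_def by simp
qed

lemma integrable_B:
  assumes "\<mu> \<in> G" "C1_with F G'"
  shows "(\<lambda>t. B (curve \<mu> t) (G' t)) integrable_on {0..1}"
  using C1_with_continuous_bilin[OF B_bilin dcurve[OF assms(1)] assms(2)]
  by (intro integrable_continuous_real) (rule continuous_on_subset, auto)

lemma curve_lie: "\<mu> \<in> G \<Longrightarrow> \<nu> \<in> G \<Longrightarrow> curve (lie \<mu> \<nu>) = (\<lambda>t. lie (curve \<mu> t) (curve \<nu> t))"
  by (intro ext mero_value_lie[OF _ _ gamma_bd])

lemma G_lie: "\<mu> \<in> G \<Longrightarrow> \<nu> \<in> G \<Longrightarrow> lie \<mu> \<nu> \<in> G"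
  by (rule lie_in_regular_on)

lemma bp_add_left:
  assumes "\<mu> \<in> G" "\<mu>' \<in> G" "\<nu> \<in> G"
  shows "bp (\<mu> + \<mu>') \<nu> = bp \<mu> \<nu> + bp \<mu>' \<nu>"
  unfolding bp_eq[OF dcurve[OF assms(3)]] mero_value_add[OF assms(1,2) gamma_bd] B_simps(1)
    Henstock_Kurzweil_Integration.integral_add[OF integrable_B[OF assms(1) dcurve[OF assms(3)]]
      integrable_B[OF assms(2) dcurve[OF assms(3)]]]
  by (rule distrib_left)

lemma bp_scaleC_left:
  assumes "\<mu> \<in> G" "\<nu> \<in> G"
  shows "bp (c *\<^sub>C \<mu>) \<nu> = c * bp \<mu> \<nu>"
  unfolding bp_eq[OF dcurve[OF assms(2)]] mero_value_scaleC[OF assms(1) gamma_bd] B_simps(3) scaleC_complex_def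
  by simp

text \<open>Integration by parts along the closed boundary curve.\<close>

lemma bp_antisym:
  assumes \<mu>: "\<mu> \<in> G" and \<nu>: "\<nu> \<in> G"
  shows "bp \<mu> \<nu> = - bp \<nu> \<mu>"
proof -
  let ?h = "\<lambda>t. B (curve \<mu> t) (curve \<nu> t)"
  let ?h' = "\<lambda>t. B (dcurve \<mu> t) (curve \<nu> t) + B (curve \<mu> t) (dcurve \<nu> t)"
  have "(?h has_vector_derivative ?h' t) (at t within {0..1})" for t
    by (rule has_vector_derivative_at_within, rule C1_with_complex,
        rule C1_with_bilin[OF B_bilin dcurve[OF \<mu>] dcurve[OF \<nu>]])
  then have "(?h' has_integral (?h 1 - ?h 0)) {0..1}"
    by (intro fundamental_theorem_of_calculus) auto
  moreover have "?h 1 = ?h 0" using gamma_periodic[of 0] by simp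
  ultimately have "integral {0..1} ?h' = 0" by (simp add: integral_unique)
  moreover have "integral {0..1} ?h' =
      integral {0..1} (\<lambda>t. B (curve \<nu> t) (dcurve \<mu> t)) + integral {0..1} (\<lambda>t. B (curve \<mu> t) (dcurve \<nu> t))"
    unfolding B_sym[of "dcurve \<mu> _"]
    by (intro Henstock_Kurzweil_Integration.integral_add integrable_B[OF \<nu> dcurve[OF \<mu>]]
        integrable_B[OF \<mu> dcurve[OF \<nu>]])
  ultimately show ?thesis
    unfolding bp_eq[OF dcurve[OF \<nu>]] bp_eq[OF dcurve[OF \<mu>]]
    by (simp add: add_eq_0_iff)
qed

lemma bp_add_right:
  assumes "\<mu> \<in> G" "\<nu> \<in> G" "\<nu>' \<in> G"
  shows "bp \<mu> (\<nu> + \<nu>') = bp \<mu> \<nu> + bp \<mu> \<nu>'"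
proof -
  have "\<nu> + \<nu>' \<in> G" using assms by (intro complex_vector.subspace_add[OF subspace_regular_on])
  then show ?thesis
    using bp_antisym[OF assms(1)] bp_add_left[OF assms(2,3,1)] assms by simp
qed

lemma bp_scaleC_right:
  assumes "\<mu> \<in> G" "\<nu> \<in> G"
  shows "bp \<mu> (c *\<^sub>C \<nu>) = c * bp \<mu> \<nu>"
proof -
  have "c *\<^sub>C \<nu> \<in> G" using assms by (intro complex_vector.subspace_scale[OF subspace_regular_on])
  then show ?thesis
    using bp_antisym[OF assms(1)] bp_scaleC_left[OF assms(2,1)] assms by simp
qed

text \<open>The cocycle identity, which holds pointwise by the product rule and the invariance of the
  form.\<close>

lemma bp_cocycle:
  assumes \<nu>: "\<nu> \<in> G" and \<alpha>: "\<alpha> \<in> G" and \<beta>: "\<beta> \<in> G"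
  shows "bp \<nu> (lie \<alpha> \<beta>) = bp (lie \<nu> \<alpha>) \<beta> - bp (lie \<nu> \<beta>) \<alpha>"
proof -
  have "C1_with (curve (lie \<alpha> \<beta>)) (\<lambda>t. lie (dcurve \<alpha> t) (curve \<beta> t) + lie (curve \<alpha> t) (dcurve \<beta> t))"
    unfolding curve_lie[OF \<alpha> \<beta>] by (rule C1_with_bilin[OF bilin_lie dcurve[OF \<alpha>] dcurve[OF \<beta>]])
  note 1 = bp_eq[OF this, of \<nu>]
  have neg: "B x (- y) = - B x y" for x y
    using B_simps(2)[of x y "- y"] by (simp add: B_simps(6) eq_neg_iff_add_eq_0 add.commute)
  have pt: "B (curve \<nu> t) (lie (dcurve \<alpha> t) (curve \<beta> t) + lie (curve \<alpha> t) (dcurve \<beta> t)) =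
      B (curve (lie \<nu> \<alpha>) t) (dcurve \<beta> t) - B (curve (lie \<nu> \<beta>) t) (dcurve \<alpha> t)" for t
    unfolding mero_value_lie[OF \<nu> \<alpha> gamma_bd] mero_value_lie[OF \<nu> \<beta> gamma_bd] B_inv B_simps(2)
    by (subst lie_antisym[of "dcurve \<alpha> t"]) (simp add: neg)
  show ?thesis
    unfolding 1 pt bp_eq[OF dcurve[OF \<alpha>]] bp_eq[OF dcurve[OF \<beta>]]
      Henstock_Kurzweil_Integration.integral_diff[OF integrable_B[OF G_lie[OF \<nu> \<alpha>] dcurve[OF \<beta>]]
        integrable_B[OF G_lie[OF \<nu> \<beta>] dcurve[OF \<alpha>]]]
    by (rule right_diff_distrib)
qed

lemma bp_const_right: "bp \<mu> (const_mero x) = 0"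
proof -
  have "C1_with (curve (const_mero x)) (\<lambda>_. 0)" using C1_with_const[of x] by simp
  from bp_eq[OF this] show ?thesis by (simp add: B_simps)
qed

lemma bp_const_left: "\<nu> \<in> G \<Longrightarrow> bp (const_mero x) \<nu> = 0"
  using bp_antisym[of "const_mero x" \<nu>] by (simp add: bp_const_right)

text \<open>Cauchy's theorem, for maps with a single pole. If \<open>q\<close> is not \<open>p\<close>, the coordinate \<open>coord q\<close>
  is a function of \<open>coord p\<close> that is holomorphic except at \<open>c = coord p q\<close>, around which the
  boundary curve has winding number zero in the coordinate \<open>coord p\<close>.\<close>

lemma bp_pole_map:
  assumes K: "connectedin proj_line K" "K \<inter> bd = {}" and pq: "p \<in> K" "q \<in> K" and l: "l \<ge> 1"
  shows "bp (pole_map p k x) (pole_map q l y) = 0"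
proof -
  have pbd: "p \<notin> bd" "q \<notin> bd" using K pq by auto
  define u where "u = (\<lambda>s. coord p (\<gamma> s))"
  define v where "v = (\<lambda>s. coord q (\<gamma> s))"
  obtain u' where u': "\<And>t. (u has_vector_derivative u' t) (at t)" "continuous_on UNIV u'"
    unfolding u_def using coord_gamma_C1[OF pbd(1)] by blast
  have path: "path u" "pathfinish u = pathstart u"
    unfolding u_def by (rule coord_gamma_path[OF pbd(1)])+
  have img: "path_image u = coord p ` bd" unfolding u_def by (rule coord_gamma_image)
  have valid: "valid_path u"
    unfolding valid_path_def
    by (intro C1_differentiable_imp_piecewise)
      (use u' in \<open>auto simp: C1_differentiable_on_def intro: continuous_on_subset\<close>)
  \<comment> \<open>\<open>V\<close> expresses \<open>v\<close> as a function of \<open>u\<close>. For \<open>q = p\<close> it is the identity, with no point removed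
    from the plane.\<close>
  have "\<exists>V V' S. open S \<and> path_image u \<subseteq> S \<and> (\<forall>w. w \<notin> S \<longrightarrow> winding_number u w = 0) \<and>
      V' holomorphic_on S \<and> (\<forall>w\<in>S. (V has_field_derivative V' w) (at w)) \<and> v = V \<circ> u"
  proof (cases "q = p")
    case True
    show ?thesis
      by (intro exI[of _ "\<lambda>w. w"] exI[of _ "\<lambda>_. 1"] exI[of _ UNIV])
        (auto simp: v_def u_def True)
  next
    case False
    define c where "c = coord p q"
    obtain A A' where A: "\<And>r. r \<noteq> p \<Longrightarrow> r \<noteq> q \<Longrightarrow> coord q r = A / (coord p r - c) + A'"
      unfolding c_def using coord_moebius[OF False] by blast
    have c: "c \<notin> path_image u"
    proof
      assume "c \<in> path_image u"
      then obtain r where "r \<in> bd" "coord p q = coord p r" unfolding img c_def by blast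
      then show False using coord_inj[of p q r] False pbd by auto
    qed
    have "winding_number u c = 0" unfolding c_def
    proof (rule winding_number_coord_eq_0[OF K(1) pq False path])
      fix s assume s: "s \<in> K" "s \<noteq> p"
      show "coord p s \<notin> path_image u"
      proof
        assume "coord p s \<in> path_image u"
        then obtain r where "r \<in> bd" "coord p s = coord p r" unfolding img by blast
        then show False using coord_inj[of p s r] s K(2) pbd by auto
      qed
    qed
    then have "\<forall>w. w \<notin> - {c} \<longrightarrow> winding_number u w = 0" by simp
    moreover have "v = (\<lambda>w. A / (w - c) + A') \<circ> u"
      unfolding v_def u_def comp_def using A gamma_bd pbd by (intro ext) metis
    moreover have "((\<lambda>w. A / (w - c) + A') has_field_derivative - A / (w - c)^2) (at w)" if "w \<in> - {c}" for w
      using that by (auto intro!: derivative_eq_intros simp: power2_eq_square)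
    moreover have "(\<lambda>w. - A / (w - c)^2) holomorphic_on - {c}"
      by (intro holomorphic_intros) auto
    ultimately show ?thesis using c
      by (intro exI[of _ "\<lambda>w. A / (w - c) + A'"] exI[of _ "\<lambda>w. - A / (w - c)^2"] exI[of _ "- {c}"]) auto
  qed
  then obtain V V' S where S: "open S" "path_image u \<subseteq> S" "\<And>w. w \<notin> S \<Longrightarrow> winding_number u w = 0"
    and V: "V' holomorphic_on S" "\<And>w. w \<in> S \<Longrightarrow> (V has_field_derivative V' w) (at w)" "v = V \<circ> u"
    by blast
  define h where "h w = w ^ k * (of_nat l * V w ^ (l - 1) * V' w)" for w
  have "V holomorphic_on S"
    unfolding holomorphic_on_open[OF S(1)] using V(2) by blast
  then have "h holomorphic_on S" unfolding h_def by (intro holomorphic_intros V(1))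
  then have "(h has_contour_integral 0) u"
    by (rule Cauchy_theorem_global[OF S(1) _ valid path(2)]) (use S in auto)
  then have int0: "((\<lambda>t. h (u t) * vector_derivative u (at t)) has_integral 0) {0..1}"
    unfolding has_contour_integral .
  have u_in: "u t \<in> S" for t
  proof -
    have "u t \<in> path_image u" unfolding img unfolding u_def by (intro imageI gamma_bd)
    then show ?thesis by (rule subsetD[OF S(2)])
  qed
  define d where "d t = u' t * (of_nat l * V (u t) ^ (l - 1) * V' (u t))" for t
  have d: "((\<lambda>s. v s ^ l) has_vector_derivative d t) (at t)" for t
  proof -
    have "((\<lambda>w. V w ^ l) has_field_derivative (of_nat l * V (u t) ^ (l - 1) * V' (u t))) (at (u t))"
      using DERIV_power[OF V(2)[OF u_in[of t]], of l] by (simp add: One_nat_def ac_simps)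
    from field_vector_diff_chain_at[OF u'(1) this] show ?thesis
      by (simp add: d_def comp_def V(3))
  qed
  have neq: "\<gamma> t \<noteq> p" "\<gamma> t \<noteq> q" for t using gamma_bd[of t] pbd by auto
  have curve_q: "curve (pole_map q l y) = (\<lambda>t. v t ^ l *\<^sub>C y)"
    unfolding v_def by (rule ext) (rule mero_value_pole_map[OF neq(2)])
  have curve_p: "mero_value (pole_map p k x) (\<gamma> t) = u t ^ k *\<^sub>C x" for t
    unfolding u_def by (rule mero_value_pole_map[OF neq(1)])
  have ucont: "continuous_on UNIV u"
    using u'(1) has_vector_derivative_continuous by (blast intro: continuous_at_imp_continuous_on)
  have "continuous_on UNIV (\<lambda>t. V' (u t))"
    by (rule continuous_on_compose2[OF holomorphic_on_imp_continuous_on[OF V(1)] ucont]) (use u_in in blast)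
  moreover have "continuous_on UNIV (\<lambda>t. V (u t))"
    by (rule continuous_on_compose2[OF holomorphic_on_imp_continuous_on[OF \<open>V holomorphic_on S\<close>] ucont])
      (use u_in in blast)
  ultimately have "continuous_on UNIV d" unfolding d_def by (intro continuous_intros u')
  then have "C1_with (curve (pole_map q l y)) (\<lambda>t. d t *\<^sub>C y)"
    unfolding curve_q by (rule C1_with.single[OF d])
  from bp_eq[OF this, of "pole_map p k x"]
  have "bp (pole_map p k x) (pole_map q l y) = 1 / (2 * of_real pi * \<i>) *
      integral {0..1} (\<lambda>t. B (u t ^ k *\<^sub>C x) (d t *\<^sub>C y))"
    unfolding curve_p .
  moreover have "B (u t ^ k *\<^sub>C x) (d t *\<^sub>C y) = h (u t) * vector_derivative u (at t) * B x y" for t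
    using vector_derivative_at[OF u'(1), of t]
    by (simp add: B_simps scaleC_complex_def d_def h_def)
  ultimately show ?thesis using integral_unique[OF int0] by simp
qed

text \<open>The pairing vanishes if all poles lie in one connected set that avoids the boundary, by
  bilinearity and partial fractions.\<close>

lemma bp_eq_0:
  assumes K: "connectedin proj_line K" "K \<inter> bd = {}"
    and \<mu>: "\<mu> \<in> regular_on (- K)" and \<nu>: "\<nu> \<in> regular_on (- K)"
  shows "bp \<mu> \<nu> = 0"
proof -
  have frac_G: "fractions (- K) \<subseteq> G"
    using fractions_subset[of "- K"] K(2) by (fastforce simp: regular_on_def)
  have frac: "bp \<alpha> \<beta> = 0" if "\<alpha> \<in> fractions (- K)" "\<beta> \<in> fractions (- K)" for \<alpha> \<beta>
  proof -
    have "\<beta> \<in> G" by (rule subsetD[OF frac_G that(2)])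
    then show ?thesis
      using that unfolding fractions_def
      by (elim UnE imageE CollectE exE conjE)
        (simp_all add: bp_const_left bp_const_right bp_pole_map[OF K])
  qed
  note sub = complex_vector.subspace_0[OF subspace_regular_on] complex_vector.subspace_add[OF subspace_regular_on]
    complex_vector.subspace_scale[OF subspace_regular_on]
  have 1: "\<nu> \<in> G \<and> bp \<alpha> \<nu> = 0" if "\<alpha> \<in> fractions (- K)" for \<alpha>
  proof -
    have \<alpha>: "\<alpha> \<in> G" by (rule subsetD[OF frac_G that])
    have "\<nu> \<in> complex_vector.span (fractions (- K))" using \<nu> by (simp only: regular_on_eq_span)
    then show ?thesis
    proof (induction rule: complex_vector.span_induct_alt)
      case base
      show ?case using bp_const_right[of \<alpha> 0] by (simp add: const_mero_0 sub)
    next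
      case (step c \<beta> \<beta>')
      have "\<beta> \<in> G" by (rule subsetD[OF frac_G step(1)])
      then show ?case
        using \<alpha> step frac[OF that] by (simp add: bp_add_right bp_scaleC_right sub)
    qed
  qed
  have \<nu>G: "\<nu> \<in> G" using 1[OF const_in_fractions] by blast
  have "\<mu> \<in> complex_vector.span (fractions (- K))" using \<mu> by (simp only: regular_on_eq_span)
  then have "\<mu> \<in> G \<and> bp \<mu> \<nu> = 0"
  proof (induction rule: complex_vector.span_induct_alt)
    case base
    show ?case using bp_const_left[OF \<nu>G, of 0] by (simp add: const_mero_0 sub)
  next
    case (step c \<beta> \<beta>')
    have "\<beta> \<in> G" by (rule subsetD[OF frac_G step(1)])
    then show ?case
      using \<nu>G step 1 by (simp add: bp_add_left bp_scaleC_left sub)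
  qed
  then show ?thesis by blast
qed

lemma bp_eq_0_poles_in_D:
  "\<mu> \<in> regular_on (- D) \<Longrightarrow> \<nu> \<in> regular_on (- D) \<Longrightarrow> bp \<mu> \<nu> = 0"
  by (rule bp_eq_0[OF D_connected]) (auto simp: bd_eq)

lemma bp_eq_0_poles_in_exterior:
  assumes "\<mu> \<in> regular_on (- exterior D)" "\<nu> \<in> regular_on (- exterior D)"
  shows "bp \<mu> \<nu> = 0"
proof -
  obtain S where S: "connectedin proj_line S" "exterior D \<subseteq> S" "S \<inter> bd = {}"
    by (rule exterior_in_connected)
  then show ?thesis
    using assms by (intro bp_eq_0[OF S(1,3)]) (auto simp: regular_on_def)
qed

end

section \<open>The induced module as a subspace of a vector space\<close>

instantiation prod :: (complex_vector, complex_vector) complex_vector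
begin
definition scaleC_prod :: "complex \<Rightarrow> 'a \<times> 'b \<Rightarrow> 'a \<times> 'b" where
  "scaleC_prod c x = (c *\<^sub>C fst x, c *\<^sub>C snd x)"
instance by standard (auto simp: scaleC_prod_def prod_eq_iff scaleC_add_right scaleC_add_left
    scaleC_scaleC scaleC_one)
end

instantiation "fun" :: (type, complex_vector) complex_vector
begin
definition scaleC_fun :: "complex \<Rightarrow> ('a \<Rightarrow> 'b) \<Rightarrow> 'a \<Rightarrow> 'b" where
  "scaleC_fun c f = (\<lambda>x. c *\<^sub>C f x)"
instance by standard (auto simp: scaleC_fun_def fun_eq_iff scaleC_add_right scaleC_add_left
    scaleC_scaleC scaleC_one)
end

lemma fst_scaleC [simp]: "fst (c *\<^sub>C x) = c *\<^sub>C fst x"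
  and snd_scaleC [simp]: "snd (c *\<^sub>C x) = c *\<^sub>C snd x"
  by (simp_all add: scaleC_prod_def)

lemma scaleC_fun_apply [simp]: "(c *\<^sub>C f) x = c *\<^sub>C f x"
  by (simp add: scaleC_fun_def)

context ind_ctx
begin

text \<open>The induced module is identified with a subspace \<open>vs\<close> of the free vector space on the basis of \<open>F2\<close>
  by \<open>iota\<close>, with inverse \<open>kappa\<close>; so vectors can be added and subtracted as elements of a type, and
  families of them are again vectors. In \<open>vs\<close>, \<open>proj g\<close> is the class of \<open>g\<close>, \<open>vs_act\<close> the action
  of \<open>L\<close>, and \<open>tens w\<close> the image of a pure tensor.\<close>

definition iota where
  "iota = (SOME \<iota> :: ('g, 'w) ind_elem \<Rightarrow> ('g mero env_elem \<times> 'w tensor_elem \<Rightarrow>\<^sub>0 complex). inj_on \<iota> (carrier V.Q) \<and>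
     (\<forall>A\<in>carrier V.Q. \<forall>B\<in>carrier V.Q. \<iota> (A \<oplus>\<^bsub>V.Q\<^esub> B) = \<iota> A + \<iota> B) \<and>
     (\<forall>c. \<forall>A\<in>carrier V.Q. \<iota> (c \<odot>\<^bsub>V.Q\<^esub> A) = c *\<^sub>C \<iota> A))"

lemma iota:
  "inj_on iota (carrier V.Q)"
  "A \<in> carrier V.Q \<Longrightarrow> A' \<in> carrier V.Q \<Longrightarrow> iota (A \<oplus>\<^bsub>V.Q\<^esub> A') = iota A + iota A'"
  "A \<in> carrier V.Q \<Longrightarrow> iota (c \<odot>\<^bsub>V.Q\<^esub> A) = c *\<^sub>C iota A"
  using someI_ex[OF V.ex_section] unfolding iota_def[symmetric] by simp_all

definition vs where "vs = iota ` carrier V.Q"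

definition kappa where "kappa = inv_into (carrier V.Q) iota"

definition proj where "proj g = iota (V.cl g)"

definition vs_act where "vs_act \<alpha> v = iota (ind_act n W \<rho> D \<alpha> (kappa v))"

definition tens where "tens w = proj (itens w)"

lemma kappa_iota: "A \<in> carrier V.Q \<Longrightarrow> kappa (iota A) = A"
  unfolding kappa_def by (rule inv_into_f_f[OF iota(1)])

lemma iota_kappa: "v \<in> vs \<Longrightarrow> iota (kappa v) = v"
  unfolding kappa_def vs_def by (rule f_inv_into_f)

lemma kappa_closed: "v \<in> vs \<Longrightarrow> kappa v \<in> carrier V.Q"
  unfolding kappa_def vs_def by (rule inv_into_into)

lemma iota_closed: "A \<in> carrier V.Q \<Longrightarrow> iota A \<in> vs"
  unfolding vs_def by (rule imageI)

lemma proj_vs: "g \<in> carrier F2 \<Longrightarrow> proj g \<in> vs"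
  unfolding proj_def by (intro iota_closed V.carrier_Q_I)

lemma vs_E:
  assumes "v \<in> vs" obtains g where "g \<in> carrier F2" "v = proj g"
  using assms unfolding vs_def proj_def V.carrier_Q by blast

lemma proj_add: "g \<in> carrier F2 \<Longrightarrow> h \<in> carrier F2 \<Longrightarrow> proj (g + h) = proj g + proj h"
  unfolding proj_def by (simp only: V.add_Q[symmetric] iota(2) V.carrier_Q_I)

lemma proj_scaleC: "g \<in> carrier F2 \<Longrightarrow> proj (c *\<^sub>C g) = c *\<^sub>C proj g"
  unfolding proj_def by (simp only: V.smult_Q[symmetric] iota(3) V.carrier_Q_I)

lemma proj_0: "proj 0 = 0"
  using proj_scaleC[OF F2.closed(1), of 0] by (simp add: complex_vector.scale_zero_left)

lemma proj_diff: "g \<in> carrier F2 \<Longrightarrow> h \<in> carrier F2 \<Longrightarrow> proj (g - h) = proj g - proj h"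
  using proj_add[of "g - h" h] F2.closed(3)[of g h] by simp

lemma proj_sum: "(\<And>i. i \<in> I \<Longrightarrow> g i \<in> carrier F2) \<Longrightarrow> proj (\<Sum>i\<in>I. g i) = (\<Sum>i\<in>I. proj (g i))"
proof (induction I rule: infinite_finite_induct)
  case (insert i I)
  have "(\<Sum>i\<in>I. g i) \<in> carrier F2"
    using insert.prems by (intro complex_vector.subspace_sum F2.carrier_subspace) auto
  then show ?case using insert by (simp add: proj_add)
qed (simp_all add: proj_0)

lemma proj_T2: "g \<in> T2 \<Longrightarrow> proj g = 0"
proof -
  assume "g \<in> T2"
  then have "V.cl g = V.cl 0" by (simp add: V.cl_eq_iff)
  then show "proj g = 0" using proj_0 by (simp add: proj_def)
qed

lemma proj_cong: "V.cl g = V.cl h \<Longrightarrow> proj g = proj h"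
  by (simp add: proj_def)

lemma proj_eqD: "g \<in> carrier F2 \<Longrightarrow> h \<in> carrier F2 \<Longrightarrow> proj g = proj h \<Longrightarrow> V.cl g = V.cl h"
  unfolding proj_def by (rule inj_onD[OF iota(1)]) (simp_all add: V.carrier_Q_I)

lemma vs_subspace: "complex_vector.subspace vs"
proof (rule complex_vector.subspaceI)
  show "0 \<in> vs" using proj_vs[OF F2.closed(1)] by (simp only: proj_0)
  show "x + y \<in> vs" if x: "x \<in> vs" and y: "y \<in> vs" for x y
  proof -
    obtain g where "g \<in> carrier F2" "x = proj g" using x by (rule vs_E)
    moreover obtain h where "h \<in> carrier F2" "y = proj h" using y by (rule vs_E)
    ultimately show ?thesis using proj_vs[OF F2.closed(2), of g h] by (simp only: proj_add)
  qed
  show "c *\<^sub>C x \<in> vs" if x: "x \<in> vs" for c x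
  proof -
    obtain g where "g \<in> carrier F2" "x = proj g" using x by (rule vs_E)
    then show ?thesis using proj_vs[OF F2.closed(4), of g c] by (simp only: proj_scaleC)
  qed
qed

lemma vs_act_proj: "\<alpha> \<in> L \<Longrightarrow> g \<in> carrier F2 \<Longrightarrow> vs_act \<alpha> (proj g) = proj (iact \<alpha> g)"
  unfolding vs_act_def proj_def by (simp only: kappa_iota V.carrier_Q_I ind_act_cl)

lemma iota_ind_act: "\<alpha> \<in> L \<Longrightarrow> A \<in> carrier V.Q \<Longrightarrow> iota (ind_act n W \<rho> D \<alpha> A) = vs_act \<alpha> (iota A)"
  by (simp only: vs_act_def kappa_iota)

lemma ind_act_closed: "\<alpha> \<in> L \<Longrightarrow> A \<in> carrier V.Q \<Longrightarrow> ind_act n W \<rho> D \<alpha> A \<in> carrier V.Q"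
  by (elim V.carrier_Q_E) (simp only: ind_act_cl iact_F2 V.carrier_Q_I)

lemma iota_minus:
  assumes "A \<in> carrier V.Q" "A' \<in> carrier V.Q"
  shows "iota (A \<ominus>\<^bsub>V.Q\<^esub> A') = iota A - iota A'"
proof -
  obtain g where "g \<in> carrier F2" "A = V.cl g" using assms(1) by (rule V.carrier_Q_E)
  moreover obtain h where "h \<in> carrier F2" "A' = V.cl h" using assms(2) by (rule V.carrier_Q_E)
  ultimately show ?thesis using proj_diff[of g h] by (simp only: V.minus_Q proj_def)
qed

lemma tens_vs: "w \<in> PW \<Longrightarrow> tens w \<in> vs"
  unfolding tens_def by (intro proj_vs itens_F2)

lemma ind_tensor_itens: "ind_tensor n W \<rho> D w = V.cl (itens w)"
  unfolding itens_def by (rule ind_tensor_eq)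

lemma iota_ind_tensor: "iota (ind_tensor n W \<rho> D w) = tens w"
  unfolding tens_def proj_def ind_tensor_itens ..

lemma ind_tensor_closed: "w \<in> PW \<Longrightarrow> ind_tensor n W \<rho> D w \<in> carrier V.Q"
  unfolding ind_tensor_itens by (intro V.carrier_Q_I itens_F2)

lemma iota_finsum_tensor:
  assumes "\<And>k. k \<in> K \<Longrightarrow> w k \<in> PW"
  shows "iota (\<Oplus>\<^bsub>V.Q\<^esub>k\<in>K. ind_tensor n W \<rho> D (w k)) = (\<Sum>k\<in>K. tens (w k))"
    and "(\<Oplus>\<^bsub>V.Q\<^esub>k\<in>K. ind_tensor n W \<rho> D (w k)) \<in> carrier V.Q"
proof -
  have eq: "(\<Oplus>\<^bsub>V.Q\<^esub>k\<in>K. ind_tensor n W \<rho> D (w k)) = V.cl (\<Sum>k\<in>K. itens (w k))"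
    unfolding ind_tensor_itens by (rule V.finsum_Q) (intro itens_F2 assms)
  show "iota (\<Oplus>\<^bsub>V.Q\<^esub>k\<in>K. ind_tensor n W \<rho> D (w k)) = (\<Sum>k\<in>K. tens (w k))"
    unfolding eq tens_def by (subst proj_sum[symmetric]) (simp_all add: proj_def itens_F2 assms)
  show "(\<Oplus>\<^bsub>V.Q\<^esub>k\<in>K. ind_tensor n W \<rho> D (w k)) \<in> carrier V.Q"
    unfolding eq by (intro V.carrier_Q_I complex_vector.subspace_sum F2.carrier_subspace itens_F2 assms)
qed

lemma tens_multilinear: "multilinear_mod {0} n W tens"
  unfolding multilinear_mod_def
proof (intro conjI ballI allI)
  fix w k u v assume w: "w \<in> PW" "k \<in> {1..n}" and u: "u \<in> W k" and v: "v \<in> W k"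
  have uv: "u + v \<in> W k" by (rule complex_vector.subspace_add[OF W_subspace[OF w(2)] u v])
  have "proj (itens (w(k := u + v)) - itens (w(k := u)) - itens (w(k := v))) = 0"
    by (intro proj_T2 multilinear_modD(1)[OF itens_multilinear w u v])
  then show "tens (w(k := u + v)) - tens (w(k := u)) - tens (w(k := v)) \<in> {0}"
    by (simp add: tens_def proj_diff F2.closed itens_F2 upd_PW[OF w] u v uv)
next
  fix w k c u assume w: "w \<in> PW" "k \<in> {1..n}" and u: "u \<in> W k"
  have cu: "c *\<^sub>C u \<in> W k" by (rule complex_vector.subspace_scale[OF W_subspace[OF w(2)] u])
  have "proj (itens (w(k := c *\<^sub>C u)) - c *\<^sub>C itens (w(k := u))) = 0"
    by (intro proj_T2 multilinear_modD(2)[OF itens_multilinear w u])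
  then show "tens (w(k := c *\<^sub>C u)) - c *\<^sub>C tens (w(k := u)) \<in> {0}"
    by (simp add: tens_def proj_diff proj_scaleC F2.closed itens_F2 upd_PW[OF w] u cu)
qed

lemma vs_act_const: "w \<in> PW \<Longrightarrow> vs_act (const_mero x) (tens w) = slot_sum tens {1..n} (\<lambda>k. \<rho> k x) w"
proof -
  assume w: "w \<in> PW"
  have "vs_act (const_mero x) (tens w) = proj (iact (const_mero x) (itens w))"
    unfolding tens_def by (rule vs_act_proj) (simp_all add: itens_F2 w)
  also have "\<dots> = proj (slot_sum itens {1..n} (\<lambda>k. \<rho> k x) w)"
    by (rule proj_cong) (rule iact_const_itens[OF w])
  also have "\<dots> = slot_sum tens {1..n} (\<lambda>k. \<rho> k x) w"
    unfolding slot_sum_def tens_def by (rule proj_sum) (intro itens_F2 upd_rho_PW w)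
  finally show ?thesis .
qed

lemma lie_rep_vs_act: "lie_rep_mod L vs_act vs {0}"
proof -
  have L_add: "\<alpha> + \<beta> \<in> L" if "\<alpha> \<in> L" "\<beta> \<in> L" for \<alpha> \<beta>
    by (rule complex_vector.subspace_add[OF P.L_subspace that])
  have L_scale: "c *\<^sub>C \<alpha> \<in> L" if "\<alpha> \<in> L" for c \<alpha>
    by (rule complex_vector.subspace_scale[OF P.L_subspace that])
  show ?thesis
  proof unfold_locales
    fix \<alpha> \<beta> c e e' assume \<alpha>: "\<alpha> \<in> L" and \<beta>: "\<beta> \<in> L" and e: "e \<in> vs" and e': "e' \<in> vs"
    obtain g where g: "g \<in> carrier F2" "e = proj g" using e by (rule vs_E)
    obtain h where h: "h \<in> carrier F2" "e' = proj h" using e' by (rule vs_E)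
    note cl = F2.closed VR.act_E
    show "vs_act \<alpha> e \<in> vs" using g \<alpha> by (simp only: vs_act_proj proj_vs VR.act_E)
    show "vs_act \<alpha> (e + e') = vs_act \<alpha> e + vs_act \<alpha> e'"
      using g h \<alpha> by (simp only: proj_add[symmetric] vs_act_proj cl VR.act_add)
    show "vs_act \<alpha> (c *\<^sub>C e) = c *\<^sub>C vs_act \<alpha> e"
      using g \<alpha> by (simp only: proj_scaleC[symmetric] vs_act_proj cl VR.act_scaleC)
    show "vs_act (\<alpha> + \<beta>) e - vs_act \<alpha> e - vs_act \<beta> e \<in> {0}"
      using proj_T2[OF VR.act_add_left[OF \<alpha> \<beta> g(1)]] g \<alpha> \<beta> L_add[OF \<alpha> \<beta>]
      by (simp only: vs_act_proj proj_diff cl) simp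
    show "vs_act (c *\<^sub>C \<alpha>) e - c *\<^sub>C vs_act \<alpha> e \<in> {0}"
      using proj_T2[OF VR.act_scaleC_left[OF \<alpha> g(1), of c]] g \<alpha> L_scale[OF \<alpha>]
      by (simp only: vs_act_proj proj_diff proj_scaleC cl) simp
    show "vs_act \<alpha> (vs_act \<beta> e) - vs_act \<beta> (vs_act \<alpha> e) - vs_act (lie \<alpha> \<beta>) e \<in> {0}"
      using proj_T2[OF VR.act_lie[OF \<alpha> \<beta> g(1)]] g \<alpha> \<beta> P.L_lie[OF \<alpha> \<beta>]
      by (simp only: vs_act_proj proj_diff cl) simp
  next
    fix \<alpha> e assume \<alpha>: "\<alpha> \<in> L" and "e \<in> {0 :: ('g mero env_elem \<times> 'w tensor_elem) \<Rightarrow>\<^sub>0 complex}"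
    then have e: "e = 0" by simp
    have "vs_act \<alpha> 0 = proj (iact \<alpha> 0)" using vs_act_proj[OF \<alpha> F2.closed(1)] by (simp only: proj_0)
    also have "iact \<alpha> 0 = 0" unfolding iact_def by (rule lin_ext_0)
    finally have "vs_act \<alpha> 0 = 0" by (simp only: proj_0)
    then show "vs_act \<alpha> e \<in> {0}" by (simp add: e)
  qed (simp_all only: vs_subspace complex_vector.subspace_0[OF vs_subspace] singleton_iff subset_iff
      complex_vector.subspace_single_0 HOL.simp_thms ball_simps)
qed

sublocale AV: lie_rep_mod L vs_act vs "{0}"
  by (rule lie_rep_vs_act)

lemma vs_act_add_left: "\<alpha> \<in> L \<Longrightarrow> \<beta> \<in> L \<Longrightarrow> v \<in> vs \<Longrightarrow> vs_act (\<alpha> + \<beta>) v = vs_act \<alpha> v + vs_act \<beta> v"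
  using AV.act_add_left[of \<alpha> \<beta> v] by (simp add: algebra_simps)

lemma vs_act_scaleC_left: "\<alpha> \<in> L \<Longrightarrow> v \<in> vs \<Longrightarrow> vs_act (c *\<^sub>C \<alpha>) v = c *\<^sub>C vs_act \<alpha> v"
  using AV.act_scaleC_left[of \<alpha> v c] by simp

lemma vs_act_lie: "\<alpha> \<in> L \<Longrightarrow> \<beta> \<in> L \<Longrightarrow> v \<in> vs \<Longrightarrow> vs_act (lie \<alpha> \<beta>) v = vs_act \<alpha> (vs_act \<beta> v) - vs_act \<beta> (vs_act \<alpha> v)"
  using AV.act_lie[of \<alpha> \<beta> v] by simp

lemma vs_act_sum:
  assumes "\<alpha> \<in> L" "\<And>i. i \<in> I \<Longrightarrow> f i \<in> vs"
  shows "vs_act \<alpha> (\<Sum>i\<in>I. f i) = (\<Sum>i\<in>I. vs_act \<alpha> (f i))"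
  using assms(2)
proof (induction I rule: infinite_finite_induct)
  case (insert i I)
  have "(\<Sum>i\<in>I. f i) \<in> vs"
    using insert.prems by (intro complex_vector.subspace_sum vs_subspace) auto
  then show ?case using insert by (simp add: AV.act_add[OF assms(1)])
qed (use AV.act_S[OF assms(1)] in simp_all)

lemma vs_generated [consumes 1, case_names zero add scale act tens]:
  assumes "v \<in> vs" "P 0"
    and "\<And>u v. u \<in> vs \<Longrightarrow> v \<in> vs \<Longrightarrow> P u \<Longrightarrow> P v \<Longrightarrow> P (u + v)"
    and "\<And>c v. v \<in> vs \<Longrightarrow> P v \<Longrightarrow> P (c *\<^sub>C v)"
    and "\<And>\<alpha> v. \<alpha> \<in> L \<Longrightarrow> v \<in> vs \<Longrightarrow> P v \<Longrightarrow> P (vs_act \<alpha> v)"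
    and "\<And>w. w \<in> PW \<Longrightarrow> P (tens w)"
  shows "P v"
proof -
  obtain g where g: "g \<in> carrier F2" "v = proj g" using assms(1) by (rule vs_E)
  have "P (proj g)"
  proof (rule ind_generated[OF g(1), of "\<lambda>g. P (proj g)"])
    show "P (proj h)" if "V.cl g = V.cl h" "P (proj g)" for g h using that proj_cong by metis
    show "P (proj 0)" using assms(2) by (simp add: proj_0)
    show "P (proj (g + h))" if "g \<in> carrier F2" "h \<in> carrier F2" "P (proj g)" "P (proj h)" for g h
      unfolding proj_add[OF that(1,2)] by (intro assms(3) proj_vs that)
    show "P (proj (c *\<^sub>C g))" if "g \<in> carrier F2" "P (proj g)" for c g
      unfolding proj_scaleC[OF that(1)] by (intro assms(4) proj_vs that)
    show "P (proj (iact \<alpha> g))" if "\<alpha> \<in> L" "g \<in> carrier F2" "P (proj g)" for \<alpha> g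
      unfolding vs_act_proj[OF that(1,2), symmetric] by (intro assms(5) proj_vs that)
    show "P (proj (itens w))" if "w \<in> PW" for w
      unfolding tens_def[symmetric] by (intro assms(6) that)
  qed
  then show ?thesis using g by simp
qed

lemma vs_universal:
  fixes act :: "'g mero \<Rightarrow> 'e::complex_vector \<Rightarrow> 'e"
  assumes "lie_rep_mod L act E {0}"
    and "multilinear_mod {0} n W \<Phi>" "\<And>w. w \<in> PW \<Longrightarrow> \<Phi> w \<in> E"
    and "\<And>x w. w \<in> PW \<Longrightarrow> act (const_mero x) (\<Phi> w) = slot_sum \<Phi> {1..n} (\<lambda>k. \<rho> k x) w"
  obtains \<Psi> where "\<And>v. v \<in> vs \<Longrightarrow> \<Psi> v \<in> E"
    "\<And>u v. u \<in> vs \<Longrightarrow> v \<in> vs \<Longrightarrow> \<Psi> (u + v) = \<Psi> u + \<Psi> v"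
    "\<And>c v. v \<in> vs \<Longrightarrow> \<Psi> (c *\<^sub>C v) = c *\<^sub>C \<Psi> v"
    "\<And>\<alpha> v. \<alpha> \<in> L \<Longrightarrow> v \<in> vs \<Longrightarrow> \<Psi> (vs_act \<alpha> v) = act \<alpha> (\<Psi> v)"
    "\<And>w. w \<in> PW \<Longrightarrow> \<Psi> (tens w) = \<Phi> w"
proof -
  obtain \<Psi> where E: "\<And>g. g \<in> carrier F2 \<Longrightarrow> \<Psi> g \<in> E" and T: "\<And>r. r \<in> T2 \<Longrightarrow> \<Psi> r = 0"
    and add: "\<And>g h. \<Psi> (g + h) = \<Psi> g + \<Psi> h" and scale: "\<And>c g. \<Psi> (c *\<^sub>C g) = c *\<^sub>C \<Psi> g"
    and act: "\<And>\<alpha> g. \<alpha> \<in> L \<Longrightarrow> g \<in> carrier F2 \<Longrightarrow> \<Psi> (iact \<alpha> g) = act \<alpha> (\<Psi> g)"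
    and tens: "\<And>w. w \<in> PW \<Longrightarrow> \<Psi> (itens w) = \<Phi> w"
    by (rule ind_universal[OF assms]) blast+
  define \<Psi>' where "\<Psi>' v = \<Psi> (SOME g. g \<in> carrier F2 \<and> proj g = v)" for v
  have \<Psi>': "\<Psi>' (proj g) = \<Psi> g" if g: "g \<in> carrier F2" for g
  proof -
    define h where "h = (SOME h. h \<in> carrier F2 \<and> proj h = proj g)"
    have h: "h \<in> carrier F2 \<and> proj h = proj g"
      unfolding h_def by (rule someI[of _ g]) (simp only: g simp_thms)
    then have "h - g \<in> T2" using proj_eqD[of h g] g by (simp only: V.cl_eq_iff)
    then have "\<Psi> h = \<Psi> g" using T[of "h - g"] add[of "h - g" g] by simp
    then show ?thesis by (simp only: \<Psi>'_def h_def)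
  qed
  show ?thesis
  proof (rule that[of \<Psi>'])
    show "\<Psi>' v \<in> E" if "v \<in> vs" for v
      using that by (elim vs_E) (simp only: \<Psi>' E)
    show "\<Psi>' (u + v) = \<Psi>' u + \<Psi>' v" if "u \<in> vs" "v \<in> vs" for u v
      using that by (elim vs_E) (simp only: proj_add[symmetric] \<Psi>' F2.closed add)
    show "\<Psi>' (c *\<^sub>C v) = c *\<^sub>C \<Psi>' v" if "v \<in> vs" for c v
      using that by (elim vs_E) (simp only: proj_scaleC[symmetric] \<Psi>' F2.closed scale)
    show "\<Psi>' (vs_act \<alpha> v) = act \<alpha> (\<Psi>' v)" if "\<alpha> \<in> L" "v \<in> vs" for \<alpha> v
      using that(2) by (elim vs_E) (simp only: vs_act_proj[OF that(1)] \<Psi>' iact_F2[OF that(1)] act[OF that(1)])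
    show "\<Psi>' (tens w) = \<Phi> w" if "w \<in> PW" for w
      unfolding tens_def by (simp only: \<Psi>' itens_F2 that tens)
  qed
qed

end

section \<open>The current operators\<close>

lemma lie_uminus_right: "lie x (- y) = - lie x y" for x y :: "'l::complex_lie_algebra"
  using lie_scaleC_right[of x "- 1" y]
  by (simp add: complex_vector.scale_minus_left scaleC_one)

lemma lie_derivation: "lie (lie x y) w = lie (lie x w) y + lie x (lie y w)"
  for x y w :: "'l::complex_lie_algebra"
proof -
  have "lie (lie x w) y = lie y (lie w x)"
    using lie_antisym[of "lie x w" y] lie_antisym[of x w] by (simp add: lie_uminus_right)
  moreover have "lie (lie x y) w = - lie w (lie x y)" by (rule lie_antisym)
  ultimately show ?thesis
    using jacobi[of x y w] by (simp add: minus_unique add.assoc eq_neg_iff_add_eq_0 add.left_commute add.commute)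
qed

lemma regular_on_mono: "S \<subseteq> S' \<Longrightarrow> \<nu> \<in> regular_on S' \<Longrightarrow> \<nu> \<in> regular_on S"
  by (auto simp: regular_on_def)

lemma sum_fun_apply: "(\<Sum>i\<in>I. f i) x = (\<Sum>i\<in>I. f i x)"
  for f :: "'i \<Rightarrow> 'a \<Rightarrow> 'b::ab_group_add"
  by (induction I rule: infinite_finite_induct) simp_all

text \<open>The complete setting. The maps in \<open>G2\<close> have all poles in the exterior, those in \<open>L\<close> all
  poles in \<open>D\<close>; \<open>KD\<close> and \<open>KE\<close> are the indices of the points that lie in \<open>D\<close> and in the exterior.\<close>

locale current_ctx = ind_ctx n W \<rho> D + form_ctx D \<gamma> B
  for n :: nat and W :: "nat \<Rightarrow> 'w::complex_vector set"
    and \<rho> :: "nat \<Rightarrow> 'g::complex_lie_algebra \<Rightarrow> 'w \<Rightarrow> 'w"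
    and D :: "complex option set" and \<gamma> :: "real \<Rightarrow> complex option"
    and B :: "'g \<Rightarrow> 'g \<Rightarrow> complex" +
  fixes z :: "nat \<Rightarrow> complex option"
  assumes z_off: "\<forall>k\<in>{1..n}. z k \<notin> bd"
begin

abbreviation G2 :: "'g mero set" where "G2 \<equiv> regular_on (- exterior D)"
definition KD :: "nat set" where "KD = {k \<in> {1..n}. z k \<in> D}"
definition KE :: "nat set" where "KE = {k \<in> {1..n}. z k \<in> exterior D}"

lemma KD_subset: "KD \<subseteq> {1..n}" and KE_subset: "KE \<subseteq> {1..n}"
  by (auto simp: KD_def KE_def)

lemma KD_KE: "KD \<union> KE = {1..n}" "KD \<inter> KE = {}" "KE \<inter> KD = {}"
  using z_off compl_bd D_exterior by (auto simp: KD_def KE_def)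

lemma z_KE: "z ` KE \<subseteq> - D" and z_KD: "z ` KD \<subseteq> - exterior D"
  using D_exterior by (auto simp: KD_def KE_def)

lemma L_G: "\<nu> \<in> L \<Longrightarrow> \<nu> \<in> G"
  by (rule regular_on_mono[of bd]) (auto simp: compl_D)

lemma G2_G: "\<nu> \<in> G2 \<Longrightarrow> \<nu> \<in> G"
  by (rule regular_on_mono[of bd]) (auto simp: compl_exterior)

lemma G_decomp:
  assumes "\<nu> \<in> G" obtains \<nu>1 \<nu>2 where "\<nu>1 \<in> L" "\<nu>2 \<in> G2" "\<nu> = \<nu>1 + \<nu>2"
proof -
  have "bd = - D \<inter> - exterior D" using compl_bd by blast
  then show ?thesis using assms that regular_on_Int_decompose[of \<nu> "- D" "- exterior D"] by metis
qed

lemma L_G2_const: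
  assumes "\<nu> \<in> L" "\<nu> \<in> G2" obtains x where "\<nu> = const_mero x"
proof (rule regular_everywhere_const)
  show "\<nu> \<in> regular_on UNIV" using assms D_exterior by (auto simp: regular_on_def)
qed

lemma G_add: "\<mu> \<in> G \<Longrightarrow> \<nu> \<in> G \<Longrightarrow> \<mu> + \<nu> \<in> G"
  and G_scaleC: "\<mu> \<in> G \<Longrightarrow> c *\<^sub>C \<mu> \<in> G"
  and G_0: "0 \<in> G"
  by (rule complex_vector.subspace_add[OF subspace_regular_on] complex_vector.subspace_scale[OF subspace_regular_on]
      complex_vector.subspace_0[OF subspace_regular_on]; assumption)+

text \<open>The sum over the slots \<open>k\<close> in \<open>K\<close> of the values of \<open>f\<close> after the value of \<open>\<nu>\<close> at \<open>z k\<close> is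
  applied in the slot \<open>k\<close>.\<close>

definition points_op :: "nat set \<Rightarrow> 'g mero \<Rightarrow> ((nat \<Rightarrow> 'w) \<Rightarrow> 'e::ab_group_add) \<Rightarrow> (nat \<Rightarrow> 'w) \<Rightarrow> 'e" where
  "points_op K \<nu> f w = slot_sum f K (\<lambda>k. \<rho> k (mero_value \<nu> (z k))) w"

lemma points_op_eq: "points_op K \<nu> f w = (\<Sum>k\<in>K. f (w(k := \<rho> k (mero_value \<nu> (z k)) (w k))))"
  by (simp add: points_op_def slot_sum_def)

lemma points_op_const: "points_op K (const_mero x) f w = slot_sum f K (\<lambda>k. \<rho> k x) w"
  by (simp add: points_op_def)

lemma points_op_PW: "K \<subseteq> {1..n} \<Longrightarrow> w \<in> PW \<Longrightarrow> k \<in> K \<Longrightarrow> w(k := \<rho> k x (w k)) \<in> PW"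
  by (rule upd_rho_PW) auto

lemma points_op_cong:
  assumes "K \<subseteq> {1..n}" "w \<in> PW" "\<And>w. w \<in> PW \<Longrightarrow> f w = f' w"
  shows "points_op K \<nu> f w = points_op K \<nu> f' w"
  unfolding points_op_eq by (intro sum.cong refl assms(3) points_op_PW[OF assms(1,2)])

lemma points_op_diff: "points_op K \<nu> (\<lambda>w. f w - g w) w = points_op K \<nu> f w - points_op K \<nu> g w"
  by (simp add: points_op_eq sum_subtractf)

lemma points_op_plus: "points_op K \<nu> (\<lambda>w. f w + g w) w = points_op K \<nu> f w + points_op K \<nu> g w"
  by (simp add: points_op_eq sum.distrib)

lemma points_op_in:
  assumes "complex_vector.subspace E" "K \<subseteq> {1..n}" "w \<in> PW" "\<And>w. w \<in> PW \<Longrightarrow> f w \<in> E"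
  shows "points_op K \<nu> f w \<in> E"
  unfolding points_op_eq by (intro complex_vector.subspace_sum assms(1,4) points_op_PW[OF assms(2,3)])

lemma points_op_tens_vs: "K \<subseteq> {1..n} \<Longrightarrow> w \<in> PW \<Longrightarrow> points_op K \<nu> tens w \<in> vs"
  by (rule points_op_in[OF vs_subspace _ _ tens_vs])

lemma vs_act_points_op:
  assumes "\<alpha> \<in> L" "K \<subseteq> {1..n}" "w \<in> PW" "\<And>w. w \<in> PW \<Longrightarrow> f w \<in> vs"
  shows "vs_act \<alpha> (points_op K \<nu> f w) = points_op K \<nu> (\<lambda>w. vs_act \<alpha> (f w)) w"
  unfolding points_op_eq by (rule vs_act_sum[OF assms(1)]) (intro assms(4) points_op_PW[OF assms(2,3)])

lemma subspace_0_set: "complex_vector.subspace {0 :: 'e::complex_vector}"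
  by (rule complex_vector.subspace_single_0)

lemma multilinear_points_op:
  "multilinear_mod {0} n W f \<Longrightarrow> K \<subseteq> {1..n} \<Longrightarrow> multilinear_mod {0} n W (points_op K \<nu> f)"
  unfolding points_op_def[abs_def]
  by (rule multilinear_mod_slot_sum[OF subspace_0_set]) (auto intro: slot_ops_rho)

lemma points_op_add:
  assumes f: "multilinear_mod {0} n W f" and K: "K \<subseteq> {1..n}" "z ` K \<subseteq> S"
    and \<mu>\<nu>: "\<mu> \<in> regular_on S" "\<nu> \<in> regular_on S" and w: "w \<in> PW"
  shows "points_op K (\<mu> + \<nu>) f w = points_op K \<mu> f w + points_op K \<nu> f w"
  unfolding points_op_eq sum.distrib[symmetric]
proof (rule sum.cong)
  fix k assume k: "k \<in> K"
  then have k': "k \<in> {1..n}" "z k \<in> S" using K by auto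
  have wk: "w k \<in> W k" using w k' by (auto simp: PiE_iff)
  show "f (w(k := \<rho> k (mero_value (\<mu> + \<nu>) (z k)) (w k))) =
      f (w(k := \<rho> k (mero_value \<mu> (z k)) (w k))) + f (w(k := \<rho> k (mero_value \<nu> (z k)) (w k)))"
    using multilinear_modD(1)[OF f w k'(1) rho_closed[OF k'(1) wk] rho_closed[OF k'(1) wk]]
    by (simp add: mero_value_add[OF \<mu>\<nu> k'(2)] rho_add[OF k'(1) wk] diff_diff_eq)
qed simp

lemma points_op_scaleC:
  assumes f: "multilinear_mod {0} n W f" and K: "K \<subseteq> {1..n}" "z ` K \<subseteq> S"
    and \<mu>: "\<mu> \<in> regular_on S" and w: "w \<in> PW"
  shows "points_op K (c *\<^sub>C \<mu>) f w = c *\<^sub>C points_op K \<mu> f w"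
  unfolding points_op_eq complex_vector.scale_sum_right
proof (rule sum.cong)
  fix k assume k: "k \<in> K"
  then have k': "k \<in> {1..n}" "z k \<in> S" using K by auto
  have wk: "w k \<in> W k" using w k' by (auto simp: PiE_iff)
  show "f (w(k := \<rho> k (mero_value (c *\<^sub>C \<mu>) (z k)) (w k))) =
      c *\<^sub>C f (w(k := \<rho> k (mero_value \<mu> (z k)) (w k)))"
    using multilinear_modD(2)[OF f w k'(1) rho_closed[OF k'(1) wk]]
    by (simp add: mero_value_scaleC[OF \<mu> k'(2)] rho_scaleC[OF k'(1) wk])
qed simp

lemma points_op_commutator:
  assumes f: "multilinear_mod {0} n W f" and K: "K \<subseteq> {1..n}" "z ` K \<subseteq> S"
    and K': "K' \<subseteq> {1..n}" "z ` K' \<subseteq> S'"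
    and \<mu>\<nu>: "\<nu> \<in> regular_on S" "\<mu> \<in> regular_on S'" and w: "w \<in> PW"
  shows "points_op K \<nu> (points_op K' \<mu> f) w - points_op K' \<mu> (points_op K \<nu> f) w = points_op (K \<inter> K') (lie \<mu> \<nu>) f w"
proof -
  have "points_op K \<nu> (points_op K' \<mu> f) w - points_op K' \<mu> (points_op K \<nu> f) w = slot_sum f (K \<inter> K')
     (\<lambda>k u. \<rho> k (mero_value \<mu> (z k)) (\<rho> k (mero_value \<nu> (z k)) u)
        - \<rho> k (mero_value \<nu> (z k)) (\<rho> k (mero_value \<mu> (z k)) u)) w"
    using slot_sum_commutator[OF subspace_0_set f W_subspace K(1) K'(1) slot_ops_rho[OF K(1)]
        slot_ops_rho[OF K'(1)] w, of "\<lambda>k. mero_value \<mu> (z k)" "\<lambda>k. mero_value \<nu> (z k)"]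
    unfolding points_op_def[abs_def] by simp
  also have "\<dots> = points_op (K \<inter> K') (lie \<mu> \<nu>) f w"
    unfolding slot_sum_def points_op_eq
  proof (rule sum.cong)
    fix k assume k: "k \<in> K \<inter> K'"
    then have k': "k \<in> {1..n}" "z k \<in> S \<inter> S'" using K K' by auto
    have wk: "w k \<in> W k" using w k' by (auto simp: PiE_iff)
    have r: "\<mu> \<in> regular_on (S \<inter> S')" "\<nu> \<in> regular_on (S \<inter> S')"
      using \<mu>\<nu> by (auto intro: regular_on_mono)
    show "f (w(k := \<rho> k (mero_value \<mu> (z k)) (\<rho> k (mero_value \<nu> (z k)) (w k))
        - \<rho> k (mero_value \<nu> (z k)) (\<rho> k (mero_value \<mu> (z k)) (w k)))) =
       f (w(k := \<rho> k (mero_value (lie \<mu> \<nu>) (z k)) (w k)))"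
      by (simp only: mero_value_lie[OF r k'(2)] rho_lie[OF k'(1) wk])
  qed simp
  finally show ?thesis .
qed

lemmas points_op_tens_add_KE = points_op_add[OF tens_multilinear KE_subset z_KE]
lemmas points_op_tens_add_KD = points_op_add[OF tens_multilinear KD_subset z_KD]
lemmas points_op_tens_scaleC_KE = points_op_scaleC[OF tens_multilinear KE_subset z_KE]
lemmas points_op_tens_scaleC_KD = points_op_scaleC[OF tens_multilinear KD_subset z_KD]

text \<open>The defining properties of the current operators, for operators on \<open>vs\<close>.\<close>

definition current_family where
  "current_family J \<longleftrightarrow>
     (\<forall>\<nu>\<in>G. \<forall>v\<in>vs. J \<nu> v \<in> vs) \<and>
     (\<forall>\<nu>\<in>G. \<forall>u\<in>vs. \<forall>v\<in>vs. J \<nu> (u + v) = J \<nu> u + J \<nu> v) \<and>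
     (\<forall>\<nu>\<in>G. \<forall>c. \<forall>v\<in>vs. J \<nu> (c *\<^sub>C v) = c *\<^sub>C J \<nu> v) \<and>
     (\<forall>\<mu>\<in>G. \<forall>\<nu>\<in>G. \<forall>v\<in>vs. J (\<mu> + \<nu>) v = J \<mu> v + J \<nu> v) \<and>
     (\<forall>\<nu>\<in>G. \<forall>c. \<forall>v\<in>vs. J (c *\<^sub>C \<nu>) v = c *\<^sub>C J \<nu> v) \<and>
     (\<forall>\<nu>\<in>G. \<forall>\<alpha>\<in>L. \<forall>v\<in>vs. J \<nu> (vs_act \<alpha> v) - vs_act \<alpha> (J \<nu> v) = J (lie \<nu> \<alpha>) v + bp \<nu> \<alpha> *\<^sub>C v) \<and>
     (\<forall>\<nu>\<in>L. \<forall>w\<in>PW. J \<nu> (tens w) = vs_act \<nu> (tens w) - points_op KE \<nu> tens w) \<and>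
     (\<forall>\<nu>\<in>G2. \<forall>w\<in>PW. J \<nu> (tens w) = points_op KD \<nu> tens w)"

context
  fixes J assumes current_family: "current_family J"
begin

lemma J_vs: "\<nu> \<in> G \<Longrightarrow> v \<in> vs \<Longrightarrow> J \<nu> v \<in> vs"
  and J_add: "\<nu> \<in> G \<Longrightarrow> u \<in> vs \<Longrightarrow> v \<in> vs \<Longrightarrow> J \<nu> (u + v) = J \<nu> u + J \<nu> v"
  and J_scaleC: "\<nu> \<in> G \<Longrightarrow> v \<in> vs \<Longrightarrow> J \<nu> (c *\<^sub>C v) = c *\<^sub>C J \<nu> v"
  and J_add_left: "\<mu> \<in> G \<Longrightarrow> \<nu> \<in> G \<Longrightarrow> v \<in> vs \<Longrightarrow> J (\<mu> + \<nu>) v = J \<mu> v + J \<nu> v"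
  and J_scaleC_left: "\<nu> \<in> G \<Longrightarrow> v \<in> vs \<Longrightarrow> J (c *\<^sub>C \<nu>) v = c *\<^sub>C J \<nu> v"
  and J_L: "\<nu> \<in> L \<Longrightarrow> w \<in> PW \<Longrightarrow> J \<nu> (tens w) = vs_act \<nu> (tens w) - points_op KE \<nu> tens w"
  and J_G2: "\<nu> \<in> G2 \<Longrightarrow> w \<in> PW \<Longrightarrow> J \<nu> (tens w) = points_op KD \<nu> tens w"
  using current_family unfolding current_family_def by simp_all

lemma J_vs_act: "\<nu> \<in> G \<Longrightarrow> \<alpha> \<in> L \<Longrightarrow> v \<in> vs \<Longrightarrow>
    J \<nu> (vs_act \<alpha> v) = vs_act \<alpha> (J \<nu> v) + J (lie \<nu> \<alpha>) v + bp \<nu> \<alpha> *\<^sub>C v"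
proof -
  assume "\<nu> \<in> G" "\<alpha> \<in> L" "v \<in> vs"
  then have "J \<nu> (vs_act \<alpha> v) - vs_act \<alpha> (J \<nu> v) = J (lie \<nu> \<alpha>) v + bp \<nu> \<alpha> *\<^sub>C v"
    using current_family unfolding current_family_def by blast
  then show ?thesis by (simp add: algebra_simps)
qed

lemma J_0: "\<nu> \<in> G \<Longrightarrow> J \<nu> 0 = 0"
  using J_scaleC[of \<nu> 0 0] complex_vector.subspace_0[OF vs_subspace]
  by (simp add: complex_vector.scale_zero_left)

lemma J_diff: "\<nu> \<in> G \<Longrightarrow> u \<in> vs \<Longrightarrow> v \<in> vs \<Longrightarrow> J \<nu> (u - v) = J \<nu> u - J \<nu> v"
  using J_add[of \<nu> "u - v" v] complex_vector.subspace_diff[OF vs_subspace, of u v] by simp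

lemma J_uminus_left: "\<nu> \<in> G \<Longrightarrow> v \<in> vs \<Longrightarrow> J (- \<nu>) v = - J \<nu> v"
  using J_scaleC_left[of \<nu> v "- 1"] by (simp add: complex_vector.scale_minus_left scaleC_one)

lemma J_sum:
  assumes "\<nu> \<in> G" "\<And>i. i \<in> I \<Longrightarrow> f i \<in> vs"
  shows "J \<nu> (\<Sum>i\<in>I. f i) = (\<Sum>i\<in>I. J \<nu> (f i))"
  using assms(2)
proof (induction I rule: infinite_finite_induct)
  case (insert i I)
  have "(\<Sum>i\<in>I. f i) \<in> vs"
    using insert.prems by (intro complex_vector.subspace_sum vs_subspace) auto
  then show ?case using insert by (simp add: J_add[OF assms(1)])
qed (use J_0[OF assms(1)] in simp_all)

lemma J_points_op:
  assumes "\<mu> \<in> G" "K \<subseteq> {1..n}" "w \<in> PW"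
  shows "J \<mu> (points_op K \<nu> tens w) = points_op K \<nu> (\<lambda>w. J \<mu> (tens w)) w"
  unfolding points_op_eq by (rule J_sum[OF assms(1)]) (intro tens_vs points_op_PW[OF assms(2,3)])

text \<open>The failure of the commutation relations.\<close>

definition defect where
  "defect \<mu> \<nu> v = J \<mu> (J \<nu> v) - J \<nu> (J \<mu> v) - J (lie \<mu> \<nu>) v - bp \<mu> \<nu> *\<^sub>C v"

lemma defect_swap:
  assumes "\<mu> \<in> G" "\<nu> \<in> G" "v \<in> vs"
  shows "defect \<nu> \<mu> v = - defect \<mu> \<nu> v"
proof -
  have "J (lie \<nu> \<mu>) v = - J (lie \<mu> \<nu>) v"
    using J_uminus_left[OF G_lie[OF assms(1,2)] assms(3)] lie_antisym[of \<nu> \<mu>] by simp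
  moreover have "bp \<nu> \<mu> = - bp \<mu> \<nu>" by (rule bp_antisym[OF assms(2,1)])
  ultimately show ?thesis
    by (simp add: defect_def complex_vector.scale_minus_left algebra_simps)
qed

lemma defect_add_left:
  assumes "\<mu> \<in> G" "\<mu>' \<in> G" "\<nu> \<in> G" "v \<in> vs"
  shows "defect (\<mu> + \<mu>') \<nu> v = defect \<mu> \<nu> v + defect \<mu>' \<nu> v"
  unfolding defect_def using assms
  by (simp add: J_add_left J_add J_vs G_add G_lie lie_add_left bp_add_left scaleC_add_left algebra_simps)

lemma defect_add_right:
  assumes "\<mu> \<in> G" "\<nu> \<in> G" "\<nu>' \<in> G" "v \<in> vs"
  shows "defect \<mu> (\<nu> + \<nu>') v = defect \<mu> \<nu> v + defect \<mu> \<nu>' v"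
  unfolding defect_swap[OF G_add[OF assms(2,3)] assms(1,4)] defect_swap[OF assms(2,1,4)]
    defect_swap[OF assms(3,1,4)] defect_add_left[OF assms(2,3,1,4)]
  by simp

lemma defect_tens_L:
  assumes \<mu>: "\<mu> \<in> L" and \<nu>: "\<nu> \<in> L" and w: "w \<in> PW"
  shows "defect \<mu> \<nu> (tens w) = 0"
proof -
  have JJ: "J \<mu> (J \<nu> (tens w)) = vs_act \<nu> (vs_act \<mu> (tens w)) - vs_act \<nu> (points_op KE \<mu> tens w)
      + J (lie \<mu> \<nu>) (tens w) - vs_act \<mu> (points_op KE \<nu> tens w) + points_op KE \<nu> (points_op KE \<mu> tens) w"
    if \<mu>: "\<mu> \<in> L" and \<nu>: "\<nu> \<in> L" for \<mu> \<nu>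
  proof -
    note G = L_G[OF \<mu>] L_G[OF \<nu>]
    note t = tens_vs[OF w] and s = points_op_tens_vs[OF KE_subset w]
    have "J \<mu> (J \<nu> (tens w)) = J \<mu> (vs_act \<nu> (tens w)) - J \<mu> (points_op KE \<nu> tens w)"
      using \<nu> G t s by (simp only: J_L w J_diff AV.act_E)
    also have "J \<mu> (vs_act \<nu> (tens w)) = vs_act \<nu> (J \<mu> (tens w)) + J (lie \<mu> \<nu>) (tens w)"
      using J_vs_act[OF G(1) \<nu> t] bp_eq_0_poles_in_D[OF \<mu> \<nu>] by (simp add: complex_vector.scale_zero_left)
    also have "vs_act \<nu> (J \<mu> (tens w)) = vs_act \<nu> (vs_act \<mu> (tens w)) - vs_act \<nu> (points_op KE \<mu> tens w)"
    proof -
      have "vs_act \<nu> (u - v) = vs_act \<nu> u - vs_act \<nu> v" if "u \<in> vs" "v \<in> vs" for u v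
        using AV.act_add[OF \<nu> complex_vector.subspace_diff[OF vs_subspace that] that(2)] by simp
      then show ?thesis using \<mu> t s by (simp only: J_L w AV.act_E)
    qed
    also have "J \<mu> (points_op KE \<nu> tens w) = points_op KE \<nu> (\<lambda>w. vs_act \<mu> (tens w) - points_op KE \<mu> tens w) w"
      unfolding J_points_op[OF G(1) KE_subset w]
      by (rule points_op_cong[OF KE_subset w]) (rule J_L[OF \<mu>])
    also have "\<dots> = vs_act \<mu> (points_op KE \<nu> tens w) - points_op KE \<nu> (points_op KE \<mu> tens) w"
      using vs_act_points_op[where f = tens, OF \<mu> KE_subset w tens_vs, of \<nu>] by (simp add: points_op_diff)
    finally show ?thesis by (simp add: algebra_simps)
  qed
  have c: "points_op KE \<nu> (points_op KE \<mu> tens) w - points_op KE \<mu> (points_op KE \<nu> tens) w = points_op KE (lie \<mu> \<nu>) tens w"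
    using points_op_commutator[OF tens_multilinear KE_subset z_KE KE_subset z_KE \<nu> \<mu> w] by simp
  have l: "lie \<mu> \<nu> \<in> L" by (rule P.L_lie[OF \<mu> \<nu>])
  have swap: "J (lie \<nu> \<mu>) (tens w) = - J (lie \<mu> \<nu>) (tens w)"
    using J_uminus_left[OF L_G[OF l] tens_vs[OF w]] lie_antisym[of \<nu> \<mu>] by simp
  have Jl: "J (lie \<mu> \<nu>) (tens w) = vs_act \<mu> (vs_act \<nu> (tens w)) - vs_act \<nu> (vs_act \<mu> (tens w))
      - (points_op KE \<nu> (points_op KE \<mu> tens) w - points_op KE \<mu> (points_op KE \<nu> tens) w)"
    unfolding J_L[OF l w] vs_act_lie[OF \<mu> \<nu> tens_vs[OF w]] c ..
  have "J \<mu> (J \<nu> (tens w)) - J \<nu> (J \<mu> (tens w)) = J (lie \<mu> \<nu>) (tens w)"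
    unfolding JJ[OF \<mu> \<nu>] JJ[OF \<nu> \<mu>] swap Jl by (simp add: algebra_simps)
  then show ?thesis
    by (simp add: defect_def bp_eq_0_poles_in_D[OF \<mu> \<nu>] complex_vector.scale_zero_left)
qed

lemma defect_tens_G2:
  assumes \<mu>: "\<mu> \<in> G2" and \<nu>: "\<nu> \<in> G2" and w: "w \<in> PW"
  shows "defect \<mu> \<nu> (tens w) = 0"
proof -
  have JJ: "J \<mu> (J \<nu> (tens w)) = points_op KD \<nu> (points_op KD \<mu> tens) w"
    if \<mu>: "\<mu> \<in> G2" and \<nu>: "\<nu> \<in> G2" for \<mu> \<nu>
    unfolding J_G2[OF \<nu> w] J_points_op[OF G2_G[OF \<mu>] KD_subset w]
    by (rule points_op_cong[OF KD_subset w]) (rule J_G2[OF \<mu>])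
  have "points_op KD \<nu> (points_op KD \<mu> tens) w - points_op KD \<mu> (points_op KD \<nu> tens) w = points_op KD (lie \<mu> \<nu>) tens w"
    using points_op_commutator[OF tens_multilinear KD_subset z_KD KD_subset z_KD \<nu> \<mu> w] by simp
  then show ?thesis
    by (simp add: defect_def JJ \<mu> \<nu> J_G2[OF lie_in_regular_on[OF \<mu> \<nu>] w]
        bp_eq_0_poles_in_exterior complex_vector.scale_zero_left)
qed

text \<open>The operators at the points of \<open>D\<close> and those at the points of the exterior commute, as they
  act in different slots. The pairing of \<open>\<mu>\<close> and \<open>\<nu>\<close> comes from the commutation relation of \<open>J \<mu>\<close>
  with \<open>\<nu>\<close>.\<close>

lemma defect_tens_G2_L:
  assumes \<mu>: "\<mu> \<in> G2" and \<nu>: "\<nu> \<in> L" and w: "w \<in> PW"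
  shows "defect \<mu> \<nu> (tens w) = 0"
proof -
  note G = G2_G[OF \<mu>] L_G[OF \<nu>]
  note t = tens_vs[OF w] and s = points_op_tens_vs[OF KE_subset w]
  have "J \<mu> (J \<nu> (tens w)) = J \<mu> (vs_act \<nu> (tens w)) - J \<mu> (points_op KE \<nu> tens w)"
    using \<nu> G t s by (simp only: J_L w J_diff AV.act_E)
  also have "J \<mu> (vs_act \<nu> (tens w)) = vs_act \<nu> (points_op KD \<mu> tens w) + J (lie \<mu> \<nu>) (tens w) + bp \<mu> \<nu> *\<^sub>C tens w"
    using J_vs_act[OF G(1) \<nu> t] by (simp only: J_G2[OF \<mu> w])
  also have "J \<mu> (points_op KE \<nu> tens w) = points_op KE \<nu> (points_op KD \<mu> tens) w"
    unfolding J_points_op[OF G(1) KE_subset w] by (rule points_op_cong[OF KE_subset w]) (rule J_G2[OF \<mu>])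
  finally have 1: "J \<mu> (J \<nu> (tens w)) = vs_act \<nu> (points_op KD \<mu> tens w) + J (lie \<mu> \<nu>) (tens w)
      + bp \<mu> \<nu> *\<^sub>C tens w - points_op KE \<nu> (points_op KD \<mu> tens) w" .
  have "J \<nu> (J \<mu> (tens w)) = points_op KD \<mu> (\<lambda>w. vs_act \<nu> (tens w) - points_op KE \<nu> tens w) w"
    unfolding J_G2[OF \<mu> w] J_points_op[OF G(2) KD_subset w] by (rule points_op_cong[OF KD_subset w]) (rule J_L[OF \<nu>])
  also have "\<dots> = vs_act \<nu> (points_op KD \<mu> tens w) - points_op KD \<mu> (points_op KE \<nu> tens) w"
    using vs_act_points_op[where f = tens, OF \<nu> KD_subset w tens_vs, of \<mu>] by (simp add: points_op_diff)
  finally have 2: "J \<nu> (J \<mu> (tens w)) = vs_act \<nu> (points_op KD \<mu> tens w) - points_op KD \<mu> (points_op KE \<nu> tens) w" .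
  have "points_op KE \<nu> (points_op KD \<mu> tens) w - points_op KD \<mu> (points_op KE \<nu> tens) w = points_op (KE \<inter> KD) (lie \<mu> \<nu>) tens w"
    by (rule points_op_commutator[OF tens_multilinear KE_subset z_KE KD_subset z_KD \<nu> \<mu> w])
  then have "points_op KE \<nu> (points_op KD \<mu> tens) w = points_op KD \<mu> (points_op KE \<nu> tens) w"
    by (simp add: KD_KE points_op_eq[of "{}"])
  then show ?thesis unfolding defect_def 1 2 by simp
qed

lemma defect_tens:
  assumes \<mu>: "\<mu> \<in> G" and \<nu>: "\<nu> \<in> G" and w: "w \<in> PW"
  shows "defect \<mu> \<nu> (tens w) = 0"
proof -
  note t = tens_vs[OF w]
  obtain \<mu>1 \<mu>2 where m: "\<mu>1 \<in> L" "\<mu>2 \<in> G2" "\<mu> = \<mu>1 + \<mu>2" using \<mu> by (rule G_decomp)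
  obtain \<nu>1 \<nu>2 where n: "\<nu>1 \<in> L" "\<nu>2 \<in> G2" "\<nu> = \<nu>1 + \<nu>2" using \<nu> by (rule G_decomp)
  note G = L_G[OF m(1)] G2_G[OF m(2)] L_G[OF n(1)] G2_G[OF n(2)]
  have "defect \<mu>1 \<nu>2 (tens w) = - defect \<nu>2 \<mu>1 (tens w)" by (rule defect_swap[OF G(4,1) t])
  also have "\<dots> = 0" using defect_tens_G2_L[OF n(2) m(1) w] by simp
  finally have "defect \<mu>1 \<nu>2 (tens w) = 0" .
  moreover have "defect \<mu> \<nu> (tens w) = defect \<mu>1 \<nu>1 (tens w) + defect \<mu>1 \<nu>2 (tens w)
      + (defect \<mu>2 \<nu>1 (tens w) + defect \<mu>2 \<nu>2 (tens w))"
    unfolding m(3) n(3)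
    by (simp only: defect_add_left[OF G(1,2) G_add[OF G(3,4)] t]
        defect_add_right[OF G(1,3,4) t] defect_add_right[OF G(2,3,4) t])
  ultimately show ?thesis
    using defect_tens_L[OF m(1) n(1) w] defect_tens_G2_L[OF m(2) n(1) w] defect_tens_G2[OF m(2) n(2) w]
    by simp
qed

text \<open>The commutator of the defect with \<open>\<alpha>\<close> results from applying the derivation \<open>[\<cdot>, \<alpha>]\<close> to its
  two arguments, by the Jacobi identity and the cocycle identity.\<close>

lemma defect_act:
  assumes \<mu>: "\<mu> \<in> G" and \<nu>: "\<nu> \<in> G" and \<alpha>: "\<alpha> \<in> L" and v: "v \<in> vs"
  shows "defect \<mu> \<nu> (vs_act \<alpha> v) = vs_act \<alpha> (defect \<mu> \<nu> v) + defect (lie \<mu> \<alpha>) \<nu> v + defect \<mu> (lie \<nu> \<alpha>) v"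
proof -
  note \<alpha>G = L_G[OF \<alpha>]
  note sub = complex_vector.subspace_add[OF vs_subspace] complex_vector.subspace_scale[OF vs_subspace]
    complex_vector.subspace_diff[OF vs_subspace]
  have JJ: "J \<mu> (J \<nu> (vs_act \<alpha> v)) = vs_act \<alpha> (J \<mu> (J \<nu> v)) + J (lie \<mu> \<alpha>) (J \<nu> v) + bp \<mu> \<alpha> *\<^sub>C J \<nu> v
      + J \<mu> (J (lie \<nu> \<alpha>) v) + bp \<nu> \<alpha> *\<^sub>C J \<mu> v" if \<mu>: "\<mu> \<in> G" and \<nu>: "\<nu> \<in> G" for \<mu> \<nu>
    using \<mu> \<nu> \<alpha> v \<alpha>G
    by (simp add: J_vs_act J_add J_scaleC J_vs AV.act_E G_lie sub algebra_simps)
  have vs_act_diff: "vs_act \<alpha> (u - v) = vs_act \<alpha> u - vs_act \<alpha> v" if "u \<in> vs" "v \<in> vs" for u v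
    using AV.act_add[OF \<alpha> sub(3)[OF that] that(2)] by simp
  have vs_act: "vs_act \<alpha> (defect \<mu> \<nu> v) = vs_act \<alpha> (J \<mu> (J \<nu> v)) - vs_act \<alpha> (J \<nu> (J \<mu> v)) - vs_act \<alpha> (J (lie \<mu> \<nu>) v) - bp \<mu> \<nu> *\<^sub>C vs_act \<alpha> v"
    unfolding defect_def using \<mu> \<nu> v by (simp add: vs_act_diff J_vs G_lie sub AV.act_scaleC[OF \<alpha>])
  have Jl: "J (lie \<mu> \<nu>) (vs_act \<alpha> v) = vs_act \<alpha> (J (lie \<mu> \<nu>) v)
      + (J (lie (lie \<mu> \<alpha>) \<nu>) v + J (lie \<mu> (lie \<nu> \<alpha>)) v) + (bp (lie \<mu> \<alpha>) \<nu> + bp \<mu> (lie \<nu> \<alpha>)) *\<^sub>C v"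
  proof -
    have "bp (lie \<mu> \<nu>) \<alpha> = bp (lie \<mu> \<alpha>) \<nu> + bp \<mu> (lie \<nu> \<alpha>)"
      using bp_cocycle[OF \<mu> \<nu> \<alpha>G] by simp
    moreover have "J (lie (lie \<mu> \<nu>) \<alpha>) v = J (lie (lie \<mu> \<alpha>) \<nu>) v + J (lie \<mu> (lie \<nu> \<alpha>)) v"
      unfolding lie_derivation[of \<mu> \<nu> \<alpha>] using \<mu> \<nu> \<alpha>G v by (intro J_add_left G_lie)
    ultimately show ?thesis using J_vs_act[OF G_lie[OF \<mu> \<nu>] \<alpha> v] by simp
  qed
  show ?thesis
    unfolding vs_act unfolding defect_def[of \<mu> \<nu> "vs_act \<alpha> v"] JJ[OF \<mu> \<nu>] JJ[OF \<nu> \<mu>] Jl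
    by (simp add: defect_def scaleC_add_left algebra_simps)
qed

lemma defect_0:
  assumes "v \<in> vs" "\<mu> \<in> G" "\<nu> \<in> G"
  shows "defect \<mu> \<nu> v = 0"
proof -
  note sub = complex_vector.subspace_0[OF vs_subspace]
  have "\<forall>\<mu>\<in>G. \<forall>\<nu>\<in>G. defect \<mu> \<nu> v = 0"
    using assms(1)
  proof (induction rule: vs_generated)
    case zero
    show ?case by (simp add: defect_def J_0 G_lie complex_vector.scale_zero_right)
  next
    case (add u v)
    have "defect \<mu> \<nu> (u + v) = defect \<mu> \<nu> u + defect \<mu> \<nu> v" if "\<mu> \<in> G" "\<nu> \<in> G" for \<mu> \<nu>
      unfolding defect_def using that add(1,2)
      by (simp add: J_add J_vs G_lie scaleC_add_right algebra_simps)
    then show ?case using add by simp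
  next
    case (scale c v)
    have "defect \<mu> \<nu> (c *\<^sub>C v) = c *\<^sub>C defect \<mu> \<nu> v" if "\<mu> \<in> G" "\<nu> \<in> G" for \<mu> \<nu>
      unfolding defect_def using that scale(1)
      by (simp add: J_scaleC J_vs G_lie complex_vector.scale_right_diff_distrib mult.commute)
    then show ?case using scale by (simp add: complex_vector.scale_zero_right)
  next
    case (act \<alpha> v)
    then show ?case
      using AV.act_S[OF act(1), of 0] by (simp add: defect_act L_G G_lie)
  next
    case (tens w)
    then show ?case by (simp add: defect_tens)
  qed
  then show ?thesis using assms by blast
qed

end

lemma current_family_commutator:
  assumes "current_family J" "\<mu> \<in> G" "\<nu> \<in> G" "v \<in> vs"
  shows "J \<mu> (J \<nu> v) - J \<nu> (J \<mu> v) - J (lie \<mu> \<nu>) v = bp \<mu> \<nu> *\<^sub>C v"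
  using defect_0[OF assms(1,4,2,3)] unfolding defect_def[OF assms(1)] by simp

lemma current_family_unique:
  assumes J: "current_family J" and J': "current_family J'" and \<nu>: "\<nu> \<in> G" and v: "v \<in> vs"
  shows "J \<nu> v = J' \<nu> v"
proof -
  have "\<forall>\<nu>\<in>G. J \<nu> v = J' \<nu> v"
    using v
  proof (induction rule: vs_generated)
    case zero
    then show ?case by (simp add: J_0[OF J] J_0[OF J'])
  next
    case (add u v)
    then show ?case by (simp add: J_add[OF J] J_add[OF J'])
  next
    case (scale c v)
    then show ?case by (simp add: J_scaleC[OF J] J_scaleC[OF J'])
  next
    case (act \<alpha> v)
    then show ?case by (simp add: J_vs_act[OF J] J_vs_act[OF J'] L_G G_lie)
  next
    case (tens w)
    show ?case
    proof
      fix \<nu> assume "\<nu> \<in> G"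
      then obtain \<nu>1 \<nu>2 where n: "\<nu>1 \<in> L" "\<nu>2 \<in> G2" "\<nu> = \<nu>1 + \<nu>2" by (rule G_decomp)
      show "J \<nu> (tens w) = J' \<nu> (tens w)"
        unfolding n(3) J_add_left[OF J L_G[OF n(1)] G2_G[OF n(2)] tens_vs[OF tens]]
          J_add_left[OF J' L_G[OF n(1)] G2_G[OF n(2)] tens_vs[OF tens]]
        by (simp only: J_L[OF J n(1) tens] J_L[OF J' n(1) tens] J_G2[OF J n(2) tens] J_G2[OF J' n(2) tens])
    qed
  qed
  then show ?thesis using \<nu> by blast
qed

end


context current_ctx
begin

text \<open>The values that are prescribed for the operators on the image of the tensor product, for
  maps in \<open>L\<close> and for maps in \<open>G2\<close>.\<close>

definition S1 where "S1 \<nu> w = vs_act \<nu> (tens w) - points_op KE \<nu> tens w"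
definition S2 where "S2 \<nu> w = points_op KD \<nu> tens w"

lemma S1_vs: "\<nu> \<in> L \<Longrightarrow> w \<in> PW \<Longrightarrow> S1 \<nu> w \<in> vs"
  unfolding S1_def
  by (intro complex_vector.subspace_diff[OF vs_subspace] AV.act_E tens_vs points_op_tens_vs KE_subset)

lemma S2_vs: "w \<in> PW \<Longrightarrow> S2 \<nu> w \<in> vs"
  unfolding S2_def by (intro points_op_tens_vs KD_subset)

lemma S1_add: "\<mu> \<in> L \<Longrightarrow> \<nu> \<in> L \<Longrightarrow> w \<in> PW \<Longrightarrow> S1 (\<mu> + \<nu>) w = S1 \<mu> w + S1 \<nu> w"
  by (simp add: S1_def vs_act_add_left tens_vs points_op_tens_add_KE)

lemma S1_scaleC: "\<nu> \<in> L \<Longrightarrow> w \<in> PW \<Longrightarrow> S1 (c *\<^sub>C \<nu>) w = c *\<^sub>C S1 \<nu> w"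
  by (simp add: S1_def vs_act_scaleC_left tens_vs points_op_tens_scaleC_KE complex_vector.scale_right_diff_distrib)

lemma S2_add: "\<mu> \<in> G2 \<Longrightarrow> \<nu> \<in> G2 \<Longrightarrow> w \<in> PW \<Longrightarrow> S2 (\<mu> + \<nu>) w = S2 \<mu> w + S2 \<nu> w"
  unfolding S2_def by (rule points_op_tens_add_KD)

lemma S2_scaleC: "\<nu> \<in> G2 \<Longrightarrow> w \<in> PW \<Longrightarrow> S2 (c *\<^sub>C \<nu>) w = c *\<^sub>C S2 \<nu> w"
  unfolding S2_def by (rule points_op_tens_scaleC_KD)

lemma S1_S2_const:
  assumes "w \<in> PW"
  shows "S1 (const_mero x) w = S2 (const_mero x) w"
proof -
  have fin: "finite KD" "finite KE" using KD_subset KE_subset finite_subset by auto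
  have "vs_act (const_mero x) (tens w) = (\<Sum>k\<in>KD \<union> KE. tens (w(k := \<rho> k x (w k))))"
    unfolding vs_act_const[OF assms] KD_KE slot_sum_def ..
  also have "\<dots> = points_op KD (const_mero x) tens w + points_op KE (const_mero x) tens w"
    by (simp add: points_op_eq sum.union_disjoint[OF fin KD_KE(2)])
  finally show ?thesis by (simp add: S1_def S2_def)
qed

text \<open>As both prescriptions agree on constants, the value prescribed for a sum does not depend on
  the decomposition.\<close>

lemma S1_S2_unique:
  assumes "\<mu>1 \<in> L" "\<mu>2 \<in> G2" "\<nu>1 \<in> L" "\<nu>2 \<in> G2" "\<mu>1 + \<mu>2 = \<nu>1 + \<nu>2" and w: "w \<in> PW"
  shows "S1 \<mu>1 w + S2 \<mu>2 w = S1 \<nu>1 w + S2 \<nu>2 w"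
proof -
  have d: "\<mu>1 - \<nu>1 = \<nu>2 - \<mu>2" using assms(5) by (simp add: algebra_simps)
  have "\<mu>1 - \<nu>1 \<in> L" by (rule complex_vector.subspace_diff[OF subspace_regular_on assms(1,3)])
  moreover have "\<mu>1 - \<nu>1 \<in> G2"
    unfolding d by (rule complex_vector.subspace_diff[OF subspace_regular_on assms(4,2)])
  ultimately obtain x where x: "\<mu>1 - \<nu>1 = const_mero x" by (rule L_G2_const)
  have \<mu>1: "\<mu>1 = \<nu>1 + const_mero x" using x by (simp add: algebra_simps)
  have \<nu>2: "\<nu>2 = \<mu>2 + const_mero x" using x d by (simp add: algebra_simps)
  show ?thesis
    unfolding \<mu>1 \<nu>2 S1_add[OF assms(3) const_in_regular_on w] S2_add[OF assms(2) const_in_regular_on w]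
      S1_S2_const[OF w]
    by (simp add: algebra_simps)
qed

text \<open>The values that are prescribed for all maps in \<open>G\<close>; any decomposition may be chosen.\<close>

definition J_tens where
  "J_tens \<nu> w = (let p = SOME p. fst p \<in> L \<and> snd p \<in> G2 \<and> \<nu> = fst p + snd p in S1 (fst p) w + S2 (snd p) w)"

lemma J_tens_eq:
  assumes "\<nu>1 \<in> L" "\<nu>2 \<in> G2" "w \<in> PW"
  shows "J_tens (\<nu>1 + \<nu>2) w = S1 \<nu>1 w + S2 \<nu>2 w"
proof -
  define p where "p = (SOME p. fst p \<in> L \<and> snd p \<in> G2 \<and> \<nu>1 + \<nu>2 = fst p + snd p)"
  have p: "fst p \<in> L \<and> snd p \<in> G2 \<and> \<nu>1 + \<nu>2 = fst p + snd p"
    unfolding p_def by (rule someI[of _ "(\<nu>1, \<nu>2)"]) (use assms in simp)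
  have "J_tens (\<nu>1 + \<nu>2) w = S1 (fst p) w + S2 (snd p) w"
    unfolding J_tens_def Let_def p_def[symmetric] ..
  also have "\<dots> = S1 \<nu>1 w + S2 \<nu>2 w"
    by (rule S1_S2_unique) (use p assms in simp_all)
  finally show ?thesis .
qed

lemma L_add: "\<mu> \<in> L \<Longrightarrow> \<nu> \<in> L \<Longrightarrow> \<mu> + \<nu> \<in> L" and G2_add: "\<mu> \<in> G2 \<Longrightarrow> \<nu> \<in> G2 \<Longrightarrow> \<mu> + \<nu> \<in> G2"
  and L_scaleC: "\<nu> \<in> L \<Longrightarrow> c *\<^sub>C \<nu> \<in> L" and G2_scaleC: "\<nu> \<in> G2 \<Longrightarrow> c *\<^sub>C \<nu> \<in> G2"
  and L_0: "0 \<in> L" and G2_0: "0 \<in> G2"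
  by (rule complex_vector.subspace_add[OF subspace_regular_on] complex_vector.subspace_scale[OF subspace_regular_on]
      complex_vector.subspace_0[OF subspace_regular_on]; assumption)+

lemma J_tens_vs:
  assumes "\<nu> \<in> G" "w \<in> PW"
  shows "J_tens \<nu> w \<in> vs"
proof -
  obtain \<nu>1 \<nu>2 where n: "\<nu>1 \<in> L" "\<nu>2 \<in> G2" "\<nu> = \<nu>1 + \<nu>2" using assms(1) by (rule G_decomp)
  show ?thesis unfolding n(3) J_tens_eq[OF n(1,2) assms(2)]
    by (intro complex_vector.subspace_add[OF vs_subspace] S1_vs S2_vs n assms)
qed

lemma J_tens_add:
  assumes "\<mu> \<in> G" "\<nu> \<in> G" and w: "w \<in> PW"
  shows "J_tens (\<mu> + \<nu>) w = J_tens \<mu> w + J_tens \<nu> w"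
proof -
  obtain \<mu>1 \<mu>2 where m: "\<mu>1 \<in> L" "\<mu>2 \<in> G2" "\<mu> = \<mu>1 + \<mu>2" using assms(1) by (rule G_decomp)
  obtain \<nu>1 \<nu>2 where n: "\<nu>1 \<in> L" "\<nu>2 \<in> G2" "\<nu> = \<nu>1 + \<nu>2" using assms(2) by (rule G_decomp)
  have "\<mu> + \<nu> = (\<mu>1 + \<nu>1) + (\<mu>2 + \<nu>2)" unfolding m(3) n(3) by (simp add: algebra_simps)
  then have "J_tens (\<mu> + \<nu>) w = S1 (\<mu>1 + \<nu>1) w + S2 (\<mu>2 + \<nu>2) w"
    using J_tens_eq[OF L_add[OF m(1) n(1)] G2_add[OF m(2) n(2)] w] by simp
  then show ?thesis
    unfolding m(3) n(3) J_tens_eq[OF m(1,2) w] J_tens_eq[OF n(1,2) w]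
      S1_add[OF m(1) n(1) w] S2_add[OF m(2) n(2) w] by (simp add: algebra_simps)
qed

lemma J_tens_scaleC:
  assumes "\<nu> \<in> G" and w: "w \<in> PW"
  shows "J_tens (c *\<^sub>C \<nu>) w = c *\<^sub>C J_tens \<nu> w"
proof -
  obtain \<nu>1 \<nu>2 where n: "\<nu>1 \<in> L" "\<nu>2 \<in> G2" "\<nu> = \<nu>1 + \<nu>2" using assms(1) by (rule G_decomp)
  show ?thesis
    unfolding n(3) scaleC_add_right J_tens_eq[OF L_scaleC[OF n(1)] G2_scaleC[OF n(2)] w] J_tens_eq[OF n(1,2) w]
      S1_scaleC[OF n(1) w] S2_scaleC[OF n(2) w] ..
qed

lemma J_tens_L: "\<nu> \<in> L \<Longrightarrow> w \<in> PW \<Longrightarrow> J_tens \<nu> w = S1 \<nu> w"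
  using J_tens_eq[OF _ G2_0, of \<nu> w] S2_scaleC[OF G2_0, of w 0] by (simp add: complex_vector.scale_zero_left)

lemma J_tens_G2: "\<nu> \<in> G2 \<Longrightarrow> w \<in> PW \<Longrightarrow> J_tens \<nu> w = S2 \<nu> w"
  using J_tens_eq[OF L_0, of \<nu> w] S1_scaleC[OF L_0, of w 0] by (simp add: complex_vector.scale_zero_left)

lemma S1_multilinear:
  assumes "\<nu> \<in> L"
  shows "multilinear_mod {0} n W (S1 \<nu>)"
  unfolding multilinear_mod_def
proof (intro conjI ballI allI)
  note s = multilinear_points_op[OF tens_multilinear KE_subset, of \<nu>]
  fix w k u v assume w: "w \<in> PW" "k \<in> {1..n}" and u: "u \<in> W k" and v: "v \<in> W k"
  note tv = tens_vs[OF upd_PW[OF w u]] tens_vs[OF upd_PW[OF w v]]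
  have "tens (w(k := u + v)) = tens (w(k := u)) + tens (w(k := v))"
    using multilinear_modD(1)[OF tens_multilinear w u v] by (simp add: diff_diff_eq)
  moreover have "points_op KE \<nu> tens (w(k := u + v)) = points_op KE \<nu> tens (w(k := u)) + points_op KE \<nu> tens (w(k := v))"
    using multilinear_modD(1)[OF s w u v] by (simp add: diff_diff_eq)
  ultimately show "S1 \<nu> (w(k := u + v)) - S1 \<nu> (w(k := u)) - S1 \<nu> (w(k := v)) \<in> {0}"
    by (simp add: S1_def AV.act_add[OF assms tv])
next
  note s = multilinear_points_op[OF tens_multilinear KE_subset, of \<nu>]
  fix w k c u assume w: "w \<in> PW" "k \<in> {1..n}" and u: "u \<in> W k"
  have "tens (w(k := c *\<^sub>C u)) = c *\<^sub>C tens (w(k := u))"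
    using multilinear_modD(2)[OF tens_multilinear w u] by simp
  moreover have "points_op KE \<nu> tens (w(k := c *\<^sub>C u)) = c *\<^sub>C points_op KE \<nu> tens (w(k := u))"
    using multilinear_modD(2)[OF s w u] by simp
  ultimately show "S1 \<nu> (w(k := c *\<^sub>C u)) - c *\<^sub>C S1 \<nu> (w(k := u)) \<in> {0}"
    by (simp add: S1_def AV.act_scaleC[OF assms tens_vs[OF upd_PW[OF w u]]]
        complex_vector.scale_right_diff_distrib)
qed

lemma S2_multilinear: "multilinear_mod {0} n W (S2 \<nu>)"
  using multilinear_points_op[OF tens_multilinear KD_subset] by (simp add: S2_def[abs_def])

lemma J_tens_multilinear:
  assumes "\<nu> \<in> G"
  shows "multilinear_mod {0} n W (J_tens \<nu>)"
  unfolding multilinear_mod_def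
proof (intro conjI ballI allI)
  obtain \<nu>1 \<nu>2 where n: "\<nu>1 \<in> L" "\<nu>2 \<in> G2" "\<nu> = \<nu>1 + \<nu>2" using assms(1) by (rule G_decomp)
  note J_tens = J_tens_eq[OF n(1,2), folded n(3)]
  {
    fix w k u v assume w: "w \<in> PW" "k \<in> {1..n}" and u: "u \<in> W k" and v: "v \<in> W k"
    have uv: "u + v \<in> W k" by (rule complex_vector.subspace_add[OF W_subspace[OF w(2)] u v])
    show "J_tens \<nu> (w(k := u + v)) - J_tens \<nu> (w(k := u)) - J_tens \<nu> (w(k := v)) \<in> {0}"
      using multilinear_modD(1)[OF S1_multilinear[OF n(1)] w u v] multilinear_modD(1)[OF S2_multilinear w u v, of \<nu>2]
      by (simp add: J_tens upd_PW[OF w] u v uv diff_diff_eq algebra_simps)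
  next
    fix w k c u assume w: "w \<in> PW" "k \<in> {1..n}" and u: "u \<in> W k"
    have cu: "c *\<^sub>C u \<in> W k" by (rule complex_vector.subspace_scale[OF W_subspace[OF w(2)] u])
    show "J_tens \<nu> (w(k := c *\<^sub>C u)) - c *\<^sub>C J_tens \<nu> (w(k := u)) \<in> {0}"
      using multilinear_modD(2)[OF S1_multilinear[OF n(1)] w u, of c] multilinear_modD(2)[OF S2_multilinear w u, of \<nu>2 c]
      by (simp add: J_tens upd_PW[OF w] u cu scaleC_add_right)
  }
qed

text \<open>The equivariance of \<open>w \<mapsto> (tens w, \<nu> \<mapsto> J_tens \<nu> w)\<close> under the constants, for which \<open>c(\<nu>, x) = 0\<close>.\<close>

lemma J_tens_const:
  assumes \<nu>: "\<nu> \<in> G" and w: "w \<in> PW"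
  shows "vs_act (const_mero x) (J_tens \<nu> w) + J_tens (lie \<nu> (const_mero x)) w = slot_sum (J_tens \<nu>) {1..n} (\<lambda>k. \<rho> k x) w"
proof -
  let ?x = "const_mero x :: 'g mero"
  have xL: "?x \<in> L" "?x \<in> G2" by simp_all
  have comm: "points_op {1..n} ?x (points_op K \<nu>' tens) w - points_op K \<nu>' (points_op {1..n} ?x tens) w = points_op K (lie \<nu>' ?x) tens w"
    if "K \<subseteq> {1..n}" "z ` K \<subseteq> S" "\<nu>' \<in> regular_on S" for K S \<nu>'
    using points_op_commutator[OF tens_multilinear order_refl subset_UNIV that(1,2) const_in_regular_on that(3) w] that(1)
    by (simp add: Int_absorb1)
  have vs_act_points_op_x: "vs_act ?x (points_op K \<nu>' tens w) = points_op K \<nu>' (points_op {1..n} ?x tens) w" if "K \<subseteq> {1..n}" for K \<nu>'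
  proof -
    have "vs_act ?x (points_op K \<nu>' tens w) = points_op K \<nu>' (\<lambda>w. vs_act ?x (tens w)) w"
      by (rule vs_act_points_op[where f = tens, OF xL(1) that w tens_vs])
    also have "\<dots> = points_op K \<nu>' (points_op {1..n} ?x tens) w"
      by (rule points_op_cong[OF that w]) (simp add: vs_act_const points_op_const)
    finally show ?thesis .
  qed
  have 1: "vs_act ?x (S1 \<nu>1 w) + S1 (lie \<nu>1 ?x) w = points_op {1..n} ?x (S1 \<nu>1) w" if \<nu>1: "\<nu>1 \<in> L" for \<nu>1
  proof -
    note t = tens_vs[OF w] and s = points_op_tens_vs[OF KE_subset w]
    have e1: "vs_act ?x (S1 \<nu>1 w) = vs_act ?x (vs_act \<nu>1 (tens w)) - vs_act ?x (points_op KE \<nu>1 tens w)"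
      using AV.act_add[OF xL(1) S1_vs[OF \<nu>1 w] s[of \<nu>1]] by (simp add: S1_def)
    have e2: "vs_act (lie \<nu>1 ?x) (tens w) = vs_act \<nu>1 (vs_act ?x (tens w)) - vs_act ?x (vs_act \<nu>1 (tens w))"
      by (rule vs_act_lie[OF \<nu>1 xL(1) t])
    have e3: "vs_act \<nu>1 (vs_act ?x (tens w)) = points_op {1..n} ?x (\<lambda>w. vs_act \<nu>1 (tens w)) w"
      using vs_act_points_op[where f = tens, OF \<nu>1 order_refl w tens_vs, of ?x] by (simp add: vs_act_const[OF w] points_op_const)
    have e4: "points_op {1..n} ?x (S1 \<nu>1) w = points_op {1..n} ?x (\<lambda>w. vs_act \<nu>1 (tens w)) w - points_op {1..n} ?x (points_op KE \<nu>1 tens) w"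
      unfolding S1_def[abs_def] by (rule points_op_diff)
    show ?thesis
      unfolding e1 e4 S1_def[of "lie \<nu>1 ?x"] e2 e3 vs_act_points_op_x[OF KE_subset] comm[OF KE_subset z_KE \<nu>1, symmetric]
      by simp
  qed
  have 2: "vs_act ?x (S2 \<nu>2 w) + S2 (lie \<nu>2 ?x) w = points_op {1..n} ?x (S2 \<nu>2) w" if \<nu>2: "\<nu>2 \<in> G2" for \<nu>2
    using comm[OF KD_subset z_KD \<nu>2] vs_act_points_op_x[OF KD_subset, of \<nu>2]
    by (simp add: S2_def S2_def[abs_def] algebra_simps)
  obtain \<nu>1 \<nu>2 where n: "\<nu>1 \<in> L" "\<nu>2 \<in> G2" "\<nu> = \<nu>1 + \<nu>2" using \<nu> by (rule G_decomp)
  have lie: "lie \<nu> ?x = lie \<nu>1 ?x + lie \<nu>2 ?x" unfolding n(3) by (rule lie_add_left)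
  have "slot_sum (J_tens \<nu>) {1..n} (\<lambda>k. \<rho> k x) w = points_op {1..n} ?x (\<lambda>w. S1 \<nu>1 w + S2 \<nu>2 w) w"
    unfolding points_op_const[symmetric] by (rule points_op_cong[OF order_refl w]) (simp only: n(3) J_tens_eq[OF n(1,2)])
  also have "\<dots> = points_op {1..n} ?x (S1 \<nu>1) w + points_op {1..n} ?x (S2 \<nu>2) w" by (rule points_op_plus)
  also have "\<dots> = vs_act ?x (S1 \<nu>1 w + S2 \<nu>2 w) + (S1 (lie \<nu>1 ?x) w + S2 (lie \<nu>2 ?x) w)"
    unfolding 1[OF n(1), symmetric] 2[OF n(2), symmetric] AV.act_add[OF xL(1) S1_vs[OF n(1) w] S2_vs[OF w]]
    by (simp add: algebra_simps)
  also have "S1 (lie \<nu>1 ?x) w + S2 (lie \<nu>2 ?x) w = J_tens (lie \<nu> ?x) w"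
    unfolding lie by (rule J_tens_eq[symmetric]) (intro lie_in_regular_on n xL w)+
  also have "S1 \<nu>1 w + S2 \<nu>2 w = J_tens \<nu> w" unfolding n(3) by (rule J_tens_eq[OF n(1,2) w, symmetric])
  finally show ?thesis ..
qed

text \<open>The pairs of a vector and of a linear map from \<open>G\<close> to \<open>vs\<close>, extended by zero outside \<open>G\<close>,
  and the action of \<open>L\<close> on them. A homomorphism \<open>v \<mapsto> (v, \<nu> \<mapsto> J \<nu> v)\<close> from \<open>vs\<close> amounts to
  operators \<open>J \<nu>\<close> with the commutation relations of the current operators.\<close>

definition pair_space where
  "pair_space = {e. fst e \<in> vs \<and> (\<forall>\<nu>. \<nu> \<notin> G \<longrightarrow> snd e \<nu> = 0) \<and> (\<forall>\<nu>\<in>G. snd e \<nu> \<in> vs) \<and>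
     (\<forall>\<mu>\<in>G. \<forall>\<nu>\<in>G. snd e (\<mu> + \<nu>) = snd e \<mu> + snd e \<nu>) \<and>
     (\<forall>\<nu>\<in>G. \<forall>c. snd e (c *\<^sub>C \<nu>) = c *\<^sub>C snd e \<nu>)}"

definition pair_act where
  "pair_act \<alpha> e = (vs_act \<alpha> (fst e), \<lambda>\<nu>. if \<nu> \<in> G then vs_act \<alpha> (snd e \<nu>) + snd e (lie \<nu> \<alpha>) + bp \<nu> \<alpha> *\<^sub>C fst e else 0)"

lemma pair_space_D:
  assumes "e \<in> pair_space"
  shows "fst e \<in> vs" "\<nu> \<notin> G \<Longrightarrow> snd e \<nu> = 0" "\<nu> \<in> G \<Longrightarrow> snd e \<nu> \<in> vs"
    "\<mu> \<in> G \<Longrightarrow> \<nu> \<in> G \<Longrightarrow> snd e (\<mu> + \<nu>) = snd e \<mu> + snd e \<nu>"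
    "\<nu> \<in> G \<Longrightarrow> snd e (c *\<^sub>C \<nu>) = c *\<^sub>C snd e \<nu>"
  using assms by (simp_all add: pair_space_def)

lemma pair_space_diff:
  assumes "e \<in> pair_space" "\<mu> \<in> G" "\<nu> \<in> G"
  shows "snd e (\<mu> - \<nu>) = snd e \<mu> - snd e \<nu>"
  using pair_space_D(4)[OF assms(1), of "\<mu> - \<nu>" \<nu>] complex_vector.subspace_diff[OF subspace_regular_on assms(2,3)] assms
  by simp

lemma pair_space_subspace: "complex_vector.subspace pair_space"
proof (rule complex_vector.subspaceI)
  note sub = complex_vector.subspace_0[OF vs_subspace] complex_vector.subspace_add[OF vs_subspace]
    complex_vector.subspace_scale[OF vs_subspace]
  show "0 \<in> pair_space" by (simp add: pair_space_def sub complex_vector.scale_zero_right)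
  show "e + e' \<in> pair_space" if "e \<in> pair_space" "e' \<in> pair_space" for e e'
    using that by (simp add: pair_space_def sub scaleC_add_right algebra_simps)
  show "c *\<^sub>C e \<in> pair_space" if "e \<in> pair_space" for c e
    using that by (simp add: pair_space_def sub scaleC_add_right complex_vector.scale_zero_right mult.commute)
qed

lemma vs_sub: "0 \<in> vs" "u \<in> vs \<Longrightarrow> v \<in> vs \<Longrightarrow> u + v \<in> vs" "v \<in> vs \<Longrightarrow> c *\<^sub>C v \<in> vs"
  by (rule complex_vector.subspace_0[OF vs_subspace] complex_vector.subspace_add[OF vs_subspace]
    complex_vector.subspace_scale[OF vs_subspace]; assumption)+

lemma pair_act_pair_space:
  assumes \<alpha>: "\<alpha> \<in> L" and e: "e \<in> pair_space"
  shows "pair_act \<alpha> e \<in> pair_space"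
proof -
  note E = pair_space_D[OF e] and a = L_G[OF \<alpha>] and A = AV.act_E[OF \<alpha>] AV.act_add[OF \<alpha>] AV.act_scaleC[OF \<alpha>]
  have add: "snd (pair_act \<alpha> e) (\<mu> + \<nu>) = snd (pair_act \<alpha> e) \<mu> + snd (pair_act \<alpha> e) \<nu>" if "\<mu> \<in> G" "\<nu> \<in> G" for \<mu> \<nu>
    using that a by (simp add: pair_act_def G_add E A lie_add_left G_lie bp_add_left scaleC_add_left algebra_simps)
  have scale: "snd (pair_act \<alpha> e) (c *\<^sub>C \<nu>) = c *\<^sub>C snd (pair_act \<alpha> e) \<nu>" if "\<nu> \<in> G" for c \<nu>
    using that a by (simp add: pair_act_def G_scaleC E A lie_scaleC_left G_lie bp_scaleC_left scaleC_add_right)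
  have "snd (pair_act \<alpha> e) \<nu> \<in> vs" if "\<nu> \<in> G" for \<nu>
    using that a by (simp add: pair_act_def E A G_lie vs_sub)
  moreover have "fst (pair_act \<alpha> e) \<in> vs" "\<And>\<nu>. \<nu> \<notin> G \<Longrightarrow> snd (pair_act \<alpha> e) \<nu> = 0"
    by (simp_all add: pair_act_def E A)
  ultimately show ?thesis using add scale unfolding pair_space_def by simp
qed

text \<open>The compatibility with the bracket is the Jacobi identity together with the cocycle
  identity.\<close>

lemma lie_rep_pair_act: "lie_rep_mod L pair_act pair_space {0}"
proof unfold_locales
  fix \<alpha> \<beta> :: "'g mero" and c e e'
  assume \<alpha>: "\<alpha> \<in> L" and \<beta>: "\<beta> \<in> L" and e: "e \<in> pair_space" and e': "e' \<in> pair_space"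
  note E = pair_space_D[OF e] and E' = pair_space_D[OF e'] and a = L_G[OF \<alpha>] and b = L_G[OF \<beta>]
  note A = AV.act_E[OF \<alpha>] AV.act_add[OF \<alpha>] AV.act_scaleC[OF \<alpha>]
  note A' = AV.act_E[OF \<beta>] AV.act_add[OF \<beta>] AV.act_scaleC[OF \<beta>]
  show "pair_act \<alpha> e \<in> pair_space" by (rule pair_act_pair_space[OF \<alpha> e])
  show "pair_act \<alpha> (e + e') = pair_act \<alpha> e + pair_act \<alpha> e'"
    by (rule prod_eqI; (rule ext)?) (simp_all add: pair_act_def E E' A scaleC_add_right algebra_simps)
  show "pair_act \<alpha> (c *\<^sub>C e) = c *\<^sub>C pair_act \<alpha> e"
    by (rule prod_eqI; (rule ext)?)
      (simp_all add: pair_act_def E A scaleC_add_right complex_vector.scale_zero_right mult.commute)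
  show "pair_act (\<alpha> + \<beta>) e - pair_act \<alpha> e - pair_act \<beta> e \<in> {0}"
  proof -
    have "pair_act (\<alpha> + \<beta>) e = pair_act \<alpha> e + pair_act \<beta> e"
      using a b by (intro prod_eqI ext)
        (simp_all add: pair_act_def E vs_act_add_left[OF \<alpha> \<beta>] lie_add_right G_lie bp_add_right scaleC_add_left algebra_simps)
    then show ?thesis by simp
  qed
  show "pair_act (c *\<^sub>C \<alpha>) e - c *\<^sub>C pair_act \<alpha> e \<in> {0}"
  proof -
    have "pair_act (c *\<^sub>C \<alpha>) e = c *\<^sub>C pair_act \<alpha> e"
      using a by (intro prod_eqI ext)
        (simp_all add: pair_act_def E vs_act_scaleC_left[OF \<alpha>] lie_scaleC_right G_lie bp_scaleC_right scaleC_add_right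
          complex_vector.scale_zero_right)
    then show ?thesis by simp
  qed
  show "pair_act \<alpha> (pair_act \<beta> e) - pair_act \<beta> (pair_act \<alpha> e) - pair_act (lie \<alpha> \<beta>) e \<in> {0}"
  proof -
    have "pair_act (lie \<alpha> \<beta>) e = pair_act \<alpha> (pair_act \<beta> e) - pair_act \<beta> (pair_act \<alpha> e)"
    proof (rule prod_eqI)
      show "fst (pair_act (lie \<alpha> \<beta>) e) = fst (pair_act \<alpha> (pair_act \<beta> e) - pair_act \<beta> (pair_act \<alpha> e))"
        by (simp add: pair_act_def vs_act_lie[OF \<alpha> \<beta> E(1)])
      show "snd (pair_act (lie \<alpha> \<beta>) e) = snd (pair_act \<alpha> (pair_act \<beta> e) - pair_act \<beta> (pair_act \<alpha> e))"
      proof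
        fix \<nu>
        show "snd (pair_act (lie \<alpha> \<beta>) e) \<nu> = snd (pair_act \<alpha> (pair_act \<beta> e) - pair_act \<beta> (pair_act \<alpha> e)) \<nu>"
        proof (cases "\<nu> \<in> G")
          case \<nu>: True
          note G = G_lie[OF \<nu> a] G_lie[OF \<nu> b]
          have "lie \<nu> (lie \<alpha> \<beta>) = lie (lie \<nu> \<alpha>) \<beta> - lie (lie \<nu> \<beta>) \<alpha>"
            using lie_derivation[of \<nu> \<alpha> \<beta>] by simp
          then have 1: "snd e (lie \<nu> (lie \<alpha> \<beta>)) = snd e (lie (lie \<nu> \<alpha>) \<beta>) - snd e (lie (lie \<nu> \<beta>) \<alpha>)"
            using pair_space_diff[OF e G_lie[OF G(1) b] G_lie[OF G(2) a]] by simp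
          have 2: "bp \<nu> (lie \<alpha> \<beta>) *\<^sub>C fst e = bp (lie \<nu> \<alpha>) \<beta> *\<^sub>C fst e - bp (lie \<nu> \<beta>) \<alpha> *\<^sub>C fst e"
            unfolding bp_cocycle[OF \<nu> a b] by (rule complex_vector.scale_left_diff_distrib)
          have l: "snd (pair_act (lie \<alpha> \<beta>) e) \<nu> = vs_act \<alpha> (vs_act \<beta> (snd e \<nu>)) - vs_act \<beta> (vs_act \<alpha> (snd e \<nu>))
              + (snd e (lie (lie \<nu> \<alpha>) \<beta>) - snd e (lie (lie \<nu> \<beta>) \<alpha>))
              + (bp (lie \<nu> \<alpha>) \<beta> *\<^sub>C fst e - bp (lie \<nu> \<beta>) \<alpha> *\<^sub>C fst e)"
            using \<nu> by (simp add: pair_act_def vs_act_lie[OF \<alpha> \<beta> E(3)] 1 2)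
          have r1: "snd (pair_act \<alpha> (pair_act \<beta> e)) \<nu> = vs_act \<alpha> (vs_act \<beta> (snd e \<nu>)) + vs_act \<alpha> (snd e (lie \<nu> \<beta>))
              + bp \<nu> \<beta> *\<^sub>C vs_act \<alpha> (fst e) + (vs_act \<beta> (snd e (lie \<nu> \<alpha>)) + snd e (lie (lie \<nu> \<alpha>) \<beta>)
              + bp (lie \<nu> \<alpha>) \<beta> *\<^sub>C fst e) + bp \<nu> \<alpha> *\<^sub>C vs_act \<beta> (fst e)"
            using \<nu> G by (simp add: pair_act_def E A A' vs_sub)
          have r2: "snd (pair_act \<beta> (pair_act \<alpha> e)) \<nu> = vs_act \<beta> (vs_act \<alpha> (snd e \<nu>)) + vs_act \<beta> (snd e (lie \<nu> \<alpha>))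
              + bp \<nu> \<alpha> *\<^sub>C vs_act \<beta> (fst e) + (vs_act \<alpha> (snd e (lie \<nu> \<beta>)) + snd e (lie (lie \<nu> \<beta>) \<alpha>)
              + bp (lie \<nu> \<beta>) \<alpha> *\<^sub>C fst e) + bp \<nu> \<beta> *\<^sub>C vs_act \<alpha> (fst e)"
            using \<nu> G by (simp add: pair_act_def E A A' vs_sub)
          show ?thesis by (simp add: l r1 r2 algebra_simps)
        qed (simp add: pair_act_def)
      qed
    qed
    then show ?thesis by simp
  qed
next
  fix \<alpha> :: "'g mero" and e assume \<alpha>: "\<alpha> \<in> L" and "e \<in> {0 :: ('g mero env_elem \<times> 'w tensor_elem \<Rightarrow>\<^sub>0 complex) \<times> ('g mero \<Rightarrow> 'g mero env_elem \<times> 'w tensor_elem \<Rightarrow>\<^sub>0 complex)}"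
  then have e: "e = 0" by simp
  have "vs_act \<alpha> 0 = 0" using AV.act_S[OF \<alpha>] by simp
  then have "pair_act \<alpha> 0 = 0"
    by (intro prod_eqI ext) (simp_all add: pair_act_def complex_vector.scale_zero_right)
  then show "pair_act \<alpha> e \<in> {0}" by (simp add: e)
qed (use pair_space_subspace complex_vector.subspace_0[OF pair_space_subspace] in simp_all)

text \<open>The prescribed values on the image of the tensor product, as pairs.\<close>

definition pair_tens where "pair_tens w = (tens w, \<lambda>\<nu>. if \<nu> \<in> G then J_tens \<nu> w else 0)"

lemma pair_tens_multilinear: "multilinear_mod {0} n W pair_tens"
  unfolding multilinear_mod_def
proof (intro conjI ballI allI)
  fix w k u v assume w: "w \<in> PW" "k \<in> {1..n}" and u: "u \<in> W k" and v: "v \<in> W k"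
  have "pair_tens (w(k := u + v)) = pair_tens (w(k := u)) + pair_tens (w(k := v))"
    using multilinear_modD(1)[OF tens_multilinear w u v] multilinear_modD(1)[OF J_tens_multilinear w u v]
    by (intro prod_eqI ext) (simp_all add: pair_tens_def diff_diff_eq)
  then show "pair_tens (w(k := u + v)) - pair_tens (w(k := u)) - pair_tens (w(k := v)) \<in> {0}" by simp
next
  fix w k c u assume w: "w \<in> PW" "k \<in> {1..n}" and u: "u \<in> W k"
  have "pair_tens (w(k := c *\<^sub>C u)) = c *\<^sub>C pair_tens (w(k := u))"
    using multilinear_modD(2)[OF tens_multilinear w u] multilinear_modD(2)[OF J_tens_multilinear w u]
    by (intro prod_eqI ext) (simp_all add: pair_tens_def complex_vector.scale_zero_right)
  then show "pair_tens (w(k := c *\<^sub>C u)) - c *\<^sub>C pair_tens (w(k := u)) \<in> {0}" by simp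
qed

lemma pair_tens_pair_space: "w \<in> PW \<Longrightarrow> pair_tens w \<in> pair_space"
  by (simp add: pair_space_def pair_tens_def tens_vs J_tens_vs J_tens_add J_tens_scaleC G_add G_scaleC)

lemma pair_tens_const:
  assumes "w \<in> PW"
  shows "pair_act (const_mero x) (pair_tens w) = slot_sum pair_tens {1..n} (\<lambda>k. \<rho> k x) w"
proof (rule prod_eqI)
  show "fst (pair_act (const_mero x) (pair_tens w)) = fst (slot_sum pair_tens {1..n} (\<lambda>k. \<rho> k x) w)"
    by (simp add: pair_act_def pair_tens_def slot_sum_def fst_sum vs_act_const[OF assms])
  show "snd (pair_act (const_mero x) (pair_tens w)) = snd (slot_sum pair_tens {1..n} (\<lambda>k. \<rho> k x) w)"
  proof
    fix \<nu>
    show "snd (pair_act (const_mero x) (pair_tens w)) \<nu> = snd (slot_sum pair_tens {1..n} (\<lambda>k. \<rho> k x) w) \<nu>"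
      using J_tens_const[OF _ assms, of \<nu> x] G_lie[of \<nu> "const_mero x"]
      by (simp add: pair_act_def pair_tens_def slot_sum_def snd_sum sum_fun_apply bp_const_right
          complex_vector.scale_zero_left)
  qed
qed

lemma ex_current_family: "\<exists>J. current_family J"
proof -
  obtain \<Psi> where E: "\<And>v. v \<in> vs \<Longrightarrow> \<Psi> v \<in> pair_space"
    and add: "\<And>u v. u \<in> vs \<Longrightarrow> v \<in> vs \<Longrightarrow> \<Psi> (u + v) = \<Psi> u + \<Psi> v"
    and scale: "\<And>c v. v \<in> vs \<Longrightarrow> \<Psi> (c *\<^sub>C v) = c *\<^sub>C \<Psi> v"
    and act: "\<And>\<alpha> v. \<alpha> \<in> L \<Longrightarrow> v \<in> vs \<Longrightarrow> \<Psi> (vs_act \<alpha> v) = pair_act \<alpha> (\<Psi> v)"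
    and tens: "\<And>w. w \<in> PW \<Longrightarrow> \<Psi> (tens w) = pair_tens w"
    by (rule vs_universal[OF lie_rep_pair_act pair_tens_multilinear pair_tens_pair_space pair_tens_const]) blast+
  have fst: "fst (\<Psi> v) = v" if "v \<in> vs" for v
    using that
  proof (induction rule: vs_generated)
    case zero
    show ?case using scale[OF vs_sub(1), of 0] by (simp add: complex_vector.scale_zero_left)
  next
    case (act \<alpha> v)
    then show ?case by (simp add: \<open>\<And>\<alpha> v. \<alpha> \<in> L \<Longrightarrow> v \<in> vs \<Longrightarrow> \<Psi> (vs_act \<alpha> v) = pair_act \<alpha> (\<Psi> v)\<close> pair_act_def)
  next
    case (tens w)
    then show ?case by (simp add: \<open>\<And>w. w \<in> PW \<Longrightarrow> \<Psi> (tens w) = pair_tens w\<close> pair_tens_def)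
  qed (simp_all add: add scale)
  have "current_family (\<lambda>\<nu> v. snd (\<Psi> v) \<nu>)"
    unfolding current_family_def
  proof (intro conjI ballI allI)
    fix \<mu> \<nu> \<alpha> :: "'g mero" and u v c w
    show "snd (\<Psi> v) \<nu> \<in> vs" if "\<nu> \<in> G" "v \<in> vs" using pair_space_D(3)[OF E[OF that(2)] that(1)] .
    show "snd (\<Psi> (u + v)) \<nu> = snd (\<Psi> u) \<nu> + snd (\<Psi> v) \<nu>" if "\<nu> \<in> G" "u \<in> vs" "v \<in> vs"
      by (simp add: add that)
    show "snd (\<Psi> (c *\<^sub>C v)) \<nu> = c *\<^sub>C snd (\<Psi> v) \<nu>" if "\<nu> \<in> G" "v \<in> vs"
      by (simp add: scale that)
    show "snd (\<Psi> v) (\<mu> + \<nu>) = snd (\<Psi> v) \<mu> + snd (\<Psi> v) \<nu>" if "\<mu> \<in> G" "\<nu> \<in> G" "v \<in> vs"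
      using pair_space_D(4)[OF E[OF that(3)] that(1,2)] .
    show "snd (\<Psi> v) (c *\<^sub>C \<nu>) = c *\<^sub>C snd (\<Psi> v) \<nu>" if "\<nu> \<in> G" "v \<in> vs"
      using pair_space_D(5)[OF E[OF that(2)] that(1)] .
    show "snd (\<Psi> (vs_act \<alpha> v)) \<nu> - vs_act \<alpha> (snd (\<Psi> v) \<nu>) = snd (\<Psi> v) (lie \<nu> \<alpha>) + bp \<nu> \<alpha> *\<^sub>C v"
      if "\<nu> \<in> G" "\<alpha> \<in> L" "v \<in> vs"
      using that by (simp add: act pair_act_def fst)
    show "snd (\<Psi> (tens w)) \<nu> = vs_act \<nu> (tens w) - points_op KE \<nu> tens w" if "\<nu> \<in> L" "w \<in> PW"
      using that L_G[OF that(1)] by (simp add: \<open>\<And>w. w \<in> PW \<Longrightarrow> \<Psi> (tens w) = pair_tens w\<close> pair_tens_def J_tens_L S1_def)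
    show "snd (\<Psi> (tens w)) \<nu> = points_op KD \<nu> tens w" if "\<nu> \<in> G2" "w \<in> PW"
      using that G2_G[OF that(1)] by (simp add: \<open>\<And>w. w \<in> PW \<Longrightarrow> \<Psi> (tens w) = pair_tens w\<close> pair_tens_def J_tens_G2 S2_def)
  qed
  then show ?thesis by blast
qed

end


context current_ctx
begin

lemma exterior_condition: "G \<inter> regular_on (exterior D) = L"
  by (auto simp: regular_on_def compl_D)

lemma interior_condition: "G \<inter> regular_on D = G2"
  by (auto simp: regular_on_def compl_exterior)

abbreviation "is_current_op \<equiv> is_current_operator n W \<rho> D B \<gamma> z"

text \<open>The defining properties, transported from the induced module to \<open>vs\<close>.\<close>

lemma is_current_operator_iff:
  "is_current_op J \<longleftrightarrow> J \<in> G \<rightarrow>\<^sub>E (carrier V.Q \<rightarrow>\<^sub>E carrier V.Q) \<and> current_family (\<lambda>\<nu> v. iota (J \<nu> (kappa v)))"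
proof -
  have fin: "iota (\<Oplus>\<^bsub>V.Q\<^esub>k\<in>K. ind_tensor n W \<rho> D (w(k := \<rho> k (mero_value \<nu> (z k)) (w k)))) = points_op K \<nu> tens w"
    "(\<Oplus>\<^bsub>V.Q\<^esub>k\<in>K. ind_tensor n W \<rho> D (w(k := \<rho> k (mero_value \<nu> (z k)) (w k)))) \<in> carrier V.Q"
    if "K \<subseteq> {1..n}" "w \<in> PW" for K \<nu> w
    unfolding points_op_eq by (rule iota_finsum_tensor, rule points_op_PW[OF that], assumption)+
  interpret Q: module complex_ring V.Q by (rule V.module_Q)
  have kappa: "A \<in> carrier V.Q \<Longrightarrow> A' \<in> carrier V.Q \<Longrightarrow> kappa (iota A + iota A') = A \<oplus>\<^bsub>V.Q\<^esub> A'"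
    "A \<in> carrier V.Q \<Longrightarrow> kappa (c *\<^sub>C iota A) = c \<odot>\<^bsub>V.Q\<^esub> A"
    "\<alpha> \<in> L \<Longrightarrow> A \<in> carrier V.Q \<Longrightarrow> kappa (vs_act \<alpha> (iota A)) = ind_act n W \<rho> D \<alpha> A"
    "w \<in> PW \<Longrightarrow> kappa (tens w) = ind_tensor n W \<rho> D w" for A A' c \<alpha> w
    using kappa_iota[of "A \<oplus>\<^bsub>V.Q\<^esub> A'"] kappa_iota[of "c \<odot>\<^bsub>V.Q\<^esub> A"]
      kappa_iota[of "ind_act n W \<rho> D \<alpha> A"] kappa_iota[of "ind_tensor n W \<rho> D w"]
    by (simp_all add: iota(2,3) iota_ind_act iota_ind_tensor Q.smult_closed ind_act_closed ind_tensor_closed)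
  have all: "(\<forall>v\<in>vs. P v) \<longleftrightarrow> (\<forall>A\<in>carrier V.Q. P (iota A))" for P
    unfolding vs_def by blast
  show ?thesis
  proof (cases "J \<in> G \<rightarrow>\<^sub>E (carrier V.Q \<rightarrow>\<^sub>E carrier V.Q)")
    case False
    then show ?thesis unfolding is_current_operator_def Let_def ind_module_eq by blast
  next
    case True
    have J: "J \<nu> A \<in> carrier V.Q" if "\<nu> \<in> G" "A \<in> carrier V.Q" for \<nu> A
      using PiE_mem[OF PiE_mem[OF True that(1)] that(2)] .
    have eq: "A = A' \<longleftrightarrow> iota A = iota A'" if "A \<in> carrier V.Q" "A' \<in> carrier V.Q" for A A'
      using inj_on_eq_iff[OF iota(1) that] by simp
    note cl = J Q.a_closed Q.smult_closed[unfolded carrier_complex_ring, OF UNIV_I] Q.minus_closed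
      ind_act_closed ind_tensor_closed
    have 1: "(\<forall>\<nu>\<in>G. \<forall>v\<in>carrier V.Q. \<forall>v'\<in>carrier V.Q. J \<nu> (v \<oplus>\<^bsub>V.Q\<^esub> v') = J \<nu> v \<oplus>\<^bsub>V.Q\<^esub> J \<nu> v') \<longleftrightarrow>
      (\<forall>\<nu>\<in>G. \<forall>u\<in>vs. \<forall>v\<in>vs. iota (J \<nu> (kappa (u + v))) = iota (J \<nu> (kappa u)) + iota (J \<nu> (kappa v)))"
      unfolding all
      by (intro ball_cong refl) (simp only: eq cl iota(2,3) kappa_iota kappa)
    have 2: "(\<forall>\<nu>\<in>G. \<forall>c. \<forall>v\<in>carrier V.Q. J \<nu> (c \<odot>\<^bsub>V.Q\<^esub> v) = c \<odot>\<^bsub>V.Q\<^esub> J \<nu> v) \<longleftrightarrow>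
      (\<forall>\<nu>\<in>G. \<forall>c. \<forall>v\<in>vs. iota (J \<nu> (kappa (c *\<^sub>C v))) = c *\<^sub>C iota (J \<nu> (kappa v)))"
      unfolding all
      by (intro ball_cong all_cong1 refl) (simp only: eq cl iota(2,3) kappa_iota kappa)
    have 3: "(\<forall>\<mu>\<in>G. \<forall>\<nu>\<in>G. \<forall>v\<in>carrier V.Q. J (\<mu> + \<nu>) v = J \<mu> v \<oplus>\<^bsub>V.Q\<^esub> J \<nu> v) \<longleftrightarrow>
      (\<forall>\<mu>\<in>G. \<forall>\<nu>\<in>G. \<forall>v\<in>vs. iota (J (\<mu> + \<nu>) (kappa v)) = iota (J \<mu> (kappa v)) + iota (J \<nu> (kappa v)))"
      unfolding all
      by (intro ball_cong refl) (simp only: eq cl G_add iota(2,3) kappa_iota)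
    have 4: "(\<forall>\<nu>\<in>G. \<forall>c. \<forall>v\<in>carrier V.Q. J (c *\<^sub>C \<nu>) v = c \<odot>\<^bsub>V.Q\<^esub> J \<nu> v) \<longleftrightarrow>
      (\<forall>\<nu>\<in>G. \<forall>c. \<forall>v\<in>vs. iota (J (c *\<^sub>C \<nu>) (kappa v)) = c *\<^sub>C iota (J \<nu> (kappa v)))"
      unfolding all
      by (intro ball_cong all_cong1 refl) (simp only: eq cl G_scaleC iota(2,3) kappa_iota)
    have 5: "(\<forall>\<nu>\<in>G. \<forall>\<alpha>\<in>L. \<forall>v\<in>carrier V.Q.
         J \<nu> (ind_act n W \<rho> D \<alpha> v) \<ominus>\<^bsub>V.Q\<^esub> ind_act n W \<rho> D \<alpha> (J \<nu> v) =
         J (lie \<nu> \<alpha>) v \<oplus>\<^bsub>V.Q\<^esub> bp \<nu> \<alpha> \<odot>\<^bsub>V.Q\<^esub> v) \<longleftrightarrow>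
      (\<forall>\<nu>\<in>G. \<forall>\<alpha>\<in>L. \<forall>v\<in>vs. iota (J \<nu> (kappa (vs_act \<alpha> v))) - vs_act \<alpha> (iota (J \<nu> (kappa v))) =
         iota (J (lie \<nu> \<alpha>) (kappa v)) + bp \<nu> \<alpha> *\<^sub>C v)"
      unfolding all
      by (intro ball_cong refl)
        (simp only: eq cl G_lie L_G iota(2,3) iota_minus kappa_iota kappa iota_ind_act)
    have 6: "(\<forall>\<nu>\<in>L. \<forall>w\<in>PW. J \<nu> (ind_tensor n W \<rho> D w) = ind_act n W \<rho> D \<nu> (ind_tensor n W \<rho> D w) \<ominus>\<^bsub>V.Q\<^esub>
           (\<Oplus>\<^bsub>V.Q\<^esub>k\<in>KE. ind_tensor n W \<rho> D (w(k := \<rho> k (mero_value \<nu> (z k)) (w k))))) \<longleftrightarrow>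
      (\<forall>\<nu>\<in>L. \<forall>w\<in>PW. iota (J \<nu> (kappa (tens w))) = vs_act \<nu> (tens w) - points_op KE \<nu> tens w)"
      by (intro ball_cong refl)
        (simp only: eq cl L_G fin KE_subset iota_minus kappa iota_ind_act iota_ind_tensor)
    have 7: "(\<forall>\<nu>\<in>G2. \<forall>w\<in>PW. J \<nu> (ind_tensor n W \<rho> D w) =
           (\<Oplus>\<^bsub>V.Q\<^esub>k\<in>KD. ind_tensor n W \<rho> D (w(k := \<rho> k (mero_value \<nu> (z k)) (w k))))) \<longleftrightarrow>
      (\<forall>\<nu>\<in>G2. \<forall>w\<in>PW. iota (J \<nu> (kappa (tens w))) = points_op KD \<nu> tens w)"
      by (intro ball_cong refl)
        (simp only: eq cl G2_G fin KD_subset kappa)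
    have 8: "\<forall>\<nu>\<in>G. \<forall>v\<in>vs. iota (J \<nu> (kappa v)) \<in> vs"
      using J by (intro ballI iota_closed kappa_closed) (simp add: kappa_closed)
    show ?thesis
      unfolding is_current_operator_def Let_def ind_module_eq exterior_condition interior_condition
        KE_def[symmetric] KD_def[symmetric] 1 2 3 4 5 6 7 current_family_def
      by (simp only: eqTrueI[OF True] eqTrueI[OF 8] simp_thms)
  qed
qed

lemma ex_is_current_op: "\<exists>J. is_current_op J"
proof -
  obtain J0 where J0: "current_family J0" using ex_current_family by blast
  define J where "J = (\<lambda>\<nu>\<in>G. \<lambda>A\<in>carrier V.Q. kappa (J0 \<nu> (iota A)))"
  have eq: "iota (J \<nu> (kappa v)) = J0 \<nu> v" if "\<nu> \<in> G" "v \<in> vs" for \<nu> v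
    using that by (simp add: J_def kappa_closed iota_kappa J_vs[OF J0])
  have "current_family (\<lambda>\<nu> v. iota (J \<nu> (kappa v)))"
    using J0 unfolding current_family_def
    by (simp add: eq L_G G2_G G_lie G_add G_scaleC vs_sub AV.act_E tens_vs)
  moreover have "J \<in> G \<rightarrow>\<^sub>E (carrier V.Q \<rightarrow>\<^sub>E carrier V.Q)"
    unfolding J_def by (auto intro!: kappa_closed J_vs[OF J0] iota_closed)
  ultimately show ?thesis using is_current_operator_iff by blast
qed

lemma is_current_op_unique:
  assumes "is_current_op J" "is_current_op J'"
  shows "J = J'"
proof -
  have JJ: "J \<in> G \<rightarrow>\<^sub>E (carrier V.Q \<rightarrow>\<^sub>E carrier V.Q)" "J' \<in> G \<rightarrow>\<^sub>E (carrier V.Q \<rightarrow>\<^sub>E carrier V.Q)"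
    and current_family: "current_family (\<lambda>\<nu> v. iota (J \<nu> (kappa v)))" "current_family (\<lambda>\<nu> v. iota (J' \<nu> (kappa v)))"
    using assms unfolding is_current_operator_iff by blast+
  show ?thesis
  proof (rule PiE_ext[OF JJ])
    fix \<nu> assume \<nu>: "\<nu> \<in> G"
    note J\<nu> = PiE_mem[OF JJ(1) \<nu>] PiE_mem[OF JJ(2) \<nu>]
    show "J \<nu> = J' \<nu>"
    proof (rule PiE_ext[OF J\<nu>])
      fix A assume A: "A \<in> carrier V.Q"
      have "iota (J \<nu> A) = iota (J' \<nu> A)"
        using current_family_unique[OF current_family \<nu> iota_closed[OF A]] by (simp add: kappa_iota A)
      then show "J \<nu> A = J' \<nu> A"
        using inj_onD[OF iota(1)] PiE_mem[OF J\<nu>(1) A] PiE_mem[OF J\<nu>(2) A] by blast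
    qed
  qed
qed

lemma is_current_op_current_operator: "is_current_op (current_operator n W \<rho> D B \<gamma> z)"
  unfolding current_operator_def
  by (rule theI'[of is_current_op]) (use ex_is_current_op is_current_op_unique in blast)

theorem current_operator_commutator:
  assumes \<mu>: "\<mu> \<in> G" and \<nu>: "\<nu> \<in> G" and A: "A \<in> carrier V.Q"
  defines "J \<equiv> current_operator n W \<rho> D B \<gamma> z"
  shows "(J \<mu> (J \<nu> A) \<ominus>\<^bsub>V.Q\<^esub> J \<nu> (J \<mu> A)) \<ominus>\<^bsub>V.Q\<^esub> J (lie \<mu> \<nu>) A = bp \<mu> \<nu> \<odot>\<^bsub>V.Q\<^esub> A"
proof -
  interpret Q: module complex_ring V.Q by (rule V.module_Q)
  have J: "J \<in> G \<rightarrow>\<^sub>E (carrier V.Q \<rightarrow>\<^sub>E carrier V.Q)" and current_family: "current_family (\<lambda>\<nu> v. iota (J \<nu> (kappa v)))"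
    using is_current_op_current_operator unfolding is_current_operator_iff J_def by blast+
  have Jc: "J \<nu> A \<in> carrier V.Q" if "\<nu> \<in> G" "A \<in> carrier V.Q" for \<nu> A
    using PiE_mem[OF PiE_mem[OF J that(1)] that(2)] .
  note cl = Jc[OF \<mu> Jc[OF \<nu> A]] Jc[OF \<nu> Jc[OF \<mu> A]] Jc[OF G_lie[OF \<mu> \<nu>] A]
  have "iota ((J \<mu> (J \<nu> A) \<ominus>\<^bsub>V.Q\<^esub> J \<nu> (J \<mu> A)) \<ominus>\<^bsub>V.Q\<^esub> J (lie \<mu> \<nu>) A) =
      iota (J \<mu> (J \<nu> A)) - iota (J \<nu> (J \<mu> A)) - iota (J (lie \<mu> \<nu>) A)"
    by (simp only: iota_minus cl Q.minus_closed)
  also have "\<dots> = bp \<mu> \<nu> *\<^sub>C iota A"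
    using current_family_commutator[OF current_family \<mu> \<nu> iota_closed[OF A]] by (simp only: kappa_iota A Jc \<mu> \<nu>)
  also have "\<dots> = iota (bp \<mu> \<nu> \<odot>\<^bsub>V.Q\<^esub> A)" by (rule iota(3)[OF A, symmetric])
  finally show ?thesis
    by (rule inj_onD[OF iota(1)]) (simp_all add: cl Q.minus_closed A Q.smult_closed)
qed

end

theorem proposition12p2:
  fixes D :: "complex option set"
    and \<gamma> :: "real \<Rightarrow> complex option"
    and B :: "'g::complex_lie_algebra \<Rightarrow> 'g \<Rightarrow> complex"
    and n :: nat
    and z :: "nat \<Rightarrow> complex option"
    and W :: "nat \<Rightarrow> 'w::complex_vector set"
    and \<rho> :: "nat \<Rightarrow> 'g \<Rightarrow> 'w \<Rightarrow> 'w"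
    and \<mu> \<nu> :: "'g mero"
  assumes "smoothly_bounded_disc D \<gamma>"
    and "nondegenerate_invariant_form B"
    and "inj_on z {1..n}"
    and "\<forall>k\<in>{1..n}. z k \<notin> proj_line frontier_of D"
    and "\<forall>k\<in>{1..n}. lie_representation (W k) (\<rho> k)"
    and "\<mu> \<in> regular_on (proj_line frontier_of D)"
    and "\<nu> \<in> regular_on (proj_line frontier_of D)"
  shows "let V = ind_module n W \<rho> D; J = current_operator n W \<rho> D B \<gamma> z in
    (\<mu> \<in> regular_on (exterior D) \<and> \<nu> \<in> regular_on (exterior D) \<longrightarrow>
       (\<forall>v\<in>carrier V.
          (J \<mu> (J \<nu> v) \<ominus>\<^bsub>V\<^esub> J \<nu> (J \<mu> v)) \<ominus>\<^bsub>V\<^esub> J (lie \<mu> \<nu>) v = \<zero>\<^bsub>V\<^esub>)) \<and>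
    (\<mu> \<in> regular_on D \<and> \<nu> \<in> regular_on D \<longrightarrow>
       (\<forall>v\<in>carrier V.
          (J \<mu> (J \<nu> v) \<ominus>\<^bsub>V\<^esub> J \<nu> (J \<mu> v)) \<ominus>\<^bsub>V\<^esub> J (lie \<mu> \<nu>) v = \<zero>\<^bsub>V\<^esub>)) \<and>
    (\<forall>v\<in>carrier V.
       (J \<mu> (J \<nu> v) \<ominus>\<^bsub>V\<^esub> J \<nu> (J \<mu> v)) \<ominus>\<^bsub>V\<^esub> J (lie \<mu> \<nu>) v =
         boundary_pairing B \<gamma> \<mu> \<nu> \<odot>\<^bsub>V\<^esub> v)"
proof -
  interpret current_ctx n W \<rho> D \<gamma> B z
    using assms by unfold_locales auto
  interpret Q: module complex_ring V.Q by (rule V.module_Q)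
  have zero: "0 \<odot>\<^bsub>V.Q\<^esub> v = \<zero>\<^bsub>V.Q\<^esub>" if "v \<in> carrier V.Q" for v
    using Q.smult_l_null[OF that] by (simp add: complex_ring_def)
  note general = current_operator_commutator[OF assms(6,7)]
  have ext: "boundary_pairing B \<gamma> \<mu> \<nu> = 0" if "\<mu> \<in> regular_on (exterior D)" "\<nu> \<in> regular_on (exterior D)"
    using that assms(6,7) exterior_condition by (intro bp_eq_0_poles_in_D) blast+
  have int: "boundary_pairing B \<gamma> \<mu> \<nu> = 0" if "\<mu> \<in> regular_on D" "\<nu> \<in> regular_on D"
    using that assms(6,7) interior_condition by (intro bp_eq_0_poles_in_exterior) blast+
  show ?thesis
    unfolding Let_def ind_module_eq
    by (intro conjI impI ballI) (simp_all only: general ext int zero)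
qed

end
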